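(* Let $f_0,f_1\in L^2(0,1)$, let $(f,v,z)\in\mathcal A(f_0,f_1)$, and suppose that $z$ is a weak solution of $\partial_t z+\partial_x(zv)=0$ on $(0,1)^2$ (this is in particular the case if $(f,v,z)$ minimizes the action $\frac12\int_0^1\int_0^1\kappa v^2+\lambda v_x^2+\varepsilon v_{xx}^2+z^2\,dx\,dt$ over $\mathcal A(f_0,f_1)$ for some $\kappa>0$, $\lambda\ge0$, $\varepsilon>0$). Let $\Phi$ be the flow of $v$ and $J(x,t)=\exp\big(-\int_0^t v_x(\Phi(x,s),s)\,ds\big)$. Then for a.e. $(x,t)\in[0,1]^2$, $$z(\Phi(x,t),t)=\big(f_1(\Phi(x,1))-f_0(x)\big)\frac{J(x,t)}{\int_0^1J(x,\tau)\,d\tau}$$ and $$f(\Phi(x,t),t)=(1-\eta(x,t))\,f_0(x)+\eta(x,t)\,f_1(\Phi(x,1)),\qquad \eta(x,t)=\frac{\int_0^tJ(x,s)\,ds}{\int_0^1J(x,s)\,ds}.$$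
   Context: Let $\mathcal V=L^2((0,1),H^2(0,1)\cap H^1_0(0,1))$ (time in the outer interval, space in the inner one). For $f_0,f_1\in L^2(0,1)$ the set of admissible paths $\mathcal A(f_0,f_1)$ consists of all triples $(f,v,z)$ of functions of $(x,t)\in(0,1)\times(0,1)$ with $f\in L^2((0,1),L^2(0,1))\cap C([0,1],H^{-1}(0,1))$, $v\in\mathcal V$, $z\in L^2((0,1),L^2(0,1))$, $f(\cdot,0)=f_0$, $f(\cdot,1)=f_1$, and $\partial_t f+\partial_x f\cdot v=z$ weakly, i.e. for every $\phi\in C^\infty([0,1]^2)$, $$-\int_0^1\!\!\int_0^1 f\,\partial_t\phi\,dx\,dt+\int_0^1 f_1(x)\phi(x,1)\,dx-\int_0^1 f_0(x)\phi(x,0)\,dx=\int_0^1\!\!\int_0^1 f\phi\,\partial_x v\,dx\,dt+\int_0^1\!\!\int_0^1 f\,\partial_x\phi\, v\,dx\,dt+\int_0^1\!\!\int_0^1\phi z\,dx\,dt.$$ The flow $\Phi:[0,1]\times[0,1]\to[0,1]$ of $v$ is the solution (absolutely continuous in $t$) of $\partial_t\Phi(x,t)=v(\Phi(x,t),t)$ for a.e. $t$, $\Phi(x,0)=x$. The symbol $v_x$ denotes the partial derivative of $v$ in its first variable, evaluated at the indicated point (not the derivative of the composition). A weak solution of $\partial_t z+\partial_x(zv)=0$ is $z$ with $\int_0^1\int_0^1 z\phi_t+zv\phi_x\,dx\,dt=0$ for all $\phi\in C_c^\infty((0,1)^2)$. *)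

theory Defs
  imports "HOL-Analysis.Analysis"
begin

abbreviation unit_I :: "real measure"
  where "unit_I \<equiv> lebesgue_on {0<..<1}"

text \<open>Functions of $(x,t)$ are curried with the space variable first, so that
  the time slice of \<open>u\<close> at \<open>t\<close> is \<open>\<lambda>x. u x t\<close>.  Elements of the function spaces
  below are honest functions, representing their classes modulo null sets.\<close>

definition iint :: "(real \<Rightarrow> real \<Rightarrow> real) \<Rightarrow> real"
  where "iint u = (\<integral>t. (\<integral>x. u x t \<partial>unit_I) \<partial>unit_I)"

text \<open>Partial derivatives on the closed unit square, one-sided on its boundary.\<close>

definition dx :: "(real \<Rightarrow> real \<Rightarrow> real) \<Rightarrow> real \<Rightarrow> real \<Rightarrow> real"
  where "dx u x t = vector_derivative (\<lambda>y. u y t) (at x within {0..1})"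

definition dt :: "(real \<Rightarrow> real \<Rightarrow> real) \<Rightarrow> real \<Rightarrow> real \<Rightarrow> real"
  where "dt u x t = vector_derivative (\<lambda>s. u x s) (at t within {0..1})"


subsection \<open>Test functions\<close>

definition test_fun :: "(real \<Rightarrow> real) set"
  where "test_fun = {\<phi>. (\<forall>n x. (deriv ^^ n) \<phi> field_differentiable at x) \<and>
           (\<exists>K. compact K \<and> K \<subseteq> {0<..<1} \<and> (\<forall>x. x \<notin> K \<longrightarrow> \<phi> x = 0))}"

text \<open>In \<open>smooth2 S T\<close>, \<open>D i j\<close> is $\partial_x^i\partial_t^j\phi$ on $S\times T$; the
  derivatives are relative to \<open>S\<close> and \<open>T\<close>, hence one-sided at boundary points.\<close>

definition smooth2 :: "real set \<Rightarrow> real set \<Rightarrow> (real \<Rightarrow> real \<Rightarrow> real) set"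
  where "smooth2 S T = {\<phi>. \<exists>D :: nat \<Rightarrow> nat \<Rightarrow> real \<Rightarrow> real \<Rightarrow> real.
           (\<forall>x\<in>S. \<forall>t\<in>T. D 0 0 x t = \<phi> x t) \<and>
           (\<forall>i j. continuous_on (S \<times> T) (\<lambda>(x, t). D i j x t) \<and>
             (\<forall>x\<in>S. \<forall>t\<in>T.
               ((\<lambda>y. D i j y t) has_real_derivative D (Suc i) j x t) (at x within S) \<and>
               ((\<lambda>s. D i j x s) has_real_derivative D i (Suc j) x t) (at t within T)))}"

definition test_fun2 :: "(real \<Rightarrow> real \<Rightarrow> real) set"
  where "test_fun2 = {\<phi> \<in> smooth2 UNIV UNIV.
           \<exists>K. compact K \<and> K \<subseteq> {0<..<1} \<times> {0<..<1} \<and> (\<forall>x t. (x, t) \<notin> K \<longrightarrow> \<phi> x t = 0)}"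


subsection \<open>Lebesgue and Sobolev spaces on the unit interval\<close>

definition L2 :: "(real \<Rightarrow> real) set"
  where "L2 = {u \<in> borel_measurable unit_I. integrable unit_I (\<lambda>x. (u x)\<^sup>2)}"

definition L2_norm :: "(real \<Rightarrow> real) \<Rightarrow> real"
  where "L2_norm u = sqrt (\<integral>x. (u x)\<^sup>2 \<partial>unit_I)"

definition weak_deriv :: "(real \<Rightarrow> real) \<Rightarrow> (real \<Rightarrow> real) \<Rightarrow> bool"
  where "weak_deriv u g \<longleftrightarrow> u \<in> L2 \<and> g \<in> L2 \<and>
           (\<forall>\<phi>\<in>test_fun. (\<integral>x. u x * deriv \<phi> x \<partial>unit_I) = - (\<integral>x. g x * \<phi> x \<partial>unit_I))"

definition H1 :: "(real \<Rightarrow> real) set"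
  where "H1 = {u. \<exists>g. weak_deriv u g}"

text \<open>Some representative of the weak derivative, which is unique up to null sets.\<close>

definition wd :: "(real \<Rightarrow> real) \<Rightarrow> real \<Rightarrow> real"
  where "wd u = (SOME g. weak_deriv u g)"

definition H2 :: "(real \<Rightarrow> real) set"
  where "H2 = {u \<in> H1. wd u \<in> H1}"

definition H1_norm :: "(real \<Rightarrow> real) \<Rightarrow> real"
  where "H1_norm u = sqrt ((L2_norm u)\<^sup>2 + (L2_norm (wd u))\<^sup>2)"

definition H2_norm :: "(real \<Rightarrow> real) \<Rightarrow> real"
  where "H2_norm u = sqrt ((L2_norm u)\<^sup>2 + (L2_norm (wd u))\<^sup>2 + (L2_norm (wd (wd u)))\<^sup>2)"

definition H10 :: "(real \<Rightarrow> real) set"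
  where "H10 = {u \<in> H1. \<exists>\<phi> :: nat \<Rightarrow> real \<Rightarrow> real. range \<phi> \<subseteq> test_fun \<and>
           (\<lambda>n. H1_norm (\<lambda>x. u x - \<phi> n x)) \<longlonglongrightarrow> 0}"

text \<open>$H^{-1}(0,1)$ is the dual of $H^1_0(0,1)$; only the values of a functional
  on \<open>H10\<close> matter.\<close>

definition Hm1 :: "((real \<Rightarrow> real) \<Rightarrow> real) set"
  where "Hm1 = {L. (\<forall>u\<in>H10. \<forall>w\<in>H10. \<forall>a b. L (\<lambda>x. a * u x + b * w x) = a * L u + b * L w) \<and>
           (\<exists>C. \<forall>u\<in>H10. \<bar>L u\<bar> \<le> C * H1_norm u)}"

definition Hm1_norm :: "((real \<Rightarrow> real) \<Rightarrow> real) \<Rightarrow> real"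
  where "Hm1_norm L = (SUP w\<in>{w \<in> H10. H1_norm w \<le> 1}. \<bar>L w\<bar>)"

text \<open>The embedding of $L^2(0,1)$ into $H^{-1}(0,1)$.\<close>

definition L2_functional :: "(real \<Rightarrow> real) \<Rightarrow> (real \<Rightarrow> real) \<Rightarrow> real"
  where "L2_functional g w = (\<integral>x. g x * w x \<partial>unit_I)"


subsection \<open>Spaces of time-dependent functions\<close>

text \<open>The Bochner space $L^2((0,1),X)$ for a space \<open>X\<close> of functions on the unit
  interval with norm \<open>nrm\<close>.  The first condition says that we use representatives which are
  jointly measurable; it excludes functions whose slices are modified on
  null sets that depend on \<open>t\<close> in a non-measurable way.\<close>

definition bochner_L2 ::
    "(real \<Rightarrow> real) set \<Rightarrow> ((real \<Rightarrow> real) \<Rightarrow> real) \<Rightarrow> (real \<Rightarrow> real \<Rightarrow> real) set"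
  where "bochner_L2 X nrm = {u.
           (\<lambda>(x, t). u x t) \<in> borel_measurable (lebesgue_on ({0<..<1} \<times> {0<..<1})) \<and>
           (AE t in unit_I. (\<lambda>x. u x t) \<in> X) \<and>
           (\<exists>s :: nat \<Rightarrow> real \<Rightarrow> real \<Rightarrow> real.
              (\<forall>n. simple_function unit_I (s n) \<and> s n ` {0<..<1} \<subseteq> X) \<and>
              (AE t in unit_I. (\<lambda>n. nrm (\<lambda>x. s n t x - u x t)) \<longlonglongrightarrow> 0)) \<and>
           integrable unit_I (\<lambda>t. (nrm (\<lambda>x. u x t))\<^sup>2)}"

abbreviation L2L2 :: "(real \<Rightarrow> real \<Rightarrow> real) set"
  where "L2L2 \<equiv> bochner_L2 L2 L2_norm"

text \<open>The space $\mathcal V$.  Since $H^2(0,1)$ embeds into $C^1([0,1])$, the velocity at almost every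
  time is represented by its continuous version, which is what the flow evaluates.\<close>

definition Vel :: "(real \<Rightarrow> real \<Rightarrow> real) set"
  where "Vel = {v \<in> bochner_L2 (H2 \<inter> H10) H2_norm.
           AE t in unit_I. continuous_on {0..1} (\<lambda>x. v x t)}"

text \<open>\<open>F\<close> is the continuous representative $[0,1]\to H^{-1}(0,1)$ of \<open>f\<close>; the traces of
  \<open>f\<close> at times $0$ and $1$ are the values of \<open>F\<close> there.\<close>

definition Hm1_continuous_rep ::
    "(real \<Rightarrow> real \<Rightarrow> real) \<Rightarrow> (real \<Rightarrow> (real \<Rightarrow> real) \<Rightarrow> real) \<Rightarrow> bool"
  where "Hm1_continuous_rep f F \<longleftrightarrow>
           (\<forall>t\<in>{0..1}. F t \<in> Hm1) \<and>
           (\<forall>t\<in>{0..1}. ((\<lambda>s. Hm1_norm (\<lambda>w. F s w - F t w)) \<longlongrightarrow> 0) (at t within {0..1})) \<and>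
           (AE t in unit_I. \<forall>w\<in>H10. F t w = L2_functional (\<lambda>x. f x t) w)"


subsection \<open>Admissible paths, action, flow\<close>

definition transport_eq ::
    "(real \<Rightarrow> real) \<Rightarrow> (real \<Rightarrow> real) \<Rightarrow> (real \<Rightarrow> real \<Rightarrow> real) \<Rightarrow> (real \<Rightarrow> real \<Rightarrow> real) \<Rightarrow>
     (real \<Rightarrow> real \<Rightarrow> real) \<Rightarrow> bool"
  where "transport_eq f0 f1 f v z \<longleftrightarrow> (\<forall>\<phi>\<in>smooth2 {0..1} {0..1}.
           - iint (\<lambda>x t. f x t * dt \<phi> x t)
             + (\<integral>x. f1 x * \<phi> x 1 \<partial>unit_I) - (\<integral>x. f0 x * \<phi> x 0 \<partial>unit_I)
           = iint (\<lambda>x t. f x t * \<phi> x t * wd (\<lambda>y. v y t) x)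
             + iint (\<lambda>x t. f x t * dx \<phi> x t * v x t)
             + iint (\<lambda>x t. \<phi> x t * z x t))"

definition admissible ::
    "(real \<Rightarrow> real) \<Rightarrow> (real \<Rightarrow> real) \<Rightarrow>
     ((real \<Rightarrow> real \<Rightarrow> real) \<times> (real \<Rightarrow> real \<Rightarrow> real) \<times> (real \<Rightarrow> real \<Rightarrow> real)) set"
  where "admissible f0 f1 = {(f, v, z). f \<in> L2L2 \<and> v \<in> Vel \<and> z \<in> L2L2 \<and>
           (\<exists>F. Hm1_continuous_rep f F \<and>
              (\<forall>w\<in>H10. F 0 w = L2_functional f0 w) \<and>
              (\<forall>w\<in>H10. F 1 w = L2_functional f1 w)) \<and>
           transport_eq f0 f1 f v z}"

definition weak_continuity_eq :: "(real \<Rightarrow> real \<Rightarrow> real) \<Rightarrow> (real \<Rightarrow> real \<Rightarrow> real) \<Rightarrow> bool"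
  where "weak_continuity_eq v z \<longleftrightarrow>
           (\<forall>\<phi>\<in>test_fun2. iint (\<lambda>x t. z x t * dt \<phi> x t + z x t * v x t * dx \<phi> x t) = 0)"

definition action ::
    "real \<Rightarrow> real \<Rightarrow> real \<Rightarrow> (real \<Rightarrow> real \<Rightarrow> real) \<Rightarrow> (real \<Rightarrow> real \<Rightarrow> real) \<Rightarrow> real"
  where "action \<kappa> \<mu> \<epsilon> v z = 1/2 * iint (\<lambda>x t.
           \<kappa> * (v x t)\<^sup>2 + \<mu> * (wd (\<lambda>y. v y t) x)\<^sup>2
           + \<epsilon> * (wd (wd (\<lambda>y. v y t)) x)\<^sup>2 + (z x t)\<^sup>2)"

definition minimizer ::
    "real \<Rightarrow> real \<Rightarrow> real \<Rightarrow> (real \<Rightarrow> real) \<Rightarrow> (real \<Rightarrow> real) \<Rightarrow>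
     (real \<Rightarrow> real \<Rightarrow> real) \<Rightarrow> (real \<Rightarrow> real \<Rightarrow> real) \<Rightarrow> (real \<Rightarrow> real \<Rightarrow> real) \<Rightarrow> bool"
  where "minimizer \<kappa> \<mu> \<epsilon> f0 f1 f v z \<longleftrightarrow> (f, v, z) \<in> admissible f0 f1 \<and>
           (\<forall>(f', v', z')\<in>admissible f0 f1. action \<kappa> \<mu> \<epsilon> v z \<le> action \<kappa> \<mu> \<epsilon> v' z')"

text \<open>Members of a division are nonempty compact intervals with
  disjoint interiors, so this is the usual definition by finite families of intervals.\<close>

definition absolutely_continuous_fun :: "real \<Rightarrow> real \<Rightarrow> (real \<Rightarrow> real) \<Rightarrow> bool"
  where "absolutely_continuous_fun a b g \<longleftrightarrow> (\<forall>e>0. \<exists>d>0. \<forall>\<D> S.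
           \<D> division_of S \<and> S \<subseteq> {a..b} \<and> (\<Sum>k\<in>\<D>. Sup k - Inf k) < d
             \<longrightarrow> (\<Sum>k\<in>\<D>. \<bar>g (Sup k) - g (Inf k)\<bar>) < e)"

definition is_flow :: "(real \<Rightarrow> real \<Rightarrow> real) \<Rightarrow> (real \<Rightarrow> real \<Rightarrow> real) \<Rightarrow> bool"
  where "is_flow v \<Phi> \<longleftrightarrow>
           (\<forall>x\<in>{0..1}. \<forall>t\<in>{0..1}. \<Phi> x t \<in> {0..1}) \<and>
           (\<forall>x\<in>{0..1}. \<Phi> x 0 = x \<and> absolutely_continuous_fun 0 1 (\<Phi> x) \<and>
              (AE t in unit_I. (\<Phi> x has_real_derivative v (\<Phi> x t) t) (at t)))"

definition flow_jac :: "(real \<Rightarrow> real \<Rightarrow> real) \<Rightarrow> (real \<Rightarrow> real \<Rightarrow> real) \<Rightarrow> real \<Rightarrow> real \<Rightarrow> real"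
  where "flow_jac v \<Phi> x t = exp (- (\<integral>s. dx v (\<Phi> x s) s \<partial>lebesgue_on {0..t}))"

definition flow_weight :: "(real \<Rightarrow> real \<Rightarrow> real) \<Rightarrow> (real \<Rightarrow> real \<Rightarrow> real) \<Rightarrow> real \<Rightarrow> real \<Rightarrow> real"
  where "flow_weight v \<Phi> x t =
           (\<integral>s. flow_jac v \<Phi> x s \<partial>lebesgue_on {0..t}) /
           (\<integral>s. flow_jac v \<Phi> x s \<partial>lebesgue_on {0..1})"

end

theory Submission
  imports Defs "HOL-Computational_Algebra.Polynomial"
begin

text \<open>If \<open>z\<close> solves the continuity equation, both weak equations are ordinary
  differential equations along characteristics.  To make this rigorous without regularity of \<open>f\<close>
  and \<open>z\<close>, let \<open>X\<close> be the inverse flow and test with \<open>\<theta>(t) X(y, t)\<^sup>j\<close>, where \<open>\<theta>\<close> is a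
  polynomial: these functions are constant along characteristics up to \<open>\<theta>\<close>, and they are only
  absolutely continuous in time, so they are approximated in \<open>y\<close> by Bernstein polynomials,
  which converge together with the first derivative.  Substituting \<open>y = \<Phi>(x, t)\<close>, with
  Jacobian \<open>E = 1 / J\<close>, turns the tests into moments in \<open>x\<close>; hence for almost every \<open>x\<close> the
  function \<open>u = E z(\<Phi>, t)\<close> is a constant \<open>c\<close>, and \<open>m = E f(\<Phi>, t)\<close> solves
  \<open>m' = v\<^sub>x(\<Phi>, t) m + c\<close>, so that \<open>f(\<Phi>, t) = f\<^sub>0 + c \<integral>\<^sub>0\<^sup>t J\<close>; the condition at time 1 determines \<open>c\<close>.

  For a minimizer, \<open>(f + s g, v, z + s (g\<^sub>t + v g\<^sub>x))\<close> is admissible for every test function \<open>g\<close>,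
  and the first variation in \<open>s\<close> is the continuity equation for \<open>z\<close>.\<close>

subsection \<open>Borel representatives on the unit square\<close>

text \<open>Everything is measured against one function \<open>L\<close>, twice the H2 norm of the
  velocity at time t. It bounds v and v_x on the whole interval and is square integrable in time,
  but not bounded. Hence products of f or z with v or v_x are merely integrable on the square, and
  the time modulus along the flow is an increment of the primitive of \<open>L\<close>, not a
  Lipschitz bound. The test functions built from the inverse flow have a time derivative bounded
  only by C (1 + L(t)), and the approximation in y must preserve this bound. Bernstein sums do: they
  average samples in y and leave t untouched. Each of their terms is a polynomial in y times an
  absolutely continuous function of t, so the weak equation enters only through spatial moments that
  are primitives in time. Monomials in x and t form a countable family, so one null set of starting
  points serves all tests. No values of z at the end times are given, so z is tested with \<theta>
  vanishing there; f is tested with all powers of t, which see f0 and f1.\<close>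

definition unit_B :: "real measure"
  where "unit_B = density lborel (\<lambda>x. ennreal (indicator {0<..<1} x))"

text \<open>\<open>unit_B\<close> is a density of \<open>lborel\<close> and not a restriction: it
  and its square keep the Borel sets and the whole line or plane as space, so measurability is that
  of Borel functions and Fubini applies without a completion. The objects of the statement, phrased
  with \<open>unit_I\<close>, are transferred by almost everywhere equality.\<close>

abbreviation unit_Q :: "(real \<times> real) measure"
  where "unit_Q \<equiv> unit_B \<Otimes>\<^sub>M unit_B"

lemma sets_unit_B [simp, measurable_cong]: "sets unit_B = sets borel"
  by (simp add: unit_B_def)

lemma space_unit_B [simp]: "space unit_B = UNIV"
  by (simp add: unit_B_def)

lemma measurable_unit_B [simp]: "measurable unit_B N = measurable borel N"
  by (rule measurable_cong_sets) simp_all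

lemma sets_unit_Q [simp, measurable_cong]: "sets unit_Q = sets (borel \<Otimes>\<^sub>M borel)"
  by (rule sets_pair_measure_cong) simp_all

lemma space_unit_Q [simp]: "space unit_Q = UNIV"
  by (simp add: space_pair_measure)

lemma AE_unit_B: "(AE x in unit_B. P x) \<longleftrightarrow> (AE x in lborel. x \<in> {0<..<1} \<longrightarrow> P x)"
  unfolding unit_B_def by (subst AE_density) (auto simp: indicator_def)

lemma AE_unit_B_interior: "AE x in unit_B. 0 < x \<and> x < 1"
  by (simp add: AE_unit_B)

lemma AE_unit_I: "(AE x in unit_I. P x) \<longleftrightarrow> (AE x in unit_B. P x)"
  by (simp add: AE_restrict_space_iff AE_completion_iff AE_unit_B)

lemma emeasure_unit_B: "emeasure unit_B UNIV = 1"
  unfolding unit_B_def by (subst emeasure_density) (auto simp: ennreal_indicator)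

lemma finite_measure_unit_B: "finite_measure unit_B"
  by (rule finite_measureI) (simp add: emeasure_unit_B)

interpretation unit_B: finite_measure unit_B
  by (rule finite_measure_unit_B)

interpretation unit_Q: pair_sigma_finite unit_B unit_B
  by standard

interpretation unit_Q: finite_measure unit_Q
  by (rule finite_measure_pair_measure[OF finite_measure_unit_B finite_measure_unit_B])

lemma measure_unit_B [simp]: "measure unit_B UNIV = 1"
  by (simp add: measure_def emeasure_unit_B)

lemma integrable_unit_B:
  fixes U :: "real \<Rightarrow> real"
  assumes "U \<in> borel_measurable borel"
  shows "integrable unit_B U \<longleftrightarrow> integrable lborel (\<lambda>x. indicator {0<..<1} x * U x)"
  unfolding unit_B_def using assms by (subst integrable_density) auto

lemma integral_unit_B:
  fixes U :: "real \<Rightarrow> real"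
  assumes "U \<in> borel_measurable borel"
  shows "integral\<^sup>L unit_B U = integral\<^sup>L lborel (\<lambda>x. indicator {0<..<1} x * U x)"
  unfolding unit_B_def using assms by (subst integral_density) auto

lemma borel_measurable_unit_I:
  fixes U :: "real \<Rightarrow> real"
  assumes "U \<in> borel_measurable borel"
  shows "U \<in> borel_measurable unit_I"
  using assms by (simp add: measurable_completion measurable_restrict_space1)

lemma unit_I_borel:
  fixes U :: "real \<Rightarrow> real"
  assumes [measurable]: "U \<in> borel_measurable borel"
  shows "integrable unit_I U \<longleftrightarrow> integrable unit_B U"
    and "integral\<^sup>L unit_I U = integral\<^sup>L unit_B U"
proof -
  have m: "(\<lambda>x. indicator {0<..<1} x * U x) \<in> borel_measurable lborel" by measurable
  show "integrable unit_I U \<longleftrightarrow> integrable unit_B U"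
    using integrable_completion[OF m] by (simp add: integrable_restrict_space integrable_unit_B)
  show "integral\<^sup>L unit_I U = integral\<^sup>L unit_B U"
    using integral_completion[OF m] by (simp add: integral_restrict_space integral_unit_B)
qed

text \<open>Lebesgue measure is complete, so a function may be altered on any null set without
  losing measurability.\<close>

lemma borel_measurable_unit_I_AE:
  fixes u U :: "real \<Rightarrow> real"
  assumes U: "U \<in> borel_measurable borel" and ae: "AE x in unit_B. u x = U x"
  shows "u \<in> borel_measurable unit_I"
proof -
  have "AE x in completion lborel. x \<in> {0<..<1} \<longrightarrow> u x = U x"
    using ae by (simp add: AE_unit_B AE_completion_iff)
  then have ae: "AE x in completion lborel.
      (if x \<in> {0<..<1} then U x else 0) = (if x \<in> {0<..<1} then u x else 0)"
    by eventually_elim auto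
  have "(\<lambda>x. if x \<in> {0<..<1} then U x else 0) \<in> borel_measurable (completion lborel)"
    using U by (intro measurable_completion) (auto intro!: measurable_If)
  from borel_measurable_AE[OF this ae] show ?thesis
    by (rule borel_measurable_if_D)
qed

lemma unit_I_AE:
  fixes u U :: "real \<Rightarrow> real"
  assumes U: "U \<in> borel_measurable borel" and ae: "AE x in unit_B. u x = U x"
  shows "integrable unit_I u \<longleftrightarrow> integrable unit_B U"
    and "integral\<^sup>L unit_I u = integral\<^sup>L unit_B U"
proof -
  have ae': "AE x in unit_I. u x = U x" using ae by (simp add: AE_unit_I)
  note m = borel_measurable_unit_I_AE[OF assms] borel_measurable_unit_I[OF U]
  show "integrable unit_I u \<longleftrightarrow> integrable unit_B U"
    by (rule trans[OF integrable_cong_AE[OF m ae'] unit_I_borel(1)[OF U]])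
  show "integral\<^sup>L unit_I u = integral\<^sup>L unit_B U"
    by (rule trans[OF integral_cong_AE[OF m ae'] unit_I_borel(2)[OF U]])
qed

lemma unit_I_borel_version:
  fixes u :: "real \<Rightarrow> real"
  assumes "u \<in> borel_measurable unit_I"
  obtains U where "U \<in> borel_measurable borel" "AE x in unit_B. u x = U x"
proof -
  have "(\<lambda>x. if x \<in> {0<..<1} then u x else 0) \<in> borel_measurable lebesgue"
    using assms by (subst borel_measurable_if) auto
  from completion_ex_borel_measurable_real[OF this]
  obtain U where U: "U \<in> borel_measurable lborel"
    "AE x in lborel. (if x \<in> {0<..<1} then u x else 0) = U x" by blast
  show thesis
  proof
    show "U \<in> borel_measurable borel" using U(1) by simp
    show "AE x in unit_B. u x = U x"
      unfolding AE_unit_B using U(2) by eventually_elim auto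
  qed
qed

text \<open>A Borel version of a curried function on the square.  The hypothesis is weaker than
  almost everywhere equality, since \<open>u\<close> need not be jointly measurable: it applies
  to \<open>wd (\<lambda>y. v y t) x\<close>, whose slices are chosen independently of each other.\<close>

definition borel_rep :: "(real \<Rightarrow> real \<Rightarrow> real) \<Rightarrow> (real \<Rightarrow> real \<Rightarrow> real) \<Rightarrow> bool"
  where "borel_rep u U \<longleftrightarrow> (\<lambda>p. U (fst p) (snd p)) \<in> borel_measurable (borel \<Otimes>\<^sub>M borel) \<and>
           (AE t in unit_B. AE x in unit_B. u x t = U x t)"

abbreviation Qint :: "(real \<Rightarrow> real \<Rightarrow> real) \<Rightarrow> real"
  where "Qint U \<equiv> \<integral>p. U (fst p) (snd p) \<partial>unit_Q"

abbreviation Qintegrable :: "(real \<Rightarrow> real \<Rightarrow> real) \<Rightarrow> bool"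
  where "Qintegrable U \<equiv> integrable unit_Q (\<lambda>p. U (fst p) (snd p))"

abbreviation Qmeas :: "(real \<Rightarrow> real \<Rightarrow> real) \<Rightarrow> bool"
  where "Qmeas U \<equiv> (\<lambda>p. U (fst p) (snd p)) \<in> borel_measurable (borel \<Otimes>\<^sub>M borel)"

lemma measurable_unit_Q [simp]: "measurable unit_Q N = measurable (borel \<Otimes>\<^sub>M borel) N"
  by (rule measurable_cong_sets) simp_all

lemma Qmeas_slice:
  assumes "Qmeas U"
  shows "(\<lambda>x. U x t) \<in> borel_measurable borel" and "(\<lambda>t. U x t) \<in> borel_measurable borel"
proof -
  show "(\<lambda>x. U x t) \<in> borel_measurable borel"
    using measurable_compose[OF _ assms, of "\<lambda>x. (x, t)" borel] by simp
  show "(\<lambda>t. U x t) \<in> borel_measurable borel"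
    using measurable_compose[OF _ assms, of "\<lambda>t. (x, t)" borel] by simp
qed

lemma Qmeas_swap: "Qmeas U \<Longrightarrow> Qmeas (\<lambda>t x. U x t)"
  using measurable_compose[of "\<lambda>p. (snd p, fst p)" "borel \<Otimes>\<^sub>M borel" "borel \<Otimes>\<^sub>M borel"
      "\<lambda>p. U (fst p) (snd p)" borel] by simp

lemma Qmeas_integral:
  assumes "Qmeas U"
  shows "(\<lambda>t. \<integral>x. U x t \<partial>unit_B) \<in> borel_measurable borel"
    and "(\<lambda>x. \<integral>t. U x t \<partial>unit_B) \<in> borel_measurable borel"
proof -
  have 1: "(\<lambda>t. \<integral>x. V t x \<partial>unit_B) \<in> borel_measurable borel" if "Qmeas V" for V :: "real \<Rightarrow> real \<Rightarrow> real"
    by (rule unit_B.borel_measurable_lebesgue_integral) (use that in \<open>simp add: case_prod_beta\<close>)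
  show "(\<lambda>x. \<integral>t. U x t \<partial>unit_B) \<in> borel_measurable borel" by (rule 1[OF assms])
  show "(\<lambda>t. \<integral>x. U x t \<partial>unit_B) \<in> borel_measurable borel" by (rule 1[OF Qmeas_swap[OF assms]])
qed

lemma Q_swap:
  assumes "Qintegrable U"
  shows "Qintegrable (\<lambda>t x. U x t)" and "Qint (\<lambda>t x. U x t) = Qint U"
proof -
  show "Qintegrable (\<lambda>t x. U x t)"
    using unit_Q.integrable_product_swap[OF assms] by (simp add: case_prod_beta')
  show "Qint (\<lambda>t x. U x t) = Qint U"
    using unit_Q.integral_product_swap[OF borel_measurable_integrable[OF assms]]
    by (simp add: case_prod_beta')
qed

lemma Q_Fubini:
  assumes "Qintegrable U"
  shows "Qint U = (\<integral>x. (\<integral>t. U x t \<partial>unit_B) \<partial>unit_B)"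
    and "Qint U = (\<integral>t. (\<integral>x. U x t \<partial>unit_B) \<partial>unit_B)"
    and "AE x in unit_B. integrable unit_B (\<lambda>t. U x t)"
    and "AE t in unit_B. integrable unit_B (\<lambda>x. U x t)"
    and "integrable unit_B (\<lambda>x. \<integral>t. U x t \<partial>unit_B)"
    and "integrable unit_B (\<lambda>t. \<integral>x. U x t \<partial>unit_B)"
  using unit_Q.integral_fst'[OF assms] unit_Q.integral_fst'[OF Q_swap(1)[OF assms]] Q_swap(2)[OF assms]
    unit_Q.AE_integrable_fst'[OF assms] unit_Q.AE_integrable_fst'[OF Q_swap(1)[OF assms]]
    unit_Q.integrable_fst'[OF assms] unit_Q.integrable_fst'[OF Q_swap(1)[OF assms]]
  by simp_all

lemma Qintegrable_Fubini:
  assumes "Qmeas U" "AE t in unit_B. integrable unit_B (\<lambda>x. U x t)"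
    "integrable unit_B (\<lambda>t. \<integral>x. \<bar>U x t\<bar> \<partial>unit_B)"
  shows "Qintegrable U"
proof -
  have "Qintegrable (\<lambda>t x. U x t)"
    using assms Qmeas_swap[OF assms(1)]
    by (intro unit_Q.Fubini_integrable) (simp_all add: case_prod_beta)
  from Q_swap(1)[OF this] show ?thesis .
qed

lemma iint_borel_rep:
  assumes "borel_rep u U"
  shows "iint u = (\<integral>t. (\<integral>x. U x t \<partial>unit_B) \<partial>unit_B)"
    and "AE t in unit_B. (\<integral>x. u x t \<partial>unit_I) = (\<integral>x. U x t \<partial>unit_B)"
proof -
  have m: "Qmeas U" and ae: "AE t in unit_B. AE x in unit_B. u x t = U x t"
    using assms by (auto simp: borel_rep_def)
  from ae show *: "AE t in unit_B. (\<integral>x. u x t \<partial>unit_I) = (\<integral>x. U x t \<partial>unit_B)"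
    by eventually_elim (rule unit_I_AE(2)[OF Qmeas_slice(1)[OF m]])
  show "iint u = (\<integral>t. (\<integral>x. U x t \<partial>unit_B) \<partial>unit_B)"
    unfolding iint_def by (rule unit_I_AE(2)[OF Qmeas_integral(1)[OF m] *])
qed

lemma iint_eq_Qint:
  assumes "borel_rep u U" "Qintegrable U"
  shows "iint u = Qint U"
  using iint_borel_rep(1)[OF assms(1)] Q_Fubini(2)[OF assms(2)] by simp

text \<open>The exceptional set is enclosed in a Borel null set, because exchanging the order of the
  two quantifiers requires a measurable set.\<close>

lemma AE_lborel_curry:
  fixes P :: "real \<Rightarrow> real \<Rightarrow> bool"
  assumes "AE p in lborel. P (fst p) (snd p)"
  shows "AE x in lborel. AE y in lborel. P x y" "AE y in lborel. AE x in lborel. P x y"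
proof -
  have 1: "AE p in lborel \<Otimes>\<^sub>M lborel. P (fst p) (snd p)"
    by (subst lborel_prod) (rule assms)
  show "AE x in lborel. AE y in lborel. P x y" using lborel_pair.AE_pair[OF 1] by simp
  obtain N where N: "N \<in> sets (lborel \<Otimes>\<^sub>M lborel)" "emeasure (lborel \<Otimes>\<^sub>M lborel) N = 0"
      "{p \<in> space (lborel \<Otimes>\<^sub>M lborel). \<not> P (fst p) (snd p)} \<subseteq> N"
    using 1 by (rule AE_E)
  have N': "AE p in lborel \<Otimes>\<^sub>M lborel. p \<notin> N"
    using N(1,2) by (intro AE_not_in) (auto simp: null_sets_def)
  have "{p \<in> space (lborel \<Otimes>\<^sub>M lborel). (fst p, snd p) \<notin> N} \<in> sets (lborel \<Otimes>\<^sub>M lborel)"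
    using sets.compl_sets[OF N(1)] by (simp add: set_diff_eq)
  from lborel_pair.AE_commute[OF this] lborel_pair.AE_pair[OF N']
  have "AE y in lborel. AE x in lborel. (x, y) \<notin> N" by simp
  then show "AE y in lborel. AE x in lborel. P x y"
  proof eventually_elim
    case (elim y)
    then show ?case
    proof eventually_elim
      case (elim x)
      then have "(x, y) \<notin> {p \<in> space (lborel \<Otimes>\<^sub>M lborel). \<not> P (fst p) (snd p)}"
        using N(3) by blast
      then show ?case by (simp add: space_pair_measure)
    qed
  qed
qed

text \<open>The joint statement on the plane is returned besides \<open>borel_rep\<close>: equality
  slice by slice does not control a null set of the square, and composition with the flow later
  moves such null sets.\<close>

lemma borel_rep_ex:
  assumes "(\<lambda>(x, t). u x t) \<in> borel_measurable (lebesgue_on ({0<..<1} \<times> {0<..<1}))"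
  obtains U where "borel_rep u U"
    "AE p in lborel. p \<in> {0<..<1} \<times> {0<..<1} \<longrightarrow> u (fst p) (snd p) = U (fst p) (snd p)"
proof -
  let ?S = "{0<..<1::real} \<times> {0<..<1::real}"
  have "open ?S" by (intro open_Times) auto
  then have "(\<lambda>p. if p \<in> ?S then (\<lambda>(x, t). u x t) p else 0) \<in> borel_measurable lebesgue"
    using assms by (subst borel_measurable_if) auto
  from completion_ex_borel_measurable_real[OF this]
  obtain U where U: "U \<in> borel_measurable lborel"
    "AE p in lborel. (if p \<in> ?S then (\<lambda>(x, t). u x t) p else 0) = U p" by blast
  have ae: "AE p in lborel. fst p \<in> {0<..<1} \<and> snd p \<in> {0<..<1} \<longrightarrow> u (fst p) (snd p) = U (fst p, snd p)"
    using U(2) by eventually_elim (auto split: if_splits)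
  have "U \<in> borel_measurable (borel \<Otimes>\<^sub>M borel)" using U(1) by (simp add: borel_prod)
  moreover have "AE t in unit_B. AE x in unit_B. u x t = U (x, t)"
    unfolding AE_unit_B using AE_lborel_curry(2)[OF ae] by eventually_elim auto
  ultimately have "borel_rep u (\<lambda>x t. U (x, t))" by (simp add: borel_rep_def)
  then show thesis using ae by (intro that[of "\<lambda>x t. U (x, t)"]) (auto simp: mem_Times_iff)
qed

lemma unit_I_AE_square:
  fixes u U :: "real \<Rightarrow> real"
  assumes U: "U \<in> borel_measurable borel" and ae: "AE x in unit_B. u x = U x"
  shows "integrable unit_I (\<lambda>x. (u x)\<^sup>2) \<longleftrightarrow> integrable unit_B (\<lambda>x. (U x)\<^sup>2)"
    and "(\<integral>x. (u x)\<^sup>2 \<partial>unit_I) = (\<integral>x. (U x)\<^sup>2 \<partial>unit_B)"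
proof -
  have m: "(\<lambda>x. (U x)\<^sup>2) \<in> borel_measurable borel" using U by measurable
  have ae2: "AE x in unit_B. (u x)\<^sup>2 = (U x)\<^sup>2" using ae by eventually_elim simp
  show "integrable unit_I (\<lambda>x. (u x)\<^sup>2) \<longleftrightarrow> integrable unit_B (\<lambda>x. (U x)\<^sup>2)"
    by (rule unit_I_AE(1)[OF m ae2])
  show "(\<integral>x. (u x)\<^sup>2 \<partial>unit_I) = (\<integral>x. (U x)\<^sup>2 \<partial>unit_B)"
    by (rule unit_I_AE(2)[OF m ae2])
qed

lemma L2_borel_iff:
  assumes "U \<in> borel_measurable borel" and "AE x in unit_B. u x = U x"
  shows "u \<in> L2 \<longleftrightarrow> integrable unit_B (\<lambda>x. (U x)\<^sup>2)"
  unfolding L2_def mem_Collect_eq unit_I_AE_square(1)[OF assms]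
  using borel_measurable_unit_I_AE[OF assms] by blast

lemma L2_norm_borel:
  assumes "U \<in> borel_measurable borel" "AE x in unit_B. u x = U x"
  shows "(L2_norm u)\<^sup>2 = (\<integral>x. (U x)\<^sup>2 \<partial>unit_B)"
  unfolding L2_norm_def unit_I_AE_square(2)[OF assms] by simp

lemma abs_le_one_plus_square: "\<bar>x\<bar> \<le> 1 + x\<^sup>2" for x :: real
  using zero_le_power2[of "\<bar>x\<bar> - 1"] zero_le_power2[of x]
  by (simp add: power2_diff)

lemma L2_borel_version:
  assumes "u \<in> L2"
  obtains U where "U \<in> borel_measurable borel" "AE x in unit_B. u x = U x"
    "integrable unit_B (\<lambda>x. (U x)\<^sup>2)" "integrable unit_B U"
proof -
  from assms have "u \<in> borel_measurable unit_I" by (simp add: L2_def)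
  then obtain U where U: "U \<in> borel_measurable borel" "AE x in unit_B. u x = U x"
    by (rule unit_I_borel_version)
  have 2: "integrable unit_B (\<lambda>x. (U x)\<^sup>2)"
    using assms L2_borel_iff[OF U] by blast
  then have "integrable unit_B (\<lambda>x. 1 + (U x)\<^sup>2)" by simp
  then have "integrable unit_B U"
    by (rule Bochner_Integration.integrable_bound)
      (use U(1) abs_le_one_plus_square in \<open>auto simp: abs_le_one_plus_square\<close>)
  with U 2 show thesis by (intro that)
qed

lemma bochner_L2_D:
  assumes "u \<in> bochner_L2 X nrm"
  shows "(\<lambda>(x, t). u x t) \<in> borel_measurable (lebesgue_on ({0<..<1} \<times> {0<..<1}))"
    and "AE t in unit_I. (\<lambda>x. u x t) \<in> X"
    and "integrable unit_I (\<lambda>t. (nrm (\<lambda>x. u x t))\<^sup>2)"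
  using assms unfolding bochner_L2_def mem_Collect_eq by blast+

text \<open>With a jointly Borel version the Bochner norm is an iterated integral of the square, and
  on a finite measure space square integrability implies integrability.\<close>

lemma L2L2_borel_rep:
  assumes u: "u \<in> L2L2"
  obtains U where "borel_rep u U" "Qintegrable (\<lambda>x t. (U x t)\<^sup>2)" "Qintegrable U"
    "AE p in lborel. p \<in> {0<..<1} \<times> {0<..<1} \<longrightarrow> u (fst p) (snd p) = U (fst p) (snd p)"
proof -
  have meas: "(\<lambda>(x, t). u x t) \<in> borel_measurable (lebesgue_on ({0<..<1} \<times> {0<..<1}))"
    and L2: "AE t in unit_B. (\<lambda>x. u x t) \<in> L2"
    and int: "integrable unit_I (\<lambda>t. (L2_norm (\<lambda>x. u x t))\<^sup>2)"
    using bochner_L2_D(1)[OF u] bochner_L2_D(2)[OF u, unfolded AE_unit_I] bochner_L2_D(3)[OF u] .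
  from borel_rep_ex[OF meas] obtain U where U: "borel_rep u U"
    "AE p in lborel. p \<in> {0<..<1} \<times> {0<..<1} \<longrightarrow> u (fst p) (snd p) = U (fst p) (snd p)" .
  from U(1) have m [measurable]: "Qmeas U" and ae: "AE t in unit_B. AE x in unit_B. u x t = U x t"
    by (auto simp: borel_rep_def)
  have m2: "Qmeas (\<lambda>x t. (U x t)\<^sup>2)" by measurable
  have nrm: "AE t in unit_B. (L2_norm (\<lambda>x. u x t))\<^sup>2 = (\<integral>x. (U x t)\<^sup>2 \<partial>unit_B)"
    using ae by eventually_elim (rule L2_norm_borel[OF Qmeas_slice(1)[OF m]])
  have "integrable unit_B (\<lambda>t. \<integral>x. (U x t)\<^sup>2 \<partial>unit_B)"
    using int unit_I_AE(1)[OF Qmeas_integral(1)[OF m2] nrm] by blast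
  moreover have "AE t in unit_B. integrable unit_B (\<lambda>x. (U x t)\<^sup>2)"
    using L2 ae by eventually_elim (rule L2_borel_iff[OF Qmeas_slice(1)[OF m], THEN iffD1])
  ultimately have 2: "Qintegrable (\<lambda>x t. (U x t)\<^sup>2)"
    using m2 by (intro Qintegrable_Fubini) auto
  then have "Qintegrable (\<lambda>x t. 1 + (U x t)\<^sup>2)" by simp
  then have "Qintegrable U"
    by (rule Bochner_Integration.integrable_bound) (use m abs_le_one_plus_square in auto)
  with U 2 show thesis by (intro that)
qed

subsection \<open>Smooth cutoff functions\<close>

text \<open>The one-variable analogue of \<open>smooth2\<close>. Exhibiting a tower of derivatives
  is easier than reasoning about iterated \<open>deriv\<close>; \<open>smooth1_iff_deriv\<close>
  links it to \<open>test_fun\<close>.\<close>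

definition smooth1 :: "(real \<Rightarrow> real) \<Rightarrow> bool"
  where "smooth1 a \<longleftrightarrow> (\<exists>D :: nat \<Rightarrow> real \<Rightarrow> real. D 0 = a \<and>
           (\<forall>n x. (D n has_real_derivative D (Suc n) x) (at x)))"

text \<open>Choosing a derivative inside a class closed under differentiation, again and again,
  builds the whole tower.\<close>

lemma smooth1_coinduct:
  assumes "a \<in> R" "\<And>h. h \<in> R \<Longrightarrow> \<exists>h'\<in>R. \<forall>x. (h has_real_derivative h' x) (at x)"
  shows "smooth1 a"
proof -
  obtain d where d: "\<And>h. h \<in> R \<Longrightarrow> d h \<in> R \<and> (\<forall>x. (h has_real_derivative d h x) (at x))"
    using assms(2) by metis
  have "(d ^^ n) a \<in> R" for n by (induction n) (use assms(1) d in auto)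
  then show ?thesis
    using d unfolding smooth1_def by (intro exI[of _ "\<lambda>n. (d ^^ n) a"]) auto
qed

lemma smooth1_deriv:
  assumes "smooth1 a"
  shows "smooth1 (deriv a)" and "(a has_real_derivative deriv a x) (at x)"
proof -
  obtain D where D: "D 0 = a" "\<And>n x. (D n has_real_derivative D (Suc n) x) (at x)"
    using assms unfolding smooth1_def by blast
  have "deriv a = D 1" using D(2)[of 0] D(1) by (auto intro!: ext DERIV_imp_deriv)
  then show "smooth1 (deriv a)"
    using D unfolding smooth1_def by (intro exI[of _ "\<lambda>n. D (Suc n)"]) auto
  show "(a has_real_derivative deriv a x) (at x)" using D(1) D(2)[of 0] \<open>deriv a = D 1\<close> by auto
qed

lemma smooth1_iterated_deriv: "smooth1 a \<Longrightarrow> smooth1 ((deriv ^^ n) a)"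
  by (induction n) (auto simp: smooth1_deriv)

lemma smooth1_isCont: "smooth1 a \<Longrightarrow> isCont a x"
  using smooth1_deriv(2) DERIV_isCont by blast

lemma smooth1_iff_deriv: "smooth1 a \<longleftrightarrow> (\<forall>n x. (deriv ^^ n) a field_differentiable at x)"
proof
  assume "smooth1 a"
  then show "\<forall>n x. (deriv ^^ n) a field_differentiable at x"
    using smooth1_deriv(2)[OF smooth1_iterated_deriv] unfolding field_differentiable_def by blast
next
  assume *: "\<forall>n x. (deriv ^^ n) a field_differentiable at x"
  have "((deriv ^^ n) a has_real_derivative (deriv ^^ Suc n) a x) (at x)" for n x
    using field_differentiable_derivI[OF *[rule_format, of n x]] by simp
  then show "smooth1 a"
    unfolding smooth1_def by (intro exI[of _ "\<lambda>n. (deriv ^^ n) a"] conjI allI) (simp, blast)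
qed

text \<open>Finite sums of products \<open>D i x * E j x\<close>, coded by lists of index pairs, are
  closed under differentiation: the Leibniz rule replaces each pair by two, and no binomial
  coefficients appear.\<close>

lemma smooth1_mult:
  assumes "smooth1 a" "smooth1 b"
  shows "smooth1 (\<lambda>x. a x * b x)"
proof -
  obtain D where D: "D 0 = a" "\<And>n x. (D n has_real_derivative D (Suc n) x) (at x)"
    using assms unfolding smooth1_def by blast
  obtain E where E: "E 0 = b" "\<And>n x. (E n has_real_derivative E (Suc n) x) (at x)"
    using assms unfolding smooth1_def by blast
  define S where "S l x = (\<Sum>(i, j)\<leftarrow>l. D i x * E j x)" for l :: "(nat \<times> nat) list" and x
  define nxt where "nxt l = concat (map (\<lambda>(i, j). [(Suc i, j), (i, Suc j)]) l)"
    for l :: "(nat \<times> nat) list"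
  show ?thesis
  proof (rule smooth1_coinduct[of _ "range S"])
    have "(\<lambda>x. a x * b x) = S [(0, 0)]" by (auto simp: S_def D(1) E(1))
    then show "(\<lambda>x. a x * b x) \<in> range S" by blast
  next
    fix h assume "h \<in> range S"
    then obtain l where h: "h = S l" by blast
    have "(S l has_real_derivative S (nxt l) x) (at x)" for x
    proof (induction l)
      case Nil
      then show ?case by (simp add: S_def[abs_def] nxt_def)
    next
      case (Cons ij l)
      obtain i j where ij: "ij = (i, j)" by fastforce
      have "S (ij # l) = (\<lambda>x. D i x * E j x + S l x)" by (auto simp: S_def ij)
      moreover have "S (nxt (ij # l)) x = D (Suc i) x * E j x + D i x * E (Suc j) x + S (nxt l) x"
        by (simp add: S_def nxt_def ij)
      moreover have "((\<lambda>x. D i x * E j x + S l x) has_real_derivative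
          D (Suc i) x * E j x + D i x * E (Suc j) x + S (nxt l) x) (at x)"
        by (rule derivative_eq_intros D(2) E(2) Cons refl)+ simp
      ultimately show ?case by simp
    qed
    then show "\<exists>h'\<in>range S. \<forall>x. (h has_real_derivative h' x) (at x)"
      using h by blast
  qed
qed

lemma smooth1_affine:
  assumes "smooth1 a"
  shows "smooth1 (\<lambda>x. a (c * x + d))"
proof -
  obtain D where D: "D 0 = a" "\<And>n x. (D n has_real_derivative D (Suc n) x) (at x)"
    using assms unfolding smooth1_def by blast
  have "((\<lambda>x. c ^ n * D n (c * x + d)) has_real_derivative c ^ Suc n * D (Suc n) (c * x + d)) (at x)" for n x
    by (rule derivative_eq_intros DERIV_chain'[where f="\<lambda>x. c * x + d" and g="D n"] D(2) refl)+ simp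
  then show ?thesis using D(1) unfolding smooth1_def
    by (intro exI[of _ "\<lambda>n x. c ^ n * D n (c * x + d)"]) auto
qed

lemma smooth1_poly: "smooth1 (poly p)"
  unfolding smooth1_def by (intro exI[of _ "\<lambda>n. poly ((pderiv ^^ n) p)"]) (auto simp: poly_DERIV)

lemma poly_times_exp_tendsto_0: "((\<lambda>y. poly p y * exp (- y)) \<longlongrightarrow> (0::real)) at_top"
proof -
  have "((\<lambda>y. \<Sum>i\<le>degree p. coeff p i * (y ^ i / exp y)) \<longlongrightarrow> (\<Sum>i\<le>degree p. coeff p i * 0)) at_top"
    by (intro tendsto_sum tendsto_mult tendsto_const tendsto_power_div_exp_0)
  moreover have "poly p y * exp (- y) = (\<Sum>i\<le>degree p. coeff p i * (y ^ i / exp y))" for y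
    unfolding poly_altdef sum_distrib_right exp_minus by (rule sum.cong) (auto simp: divide_inverse)
  ultimately show ?thesis by simp
qed

definition flat :: "real \<Rightarrow> real"
  where "flat x = (if 0 < x then exp (- 1 / x) else 0)"

text \<open>The functions equal to p(1/x) exp(-1/x) for x > 0 and to 0 elsewhere, with p a
  polynomial, are closed under differentiation. At the origin exponential decay beats every power of
  1/x.\<close>

lemma smooth1_flat: "smooth1 flat"
proof -
  define F where "F p x = (if 0 < x then poly p (1 / x) * exp (- 1 / x) else 0)" for p and x :: real
  show ?thesis
  proof (rule smooth1_coinduct[of _ "range F"])
    have "flat = F [:1:]" by (auto simp: F_def flat_def)
    then show "flat \<in> range F" by blast
  next
    fix h assume "h \<in> range F"
    then obtain p where h: "h = F p" by blast
    \<comment> \<open>With y = 1/x one has y' = - y^2, so the derivative of p(y) exp(-y) in x is y^2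
      (p(y) - p'(y)) exp(-y).\<close>
    let ?q = "monom 1 2 * (p - pderiv p)"
    have "(F p has_real_derivative F ?q x) (at x)" for x
    proof -
      consider "x > 0" | "x < 0" | "x = 0" by linarith
      then show ?thesis
      proof cases
        case 1
        have d: "((\<lambda>x. 1 / x) has_real_derivative - 1 / x\<^sup>2) (at x)"
          using 1 by (auto intro!: derivative_eq_intros simp: power2_eq_square)
        have e: "((\<lambda>x. - 1 / x) has_real_derivative 1 / x\<^sup>2) (at x)"
          using 1 by (auto intro!: derivative_eq_intros simp: power2_eq_square)
        have "((\<lambda>x. poly p (1 / x) * exp (- 1 / x)) has_real_derivative
            poly (pderiv p) (1 / x) * (- 1 / x\<^sup>2) * exp (- 1 / x) + exp (- 1 / x) * (1 / x\<^sup>2) * poly p (1 / x)) (at x)"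
          by (rule DERIV_mult[OF DERIV_chain2[OF poly_DERIV d] DERIV_chain2[OF DERIV_exp e]])
        also have "poly (pderiv p) (1 / x) * (- 1 / x\<^sup>2) * exp (- 1 / x) + exp (- 1 / x) * (1 / x\<^sup>2) * poly p (1 / x) = F ?q x"
          using 1 by (simp add: F_def poly_monom power_one_over algebra_simps)
        finally have "((\<lambda>x. poly p (1 / x) * exp (- 1 / x)) has_real_derivative F ?q x) (at x)" .
        then show ?thesis
          by (rule has_field_derivative_transform_within_open[of _ _ _ "{0<..}"]) (use 1 in \<open>auto simp: F_def\<close>)
      next
        case 2
        have "((\<lambda>x. 0) has_real_derivative F ?q x) (at x)" using 2 by (simp add: F_def)
        then show ?thesis
          by (rule has_field_derivative_transform_within_open[of _ _ _ "{..<0}"]) (use 2 in \<open>auto simp: F_def\<close>)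
      next
        case 3
        have "((\<lambda>y. poly (pCons 0 p) y * exp (- y)) \<longlongrightarrow> 0) at_top"
          by (rule poly_times_exp_tendsto_0)
        then have "((\<lambda>x. poly (pCons 0 p) (inverse x) * exp (- inverse x)) \<longlongrightarrow> 0) (at_right 0)"
          by (rule filterlim_compose) (rule filterlim_inverse_at_top_right)
        moreover have "\<forall>\<^sub>F x in at_right 0. poly (pCons 0 p) (inverse x) * exp (- inverse x) = (F p x - F p 0) / (x - 0)"
          using eventually_at_right_less[of "0::real"]
          by eventually_elim (simp add: F_def divide_inverse mult.commute mult.left_commute)
        ultimately have r: "((\<lambda>x. (F p x - F p 0) / (x - 0)) \<longlongrightarrow> 0) (at_right 0)"
          by (rule Lim_transform_eventually)
        have "\<forall>\<^sub>F x in at_left 0. x \<in> {-1<..<0::real}"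
          by (rule eventually_at_left_real) simp
        then have "\<forall>\<^sub>F x in at_left 0. (F p x - F p 0) / (x - 0) = 0"
          by eventually_elim (simp add: F_def)
        then have l: "((\<lambda>x. (F p x - F p 0) / (x - 0)) \<longlongrightarrow> 0) (at_left 0)"
          by (rule tendsto_eventually)
        have "(F p has_real_derivative 0) (at 0)"
          unfolding has_field_derivative_iff using filterlim_split_at[OF l r] by simp
        then show ?thesis using 3 by (simp add: F_def)
      qed
    qed
    then show "\<exists>h'\<in>range F. \<forall>x. (h has_real_derivative h' x) (at x)"
      using h by blast
  qed
qed

text \<open>The step is the normalised primitive of the bump \<open>flat x * flat (1 - x)\<close>,
  which lives on the unit interval. The bound on its derivative is recorded because rescaled copies
  are used for the cutoffs.\<close>

lemma smooth_step_exists: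
  obtains S :: "real \<Rightarrow> real" and c where "smooth1 S" "\<And>x. x \<le> 0 \<Longrightarrow> S x = 0" "\<And>x. x \<ge> 1 \<Longrightarrow> S x = 1"
    "\<And>x. 0 \<le> S x \<and> S x \<le> 1" "\<And>x. \<bar>deriv S x\<bar> \<le> c"
proof -
  define b where "b x = flat x * flat ((-1) * x + 1)" for x
  have sb: "smooth1 b" unfolding b_def[abs_def] by (intro smooth1_mult smooth1_flat smooth1_affine)
  have cb: "continuous_on A b" for A using smooth1_isCont[OF sb] by (simp add: continuous_at_imp_continuous_on)
  have b0: "b x = 0" if "x \<le> 0 \<or> x \<ge> 1" for x using that by (auto simp: b_def flat_def)
  have bnn: "b x \<ge> 0" for x by (simp add: b_def flat_def)
  define I where "I = integral {0..1} b"
  have bi: "b integrable_on {u..v}" for u v by (rule integrable_continuous_real) (rule cb)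
  have Ipos: "I > 0"
  proof -
    have "I \<ge> 0" unfolding I_def using bnn bi by (intro integral_nonneg) auto
    moreover have "I \<noteq> 0"
    proof
      assume "I = 0"
      then have "(b has_integral 0) (cbox 0 1)" using bi[of 0 1] unfolding I_def by (simp add: has_integral_integral)
      then have "b (1/2) = 0" by (rule has_integral_0_cbox_imp_0[rotated 2]) (use cb bnn in auto)
      then show False by (simp add: b_def flat_def)
    qed
    ultimately show ?thesis by simp
  qed
  define S where "S x = integral {0..x} b / I" for x
  have S0: "S x = 0" if "x \<le> 0" for x using that by (cases "x = 0") (auto simp: S_def)
  have S1: "S x = 1" if "x \<ge> 1" for x
  proof -
    have "integral {0..x} b = integral {0..1} b + integral {1..x} b"
      using that bi by (intro Henstock_Kurzweil_Integration.integral_combine[symmetric]) auto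
    also have "integral {1..x} b = integral {1..x} (\<lambda>_. 0)" by (intro integral_cong) (auto simp: b0)
    finally show ?thesis using Ipos by (simp add: S_def I_def)
  qed
  have dS: "(S has_real_derivative b x / I) (at x)" for x
  proof -
    consider "x < 0" | "x > 1" | "-1 < x \<and> x < 2" by linarith
    then show ?thesis
    proof cases
      case 1
      have "((\<lambda>_. 0) has_real_derivative b x / I) (at x)" using 1 by (simp add: b0)
      then show ?thesis
        by (rule has_field_derivative_transform_within_open[of _ _ _ "{..<0}"]) (use 1 in \<open>auto simp: S0\<close>)
    next
      case 2
      have "((\<lambda>_. 1) has_real_derivative b x / I) (at x)" using 2 by (simp add: b0)
      then show ?thesis
        by (rule has_field_derivative_transform_within_open[of _ _ _ "{1<..}"]) (use 2 in \<open>auto simp: S1\<close>)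
    next
      case 3
      have "((\<lambda>u. integral {-1..u} b) has_real_derivative b x) (at x within {-1..2})"
        using 3 by (intro integral_has_real_derivative cb) auto
      then have "((\<lambda>u. integral {-1..u} b) has_real_derivative b x) (at x)"
        using 3 by (subst (asm) at_within_interior) auto
      then have "((\<lambda>u. integral {-1..u} b / I) has_real_derivative b x / I) (at x)"
        by (rule DERIV_cdivide)
      then show ?thesis
      proof (rule has_field_derivative_transform_within_open[of _ _ _ "{-1<..<2}"])
        fix u :: real assume u: "u \<in> {-1<..<2}"
        have z: "integral {-1..min u 0} b = 0"
          using integral_cong[of "{-1..min u 0}" b "\<lambda>_. 0"] by (auto simp: b0)
        show "integral {-1..u} b / I = S u"
        proof (cases "u \<ge> 0")
          case True
          then have "integral {-1..u} b = integral {-1..0} b + integral {0..u} b"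
            using bi by (intro Henstock_Kurzweil_Integration.integral_combine[symmetric]) auto
          then show ?thesis using z True by (simp add: S_def min_def split: if_splits)
        next
          case False
          then show ?thesis using z by (simp add: S0)
        qed
      qed (use 3 in auto)
    qed
  qed
  have "smooth1 (\<lambda>x. b x * poly [:1 / I:] x)" by (intro smooth1_mult sb smooth1_poly)
  then have "smooth1 (\<lambda>x. b x / I)" by simp
  then obtain D where D: "D 0 = (\<lambda>x. b x / I)" "\<And>n x. (D n has_real_derivative D (Suc n) x) (at x)"
    unfolding smooth1_def by blast
  define E where "E n = (case n of 0 \<Rightarrow> S | Suc m \<Rightarrow> D m)" for n
  have "(E n has_real_derivative E (Suc n) x) (at x)" for n x
    by (cases n) (simp_all add: E_def D dS)
  moreover have "E 0 = S" by (simp add: E_def)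
  ultimately have "smooth1 S" unfolding smooth1_def by blast
  moreover have "0 \<le> S x \<and> S x \<le> 1" for x
  proof -
    have "\<exists>d. (S has_real_derivative d) (at u) \<and> 0 \<le> d" for u
      using dS[of u] bnn[of u] Ipos by (intro exI[of _ "b u / I"]) simp
    then have "S u \<le> S v" if "u \<le> v" for u v
      using DERIV_nonneg_imp_nondecreasing[of u v S] that by blast
    from this[of "min x 0" x] this[of x "max x 1"] S0[of "min x 0"] S1[of "max x 1"]
    show ?thesis by simp
  qed
  moreover obtain c where "\<And>x. \<bar>deriv S x\<bar> \<le> c"
  proof -
    have deriv_S: "deriv S x = b x / I" for x by (rule DERIV_imp_deriv) (rule dS)
    moreover have "bounded ((\<lambda>x. b x / I) ` {0..1})"
      by (intro compact_imp_bounded compact_continuous_image continuous_intros cb) (use Ipos in auto)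
    then obtain c where c: "\<And>x. x \<in> {0..1} \<Longrightarrow> \<bar>b x / I\<bar> \<le> c" unfolding bounded_iff by fastforce
    then have "\<bar>b x / I\<bar> \<le> c" for x using c[of 0] by (cases "x \<in> {0..1}") (auto simp: b0)
    then show ?thesis using that[of c] by (simp add: deriv_S)
  qed
  ultimately show thesis using S0 S1 by (intro that[of S c]) auto
qed

text \<open>A rising and a falling step at scale \<open>1 / r n\<close> near the two end points. The
  derivative grows like \<open>r n\<close>, but it lives only within distance \<open>2 / r n\<close>
  of the boundary, so its product with that distance stays bounded in n. This is what lets the
  cutoffs disappear in the limit.\<close>

lemma cutoff_exists:
  obtains cut :: "nat \<Rightarrow> real \<Rightarrow> real" and C where "\<And>n. cut n \<in> test_fun" "\<And>n x. \<bar>cut n x\<bar> \<le> 1"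
    "\<And>x. 0 < x \<Longrightarrow> x < 1 \<Longrightarrow> \<forall>\<^sub>F n in sequentially. cut n x = 1 \<and> deriv (cut n) x = 0"
    "\<And>n x. 0 < x \<Longrightarrow> x < 1 \<Longrightarrow> \<bar>deriv (cut n) x\<bar> * min x (1 - x) \<le> C"
proof -
  obtain S c where S: "smooth1 S" "\<And>x. x \<le> 0 \<Longrightarrow> S x = 0" "\<And>x. x \<ge> 1 \<Longrightarrow> S x = 1"
    "\<And>x. 0 \<le> S x \<and> S x \<le> 1" "\<And>x. \<bar>deriv S x\<bar> \<le> c"
    using smooth_step_exists by metis
  have c: "c \<ge> 0" using S(5)[of 0] by linarith
  define r where "r n = 5 + real n" for n
  have r: "r n > 0" for n by (simp add: r_def)
  define A where "A n x = S (r n * x + (- 1))" for n x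
  define B where "B n x = S ((- r n) * x + (r n - 1))" for n x
  define cut where "cut n x = A n x * B n x" for n x
  have sA: "smooth1 (A n)" and sB: "smooth1 (B n)" for n
    unfolding A_def B_def by (intro smooth1_affine S(1))+
  have scut: "smooth1 (cut n)" for n unfolding cut_def by (intro smooth1_mult sA sB)
  have dA: "(A n has_real_derivative deriv S (r n * x + (- 1)) * r n) (at x)" for n x
    unfolding A_def
    by (rule DERIV_chain2[OF smooth1_deriv(2)[OF S(1)]]) (auto intro!: derivative_eq_intros)
  have dB: "(B n has_real_derivative deriv S ((- r n) * x + (r n - 1)) * (- r n)) (at x)" for n x
    unfolding B_def
    by (rule DERIV_chain2[OF smooth1_deriv(2)[OF S(1)]]) (auto intro!: derivative_eq_intros)
  have AB: "0 \<le> A n x" "A n x \<le> 1" "0 \<le> B n x" "B n x \<le> 1" for n x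
    using S(4) by (auto simp: A_def B_def)
  have bound: "\<bar>deriv (cut n) x\<bar> \<le> 2 * c * r n" for n x
  proof -
    have "deriv (cut n) x = deriv S (r n * x + (- 1)) * r n * B n x + deriv S ((- r n) * x + (r n - 1)) * (- r n) * A n x"
      unfolding cut_def by (rule DERIV_imp_deriv) (rule DERIV_mult'[OF dA dB, THEN DERIV_cong], simp)
    also have "\<bar>\<dots>\<bar> \<le> \<bar>deriv S (r n * x + (- 1)) * r n * B n x\<bar> + \<bar>deriv S ((- r n) * x + (r n - 1)) * (- r n) * A n x\<bar>"
      by (rule abs_triangle_ineq)
    also have "\<dots> \<le> c * r n * 1 + c * r n * 1"
      unfolding abs_mult using AB S(5) r c by (intro add_mono mult_mono) (auto simp: less_imp_le)
    finally show ?thesis by simp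
  qed
  have one: "cut n x = 1 \<and> deriv (cut n) x = 0" if "2 / r n < x" "x < 1 - 2 / r n" for n x
  proof -
    have eq1: "cut n y = 1" if "y \<in> {2 / r n<..<1 - 2 / r n}" for y
    proof -
      have "r n * y \<ge> 2" using that r[of n] by (auto simp: field_simps)
      moreover have "r n * y \<le> r n - 2" using that r[of n] by (auto simp: field_simps)
      ultimately show ?thesis by (simp add: cut_def A_def B_def S(3))
    qed
    have "((\<lambda>_. 1) has_real_derivative 0) (at x)" by simp
    then have "(cut n has_real_derivative 0) (at x)"
      by (rule has_field_derivative_transform_within_open[of _ _ _ "{2 / r n<..<1 - 2 / r n}"])
        (use that eq1 in auto)
    then show ?thesis using eq1 that by (auto intro: DERIV_imp_deriv)
  qed
  show thesis
  proof (rule that[of cut "4 * c"])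
    fix n
    have "cut n x = 0" if "x \<notin> {1 / r n..1 - 1 / r n}" for x
    proof -
      have "r n * x \<le> 1 \<or> r n * x \<ge> r n - 1" using that r[of n] by (auto simp: field_simps)
      then show ?thesis by (auto simp: cut_def A_def B_def S(2))
    qed
    moreover have "{1 / r n..1 - 1 / r n} \<subseteq> {0<..<1}"
    proof -
      have "0 < 1 / r n" using r[of n] by simp
      then show ?thesis by (auto simp del: zero_less_divide_1_iff)
    qed
    ultimately show "cut n \<in> test_fun"
      using scut[of n] unfolding test_fun_def smooth1_iff_deriv
      by (auto intro!: exI[of _ "{1 / r n..1 - 1 / r n}"])
    show "\<bar>cut n x\<bar> \<le> 1" for x using AB[of n x] by (simp add: cut_def abs_mult mult_le_one)
    show "\<bar>deriv (cut n) x\<bar> * min x (1 - x) \<le> 4 * c" if "0 < x" "x < 1" for x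
    proof (cases "min x (1 - x) > 2 / r n")
      case True
      then show ?thesis using one[of n x] c by auto
    next
      case False
      then have "\<bar>deriv (cut n) x\<bar> * min x (1 - x) \<le> 2 * c * r n * (2 / r n)"
        using bound[of n x] that c r[of n] by (intro mult_mono) auto
      then show ?thesis using r[of n] by simp
    qed
  next
    fix x :: real assume x: "0 < x" "x < 1"
    have "filterlim r at_top sequentially" unfolding r_def
      by (rule filterlim_tendsto_add_at_top[OF tendsto_const filterlim_real_sequentially])
    then have lim: "(\<lambda>n. 2 / r n) \<longlonglongrightarrow> 0"
      by (intro tendsto_divide_0[OF tendsto_const] filterlim_at_top_imp_at_infinity)
    from order_tendstoD(2)[OF lim, of "min x (1 - x)"] x
    have "\<forall>\<^sub>F n in sequentially. 2 / r n < min x (1 - x)" by simp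
    then show "\<forall>\<^sub>F n in sequentially. cut n x = 1 \<and> deriv (cut n) x = 0"
      by eventually_elim (rule one, auto)
  qed
qed

lemma test_fun_smooth1: "a \<in> test_fun \<Longrightarrow> smooth1 a"
  by (simp add: test_fun_def smooth1_iff_deriv)

lemma test_fun_mult:
  assumes "smooth1 a" "b \<in> test_fun"
  shows "(\<lambda>x. a x * b x) \<in> test_fun"
proof -
  obtain K where K: "compact K" "K \<subseteq> {0<..<1}" "\<And>x. x \<notin> K \<Longrightarrow> b x = 0"
    using assms(2) unfolding test_fun_def by blast
  then show ?thesis
    using smooth1_mult[OF assms(1) test_fun_smooth1[OF assms(2)]] unfolding test_fun_def smooth1_iff_deriv
    by (auto intro!: exI[of _ K])
qed

lemma smooth2_product:
  assumes "smooth1 a" "smooth1 b"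
  shows "(\<lambda>x t. a x * b t) \<in> smooth2 S T"
proof -
  obtain D where D: "D 0 = a" "\<And>n x. (D n has_real_derivative D (Suc n) x) (at x)"
    using assms unfolding smooth1_def by blast
  obtain E where E: "E 0 = b" "\<And>n x. (E n has_real_derivative E (Suc n) x) (at x)"
    using assms unfolding smooth1_def by blast
  have cD: "continuous_on A (D n)" and cE: "continuous_on A (E n)" for n A
    using D(2) E(2) by (meson DERIV_isCont continuous_at_imp_continuous_on)+
  have "continuous_on (S \<times> T) (\<lambda>p. D i (fst p) * E j (snd p))" for i j
    by (intro continuous_intros continuous_on_compose2[OF cD] continuous_on_compose2[OF cE]) auto
  moreover have "((\<lambda>y. D i y * E j t) has_real_derivative D (Suc i) x * E j t) (at x within S)"
    "((\<lambda>s. D i x * E j s) has_real_derivative D i x * E (Suc j) t) (at t within T)" for i j x t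
    by (auto intro!: derivative_eq_intros DERIV_subset[OF D(2)] DERIV_subset[OF E(2)])
  ultimately show ?thesis unfolding smooth2_def
    by (auto intro!: exI[of _ "\<lambda>i j x t. D i x * E j t"] simp: D(1) E(1) case_prod_beta')
qed

lemma test_fun2_product:
  assumes "a \<in> test_fun" "b \<in> test_fun"
  shows "(\<lambda>x t. a x * b t) \<in> test_fun2"
proof -
  obtain K where K: "compact K" "K \<subseteq> {0<..<1}" "\<And>x. x \<notin> K \<Longrightarrow> a x = 0"
    using assms(1) unfolding test_fun_def by blast
  obtain L where L: "compact L" "L \<subseteq> {0<..<1}" "\<And>x. x \<notin> L \<Longrightarrow> b x = 0"
    using assms(2) unfolding test_fun_def by blast
  have "(\<lambda>x t. a x * b t) \<in> smooth2 UNIV UNIV"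
    using assms by (intro smooth2_product test_fun_smooth1)
  then show ?thesis using K L compact_Times[of K L] unfolding test_fun2_def
    by (auto intro!: exI[of _ "K \<times> L"])
qed

hide_const (open) Polynomial.content

section \<open>Lebesgue integrals on the unit interval as gauge integrals\<close>

lemma unit_I_absolutely_integrable: "integrable unit_I g \<longleftrightarrow> g absolutely_integrable_on {0..1}"
  for g :: "real \<Rightarrow> real"
proof -
  have "integrable unit_I g \<longleftrightarrow> g absolutely_integrable_on {0<..<1}"
    unfolding set_integrable_def by (subst integrable_restrict_space) auto
  also have "\<dots> \<longleftrightarrow> g absolutely_integrable_on {0..1}"
    using absolutely_integrable_on_open_interval[where f=g and a=0 and b=1] by simp
  finally show ?thesis .
qed

lemma unit_I_integral:
  fixes g :: "real \<Rightarrow> real"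
  assumes "g absolutely_integrable_on {0..1}"
  shows "integral\<^sup>L unit_I g = integral {0..1} g"
proof -
  have "integrable unit_I g" using assms by (simp only: unit_I_absolutely_integrable)
  then have "integral\<^sup>L unit_I g = integral {0<..<1} g"
    by (intro lebesgue_integral_eq_integral) auto
  then show ?thesis by (simp only: integral_open_interval_real)
qed

lemma unit_B_absolutely_integrable:
  fixes g :: "real \<Rightarrow> real"
  assumes "g \<in> borel_measurable borel"
  shows "integrable unit_B g \<longleftrightarrow> g absolutely_integrable_on {0..1}"
    and "integrable unit_B g \<Longrightarrow> integral\<^sup>L unit_B g = integral {0..1} g"
  using unit_I_borel[OF assms] unit_I_absolutely_integrable[of g] unit_I_integral[of g] by metis+

subsection \<open>Absolutely continuous functions\<close>

lemma division_content_le_measure: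
  fixes \<D> :: "real set set"
  assumes "\<D> division_of S" "S \<subseteq> U" "U \<in> lmeasurable"
  shows "(\<Sum>K\<in>\<D>. content K) \<le> measure lebesgue U"
proof -
  have "((\<lambda>_. 1) has_integral (\<Sum>K\<in>\<D>. content K)) S"
  proof (rule has_integral_combine_division[OF assms(1)])
    fix K assume "K \<in> \<D>"
    then obtain a b where "K = cbox a b" using assms(1) by blast
    then show "((\<lambda>_. 1) has_integral content K) K" using has_integral_const_real[of "1::real" a b] by (cases "a \<le> b") (auto simp: real_scaleR_def)
  qed
  then have 1: "((\<lambda>x. if x \<in> S then 1 else 0) has_integral (\<Sum>K\<in>\<D>. content K)) UNIV"
    by (simp add: has_integral_restrict_UNIV)
  have 2: "(indicator U has_integral measure lebesgue U) UNIV"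
    using assms(3) by (simp add: lmeasurable_iff_has_integral)
  show ?thesis by (rule has_integral_le[OF 1 2]) (use assms(2) in \<open>auto simp: indicator_def\<close>)
qed

text \<open>A gauge argument: tags in the exceptional null set are controlled by absolute
  continuity, the others by differentiability.  Neither Lebesgue's differentiation theorem nor
  measurability of \<open>g\<close> enters.\<close>

lemma absolutely_continuous_FTC:
  assumes ac: "absolutely_continuous_fun a b f"
    and N: "negligible N" and der: "\<And>x. x \<in> {a..c} - N \<Longrightarrow> (f has_real_derivative g x) (at x)"
    and c: "a \<le> c" "c \<le> b"
  shows "(g has_integral f c - f a) {a..c}"
proof -
  define g0 where "g0 x = (if x \<in> N then 0 else g x)" for x
  have "(g0 has_integral f c - f a) {a..c}"
    unfolding has_integral_real
  proof (intro allI impI)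
    fix e :: real assume e: "e > 0"
    define \<epsilon> where "\<epsilon> = e / (2 * (c - a + 1))"
    have \<epsilon>: "\<epsilon> > 0" "\<epsilon> * (c - a) < e / 2" using e c by (auto simp: \<epsilon>_def field_simps)
    have "e / 2 > 0" using e by simp
    with ac obtain d where d: "d > 0" "\<And>\<D> S. \<D> division_of S \<Longrightarrow> S \<subseteq> {a..b} \<Longrightarrow>
        (\<Sum>k\<in>\<D>. Sup k - Inf k) < d \<Longrightarrow> (\<Sum>k\<in>\<D>. \<bar>f (Sup k) - f (Inf k)\<bar>) < e / 2"
      unfolding absolutely_continuous_fun_def by meson
    \<comment> \<open>The exceptional set is enclosed in an open set of measure below the
      \<open>d\<close> of absolute continuity; the gauge keeps every interval tagged in
      \<open>N\<close> inside that set.\<close>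
    have "N \<in> sets lebesgue" using N by (simp add: negligible_iff_null_sets null_setsD2)
    then obtain T where T: "open T" "N \<subseteq> T" "(T - N) \<in> lmeasurable" "emeasure lebesgue (T - N) < ennreal d"
      using sets_lebesgue_outer_open d(1) by metis
    have TN: "T = (T - N) \<union> N" using T(2) by auto
    have Tm: "T \<in> lmeasurable" "measure lebesgue T < d"
    proof -
      have n: "N \<in> lmeasurable" "measure lebesgue N = 0"
        using N by (auto simp: negligible_iff_measure)
      show "T \<in> lmeasurable" by (subst TN) (intro fmeasurable.Un T n)
      have "measure lebesgue T \<le> measure lebesgue (T - N) + measure lebesgue N"
        by (subst (1) TN) (intro measure_Un_le fmeasurableD T n)
      also have "\<dots> < d" using T(3,4) d(1) n
        by (simp add: emeasure_eq_measure2 ennreal_less_iff)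
      finally show "measure lebesgue T < d" .
    qed
    have "\<exists>r>0. \<forall>y. \<bar>y - x\<bar> < r \<longrightarrow> \<bar>f y - f x - g x * (y - x)\<bar> \<le> \<epsilon> * \<bar>y - x\<bar>"
      if "x \<in> {a..c} - N" for x
    proof -
      have "(f has_derivative (\<lambda>h. g x * h)) (at x)"
        using der[OF that] by (simp add: has_field_derivative_def)
      then show ?thesis
        using \<epsilon>(1) unfolding has_derivative_at_alt by (auto simp: real_norm_def)
    qed
    then obtain r where r: "\<And>x. x \<in> {a..c} - N \<Longrightarrow> r x > 0"
      "\<And>x y. x \<in> {a..c} - N \<Longrightarrow> \<bar>y - x\<bar> < r x \<Longrightarrow> \<bar>f y - f x - g x * (y - x)\<bar> \<le> \<epsilon> * \<bar>y - x\<bar>"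
      by metis
    define \<gamma> where "\<gamma> x = (if x \<in> N then T else if x \<in> {a..c} then ball x (r x) else UNIV)" for x
    have "gauge \<gamma>" unfolding gauge_def \<gamma>_def using T(1,2) r(1) by auto
    moreover have "norm ((\<Sum>(x, K)\<in>p. content K *\<^sub>R g0 x) - (f c - f a)) < e"
      if p: "p tagged_division_of {a..c}" and fine: "\<gamma> fine p" for p
    proof -
      note pD = tagged_division_ofD[OF p]
      define h where "h = (\<lambda>(x, K). content K * g0 x - (f (Sup K) - f (Inf K)))"
      have "(\<Sum>(x, K)\<in>p. f (Sup K) - f (Inf K)) = f c - f a"
        by (rule additive_tagged_division_1[OF c(1) p])
      then have "(\<Sum>(x, K)\<in>p. content K *\<^sub>R g0 x) - (f c - f a) = (\<Sum>z\<in>p. h z)"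
        unfolding h_def by (simp add: sum_subtractf case_prod_beta)
      also have "\<bar>\<dots>\<bar> \<le> (\<Sum>z\<in>p. \<bar>h z\<bar>)" by (rule sum_abs)
      also have "\<dots> = (\<Sum>z\<in>{z\<in>p. fst z \<in> N}. \<bar>h z\<bar>) + (\<Sum>z\<in>{z\<in>p. fst z \<notin> N}. \<bar>h z\<bar>)"
        using pD(1) by (subst sum.union_disjoint[symmetric]) (auto intro!: sum.cong)
      finally have split: "\<bar>(\<Sum>(x, K)\<in>p. content K *\<^sub>R g0 x) - (f c - f a)\<bar> \<le>
        (\<Sum>z\<in>{z\<in>p. fst z \<in> N}. \<bar>h z\<bar>) + (\<Sum>z\<in>{z\<in>p. fst z \<notin> N}. \<bar>h z\<bar>)" .
      have part2: "(\<Sum>z\<in>{z\<in>p. fst z \<notin> N}. \<bar>h z\<bar>) \<le> \<epsilon> * (c - a)"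
      proof -
        have "\<bar>h z\<bar> \<le> \<epsilon> * (case z of (x, K) \<Rightarrow> content K)" if z: "z \<in> p" "fst z \<notin> N" for z
        proof -
          obtain x K where xK: "z = (x, K)" by fastforce
          have K: "(x, K) \<in> p" "x \<in> {a..c} - N" using z xK tag_in_interval[OF p] by auto
          obtain u v where uv: "K = {u..v}" using pD(4)[OF K(1)] by auto
          have x: "u \<le> x" "x \<le> v" using pD(2)[OF K(1)] uv by auto
          have "K \<subseteq> ball x (r x)" using fine K unfolding fine_def \<gamma>_def by force
          moreover have "u \<in> K" "v \<in> K" using uv x by auto
          ultimately have "dist x u < r x" "dist x v < r x" by auto
          then have "\<bar>u - x\<bar> < r x" "\<bar>v - x\<bar> < r x" by (simp_all add: dist_real_def abs_minus_commute)
          then have "\<bar>f u - f x - g x * (u - x)\<bar> \<le> \<epsilon> * (x - u)"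
            "\<bar>f v - f x - g x * (v - x)\<bar> \<le> \<epsilon> * (v - x)"
            using r(2)[OF K(2)] x by (metis abs_minus_commute abs_of_nonneg diff_ge_0_iff_ge)+
          \<comment> \<open>Straddle estimate: the tag lies between \<open>u\<close> and
            \<open>v\<close>, so the two one-sided errors add up to
            \<open>\<epsilon> * (v - u)\<close>.\<close>
          then have "\<bar>(v - u) * g x - (f v - f u)\<bar> \<le> \<epsilon> * (v - u)"
            by (simp add: algebra_simps abs_le_iff)
          then show ?thesis using uv x K by (simp add: h_def xK g0_def)
        qed
        then have "(\<Sum>z\<in>{z\<in>p. fst z \<notin> N}. \<bar>h z\<bar>) \<le> (\<Sum>z\<in>{z\<in>p. fst z \<notin> N}. \<epsilon> * (case z of (x, K) \<Rightarrow> content K))"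
          by (intro sum_mono) auto
        also have "\<dots> \<le> (\<Sum>z\<in>p. \<epsilon> * (case z of (x, K) \<Rightarrow> content K))"
          using pD(1) \<epsilon>(1) by (intro sum_mono2) auto
        also have "\<dots> = \<epsilon> * (c - a)"
          using additive_content_tagged_division[of p a c] p c(1) by (simp add: sum_distrib_left[symmetric])
        finally show ?thesis .
      qed
      have part1: "(\<Sum>z\<in>{z\<in>p. fst z \<in> N}. \<bar>h z\<bar>) < e / 2"
      proof -
        define q where "q = {z\<in>p. fst z \<in> N}"
        have q: "q tagged_partial_division_of {a..c}"
          using p tagged_partial_division_subset[of p "{a..c}" q] unfolding q_def tagged_division_of_def by auto
        define \<D> where "\<D> = snd ` q"
        have D: "\<D> division_of \<Union>\<D>" unfolding \<D>_def by (rule partial_division_of_tagged_division[OF q])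
        have Dint: "Sup K - Inf K = content K" if "K \<in> \<D>" for K
        proof -
          obtain u v where "K = cbox u v" "K \<noteq> {}" using D \<open>K \<in> \<D>\<close> by (metis division_ofD(3,4))
          then show ?thesis by auto
        qed
        have sub: "\<Union>\<D> \<subseteq> T"
          using fine unfolding \<D>_def q_def fine_def \<gamma>_def by force
        have "(\<Sum>K\<in>\<D>. Sup K - Inf K) = (\<Sum>K\<in>\<D>. content K)" by (intro sum.cong Dint refl)
        also have "\<dots> \<le> measure lebesgue T" by (rule division_content_le_measure[OF D sub Tm(1)])
        also have "\<dots> < d" by (rule Tm(2))
        finally have "(\<Sum>K\<in>\<D>. \<bar>f (Sup K) - f (Inf K)\<bar>) < e / 2"
        proof (rule d(2)[OF D, rotated])
          have "K \<subseteq> {a..c}" if "K \<in> \<D>" for K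
          proof -
            obtain x where "(x, K) \<in> p" using \<open>K \<in> \<D>\<close> unfolding \<D>_def q_def by auto
            then show ?thesis by (rule pD(3))
          qed
          then show "\<Union>\<D> \<subseteq> {a..b}" using c by fastforce
        qed
        moreover have "(\<Sum>(x, K)\<in>q. \<bar>f (Sup K) - f (Inf K)\<bar>) = (\<Sum>K\<in>\<D>. \<bar>f (Sup K) - f (Inf K)\<bar>)"
        proof -
          \<comment> \<open>Passing from tagged pairs to the intervals alone requires the value 0 on
            every interval with empty interior, including the empty one, where \<open>Sup\<close>
            and \<open>Inf\<close> carry no meaning.\<close>
          define V where "V K = (if K = {} then 0 else \<bar>f (Sup K) - f (Inf K)\<bar>)" for K
          have "(\<Sum>(x, K)\<in>q. V K) = (\<Sum>K\<in>snd ` q. V K)"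
          proof (rule sum.over_tagged_division_lemma[OF tagged_partial_division_of_Union_self[OF q]])
            fix u v :: real assume "box u v = {}"
            then show "V (cbox u v) = 0"
              by (cases "u = v") (auto simp: V_def)
          qed
          moreover have "K \<noteq> {}" if "(x, K) \<in> q" for x K
            using that pD(2)[of x K] by (auto simp: q_def)
          then have "(\<Sum>(x, K)\<in>q. V K) = (\<Sum>(x, K)\<in>q. \<bar>f (Sup K) - f (Inf K)\<bar>)"
            "(\<Sum>K\<in>snd ` q. V K) = (\<Sum>K\<in>\<D>. \<bar>f (Sup K) - f (Inf K)\<bar>)"
            unfolding \<D>_def V_def by (intro sum.cong; auto)+
          ultimately show ?thesis by simp
        qed
        moreover have "(\<Sum>z\<in>q. \<bar>h z\<bar>) = (\<Sum>(x, K)\<in>q. \<bar>f (Sup K) - f (Inf K)\<bar>)"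
          by (intro sum.cong) (auto simp: q_def h_def g0_def abs_minus_commute)
        ultimately show ?thesis by (simp add: q_def)
      qed
      show ?thesis using split part1 part2 \<epsilon>(2) by simp
    qed
    ultimately show "\<exists>\<gamma>. gauge \<gamma> \<and> (\<forall>p. p tagged_division_of {a..c} \<and> \<gamma> fine p \<longrightarrow>
        norm ((\<Sum>(x, K)\<in>p. content K *\<^sub>R g0 x) - (f c - f a)) < e)"
      by (intro exI[of _ \<gamma>]) simp
  qed
  then show ?thesis
    by (rule has_integral_spike[OF N, rotated]) (simp add: g0_def)
qed

text \<open>Telescoping over short equal steps gives
  \<open>\<bar>D t - D 0\<bar> \<le> e * integral {0..t} L\<close> for every e. This replaces almost
  everywhere differentiation in the product rule, in the chain rule and in the time equation of the
  inverse flow.\<close>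

lemma const_of_small_increments:
  fixes D L :: "real \<Rightarrow> real"
  assumes L: "L integrable_on {0..1}" "\<And>t. t \<in> {0..1} \<Longrightarrow> 0 \<le> L t"
    and small: "\<And>e. e > 0 \<Longrightarrow> \<exists>d>0. \<forall>s t. 0 \<le> s \<and> s \<le> t \<and> t \<le> 1 \<and> t - s < d \<longrightarrow>
        \<bar>D t - D s\<bar> \<le> e * integral {s..t} L"
    and t: "t \<in> {0..1}"
  shows "D t = D 0"
proof -
  have "\<bar>D t - D 0\<bar> \<le> e * integral {0..t} L" if "e > 0" for e
  proof -
    from small[OF that] obtain d where d: "d > 0" "\<And>s t. 0 \<le> s \<Longrightarrow> s \<le> t \<Longrightarrow> t \<le> 1 \<Longrightarrow> t - s < d \<Longrightarrow>
        \<bar>D t - D s\<bar> \<le> e * integral {s..t} L" by blast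
    obtain n :: nat where n: "n > 0" "1 / n < d" using d(1) by (metis nat_approx_posE of_nat_0_less_iff zero_less_Suc)
    have "k \<le> n \<Longrightarrow> \<bar>D (t * k / n) - D 0\<bar> \<le> e * integral {0..t * k / n} L" for k
    proof (induction k)
      case 0
      then show ?case by simp
    next
      case (Suc k)
      let ?s = "t * k / n" and ?r = "t * Suc k / n"
      have s: "0 \<le> ?s" "?s \<le> ?r" using t n by (auto simp: divide_right_mono mult_left_mono)
      have "t * real (Suc k) \<le> 1 * real n" using t Suc.prems by (intro mult_mono) auto
      then have r: "?r \<le> 1" using n by (simp add: field_simps)
      have "?r - ?s = t / n" using n by (simp add: field_simps)
      also have "\<dots> \<le> 1 / n" using t by (simp add: divide_right_mono)
      finally have "\<bar>D ?r - D ?s\<bar> \<le> e * integral {?s..?r} L" using s r n by (intro d(2)) auto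
      moreover have "integral {0..?s} L + integral {?s..?r} L = integral {0..?r} L"
        using s r by (intro Henstock_Kurzweil_Integration.integral_combine integrable_on_subinterval[OF L(1)]) auto
      moreover have "\<bar>D ?s - D 0\<bar> \<le> e * integral {0..?s} L" using Suc by simp
      ultimately show ?case by (simp add: algebra_simps) (smt (verit) distrib_left)
    qed
    from this[of n] n show ?thesis by simp
  qed
  note 1 = this
  have "\<bar>D t - D 0\<bar> \<le> 0"
  proof (rule field_le_epsilon)
    fix e :: real assume e: "e > 0"
    define I where "I = integral {0..t} L"
    have I: "I \<ge> 0" unfolding I_def using t L by (intro integral_nonneg integrable_on_subinterval[OF L(1)]) auto
    have "\<bar>D t - D 0\<bar> \<le> e / (I + 1) * I" using 1[of "e / (I + 1)"] e I by (simp add: I_def)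
    also have "\<dots> \<le> e" using e I by (simp add: field_simps)
    finally show "\<bar>D t - D 0\<bar> \<le> 0 + e" by simp
  qed
  then show ?thesis by simp
qed

lemma absolutely_integrable_mult_continuous:
  fixes u W :: "real \<Rightarrow> real"
  assumes "u absolutely_integrable_on {a..b}" "continuous_on {a..b} W"
  shows "(\<lambda>t. u t * W t) absolutely_integrable_on {a..b}"
proof -
  have "(\<lambda>t. W t * u t) absolutely_integrable_on {a..b}"
    using assms by (intro absolutely_integrable_bounded_measurable_product_real
        continuous_imp_measurable_on_sets_lebesgue compact_imp_bounded compact_continuous_image) auto
  then show ?thesis by (simp add: mult.commute)
qed

lemma absolutely_integrable_sub:
  fixes u :: "real \<Rightarrow> real"
  assumes "u absolutely_integrable_on {0..1}" "0 \<le> s" "t \<le> 1"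
  shows "u absolutely_integrable_on {s..t}"
  using assms by (intro set_integrable_subset[OF assms(1)]) auto

lemma primitive_increment:
  fixes u :: "real \<Rightarrow> real"
  assumes "u absolutely_integrable_on {0..1}" "\<And>t. t \<in> {0..1} \<Longrightarrow> U t = u0 + integral {0..t} u"
    "0 \<le> s" "s \<le> t" "t \<le> 1"
  shows "U t - U s = integral {s..t} u"
proof -
  have "integral {0..s} u + integral {s..t} u = integral {0..t} u"
    using assms by (intro Henstock_Kurzweil_Integration.integral_combine
        set_lebesgue_integral_eq_integral(1) absolutely_integrable_sub[OF assms(1)]) auto
  then show ?thesis using assms by simp
qed

lemma primitive_continuous:
  fixes u :: "real \<Rightarrow> real"
  assumes "u absolutely_integrable_on {0..1}" "\<And>t. t \<in> {0..1} \<Longrightarrow> U t = u0 + integral {0..t} u"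
  shows "continuous_on {0..1} U"
proof -
  have "continuous_on {0..1} (\<lambda>t. u0 + integral {0..t} u)"
    using assms(1) by (intro continuous_intros indefinite_integral_continuous_1 set_lebesgue_integral_eq_integral(1))
  then show ?thesis by (rule continuous_on_eq) (use assms(2) in simp)
qed

lemma integral_diff_le:
  fixes u v L :: "real \<Rightarrow> real"
  assumes u: "u integrable_on {s..t}" and v: "v integrable_on {s..t}" and L: "L integrable_on {s..t}"
    and le: "\<And>r. r \<in> {s..t} \<Longrightarrow> \<bar>u r - v r\<bar> \<le> e * L r"
  shows "\<bar>integral {s..t} u - integral {s..t} v\<bar> \<le> e * integral {s..t} L"
proof -
  have "norm (integral {s..t} (\<lambda>r. u r - v r)) \<le> integral {s..t} (\<lambda>r. e * L r)"
    using assms by (intro integral_norm_bound_integral integrable_diff integrable_on_mult_right) auto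
  then show ?thesis using u v by (simp add: integral_diff)
qed

text \<open>Over a short interval each factor may be frozen; by uniform continuity the error is at
  most e times the integral of the two absolute densities, as
  \<open>const_of_small_increments\<close> demands.\<close>

lemma primitive_product:
  fixes u w :: "real \<Rightarrow> real"
  assumes u: "u absolutely_integrable_on {0..1}" and U: "\<And>t. t \<in> {0..1} \<Longrightarrow> U t = u0 + integral {0..t} u"
    and w: "w absolutely_integrable_on {0..1}" and W: "\<And>t. t \<in> {0..1} \<Longrightarrow> W t = w0 + integral {0..t} w"
  shows "(\<lambda>t. u t * W t + w t * U t) absolutely_integrable_on {0..1}"
    and "t \<in> {0..1} \<Longrightarrow> U t * W t = u0 * w0 + integral {0..t} (\<lambda>t. u t * W t + w t * U t)"
proof -
  have cU: "continuous_on {0..1} U" by (rule primitive_continuous[OF u U])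
  have cW: "continuous_on {0..1} W" by (rule primitive_continuous[OF w W])
  show p: "(\<lambda>t. u t * W t + w t * U t) absolutely_integrable_on {0..1}"
    by (intro set_integral_add absolutely_integrable_mult_continuous u w cU cW)
  define D where "D t = U t * W t - integral {0..t} (\<lambda>t. u t * W t + w t * U t)" for t
  have L: "(\<lambda>t. \<bar>u t\<bar> + \<bar>w t\<bar>) absolutely_integrable_on {0..1}"
    by (intro set_integral_add set_integrable_abs u w)
  assume t: "t \<in> {0..1}"
  have "D t = D 0"
  proof (rule const_of_small_increments[OF set_lebesgue_integral_eq_integral(1)[OF L] _ _ t])
    fix e :: real assume e: "e > 0"
    obtain d1 where d1: "d1 > 0" "\<And>x y. x \<in> {0..1} \<Longrightarrow> y \<in> {0..1} \<Longrightarrow> dist y x < d1 \<Longrightarrow> dist (U y) (U x) < e"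
      by (rule uniformly_continuous_onE[OF compact_uniformly_continuous[OF cU compact_Icc] e]) blast
    obtain d2 where d2: "d2 > 0" "\<And>x y. x \<in> {0..1} \<Longrightarrow> y \<in> {0..1} \<Longrightarrow> dist y x < d2 \<Longrightarrow> dist (W y) (W x) < e"
      by (rule uniformly_continuous_onE[OF compact_uniformly_continuous[OF cW compact_Icc] e]) blast
    show "\<exists>d>0. \<forall>s t. 0 \<le> s \<and> s \<le> t \<and> t \<le> 1 \<and> t - s < d \<longrightarrow>
        \<bar>D t - D s\<bar> \<le> e * integral {s..t} (\<lambda>t. \<bar>u t\<bar> + \<bar>w t\<bar>)"
    proof (intro exI[of _ "min d1 d2"] conjI allI impI)
      fix s t assume st: "0 \<le> s \<and> s \<le> t \<and> t \<le> 1 \<and> t - s < min d1 d2"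
      have sub: "h integrable_on {s..t}" if "h absolutely_integrable_on {0..1}" for h :: "real \<Rightarrow> real"
        using absolutely_integrable_sub[OF that, of s t] st set_lebesgue_integral_eq_integral(1) by blast
      \<comment> \<open>One factor is taken at the right end and the other at the left end, which
        makes the increment of the product exact.\<close>
      have "U t * W t - U s * W s = (U t - U s) * W t + (W t - W s) * U s"
        by (simp add: algebra_simps)
      also have "\<dots> = integral {s..t} (\<lambda>r. u r * W t) + integral {s..t} (\<lambda>r. w r * U s)"
        using primitive_increment[OF u U, of s t] primitive_increment[OF w W, of s t] st by simp
      also have "\<dots> = integral {s..t} (\<lambda>r. u r * W t + w r * U s)"
        by (intro integral_add[symmetric] integrable_on_mult_left sub u w)
      finally have "D t - D s = integral {s..t} (\<lambda>r. u r * W t + w r * U s)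
          - integral {s..t} (\<lambda>r. u r * W r + w r * U r)"
        using primitive_increment[OF p, of "\<lambda>t. integral {0..t} (\<lambda>t. u t * W t + w t * U t)" 0 s t] st
        by (simp add: D_def)
      also have "\<bar>\<dots>\<bar> \<le> e * integral {s..t} (\<lambda>t. \<bar>u t\<bar> + \<bar>w t\<bar>)"
      proof (rule integral_diff_le)
        fix r assume r: "r \<in> {s..t}"
        have "dist t r < d2" "dist s r < d1" using r st by (auto simp: dist_real_def)
        then have "dist (W t) (W r) < e" "dist (U s) (U r) < e"
          using r st d1(2)[of r s] d2(2)[of r t] by auto
        then have "\<bar>W t - W r\<bar> \<le> e" "\<bar>U s - U r\<bar> \<le> e" by (auto simp: dist_real_def)
        then have "\<bar>u r * (W t - W r)\<bar> + \<bar>w r * (U s - U r)\<bar> \<le> \<bar>u r\<bar> * e + \<bar>w r\<bar> * e"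
          unfolding abs_mult by (intro add_mono mult_left_mono) auto
        moreover have "u r * W t + w r * U s - (u r * W r + w r * U r) = u r * (W t - W r) + w r * (U s - U r)"
          by (simp add: algebra_simps)
        ultimately show "\<bar>u r * W t + w r * U s - (u r * W r + w r * U r)\<bar> \<le> e * (\<bar>u r\<bar> + \<bar>w r\<bar>)"
          by (simp only: distrib_left mult.commute[of e])
      qed (intro integrable_add integrable_on_mult_left sub u w p L)+
      finally show "\<bar>D t - D s\<bar> \<le> e * integral {s..t} (\<lambda>t. \<bar>u t\<bar> + \<bar>w t\<bar>)" .
    qed (use d1 d2 in auto)
  qed auto
  then show "U t * W t = u0 * w0 + integral {0..t} (\<lambda>t. u t * W t + w t * U t)"
    using U[of 0] W[of 0] by (simp add: D_def)
qed

text \<open>The intermediate point of the mean value theorem lies between \<open>A s\<close> and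
  \<open>A t\<close>, hence equals \<open>A \<xi>\<close> for some \<xi> in between. So the
  derivative is sampled on the path itself, and uniform continuity of its composition with
  \<open>A\<close> suffices.\<close>

lemma primitive_chain:
  fixes a F F' :: "real \<Rightarrow> real"
  assumes a: "a absolutely_integrable_on {0..1}" and A: "\<And>t. t \<in> {0..1} \<Longrightarrow> A t = a0 + integral {0..t} a"
    and F: "\<And>x. (F has_real_derivative F' x) (at x)" and F': "continuous_on UNIV F'"
  shows "(\<lambda>t. a t * F' (A t)) absolutely_integrable_on {0..1}"
    and "t \<in> {0..1} \<Longrightarrow> F (A t) = F a0 + integral {0..t} (\<lambda>t. a t * F' (A t))"
proof -
  have cA: "continuous_on {0..1} A" by (rule primitive_continuous[OF a A])
  have cFA: "continuous_on {0..1} (\<lambda>t. F' (A t))"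
    by (rule continuous_on_compose2[OF F' cA]) auto
  show p: "(\<lambda>t. a t * F' (A t)) absolutely_integrable_on {0..1}"
    by (intro absolutely_integrable_mult_continuous a cFA)
  define D where "D t = F (A t) - integral {0..t} (\<lambda>t. a t * F' (A t))" for t
  have L: "(\<lambda>t. \<bar>a t\<bar>) absolutely_integrable_on {0..1}" by (intro set_integrable_abs a)
  assume t: "t \<in> {0..1}"
  have "D t = D 0"
  proof (rule const_of_small_increments[OF set_lebesgue_integral_eq_integral(1)[OF L] _ _ t])
    fix e :: real assume e: "e > 0"
    obtain d where d: "d > 0" "\<And>x y. x \<in> {0..1} \<Longrightarrow> y \<in> {0..1} \<Longrightarrow> dist y x < d \<Longrightarrow> dist (F' (A y)) (F' (A x)) < e"
      by (rule uniformly_continuous_onE[OF compact_uniformly_continuous[OF cFA compact_Icc] e]) blast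
    show "\<exists>d>0. \<forall>s t. 0 \<le> s \<and> s \<le> t \<and> t \<le> 1 \<and> t - s < d \<longrightarrow>
        \<bar>D t - D s\<bar> \<le> e * integral {s..t} (\<lambda>t. \<bar>a t\<bar>)"
    proof (intro exI[of _ d] conjI allI impI)
      fix s t assume st: "0 \<le> s \<and> s \<le> t \<and> t \<le> 1 \<and> t - s < d"
      have sub: "h integrable_on {s..t}" if "h absolutely_integrable_on {0..1}" for h :: "real \<Rightarrow> real"
        using absolutely_integrable_sub[OF that, of s t] st set_lebesgue_integral_eq_integral(1) by blast
      have "\<exists>\<xi>. \<xi> \<in> {s..t} \<and> F (A t) - F (A s) = F' (A \<xi>) * (A t - A s)"
      proof -
        have mvt: "\<exists>y\<in>closed_segment (A s) (A t). F (A t) - F (A s) = F' y * (A t - A s)"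
        proof (cases "A s" "A t" rule: linorder_cases)
          case less
          from MVT2[OF less, of F F'] F obtain y where "A s < y" "y < A t" "F (A t) - F (A s) = (A t - A s) * F' y" by blast
          then show ?thesis using less by (intro bexI[of _ y]) (auto simp: closed_segment_eq_real_ivl)
        next
          case greater
          from MVT2[OF greater, of F F'] F obtain y where "A t < y" "y < A s" "F (A s) - F (A t) = (A s - A t) * F' y" by blast
          then show ?thesis using greater by (intro bexI[of _ y]) (auto simp: closed_segment_eq_real_ivl algebra_simps)
        qed auto
        have "connected (A ` {s..t})"
          using st by (intro connected_continuous_image continuous_on_subset[OF cA]) auto
        then have "closed_segment (A s) (A t) \<subseteq> A ` {s..t}"
          using st by (intro closed_segment_subset) (auto simp: is_interval_convex_1[symmetric] is_interval_connected_1)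
        with mvt show ?thesis by blast
      qed
      then obtain \<xi> where \<xi>: "\<xi> \<in> {s..t}" "F (A t) - F (A s) = F' (A \<xi>) * (A t - A s)" by blast
      then have "F (A t) - F (A s) = integral {s..t} (\<lambda>r. a r * F' (A \<xi>))"
        using primitive_increment[OF a A, of s t] st by simp
      then have "D t - D s = integral {s..t} (\<lambda>r. a r * F' (A \<xi>)) - integral {s..t} (\<lambda>r. a r * F' (A r))"
        using primitive_increment[OF p, of "\<lambda>t. integral {0..t} (\<lambda>t. a t * F' (A t))" 0 s t] st
        by (simp add: D_def)
      also have "\<bar>\<dots>\<bar> \<le> e * integral {s..t} (\<lambda>t. \<bar>a t\<bar>)"
      proof (rule integral_diff_le)
        fix r assume r: "r \<in> {s..t}"
        have "dist \<xi> r < d" using r st \<xi>(1) by (auto simp: dist_real_def abs_less_iff)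
        then have "dist (F' (A \<xi>)) (F' (A r)) < e"
          using r st \<xi>(1) by (intro d(2)) auto
        then have "\<bar>F' (A \<xi>) - F' (A r)\<bar> \<le> e" by (auto simp: dist_real_def)
        then have "\<bar>a r\<bar> * \<bar>F' (A \<xi>) - F' (A r)\<bar> \<le> \<bar>a r\<bar> * e" by (intro mult_left_mono) auto
        then show "\<bar>a r * F' (A \<xi>) - a r * F' (A r)\<bar> \<le> e * \<bar>a r\<bar>"
          by (simp add: right_diff_distrib[symmetric] abs_mult mult.commute)
      qed (intro integrable_on_mult_left sub a p L)+
      finally show "\<bar>D t - D s\<bar> \<le> e * integral {s..t} (\<lambda>t. \<bar>a t\<bar>)" .
    qed (use d in auto)
  qed auto
  then show "F (A t) = F a0 + integral {0..t} (\<lambda>t. a t * F' (A t))"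
    using A[of 0] by (simp add: D_def)
qed

text \<open>Multiplication by the integrating factor \<open>exp (- integral {0..t} a)\<close>
  cancels the linear term through the product rule, so the formula holds for every continuous
  solution and contains uniqueness.\<close>

lemma linear_ODE:
  fixes a c U :: "real \<Rightarrow> real"
  assumes a: "a absolutely_integrable_on {0..1}" and c: "c absolutely_integrable_on {0..1}"
    and cU: "continuous_on {0..1} U" and U: "\<And>t. t \<in> {0..1} \<Longrightarrow> U t = u0 + integral {0..t} (\<lambda>s. a s * U s + c s)"
    and t: "t \<in> {0..1}"
  shows "U t = exp (integral {0..t} a) * (u0 + integral {0..t} (\<lambda>s. c s * exp (- integral {0..s} a)))"
proof -
  define E where "E s = exp (- integral {0..s} a)" for s
  have na: "(\<lambda>s. - a s) absolutely_integrable_on {0..1}"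
    using set_integrable_mult_right[of "-1" lebesgue "{0..1}" a] a by simp
  have E: "s \<in> {0..1} \<Longrightarrow> E s = 1 + integral {0..s} (\<lambda>r. - a r * E r)" for s
    using primitive_chain(2)[OF na, of "\<lambda>t. - integral {0..t} a" 0 exp exp s]
    by (simp add: E_def continuous_on_exp DERIV_exp)
  have Ea: "(\<lambda>r. - a r * E r) absolutely_integrable_on {0..1}"
    using primitive_chain(1)[OF na, of "\<lambda>t. - integral {0..t} a" 0 exp exp]
    by (simp add: E_def continuous_on_exp DERIV_exp)
  have Ua: "(\<lambda>s. a s * U s + c s) absolutely_integrable_on {0..1}"
    by (intro set_integral_add absolutely_integrable_mult_continuous a c cU)
  have "U t * E t = u0 * 1 + integral {0..t} (\<lambda>s. (a s * U s + c s) * E s + - a s * E s * U s)"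
    by (rule primitive_product(2)[OF Ua U Ea E t])
  also have "(\<lambda>s. (a s * U s + c s) * E s + - a s * E s * U s) = (\<lambda>s. c s * E s)"
    by (auto simp: algebra_simps)
  finally have "U t * E t = u0 + integral {0..t} (\<lambda>s. c s * E s)" by simp
  then have "exp (integral {0..t} a) * (U t * E t) = exp (integral {0..t} a) * (u0 + integral {0..t} (\<lambda>s. c s * E s))"
    by simp
  moreover have "exp (integral {0..t} a) * (U t * E t) = U t" by (simp add: E_def exp_minus)
  ultimately have "U t = exp (integral {0..t} a) * (u0 + integral {0..t} (\<lambda>s. c s * E s))" by simp
  then show ?thesis unfolding E_def .
qed

subsection \<open>Vanishing moments and weak primitives\<close>

lemma integrable_unit_B_mult_bounded:
  fixes h g :: "real \<Rightarrow> real"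
  assumes "integrable unit_B h" "g \<in> borel_measurable borel" "\<And>x. 0 < x \<Longrightarrow> x < 1 \<Longrightarrow> \<bar>g x\<bar> \<le> C"
  shows "integrable unit_B (\<lambda>x. h x * g x)"
proof (rule Bochner_Integration.integrable_bound[of _ "\<lambda>x. \<bar>h x\<bar> * C"])
  show "integrable unit_B (\<lambda>x. \<bar>h x\<bar> * C)" using assms(1) by simp
  show "(\<lambda>x. h x * g x) \<in> borel_measurable unit_B"
    using assms(2) borel_measurable_integrable[OF assms(1)] by simp
  show "AE x in unit_B. norm (h x * g x) \<le> norm (\<bar>h x\<bar> * C)"
    using AE_unit_B_interior
  proof eventually_elim
    case (elim x)
    then have "\<bar>g x\<bar> \<le> C" using assms(3) by simp
    then have "\<bar>h x\<bar> * \<bar>g x\<bar> \<le> \<bar>h x\<bar> * \<bar>C\<bar>" by (intro mult_left_mono) auto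
    then show ?case by (simp add: abs_mult)
  qed
qed

lemma abs_le_bound_on_unit_interval:
  fixes g :: "real \<Rightarrow> real"
  assumes "continuous_on {0..1} g"
  obtains C where "\<And>x. x \<in> {0..1} \<Longrightarrow> \<bar>g x\<bar> \<le> C"
proof -
  have "bounded (g ` {0..1})"
    by (intro compact_imp_bounded compact_continuous_image assms compact_Icc)
  then show thesis using that unfolding bounded_iff by fastforce
qed

lemma integrable_unit_B_mult_continuous:
  fixes h g :: "real \<Rightarrow> real"
  assumes h: "integrable unit_B h" and g: "g \<in> borel_measurable borel" "continuous_on {0..1} g"
  shows "integrable unit_B (\<lambda>x. h x * g x)"
proof -
  obtain C where "\<And>x. x \<in> {0..1} \<Longrightarrow> \<bar>g x\<bar> \<le> C"
    using abs_le_bound_on_unit_interval[OF g(2)] by blast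
  then show ?thesis by (intro integrable_unit_B_mult_bounded[OF h g(1), of C]) auto
qed

text \<open>The Bernstein basis as formal polynomials, so that \<open>pderiv\<close> and functionals
  of polynomials, such as moments at the end times, can be applied to it.\<close>

definition bern :: "nat \<Rightarrow> nat \<Rightarrow> real poly"
  where "bern n k = smult (of_nat (n choose k)) (monom 1 k * [:1, -1:] ^ (n - k))"

lemma poly_bern: "poly (bern n k) x = Bernstein n k x"
  by (simp add: bern_def Bernstein_def poly_monom)

lemma borel_measurable_poly [measurable]: "poly p \<in> borel_measurable borel" for p :: "real poly"
  by (intro borel_measurable_continuous_onI continuous_intros)

lemma integral_poly_zero:
  fixes h :: "real \<Rightarrow> real"
  assumes h: "integrable unit_B h" and mom: "\<And>k. (\<integral>x. h x * x ^ k \<partial>unit_B) = 0"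
  shows "(\<integral>x. h x * poly p x \<partial>unit_B) = 0"
proof -
  have "integrable unit_B (\<lambda>x. h x * (coeff p i * x ^ i))" for i
    by (rule integrable_unit_B_mult_continuous[OF h]) (auto intro!: continuous_intros)
  then have "(\<integral>x. (\<Sum>i\<le>degree p. h x * (coeff p i * x ^ i)) \<partial>unit_B) = (\<Sum>i\<le>degree p. \<integral>x. h x * (coeff p i * x ^ i) \<partial>unit_B)"
    by (intro Bochner_Integration.integral_sum) auto
  also have "\<dots> = (\<Sum>i\<le>degree p. coeff p i * (\<integral>x. h x * x ^ i \<partial>unit_B))"
    by (intro sum.cong refl) (simp flip: integral_mult_right_zero add: mult.left_commute)
  finally show ?thesis by (simp add: poly_altdef sum_distrib_left mom)
qed

lemma integral_continuous_zero:
  fixes h :: "real \<Rightarrow> real"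
  assumes h: "integrable unit_B h" and mom: "\<And>k. (\<integral>x. h x * x ^ k \<partial>unit_B) = 0"
    and g: "g \<in> borel_measurable borel" "continuous_on {0..1} g"
  shows "(\<integral>x. h x * g x \<partial>unit_B) = 0"
proof -
  define I where "I = (\<integral>x. \<bar>h x\<bar> \<partial>unit_B)"
  have I: "I \<ge> 0" unfolding I_def by simp
  have "\<bar>\<integral>x. h x * g x \<partial>unit_B\<bar> \<le> 0"
  proof (rule field_le_epsilon)
    fix e :: real assume e: "e > 0"
    define d where "d = e / (I + 1)"
    have d: "d > 0" "I * d \<le> e" using e I by (auto simp: d_def field_simps)
    obtain n where n: "\<And>x. x \<in> {0..1} \<Longrightarrow> \<bar>g x - (\<Sum>k\<le>n. g (k / n) * Bernstein n k x)\<bar> < d"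
      using Bernstein_Weierstrass[OF g(2) d(1)] by blast
    define p where "p = (\<Sum>k\<le>n. smult (g (k / n)) (bern n k))"
    have p: "poly p x = (\<Sum>k\<le>n. g (k / n) * Bernstein n k x)" for x
      by (simp add: p_def poly_sum poly_bern)
    have i1: "integrable unit_B (\<lambda>x. h x * g x)" by (rule integrable_unit_B_mult_continuous[OF h g])
    have i2: "integrable unit_B (\<lambda>x. h x * poly p x)"
      by (rule integrable_unit_B_mult_continuous[OF h]) (auto intro!: continuous_intros)
    have "(\<integral>x. h x * g x \<partial>unit_B) = (\<integral>x. h x * g x - h x * poly p x \<partial>unit_B)"
      using i1 i2 integral_poly_zero[OF h mom, of p] by simp
    also have "\<bar>\<dots>\<bar> \<le> (\<integral>x. \<bar>h x * g x - h x * poly p x\<bar> \<partial>unit_B)"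
      by (rule integral_abs_bound)
    also have "\<dots> \<le> (\<integral>x. \<bar>h x\<bar> * d \<partial>unit_B)"
    proof (rule integral_mono_AE)
      show "AE x in unit_B. \<bar>h x * g x - h x * poly p x\<bar> \<le> \<bar>h x\<bar> * d"
        using AE_unit_B_interior
      proof eventually_elim
        case (elim x)
        then have "\<bar>g x - poly p x\<bar> \<le> d" using n[of x] by (simp add: p)
        then have "\<bar>h x\<bar> * \<bar>g x - poly p x\<bar> \<le> \<bar>h x\<bar> * d" by (intro mult_left_mono) auto
        then show ?case by (simp add: right_diff_distrib[symmetric] abs_mult)
      qed
    qed (use i1 i2 h in auto)
    also have "\<dots> = I * d" by (simp add: I_def)
    finally show "\<bar>\<integral>x. h x * g x \<partial>unit_B\<bar> \<le> 0 + e" using d by simp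
  qed
  then show ?thesis by simp
qed

text \<open>Vanishing moments pass to continuous functions by Weierstrass and from there to
  indicators of half-lines. The positive and the negative part of \<open>h\<close> are then
  densities of measures that agree on half-lines, hence of the same measure, and densities are
  unique almost everywhere.\<close>

lemma moments_zero_imp_AE_zero:
  fixes h :: "real \<Rightarrow> real"
  assumes h: "integrable unit_B h" and mom: "\<And>k. (\<integral>x. h x * x ^ k \<partial>unit_B) = 0"
  shows "AE x in unit_B. h x = 0"
proof -
  have hm [measurable]: "h \<in> borel_measurable borel" using borel_measurable_integrable[OF h] by simp
  have ind: "(\<integral>x. h x * indicator {s<..} x \<partial>unit_B) = 0" for s
  proof -
    \<comment> \<open>Clipped ramps of slope m, starting at s: continuous, between 0 and 1, and
      converging pointwise to the indicator of the open half-line.\<close>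
    define g where "g m x = max 0 (min 1 (real m * (x - s)))" for m x
    have "(\<lambda>m. \<integral>x. h x * g m x \<partial>unit_B) \<longlonglongrightarrow> (\<integral>x. h x * indicator {s<..} x \<partial>unit_B)"
    proof (rule integral_dominated_convergence[where w="\<lambda>x. \<bar>h x\<bar>"])
      show "AE x in unit_B. (\<lambda>m. h x * g m x) \<longlonglongrightarrow> h x * indicator {s<..} x"
      proof (rule AE_I2, rule tendsto_mult_left)
        fix x
        show "(\<lambda>m. g m x) \<longlonglongrightarrow> indicator {s<..} x"
        proof (cases "x > s")
          case True
          obtain N :: nat where N: "1 / (x - s) < N" using reals_Archimedean2 by blast
          have "g m x = 1" if "m \<ge> N" for m
          proof -
            have "1 < real N * (x - s)" using N True by (simp add: field_simps)
            also have "\<dots> \<le> real m * (x - s)" using True that by (intro mult_right_mono) auto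
            finally show ?thesis by (simp add: g_def)
          qed
          then have "\<forall>\<^sub>F m in sequentially. g m x = indicator {s<..} x"
            using True by (auto simp: eventually_sequentially)
          then show ?thesis by (rule tendsto_eventually)
        next
          case False
          have "g m x = 0" for m
          proof -
            have "real m * (x - s) \<le> 0" using False by (intro mult_nonneg_nonpos) auto
            then show ?thesis by (simp add: g_def)
          qed
          then show ?thesis using False by simp
        qed
      qed
      show "AE x in unit_B. norm (h x * g m x) \<le> \<bar>h x\<bar>" for m
      proof (rule AE_I2)
        fix x
        have "\<bar>h x\<bar> * \<bar>g m x\<bar> \<le> \<bar>h x\<bar> * 1" by (intro mult_left_mono) (auto simp: g_def)
        then show "norm (h x * g m x) \<le> \<bar>h x\<bar>" by (simp add: abs_mult)
      qed
    qed (use h in \<open>auto simp: g_def\<close>)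
    moreover have "(\<integral>x. h x * g m x \<partial>unit_B) = 0" for m
      unfolding g_def by (intro integral_continuous_zero[OF h mom]) (auto intro!: continuous_intros)
    ultimately show ?thesis by (simp add: LIMSEQ_const_iff)
  qed
  define P where "P x = max 0 (h x)" for x
  define N where "N x = max 0 (- h x)" for x
  have PN: "integrable unit_B P" "integrable unit_B N" "P x \<ge> 0" "N x \<ge> 0" "h x = P x - N x" for x
    using h by (auto simp: P_def[abs_def] N_def[abs_def])
  have em: "emeasure (density unit_B (\<lambda>x. ennreal (F x))) {s<..} = ennreal (\<integral>x. F x * indicator {s<..} x \<partial>unit_B)"
    if "integrable unit_B F" "\<And>x. F x \<ge> 0" for F :: "real \<Rightarrow> real" and s
  proof -
    have "F \<in> borel_measurable borel" using borel_measurable_integrable[OF that(1)] by simp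
    then have "emeasure (density unit_B (\<lambda>x. ennreal (F x))) {s<..} = (\<integral>\<^sup>+x. ennreal (F x * indicator {s<..} x) \<partial>unit_B)"
      using that(2) by (subst emeasure_density) (auto simp: ennreal_mult' ennreal_indicator)
    also have "\<dots> = ennreal (\<integral>x. F x * indicator {s<..} x \<partial>unit_B)"
      by (rule nn_integral_eq_integral) (use that in \<open>auto intro!: integrable_real_mult_indicator\<close>)
    finally show ?thesis .
  qed
  have "density unit_B (\<lambda>x. ennreal (P x)) = density unit_B (\<lambda>x. ennreal (N x))"
  proof (rule measure_eqI_lessThan)
    fix s
    have "(\<integral>x. P x * indicator {s<..} x \<partial>unit_B) - (\<integral>x. N x * indicator {s<..} x \<partial>unit_B)
        = (\<integral>x. P x * indicator {s<..} x - N x * indicator {s<..} x \<partial>unit_B)"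
      using PN(1,2) by (intro Bochner_Integration.integral_diff[symmetric] integrable_real_mult_indicator) auto
    also have "\<dots> = 0" using ind[of s] by (simp add: PN(5) left_diff_distrib)
    finally show "emeasure (density unit_B (\<lambda>x. ennreal (P x))) {s<..} = emeasure (density unit_B (\<lambda>x. ennreal (N x))) {s<..}"
      using em[OF PN(1,3)] em[OF PN(2,4)] by simp
    show "emeasure (density unit_B (\<lambda>x. ennreal (P x))) {s<..} < \<infinity>" using em[OF PN(1,3)] by simp
  qed simp_all
  then have "AE x in unit_B. ennreal (P x) = ennreal (N x)"
    by (intro unit_B.density_unique_iff[THEN iffD1]) (auto simp: P_def N_def)
  then show ?thesis
  proof eventually_elim
    case (elim x)
    then have "P x = N x" using PN(3,4)[of x] by simp
    then show ?case using PN(5)[of x] by simp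
  qed
qed

lemma integral_unit_B_FTC:
  assumes "g \<in> borel_measurable borel" "continuous_on {0..1} g"
    "\<And>x. x \<in> {0..1} \<Longrightarrow> (G has_real_derivative g x) (at x within {0..1})"
  shows "(\<integral>x. g x \<partial>unit_B) = G 1 - G 0" and "integrable unit_B g"
proof -
  show i: "integrable unit_B g"
    using assms(1,2) by (simp add: unit_B_absolutely_integrable absolutely_integrable_continuous_real)
  have "(g has_integral G 1 - G 0) {0..1}"
    using assms(3) by (intro fundamental_theorem_of_calculus) (auto simp: has_real_derivative_iff_has_vector_derivative)
  then show "(\<integral>x. g x \<partial>unit_B) = G 1 - G 0"
    using unit_B_absolutely_integrable(2)[OF assms(1) i] by (simp add: integral_unique)
qed

lemma DERIV_power_Suc: "((\<lambda>x::real. x ^ Suc k) has_real_derivative real (Suc k) * x ^ k) (at x within A)"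
  by (rule DERIV_cong[OF DERIV_subset[OF DERIV_pow subset_UNIV]]) simp

lemma integral_unit_B_power: "(\<integral>x. x ^ k \<partial>unit_B) = 1 / (real k + 1)"
proof -
  have "((\<lambda>x. x ^ Suc k / real (Suc k)) has_real_derivative x ^ k) (at x within {0..1})" for x :: real
    by (rule DERIV_cong[OF DERIV_cdivide[OF DERIV_power_Suc]]) simp
  then have "(\<integral>x. x ^ k \<partial>unit_B) = 1 ^ Suc k / real (Suc k) - 0 ^ Suc k / real (Suc k)"
    by (intro integral_unit_B_FTC(1)) (auto intro!: continuous_intros simp del: power_Suc)
  then show ?thesis by (simp add: add.commute)
qed

lemma test_fun_facts:
  assumes "\<phi> \<in> test_fun"
  shows "(\<phi> has_real_derivative deriv \<phi> x) (at x within A)" "x \<le> 0 \<or> x \<ge> 1 \<Longrightarrow> \<phi> x = 0"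
    "continuous_on A \<phi>" "continuous_on A (deriv \<phi>)" "\<phi> \<in> borel_measurable borel" "deriv \<phi> \<in> borel_measurable borel"
proof -
  have s: "smooth1 \<phi>" by (rule test_fun_smooth1[OF assms])
  show "(\<phi> has_real_derivative deriv \<phi> x) (at x within A)"
    by (rule DERIV_subset[OF smooth1_deriv(2)[OF s] subset_UNIV])
  show c: "continuous_on A \<phi>" "continuous_on A (deriv \<phi>)" for A
    using smooth1_isCont[OF s] smooth1_isCont[OF smooth1_deriv(1)[OF s]]
    by (auto simp: continuous_at_imp_continuous_on)
  show "\<phi> \<in> borel_measurable borel" "deriv \<phi> \<in> borel_measurable borel"
    by (intro borel_measurable_continuous_onI c)+
  obtain K where "K \<subseteq> {0<..<1}" "\<And>x. x \<notin> K \<Longrightarrow> \<phi> x = 0"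
    using assms unfolding test_fun_def by auto
  then show "x \<le> 0 \<or> x \<ge> 1 \<Longrightarrow> \<phi> x = 0" by fastforce
qed

text \<open>Polynomials vanishing at the end points are admissible as well, after
  multiplication with cutoff functions.\<close>

lemma du_Bois_Reymond:
  fixes h :: "real \<Rightarrow> real"
  assumes h: "integrable unit_B h"
    and test: "\<And>\<phi>. \<phi> \<in> test_fun \<Longrightarrow> (\<integral>x. h x * deriv \<phi> x \<partial>unit_B) = 0"
  shows "AE x in unit_B. h x = (\<integral>x. h x \<partial>unit_B)"
proof -
  have hm [measurable]: "h \<in> borel_measurable borel" using borel_measurable_integrable[OF h] by simp
  obtain cut :: "nat \<Rightarrow> real \<Rightarrow> real" and C where cut: "\<And>n. cut n \<in> test_fun" "\<And>n x. \<bar>cut n x\<bar> \<le> 1"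
    "\<And>x. 0 < x \<Longrightarrow> x < 1 \<Longrightarrow> \<forall>\<^sub>F n in sequentially. cut n x = 1 \<and> deriv (cut n) x = 0"
    "\<And>n x. 0 < x \<Longrightarrow> x < 1 \<Longrightarrow> \<bar>deriv (cut n) x\<bar> * min x (1 - x) \<le> C"
    by (rule cutoff_exists) blast
  note [measurable] = test_fun_facts(5,6)[OF cut(1)]
  define c where "c = (\<integral>x. h x \<partial>unit_B)"
  have mom: "(\<integral>x. (h x - c) * x ^ k \<partial>unit_B) = 0" for k
  proof -
    \<comment> \<open>\<open>q\<close> vanishes at both end points and its derivative is
      \<open>x ^ k\<close> minus its mean. Orthogonality of \<open>h\<close> to \<open>q'\<close>
      therefore says that the moments of \<open>h\<close> minus its mean vanish.\<close>
    define q where "q x = (x ^ Suc k - x) / (real k + 1)" for x :: real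
    define q' where "q' x = x ^ k - 1 / (real k + 1)" for x :: real
    have qm [measurable]: "q \<in> borel_measurable borel" "q' \<in> borel_measurable borel"
      unfolding q_def[abs_def] q'_def[abs_def] by measurable
    have q: "(q has_real_derivative q' x) (at x)" for x
      unfolding q_def[abs_def] q'_def
      by (rule DERIV_cong[OF DERIV_cdivide[OF DERIV_diff[OF DERIV_power_Suc DERIV_ident]]]) (simp add: field_simps)
    have sq: "smooth1 q"
    proof -
      have "q = poly (smult (1 / (real k + 1)) (monom 1 (Suc k) - monom 1 1))"
        by (auto simp: q_def poly_monom diff_divide_distrib)
      then show ?thesis by (simp add: smooth1_poly)
    qed
    \<comment> \<open>Linear vanishing at the boundary, with constant 1 by Bernoulli's inequality;
      it compensates the growth of the derivative of the cutoff.\<close>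
    have qb: "\<bar>q x\<bar> \<le> min x (1 - x)" if "0 < x" "x < 1" for x
    proof -
      have xk: "0 \<le> x ^ k" "x ^ k \<le> 1" using that by (auto simp: power_le_one)
      have "1 - x ^ k \<le> real k * (1 - x)" using Bernoulli_inequality[of "x - 1" k] that by (simp add: algebra_simps)
      have e: "\<bar>q x\<bar> = x * (1 - x ^ k) / (real k + 1)"
      proof -
        have "q x = - (x * (1 - x ^ k) / (real k + 1))" by (simp add: q_def minus_divide_left right_diff_distrib)
        moreover have "0 \<le> x * (1 - x ^ k) / (real k + 1)" using that xk by auto
        ultimately show ?thesis by (simp only: abs_minus_cancel abs_of_nonneg)
      qed
      have "x * (1 - x ^ k) \<le> x * 1" using that xk by (intro mult_left_mono) auto
      also have "\<dots> \<le> x * (real k + 1)" using that by (intro mult_left_mono) auto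
      finally have 1: "\<bar>q x\<bar> \<le> x" unfolding e by (simp add: field_simps)
      have "x * (1 - x ^ k) \<le> 1 * (real k * (1 - x))" using that xk \<open>1 - x ^ k \<le> real k * (1 - x)\<close> by (intro mult_mono) auto
      also have "\<dots> \<le> (real k + 1) * (1 - x)" using that by (auto intro: mult_right_mono)
      finally have "\<bar>q x\<bar> \<le> 1 - x" unfolding e by (simp add: field_simps)
      with 1 show ?thesis by simp
    qed
    have q'b: "\<bar>q' x\<bar> \<le> 1" if "0 < x" "x < 1" for x
    proof -
      have xk: "0 \<le> x ^ k" "x ^ k \<le> 1" using that by (auto simp: power_le_one)
      have "0 \<le> 1 / (real k + 1)" "1 / (real k + 1) \<le> 1" by auto
      with xk show ?thesis unfolding q'_def by linarith
    qed
    have tf: "(\<lambda>x. q x * cut n x) \<in> test_fun" for n by (rule test_fun_mult[OF sq cut(1)])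
    have d: "deriv (\<lambda>x. q x * cut n x) x = q' x * cut n x + q x * deriv (cut n) x" for n x
      by (rule DERIV_imp_deriv) (auto intro!: derivative_eq_intros q test_fun_facts(1)[OF cut(1)])
    have "(\<lambda>n. \<integral>x. h x * (q' x * cut n x + q x * deriv (cut n) x) \<partial>unit_B) \<longlonglongrightarrow> (\<integral>x. h x * q' x \<partial>unit_B)"
    proof (rule integral_dominated_convergence[where w="\<lambda>x. \<bar>h x\<bar> * (1 + C)"])
      show "AE x in unit_B. (\<lambda>n. h x * (q' x * cut n x + q x * deriv (cut n) x)) \<longlonglongrightarrow> h x * q' x"
        using AE_unit_B_interior
      proof eventually_elim
        case (elim x)
        then have "\<forall>\<^sub>F n in sequentially. cut n x = 1 \<and> deriv (cut n) x = 0"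
          using cut(3)[of x] by simp
        then have "\<forall>\<^sub>F n in sequentially. h x * (q' x * cut n x + q x * deriv (cut n) x) = h x * q' x"
          by eventually_elim simp
        then show ?case by (rule tendsto_eventually)
      qed
      show "AE x in unit_B. norm (h x * (q' x * cut n x + q x * deriv (cut n) x)) \<le> \<bar>h x\<bar> * (1 + C)" for n
        using AE_unit_B_interior
      proof eventually_elim
        case (elim x)
        have "\<bar>q' x * cut n x + q x * deriv (cut n) x\<bar> \<le> \<bar>q' x\<bar> * \<bar>cut n x\<bar> + \<bar>q x\<bar> * \<bar>deriv (cut n) x\<bar>"
          by (simp add: abs_mult[symmetric] abs_triangle_ineq)
        also have "\<bar>q' x\<bar> * \<bar>cut n x\<bar> \<le> 1 * 1" using elim q'b cut(2) by (intro mult_mono) auto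
        also have "\<bar>q x\<bar> * \<bar>deriv (cut n) x\<bar> \<le> min x (1 - x) * \<bar>deriv (cut n) x\<bar>"
          using elim qb by (intro mult_right_mono) auto
        also have "\<dots> \<le> C" using cut(4)[of x n] elim by (simp add: mult.commute)
        finally have "\<bar>q' x * cut n x + q x * deriv (cut n) x\<bar> \<le> 1 + C" by simp
        then have "\<bar>h x\<bar> * \<bar>q' x * cut n x + q x * deriv (cut n) x\<bar> \<le> \<bar>h x\<bar> * (1 + C)"
          by (intro mult_left_mono) auto
        then show ?case by (simp add: abs_mult)
      qed
    qed (use h in auto)
    moreover have "(\<integral>x. h x * (q' x * cut n x + q x * deriv (cut n) x) \<partial>unit_B) = 0" for n
      using test[OF tf[of n]] by (simp add: d)
    ultimately have *: "(\<integral>x. h x * q' x \<partial>unit_B) = 0" by (simp add: LIMSEQ_const_iff)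
    have i: "integrable unit_B (\<lambda>x. h x * x ^ k)"
      by (rule integrable_unit_B_mult_continuous[OF h]) (auto intro!: continuous_intros)
    have i2: "integrable unit_B (\<lambda>x::real. x ^ k)"
    proof -
      have "integrable unit_B (\<lambda>x. 1 * x ^ k)"
        by (rule integrable_unit_B_mult_continuous) (auto intro!: continuous_intros)
      then show ?thesis by simp
    qed
    have "(\<integral>x. h x * q' x \<partial>unit_B) = (\<integral>x. h x * x ^ k \<partial>unit_B) - c / (real k + 1)"
      using i h by (simp add: q'_def right_diff_distrib c_def)
    moreover have "(\<integral>x. (h x - c) * x ^ k \<partial>unit_B) = (\<integral>x. h x * x ^ k \<partial>unit_B) - c / (real k + 1)"
      using i i2 by (simp add: left_diff_distrib integral_unit_B_power)
    ultimately show ?thesis using * by simp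
  qed
  have "integrable unit_B (\<lambda>x. h x - c)" using h by simp
  from moments_zero_imp_AE_zero[OF this mom] show ?thesis by (simp add: c_def)
qed

text \<open>The argument is clamped to the unit interval, so that the primitive is continuous and
  Borel measurable on the whole line, as integration against \<open>unit_B\<close> requires.\<close>

definition prim :: "(real \<Rightarrow> real) \<Rightarrow> real \<Rightarrow> real"
  where "prim u t = integral {0..min 1 (max 0 t)} u"

lemma prim_eq: "t \<in> {0..1} \<Longrightarrow> prim u t = integral {0..t} u"
  by (simp add: prim_def)

lemma prim_continuous:
  assumes "u absolutely_integrable_on {0..1}"
  shows "continuous_on A (prim u)" "prim u \<in> borel_measurable borel"
proof -
  have "continuous_on {0..1} (\<lambda>t. integral {0..t} u)"
    using assms by (intro indefinite_integral_continuous_1 set_lebesgue_integral_eq_integral(1))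
  then show *: "continuous_on A (prim u)" for A unfolding prim_def[abs_def]
    by (rule continuous_on_compose2) (auto intro!: continuous_intros)
  show "prim u \<in> borel_measurable borel" by (intro borel_measurable_continuous_onI *)
qed

lemma integral_prim_by_parts:
  fixes g \<psi> \<psi>' :: "real \<Rightarrow> real"
  assumes g: "g \<in> borel_measurable borel" "integrable unit_B g"
    and \<psi>': "\<psi>' \<in> borel_measurable borel" "continuous_on {0..1} \<psi>'" "continuous_on {0..1} \<psi>" "\<psi> \<in> borel_measurable borel"
    and d: "\<And>x. x \<in> {0..1} \<Longrightarrow> (\<psi> has_real_derivative \<psi>' x) (at x within {0..1})"
  shows "(\<integral>t. prim g t * \<psi>' t \<partial>unit_B) = integral {0..1} g * \<psi> 1 - (\<integral>t. g t * \<psi> t \<partial>unit_B)"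
proof -
  have ga: "g absolutely_integrable_on {0..1}" using g unit_B_absolutely_integrable(1) by blast
  have pa: "\<psi>' absolutely_integrable_on {0..1}" by (rule absolutely_integrable_continuous_real[OF \<psi>'(2)])
  have p: "\<psi> t = \<psi> 0 + integral {0..t} \<psi>'" if "t \<in> {0..1}" for t
  proof -
    have "(\<psi> has_real_derivative \<psi>' x) (at x within {0..t})" if "x \<in> {0..t}" for x
      by (rule DERIV_subset[OF d]) (use that \<open>t \<in> {0..1}\<close> in auto)
    then have "(\<psi>' has_integral \<psi> t - \<psi> 0) {0..t}"
      using that by (intro fundamental_theorem_of_calculus)
        (auto simp: has_real_derivative_iff_has_vector_derivative[symmetric])
    then show ?thesis by (simp add: integral_unique)
  qed
  have i1: "integrable unit_B (\<lambda>t. g t * \<psi> t)" by (rule integrable_unit_B_mult_continuous[OF g(2) \<psi>'(4,3)])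
  have i2: "integrable unit_B (\<lambda>t. \<psi>' t * prim g t)"
    by (rule integrable_unit_B_mult_continuous) (use \<psi>' pa prim_continuous[OF ga] unit_B_absolutely_integrable(1)[OF \<psi>'(1)] in auto)
  have "prim g 1 * \<psi> 1 = 0 * \<psi> 0 + integral {0..1} (\<lambda>t. g t * \<psi> t + \<psi>' t * prim g t)"
    by (rule primitive_product(2)[OF ga _ pa p]) (auto simp: prim_eq)
  also have "integral {0..1} (\<lambda>t. g t * \<psi> t + \<psi>' t * prim g t) = (\<integral>t. g t * \<psi> t + \<psi>' t * prim g t \<partial>unit_B)"
    using g \<psi>' prim_continuous[OF ga] i1 i2 by (intro unit_B_absolutely_integrable(2)[symmetric]) auto
  also have "\<dots> = (\<integral>t. g t * \<psi> t \<partial>unit_B) + (\<integral>t. \<psi>' t * prim g t \<partial>unit_B)" using i1 i2 by simp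
  finally show ?thesis by (simp add: prim_eq mult.commute)
qed

text \<open>The powers of t do not vanish at the end points, so they see both end values:
  \<open>0 ^ k\<close> is 1 only for k = 0, and that case relates d to c. All other k make the
  moments of \<open>m t - c - prim g t\<close> vanish after integration by parts.\<close>

lemma polynomial_weak_primitive:
  fixes m g :: "real \<Rightarrow> real"
  assumes m: "integrable unit_B m" and g: "integrable unit_B g"
    and weak: "\<And>k. (\<integral>t. m t * (real k * t ^ (k - 1)) + g t * t ^ k \<partial>unit_B) = d - c * 0 ^ k"
  shows "AE t in unit_B. m t = c + prim g t" and "d = c + integral {0..1} g"
proof -
  have mm [measurable]: "m \<in> borel_measurable borel" "g \<in> borel_measurable borel"
    using borel_measurable_integrable[OF m] borel_measurable_integrable[OF g] by simp_all
  have ga: "g absolutely_integrable_on {0..1}" using g unit_B_absolutely_integrable(1) by simp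
  note [measurable] = prim_continuous(2)[OF ga]
  have im: "integrable unit_B (\<lambda>t. m t * (real k * t ^ (k - 1)))" and ig: "integrable unit_B (\<lambda>t. g t * t ^ k)" for k
    by (intro integrable_unit_B_mult_continuous m g; auto intro!: continuous_intros)+
  have "(\<integral>t. g t \<partial>unit_B) = d - c" using weak[of 0] by simp
  then show d: "d = c + integral {0..1} g" using unit_B_absolutely_integrable(2)[OF mm(2) g] by simp
  have ip: "integrable unit_B (prim g)"
    by (rule Bochner_Integration.integrable_cong[THEN iffD1, OF refl _ integrable_unit_B_mult_continuous[of "\<lambda>_. 1" "prim g"]])
      (use prim_continuous[OF ga] in auto)
  define h where "h t = m t - c - prim g t" for t
  have h: "integrable unit_B h" unfolding h_def[abs_def] using m ip by simp
  have "(\<integral>t. h t * t ^ k \<partial>unit_B) = 0" for k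
  proof -
    let ?p = "\<lambda>t. real (Suc k) * t ^ k"
    have ib: "(\<integral>t. prim g t * ?p t \<partial>unit_B) = integral {0..1} g - (\<integral>t. g t * t ^ Suc k \<partial>unit_B)"
    proof -
      have "(\<integral>t. prim g t * ?p t \<partial>unit_B) = integral {0..1} g * 1 ^ Suc k - (\<integral>t. g t * t ^ Suc k \<partial>unit_B)"
        by (rule integral_prim_by_parts[OF mm(2) g]) (auto intro!: continuous_intros DERIV_power_Suc simp del: power_Suc of_nat_Suc)
      then show ?thesis by simp
    qed
    have i1: "integrable unit_B (\<lambda>t. prim g t * ?p t)"
      by (intro integrable_unit_B_mult_continuous ip) (auto intro!: continuous_intros)
    have i2: "integrable unit_B (\<lambda>t. m t * ?p t)" using im[of "Suc k"] by simp
    have i3: "integrable unit_B ?p"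
    proof -
      have "integrable unit_B (\<lambda>t. 1 * ?p t)"
        by (rule integrable_unit_B_mult_continuous) (auto intro!: continuous_intros)
      then show ?thesis by simp
    qed
    have e: "(\<integral>t. ?p t \<partial>unit_B) = 1" by (simp add: integral_unit_B_power add.commute)
    have "(\<integral>t. m t * ?p t \<partial>unit_B) + (\<integral>t. g t * t ^ Suc k \<partial>unit_B) = d"
      using weak[of "Suc k"] im[of "Suc k"] ig[of "Suc k"] by simp
    moreover have "(\<integral>t. h t * ?p t \<partial>unit_B) = (\<integral>t. m t * ?p t \<partial>unit_B) - (\<integral>t. c * ?p t \<partial>unit_B) - (\<integral>t. prim g t * ?p t \<partial>unit_B)"
      unfolding h_def left_diff_distrib using i1 i2 i3
      by (subst Bochner_Integration.integral_diff, auto)+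
    moreover have "(\<integral>t. c * ?p t \<partial>unit_B) = c" by (subst integral_mult_right_zero) (simp only: e mult_1_right)
    ultimately have "(\<integral>t. h t * ?p t \<partial>unit_B) = 0" using ib d by linarith
    then have "real (Suc k) * (\<integral>t. h t * t ^ k \<partial>unit_B) = 0"
      by (simp only: mult.left_commute[of _ "real (Suc k)"] integral_mult_right_zero)
    then show ?thesis by simp
  qed
  from moments_zero_imp_AE_zero[OF h this] show "AE t in unit_B. m t = c + prim g t"
    by eventually_elim (simp add: h_def)
qed

subsection \<open>Sobolev functions on the unit interval\<close>

lemma integrable_unit_B_continuous:
  fixes g :: "real \<Rightarrow> real"
  assumes "g \<in> borel_measurable borel" "continuous_on {0..1} g"
  shows "integrable unit_B g"
  using unit_B_absolutely_integrable(1)[OF assms(1)] absolutely_integrable_continuous_real[OF assms(2)] by blast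

lemma L2_absolutely_integrable: "u \<in> L2 \<Longrightarrow> u absolutely_integrable_on {0..1}"
proof -
  assume "u \<in> L2"
  then obtain U where U: "U \<in> borel_measurable borel" "AE x in unit_B. u x = U x" "integrable unit_B U"
    using L2_borel_version by metis
  then show ?thesis using unit_I_AE(1)[OF U(1,2)] unit_I_absolutely_integrable by blast
qed

lemma integral_AE_eq:
  fixes u U :: "real \<Rightarrow> real"
  assumes "AE x in unit_B. u x = U x" "0 \<le> s" "t \<le> 1"
  shows "integral {s..t} u = integral {s..t} U"
proof -
  obtain N where N: "{x \<in> space lebesgue. \<not> (x \<in> {0<..<1} \<longrightarrow> u x = U x)} \<subseteq> N" "N \<in> null_sets lebesgue"
    using AE_completion[OF assms(1)[unfolded AE_unit_B]] unfolding eventually_ae_filter by blast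
  have "negligible (N \<union> {0, 1})"
    using N(2) by (simp add: negligible_iff_null_sets[symmetric] insert_is_Un[of 0 "{1}"])
  then show ?thesis
  proof (rule integral_spike)
    fix x assume x: "x \<in> {s..t} - (N \<union> {0, 1})"
    then have "x \<in> {0<..<1}" using assms(2,3) by auto
    then show "U x = u x" using x N(1) by auto
  qed
qed

lemma prim_AE_eq: "AE x in unit_B. u x = U x \<Longrightarrow> prim u t = prim U t"
  unfolding prim_def by (rule integral_AE_eq) auto

text \<open>The bound (p + q)^2 \<le> 2 p^2 + 2 q^2 stands in for the triangle inequality; the
  approximation arguments only need convergence to zero.\<close>

lemma L2_linear:
  assumes u: "u \<in> L2" and w: "w \<in> L2"
  shows "(\<lambda>x. a * u x + b * w x) \<in> L2"
    and "(L2_norm (\<lambda>x. a * u x + b * w x))\<^sup>2 \<le> 2 * a\<^sup>2 * (L2_norm u)\<^sup>2 + 2 * b\<^sup>2 * (L2_norm w)\<^sup>2"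
proof -
  obtain U where U: "U \<in> borel_measurable borel" "AE x in unit_B. u x = U x" "integrable unit_B (\<lambda>x. (U x)\<^sup>2)"
    using L2_borel_version[OF u] by metis
  obtain W where W: "W \<in> borel_measurable borel" "AE x in unit_B. w x = W x" "integrable unit_B (\<lambda>x. (W x)\<^sup>2)"
    using L2_borel_version[OF w] by metis
  have m: "(\<lambda>x. a * U x + b * W x) \<in> borel_measurable borel" using U(1) W(1) by measurable
  have ae: "AE x in unit_B. a * u x + b * w x = a * U x + b * W x" using U(2) W(2) by eventually_elim simp
  have le: "(a * U x + b * W x)\<^sup>2 \<le> 2 * a\<^sup>2 * (U x)\<^sup>2 + 2 * b\<^sup>2 * (W x)\<^sup>2" for x
    using zero_le_power2[of "a * U x - b * W x"] by (simp add: power2_eq_square algebra_simps)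
  have i: "integrable unit_B (\<lambda>x. 2 * a\<^sup>2 * (U x)\<^sup>2 + 2 * b\<^sup>2 * (W x)\<^sup>2)" using U(3) W(3) by simp
  have i2: "integrable unit_B (\<lambda>x. (a * U x + b * W x)\<^sup>2)"
    by (rule Bochner_Integration.integrable_bound[OF i]) (use m le in \<open>auto simp: abs_le_iff intro: order_trans[OF _ le]\<close>)
  show "(\<lambda>x. a * u x + b * w x) \<in> L2" using L2_borel_iff[OF m ae] i2 by blast
  have "(\<integral>x. (a * U x + b * W x)\<^sup>2 \<partial>unit_B) \<le> (\<integral>x. 2 * a\<^sup>2 * (U x)\<^sup>2 + 2 * b\<^sup>2 * (W x)\<^sup>2 \<partial>unit_B)"
    by (rule integral_mono[OF i2 i le])
  also have "\<dots> = 2 * a\<^sup>2 * (\<integral>x. (U x)\<^sup>2 \<partial>unit_B) + 2 * b\<^sup>2 * (\<integral>x. (W x)\<^sup>2 \<partial>unit_B)"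
    using U(3) W(3) by simp
  finally show "(L2_norm (\<lambda>x. a * u x + b * w x))\<^sup>2 \<le> 2 * a\<^sup>2 * (L2_norm u)\<^sup>2 + 2 * b\<^sup>2 * (L2_norm w)\<^sup>2"
    unfolding L2_norm_borel[OF m ae] L2_norm_borel[OF U(1,2)] L2_norm_borel[OF W(1,2)] .
qed

lemma L2_norm_nonneg [simp]: "0 \<le> L2_norm u"
  by (simp add: L2_norm_def)

text \<open>The variance of the absolute value is nonnegative, the interval having length 1.\<close>

lemma L1_le_L2_norm:
  assumes "u \<in> L2"
  shows "integral {0..1} (\<lambda>x. \<bar>u x\<bar>) \<le> L2_norm u"
proof -
  obtain U where U: "U \<in> borel_measurable borel" "AE x in unit_B. u x = U x"
    "integrable unit_B (\<lambda>x. (U x)\<^sup>2)" "integrable unit_B U"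
    using L2_borel_version[OF assms] by metis
  define m where "m = (\<integral>x. \<bar>U x\<bar> \<partial>unit_B)"
  have iU: "integrable unit_B (\<lambda>x. \<bar>U x\<bar>)" using U(4) by simp
  have ae: "AE x in unit_B. \<bar>u x\<bar> = \<bar>U x\<bar>" using U(2) by eventually_elim simp
  have "integral {0..1} (\<lambda>x. \<bar>u x\<bar>) = integral {0..1} (\<lambda>x. \<bar>U x\<bar>)"
    by (rule integral_AE_eq[OF ae]) auto
  also have "\<dots> = m" unfolding m_def using U(1) iU by (intro unit_B_absolutely_integrable(2)[symmetric]) auto
  finally have e: "integral {0..1} (\<lambda>x. \<bar>u x\<bar>) = m" .
  have "0 \<le> (\<integral>x. (\<bar>U x\<bar> - m)\<^sup>2 \<partial>unit_B)" by simp
  also have "\<dots> = (\<integral>x. (U x)\<^sup>2 - 2 * m * \<bar>U x\<bar> + m\<^sup>2 \<partial>unit_B)"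
    by (intro Bochner_Integration.integral_cong) (auto simp: power2_diff)
  also have "\<dots> = (\<integral>x. (U x)\<^sup>2 \<partial>unit_B) - 2 * m * m + m\<^sup>2"
    using U(3) iU by (simp add: m_def)
  finally have "m\<^sup>2 \<le> (L2_norm u)\<^sup>2" unfolding L2_norm_borel[OF U(1,2)] by (simp add: power2_eq_square)
  then show ?thesis unfolding e by (rule power2_le_imp_le) simp
qed

lemma continuous_AE_eq:
  fixes a b :: "real \<Rightarrow> real"
  assumes a: "continuous_on {0..1} a" and b: "continuous_on {0..1} b" and ae: "AE x in unit_B. a x = b x"
    and x: "x \<in> {0..1}"
  shows "a x = b x"
proof -
  have ae': "AE x in unit_B. \<bar>a x - b x\<bar> = 0" using ae by eventually_elim simp
  have cd: "continuous_on {0..1} (\<lambda>x. \<bar>a x - b x\<bar>)" by (intro continuous_intros a b)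
  have "((\<lambda>x. \<bar>a x - b x\<bar>) has_integral integral {0..1} (\<lambda>x. \<bar>a x - b x\<bar>)) {0..1}"
    by (intro integrable_integral integrable_continuous_real cd)
  also have "integral {0..1} (\<lambda>x. \<bar>a x - b x\<bar>) = 0"
    using integral_AE_eq[OF ae', of 0 1] by simp
  finally have "((\<lambda>x. \<bar>a x - b x\<bar>) has_integral 0) (cbox 0 1)" by simp
  then have "\<bar>a x - b x\<bar> = 0"
    by (rule has_integral_0_cbox_imp_0[rotated 2]) (use x cd in auto)
  then show ?thesis by simp
qed

text \<open>The difference of \<open>u\<close> and the primitive of \<open>g\<close> has weak
  derivative zero, so the du Bois-Reymond lemma makes it constant.\<close>

lemma weak_deriv_prim:
  assumes "weak_deriv u g"
  obtains c where "AE x in unit_B. u x = c + prim g x"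
proof -
  have u: "u \<in> L2" and g: "g \<in> L2" and w: "\<And>\<phi>. \<phi> \<in> test_fun \<Longrightarrow>
      (\<integral>x. u x * deriv \<phi> x \<partial>unit_I) = - (\<integral>x. g x * \<phi> x \<partial>unit_I)"
    using assms by (auto simp: weak_deriv_def)
  obtain U where U: "U \<in> borel_measurable borel" "AE x in unit_B. u x = U x" "integrable unit_B U"
    using L2_borel_version[OF u] by metis
  obtain G where G: "G \<in> borel_measurable borel" "AE x in unit_B. g x = G x" "integrable unit_B G"
    using L2_borel_version[OF g] by metis
  have Ga: "G absolutely_integrable_on {0..1}" using G unit_B_absolutely_integrable(1) by blast
  note pc = prim_continuous[OF Ga]
  have ip: "integrable unit_B (prim G)" using pc unit_B_absolutely_integrable(1) absolutely_integrable_continuous_real by blast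
  define h where "h x = U x - prim G x" for x
  have h: "integrable unit_B h" unfolding h_def[abs_def] using U(3) ip by simp
  have "(\<integral>x. h x * deriv \<phi> x \<partial>unit_B) = 0" if \<phi>: "\<phi> \<in> test_fun" for \<phi>
  proof -
    note tf = test_fun_facts[OF \<phi>]
    have 1: "(\<integral>x. u x * deriv \<phi> x \<partial>unit_I) = (\<integral>x. U x * deriv \<phi> x \<partial>unit_B)"
    proof (rule unit_I_AE(2))
      show "(\<lambda>x. U x * deriv \<phi> x) \<in> borel_measurable borel" using U(1) tf(6) by measurable
      show "AE x in unit_B. u x * deriv \<phi> x = U x * deriv \<phi> x" using U(2) by eventually_elim simp
    qed
    have 2: "(\<integral>x. g x * \<phi> x \<partial>unit_I) = (\<integral>x. G x * \<phi> x \<partial>unit_B)"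
    proof (rule unit_I_AE(2))
      show "(\<lambda>x. G x * \<phi> x) \<in> borel_measurable borel" using G(1) tf(5) by measurable
      show "AE x in unit_B. g x * \<phi> x = G x * \<phi> x" using G(2) by eventually_elim simp
    qed
    have 3: "(\<integral>t. prim G t * deriv \<phi> t \<partial>unit_B) = integral {0..1} G * \<phi> 1 - (\<integral>t. G t * \<phi> t \<partial>unit_B)"
      by (rule integral_prim_by_parts[OF G(1,3)]) (use tf in auto)
    have i: "integrable unit_B (\<lambda>x. U x * deriv \<phi> x)" "integrable unit_B (\<lambda>x. prim G x * deriv \<phi> x)"
      by (intro integrable_unit_B_mult_continuous U ip tf)+
    have "(\<integral>x. h x * deriv \<phi> x \<partial>unit_B) = (\<integral>x. U x * deriv \<phi> x \<partial>unit_B) - (\<integral>x. prim G x * deriv \<phi> x \<partial>unit_B)"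
      unfolding h_def left_diff_distrib using i by simp
    then show ?thesis using w[OF \<phi>] 1 2 3 tf(2)[of 1] by simp
  qed
  from du_Bois_Reymond[OF h this] have "AE x in unit_B. h x = (\<integral>x. h x \<partial>unit_B)" .
  then have "AE x in unit_B. u x = (\<integral>x. h x \<partial>unit_B) + prim g x"
    using U(2)
  proof eventually_elim
    case (elim x)
    then show ?case using prim_AE_eq[OF G(2), of x] by (simp add: h_def)
  qed
  then show thesis by (rule that)
qed

lemma continuous_L2:
  assumes "\<phi> \<in> borel_measurable borel" "continuous_on {0..1} \<phi>"
  shows "\<phi> \<in> L2"
proof -
  have "integrable unit_B (\<lambda>x. 1 * (\<phi> x)\<^sup>2)"
    by (rule integrable_unit_B_mult_continuous) (use assms in \<open>auto intro!: continuous_intros\<close>)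
  then show ?thesis using L2_borel_iff[OF assms(1), of \<phi>] by simp
qed

lemma test_fun_weak_deriv:
  assumes "\<psi> \<in> test_fun"
  shows "weak_deriv \<psi> (deriv \<psi>)"
  unfolding weak_deriv_def
proof (intro conjI ballI)
  note t = test_fun_facts[OF assms]
  show "\<psi> \<in> L2" "deriv \<psi> \<in> L2" using t by (auto intro: continuous_L2)
  fix \<phi> assume "\<phi> \<in> test_fun"
  note s = test_fun_facts[OF this]
  have i: "integrable unit_B (\<lambda>x. \<psi> x * deriv \<phi> x)" "integrable unit_B (\<lambda>x. deriv \<psi> x * \<phi> x)"
    by (intro integrable_unit_B_continuous borel_measurable_times continuous_on_mult t s)+
  have "(\<integral>x. deriv \<psi> x * \<phi> x + \<psi> x * deriv \<phi> x \<partial>unit_B) = \<psi> 1 * \<phi> 1 - \<psi> 0 * \<phi> 0"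
    by (rule integral_unit_B_FTC(1)) (use t s in \<open>auto intro!: continuous_intros derivative_eq_intros\<close>)
  then have "(\<integral>x. \<psi> x * deriv \<phi> x \<partial>unit_B) = - (\<integral>x. deriv \<psi> x * \<phi> x \<partial>unit_B)"
    using t(2) s(2) i by simp
  moreover have "(\<lambda>x. \<psi> x * deriv \<phi> x) \<in> borel_measurable borel" "(\<lambda>x. deriv \<psi> x * \<phi> x) \<in> borel_measurable borel"
    using t s by measurable
  ultimately show "(\<integral>x. \<psi> x * deriv \<phi> x \<partial>unit_I) = - (\<integral>x. deriv \<psi> x * \<phi> x \<partial>unit_I)"
    by (simp add: unit_I_borel(2))
qed

lemma L2_mult_continuous_integrable:
  assumes "u \<in> L2" "\<phi> \<in> borel_measurable borel" "continuous_on {0..1} \<phi>"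
  shows "integrable unit_I (\<lambda>x. u x * \<phi> x)"
proof -
  obtain U where U: "U \<in> borel_measurable borel" "AE x in unit_B. u x = U x" "integrable unit_B U"
    using L2_borel_version[OF assms(1)] by metis
  have m: "(\<lambda>x. U x * \<phi> x) \<in> borel_measurable borel" using U(1) assms(2) by measurable
  have ae: "AE x in unit_B. u x * \<phi> x = U x * \<phi> x" using U(2) by eventually_elim simp
  show ?thesis using unit_I_AE(1)[OF m ae] integrable_unit_B_mult_continuous[OF U(3) assms(2,3)] by blast
qed

lemma weak_deriv_linear:
  assumes "weak_deriv u g" "weak_deriv w h"
  shows "weak_deriv (\<lambda>x. a * u x + b * w x) (\<lambda>x. a * g x + b * h x)"
proof -
  have L2: "u \<in> L2" "g \<in> L2" "w \<in> L2" "h \<in> L2" using assms by (auto simp: weak_deriv_def)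
  show ?thesis unfolding weak_deriv_def
  proof (intro conjI ballI L2_linear(1) L2)
    fix \<phi> assume \<phi>: "\<phi> \<in> test_fun"
    note s = test_fun_facts[OF \<phi>]
    have i: "integrable unit_I (\<lambda>x. u x * deriv \<phi> x)" "integrable unit_I (\<lambda>x. w x * deriv \<phi> x)"
      "integrable unit_I (\<lambda>x. g x * \<phi> x)" "integrable unit_I (\<lambda>x. h x * \<phi> x)"
      by (intro L2_mult_continuous_integrable L2 s)+
    have "(\<integral>x. (a * u x + b * w x) * deriv \<phi> x \<partial>unit_I) = a * (\<integral>x. u x * deriv \<phi> x \<partial>unit_I) + b * (\<integral>x. w x * deriv \<phi> x \<partial>unit_I)"
      using i by (simp add: distrib_right mult.assoc)
    also have "\<dots> = - (a * (\<integral>x. g x * \<phi> x \<partial>unit_I) + b * (\<integral>x. h x * \<phi> x \<partial>unit_I))"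
      using assms \<phi> by (simp add: weak_deriv_def)
    also have "\<dots> = - (\<integral>x. (a * g x + b * h x) * \<phi> x \<partial>unit_I)"
      using i by (simp add: distrib_right mult.assoc)
    finally show "(\<integral>x. (a * u x + b * w x) * deriv \<phi> x \<partial>unit_I) = - (\<integral>x. (a * g x + b * h x) * \<phi> x \<partial>unit_I)" .
  qed
qed

lemma wd_weak_deriv: "u \<in> H1 \<Longrightarrow> weak_deriv u (wd u)"
  unfolding H1_def wd_def mem_Collect_eq by (rule someI_ex[of "weak_deriv u"])

lemma weak_deriv_H1: "weak_deriv u g \<Longrightarrow> u \<in> H1"
  unfolding H1_def by auto

lemma weak_deriv_continuous:
  assumes "weak_deriv u g" "continuous_on {0..1} u"
  obtains c where "\<And>x. x \<in> {0..1} \<Longrightarrow> u x = c + prim g x"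
proof -
  have ga: "g absolutely_integrable_on {0..1}" using assms(1) L2_absolutely_integrable by (auto simp: weak_deriv_def)
  obtain c where c: "AE x in unit_B. u x = c + prim g x" by (rule weak_deriv_prim[OF assms(1)])
  show thesis
    by (rule that[of c], rule continuous_AE_eq[OF assms(2) _ c])
      (auto intro!: continuous_intros prim_continuous[OF ga])
qed

lemma prim_diff_le:
  assumes "g \<in> L2"
  shows "\<bar>prim g x - prim g y\<bar> \<le> L2_norm g"
proof -
  have ga: "g absolutely_integrable_on {0..1}" using assms by (rule L2_absolutely_integrable)
  have *: "\<bar>prim g x - prim g y\<bar> \<le> L2_norm g" if "y \<le> x" for x y
  proof -
    define s where "s = min 1 (max 0 y)"
    define t where "t = min 1 (max 0 x)"
    have st: "0 \<le> s" "s \<le> t" "t \<le> 1" using that by (auto simp: s_def t_def)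
    have "prim g x - prim g y = integral {s..t} g"
      unfolding prim_def s_def[symmetric] t_def[symmetric]
      by (rule primitive_increment[OF ga, of _ 0]) (use st in auto)
    also have "\<bar>\<dots>\<bar> \<le> integral {s..t} (\<lambda>x. \<bar>g x\<bar>)"
      using absolutely_integrable_sub[OF ga st(1,3)] unfolding absolutely_integrable_on_def
      by (intro integral_norm_bound_integral[of g, simplified]) auto
    also have "\<dots> \<le> integral {0..1} (\<lambda>x. \<bar>g x\<bar>)"
      using absolutely_integrable_sub[OF ga st(1,3)] ga st unfolding absolutely_integrable_on_def
      by (intro integral_subset_le) auto
    also have "\<dots> \<le> L2_norm g" by (rule L1_le_L2_norm[OF assms])
    finally show ?thesis .
  qed
  show ?thesis using *[of y x] *[of x y] by (cases "y \<le> x") (auto simp: abs_minus_commute)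
qed

text \<open>One-dimensional Sobolev embedding: the oscillation of \<open>u\<close> is at most the L2
  norm of \<open>g\<close>, so \<open>\<bar>u x\<bar>\<close> exceeds \<open>\<bar>u y\<bar>\<close>
  by at most that amount for every y, and averaging over y gives the bound.\<close>

lemma weak_deriv_sup_bound:
  assumes "weak_deriv u g" "continuous_on {0..1} u" and x: "x \<in> {0..1}"
  shows "\<bar>u x\<bar> \<le> L2_norm u + L2_norm g"
proof -
  have L2: "u \<in> L2" "g \<in> L2" using assms(1) by (auto simp: weak_deriv_def)
  obtain c where c: "\<And>x. x \<in> {0..1} \<Longrightarrow> u x = c + prim g x"
    by (rule weak_deriv_continuous[OF assms(1,2)]) blast
  have "\<bar>u x\<bar> - L2_norm g \<le> \<bar>u y\<bar>" if "y \<in> {0..1}" for y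
    using c[OF x] c[OF that] prim_diff_le[OF L2(2), of x y] by linarith
  then have "integral {0..1} (\<lambda>y::real. \<bar>u x\<bar> - L2_norm g) \<le> integral {0..1} (\<lambda>y. \<bar>u y\<bar>)"
    using assms(2) by (intro integral_le integrable_continuous_real) (auto intro!: continuous_intros)
  also have "\<dots> \<le> L2_norm u" by (rule L1_le_L2_norm[OF L2(1)])
  finally show ?thesis by simp
qed

lemma H1_norm_bounds: "L2_norm u \<le> H1_norm u" "L2_norm (wd u) \<le> H1_norm u" "0 \<le> H1_norm u"
  unfolding H1_norm_def by (auto intro: real_le_rsqrt)

text \<open>Evaluation at an end point is controlled by the H1 norm, and test functions vanish
  there. The factor 2 comes from two L2 norms, each at most the H1 norm.\<close>

lemma H10_zero_at_boundary:
  assumes u: "u \<in> H10" and c: "continuous_on {0..1} u" and x: "x = 0 \<or> x = 1"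
  shows "u x = 0"
proof -
  obtain \<phi> where \<phi>: "range \<phi> \<subseteq> test_fun" "(\<lambda>n. H1_norm (\<lambda>x. u x - \<phi> n x)) \<longlonglongrightarrow> 0" and uH: "u \<in> H1"
    using u unfolding H10_def by blast
  have le: "\<bar>u x\<bar> \<le> 2 * H1_norm (\<lambda>x. u x - \<phi> n x)" for n
  proof -
    have t: "\<phi> n \<in> test_fun" using \<phi>(1) by auto
    have "weak_deriv (\<lambda>x. 1 * u x + (-1) * \<phi> n x) (\<lambda>x. 1 * wd u x + (-1) * deriv (\<phi> n) x)"
      by (intro weak_deriv_linear wd_weak_deriv uH test_fun_weak_deriv t)
    then have "(\<lambda>x. u x - \<phi> n x) \<in> H1" using weak_deriv_H1 by fastforce
    then have wd: "weak_deriv (\<lambda>x. u x - \<phi> n x) (wd (\<lambda>x. u x - \<phi> n x))" by (rule wd_weak_deriv)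
    have cc: "continuous_on {0..1} (\<lambda>x. u x - \<phi> n x)" by (intro continuous_intros c test_fun_facts(3)[OF t])
    have "\<bar>u x - \<phi> n x\<bar> \<le> L2_norm (\<lambda>x. u x - \<phi> n x) + L2_norm (wd (\<lambda>x. u x - \<phi> n x))"
      using weak_deriv_sup_bound[OF wd cc, of x] x by auto
    then show ?thesis
      using H1_norm_bounds(1,2)[of "\<lambda>x. u x - \<phi> n x"] test_fun_facts(2)[OF t, of x] x by auto
  qed
  have lim: "(\<lambda>n. 2 * H1_norm (\<lambda>x. u x - \<phi> n x)) \<longlonglongrightarrow> 0" using tendsto_mult_left[OF \<phi>(2), of 2] by simp
  have "\<bar>u x\<bar> \<le> 0" by (rule LIMSEQ_le_const[OF lim]) (use le in blast)
  then show ?thesis by simp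
qed

lemma H2_norm_bounds: "L2_norm u \<le> H2_norm u" "L2_norm (wd u) \<le> H2_norm u" "L2_norm (wd (wd u)) \<le> H2_norm u" "0 \<le> H2_norm u"
  unfolding H2_norm_def by (auto intro: real_le_rsqrt)

text \<open>Two applications of the embedding: \<open>wd u\<close> has a continuous version
  \<open>w\<close>, and \<open>u\<close> is a primitive of it. The factor 2 arises because the
  supremum of \<open>w\<close> is bounded by the sum of two L2 norms, each at most the H2
  norm.\<close>

lemma H2_H10_regular:
  assumes u: "u \<in> H2" "u \<in> H10" and c: "continuous_on {0..1} u"
  obtains w where "\<And>x. x \<in> {0..1} \<Longrightarrow> (u has_real_derivative w x) (at x within {0..1})"
    "continuous_on {0..1} w" "u 0 = 0" "u 1 = 0" "\<And>x. x \<in> {0..1} \<Longrightarrow> \<bar>w x\<bar> \<le> 2 * H2_norm u"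
    "AE x in unit_B. wd u x = w x"
proof -
  have d1: "weak_deriv u (wd u)" and d2: "weak_deriv (wd u) (wd (wd u))"
    using u(1) wd_weak_deriv unfolding H2_def by auto
  have L2: "wd u \<in> L2" "wd (wd u) \<in> L2" using d2 by (auto simp: weak_deriv_def)
  obtain c1 where c1: "AE x in unit_B. wd u x = c1 + prim (wd (wd u)) x" by (rule weak_deriv_prim[OF d2])
  define w where "w x = c1 + prim (wd (wd u)) x" for x
  have cw: "continuous_on A w" for A
    unfolding w_def by (intro continuous_intros prim_continuous L2_absolutely_integrable L2)
  have ae: "AE x in unit_B. wd u x = w x" using c1 by (simp add: w_def)
  obtain c0 where c0: "\<And>x. x \<in> {0..1} \<Longrightarrow> u x = c0 + prim (wd u) x"
    by (rule weak_deriv_continuous[OF d1 c]) blast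
  have uw: "u x = c0 + integral {0..x} w" if "x \<in> {0..1}" for x
    using c0[OF that] prim_AE_eq[OF ae, of x] that by (simp add: prim_eq)
  show thesis
  proof (rule that[of w])
    fix x :: real assume x: "x \<in> {0..1}"
    have "((\<lambda>x. integral {0..x} w) has_real_derivative w x) (at x within {0..1})"
      by (rule integral_has_real_derivative[OF cw x])
    then have "((\<lambda>x. c0 + integral {0..x} w) has_real_derivative w x) (at x within {0..1})"
      by (auto intro!: derivative_eq_intros)
    then show "(u has_real_derivative w x) (at x within {0..1})"
      by (rule has_field_derivative_transform_within[OF _ zero_less_one x]) (simp add: uw)
    have w: "weak_deriv w (wd (wd u))"
    proof -
      have "wd u \<in> borel_measurable unit_I" using L2(1) by (simp add: L2_def)
      have wm: "w \<in> borel_measurable borel" by (intro borel_measurable_continuous_onI cw)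
      have "(\<integral>x. w x * deriv \<phi> x \<partial>unit_I) = (\<integral>x. wd u x * deriv \<phi> x \<partial>unit_I)" if "\<phi> \<in> test_fun" for \<phi>
      proof -
        have m: "(\<lambda>x. w x * deriv \<phi> x) \<in> borel_measurable borel" using wm test_fun_facts(6)[OF that] by measurable
        have "AE x in unit_B. wd u x * deriv \<phi> x = w x * deriv \<phi> x" using ae by eventually_elim simp
        from unit_I_AE(2)[OF m this] unit_I_borel(2)[OF m] show ?thesis by simp
      qed
      then show ?thesis using d2 continuous_L2[OF wm cw] by (simp add: weak_deriv_def)
    qed
    have nw: "L2_norm w = L2_norm (wd u)"
    proof -
      have wm: "w \<in> borel_measurable borel" by (intro borel_measurable_continuous_onI cw)
      have "(L2_norm w)\<^sup>2 = (L2_norm (wd u))\<^sup>2"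
        using L2_norm_borel[OF wm ae] L2_norm_borel[OF wm, of w] by simp
      then show ?thesis by simp
    qed
    show "\<bar>w x\<bar> \<le> 2 * H2_norm u"
      using weak_deriv_sup_bound[OF w cw x] nw H2_norm_bounds(2,3)[of u] by simp
  qed (use cw ae H10_zero_at_boundary[OF u(2) c] in auto)
qed

subsection \<open>Velocity fields\<close>

text \<open>The sample points step to the right, and to the left only at x = 1, so they eventually
  lie in the interval. They are an explicit Borel function of x, which gives measurability of the
  limit as x varies.\<close>

lemma difference_quotient_tendsto:
  fixes F :: "real \<Rightarrow> real"
  assumes der: "(F has_real_derivative D) (at x within {0..1})" and x: "x \<in> {0..1}"
  shows "(\<lambda>k. (F (if x < 1 then x + 1 / real (Suc k) else x - 1 / real (Suc k)) - F x) /
      ((if x < 1 then x + 1 / real (Suc k) else x - 1 / real (Suc k)) - x)) \<longlonglongrightarrow> D"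
proof -
  define s where "s k = (if x < 1 then x + 1 / real (Suc k) else x - 1 / real (Suc k))" for k
  have l0: "(\<lambda>k. 1 / real (Suc k)) \<longlonglongrightarrow> 0"
    using LIMSEQ_inverse_real_of_nat by (simp add: inverse_eq_divide)
  have "s \<longlonglongrightarrow> x"
    unfolding s_def using tendsto_add[OF tendsto_const[of x] l0] tendsto_diff[OF tendsto_const[of x] l0]
    by (cases "x < 1") (simp_all del: of_nat_Suc)
  moreover have "\<forall>\<^sub>F k in sequentially. s k \<in> {0..1} \<and> s k \<noteq> x"
  proof (cases "x < 1")
    case True
    then have "\<forall>\<^sub>F k in sequentially. 1 / real (Suc k) < 1 - x" using order_tendstoD(2)[OF l0] by simp
    then show ?thesis by eventually_elim (use True x in \<open>auto simp: s_def\<close>)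
  next
    case False
    then show ?thesis using x by (auto simp: s_def)
  qed
  ultimately have "filterlim s (at x within {0..1}) sequentially"
    unfolding filterlim_at by auto
  with der show ?thesis
    unfolding has_field_derivative_iff s_def[symmetric] by (rule filterlim_compose)
qed

text \<open>The derivative is a pointwise limit of difference quotients that are jointly Borel; the
  value 0 is imposed on the exceptional times and outside the interval.\<close>

lemma Qmeas_derivative:
  assumes F: "Qmeas F" and N: "N \<in> sets borel"
    and D0: "\<And>x t. t \<in> N \<or> x \<notin> {0..1} \<Longrightarrow> D x t = 0"
    and D: "\<And>x t. t \<notin> N \<Longrightarrow> x \<in> {0..1} \<Longrightarrow> ((\<lambda>y. F y t) has_real_derivative D x t) (at x within {0..1})"
  shows "Qmeas D"
proof -
  define s where "s k x = (if x < 1 then x + 1 / real (Suc k) else x - 1 / real (Suc k))" for k x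
  define q where "q k p = (if snd p \<notin> N \<and> fst p \<in> {0..1} then
      (F (s k (fst p)) (snd p) - F (fst p) (snd p)) / (s k (fst p) - fst p) else 0)" for k p
  have sm [measurable]: "s k \<in> borel_measurable borel" for k unfolding s_def[abs_def] by measurable
  have Fs: "(\<lambda>p. F (s k (fst p)) (snd p)) \<in> borel_measurable (borel \<Otimes>\<^sub>M borel)" for k
    using measurable_compose[OF _ F, of "\<lambda>p. (s k (fst p), snd p)"] by simp
  show ?thesis
  proof (rule borel_measurable_LIMSEQ_real[where u=q])
    fix p :: "real \<times> real"
    show "(\<lambda>k. q k p) \<longlonglongrightarrow> D (fst p) (snd p)"
    proof (cases "snd p \<notin> N \<and> fst p \<in> {0..1}")
      case True
      then show ?thesis
        using difference_quotient_tendsto[OF D[of "snd p" "fst p"]] by (simp add: q_def s_def)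
    next
      case False
      then show ?thesis using D0[of "snd p" "fst p"] by (auto simp: q_def)
    qed
  next
    fix k
    have "Measurable.pred (borel \<Otimes>\<^sub>M borel) (\<lambda>p::real \<times> real. snd p \<notin> N \<and> fst p \<in> {0..1})"
      using N by measurable
    then show "q k \<in> borel_measurable (borel \<Otimes>\<^sub>M borel)"
      unfolding q_def[abs_def] using F Fs[of k] by measurable
  qed
qed

lemma Qmeas_partial_integral:
  assumes "Qmeas U"
  shows "Qmeas (\<lambda>x t. \<integral>y. indicator {..x} y * U y t \<partial>unit_B)"
proof (rule unit_B.borel_measurable_lebesgue_integral)
  have "(\<lambda>q::(real \<times> real) \<times> real. U (snd q) (snd (fst q))) \<in> borel_measurable ((borel \<Otimes>\<^sub>M borel) \<Otimes>\<^sub>M borel)"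
    using measurable_compose[OF _ assms, of "\<lambda>q::(real \<times> real) \<times> real. (snd q, snd (fst q))" "(borel \<Otimes>\<^sub>M borel) \<Otimes>\<^sub>M borel"] by simp
  moreover have "(\<lambda>q::(real \<times> real) \<times> real. indicator {..fst (fst q)} (snd q) :: real) \<in> borel_measurable ((borel \<Otimes>\<^sub>M borel) \<Otimes>\<^sub>M borel)"
  proof -
    have "{q::(real \<times> real) \<times> real. snd q \<le> fst (fst q)} \<in> sets borel"
      by (intro borel_closed closed_Collect_le continuous_intros)
    then have "(indicator {q. snd q \<le> fst (fst q)} :: _ \<Rightarrow> real) \<in> borel_measurable ((borel \<Otimes>\<^sub>M borel) \<Otimes>\<^sub>M (borel :: real measure))"
      by (simp add: borel_prod)
    moreover have "indicator {..fst (fst q)} (snd q) = (indicator {q. snd q \<le> fst (fst q)} q :: real)" for q :: "(real \<times> real) \<times> real"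
      by (simp add: indicator_def)
    ultimately show ?thesis by simp
  qed
  moreover have "borel_measurable ((borel \<Otimes>\<^sub>M borel) \<Otimes>\<^sub>M unit_B) = (borel_measurable ((borel \<Otimes>\<^sub>M borel) \<Otimes>\<^sub>M borel) :: ((real \<times> real) \<times> real \<Rightarrow> real) set)"
    by (intro measurable_cong_sets sets_pair_measure_cong) auto
  ultimately show "(\<lambda>(p, y). indicator {..fst p} y * U y (snd p)) \<in> borel_measurable ((borel \<Otimes>\<^sub>M borel) \<Otimes>\<^sub>M unit_B)"
    by (simp add: case_prod_beta')
qed

lemma partial_integral_eq:
  fixes u :: "real \<Rightarrow> real"
  assumes u: "integrable unit_B u" and y: "y \<in> {0..1}"
  shows "(\<integral>s. indicator {..y} s * u s \<partial>unit_B) = integral {0..y} u"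
proof -
  have "u \<in> borel_measurable borel" using borel_measurable_integrable[OF u] by simp
  then have m: "(\<lambda>s. indicator {..y} s * u s) \<in> borel_measurable borel" by measurable
  have "integrable unit_B (\<lambda>s. u s * indicator {..y} s)"
    by (rule integrable_real_mult_indicator[OF _ u]) simp
  then have "(\<integral>s. indicator {..y} s * u s \<partial>unit_B) = integral {0..1} (\<lambda>s. indicator {..y} s * u s)"
    using m by (intro unit_B_absolutely_integrable(2)) (simp_all add: mult.commute)
  also have "\<dots> = integral {0..1} (\<lambda>s. if s \<in> {0..y} then u s else 0)"
    by (intro integral_cong) (auto simp: indicator_def)
  also have "\<dots> = integral {0..y} u"
    using y by (subst integral_restrict_Int) (simp add: Int_absorb2)
  finally show ?thesis .
qed

text \<open>A regular representative of the velocity, with derivative \<open>W\<close> and majorant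
  \<open>L\<close>. All properties hold for every t: at exceptional times the field is replaced by
  zero, so that later arguments along single characteristics meet no null sets of times.\<close>

locale velocity =
  fixes V W :: "real \<Rightarrow> real \<Rightarrow> real" and L :: "real \<Rightarrow> real"
  assumes V_meas [measurable]: "Qmeas V" and W_meas [measurable]: "Qmeas W"
    and L_meas [measurable]: "L \<in> borel_measurable borel"
    and L_square: "integrable unit_B (\<lambda>t. (L t)\<^sup>2)" and L_nonneg: "0 \<le> L t"
    and V_deriv: "x \<in> {0..1} \<Longrightarrow> ((\<lambda>y. V y t) has_real_derivative W x t) (at x within {0..1})"
    and W_cont: "continuous_on {0..1} (\<lambda>x. W x t)"
    and V_0: "V 0 t = 0" and V_1: "V 1 t = 0"
    and W_le: "x \<in> {0..1} \<Longrightarrow> \<bar>W x t\<bar> \<le> L t"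

text \<open>A Borel version \<open>U\<close> agrees with v only almost everywhere in x, so it says
  nothing about point values. Integrating in x removes this ambiguity, and differentiating again
  recovers the continuous slices together with joint measurability; one more derivative gives
  \<open>W\<close>. The identity for the H2 norm is kept for the computation of the action.\<close>

lemma Vel_velocity:
  assumes "v \<in> Vel"
  obtains V W L where "velocity V W L" "AE t in unit_B. \<forall>x\<in>{0..1}. v x t = V x t"
    "AE t in unit_B. AE x in unit_B. wd (\<lambda>y. v y t) x = W x t"
    "AE t in unit_B. (H2_norm (\<lambda>x. v x t))\<^sup>2 = (L t)\<^sup>2 / 4"
    "AE t in unit_B. (\<lambda>x. v x t) \<in> H2"
proof -
  have b: "v \<in> bochner_L2 (H2 \<inter> H10) H2_norm" and vc: "AE t in unit_B. continuous_on {0..1} (\<lambda>x. v x t)"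
    using assms unfolding Vel_def AE_unit_I by auto
  obtain U where "borel_rep v U" using borel_rep_ex[OF bochner_L2_D(1)[OF b]] by metis
  then have Um [measurable]: "Qmeas U" and vU: "AE t in unit_B. AE x in unit_B. v x t = U x t"
    by (auto simp: borel_rep_def)
  have vH: "AE t in unit_B. (\<lambda>x. v x t) \<in> H2 \<inter> H10"
    using bochner_L2_D(2)[OF b] unfolding AE_unit_I .
  have hI: "integrable unit_I (\<lambda>t. (H2_norm (\<lambda>x. v x t))\<^sup>2)" by (rule bochner_L2_D(3)[OF b])
  obtain h where h: "h \<in> borel_measurable borel" "AE t in unit_B. (H2_norm (\<lambda>x. v x t))\<^sup>2 = h t"
    using unit_I_borel_version[OF borel_measurable_integrable[OF hI]] by metis
  have hB: "integrable unit_B h" using unit_I_AE(1)[OF h] hI by blast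
  define good where "good t \<longleftrightarrow> continuous_on {0..1} (\<lambda>x. v x t) \<and> (AE x in unit_B. v x t = U x t) \<and>
      (\<lambda>x. v x t) \<in> H2 \<inter> H10 \<and> (H2_norm (\<lambda>x. v x t))\<^sup>2 = h t" for t
  have "AE t in unit_B. good t"
    using vc vU vH h(2) by eventually_elim (simp add: good_def)
  then obtain N where N: "{t \<in> space unit_B. \<not> good t} \<subseteq> N" "emeasure unit_B N = 0" "N \<in> sets unit_B"
    by (rule AE_E)
  have Nb: "N \<in> sets borel" and gN: "\<And>t. t \<notin> N \<Longrightarrow> good t" and aeN: "AE t in unit_B. t \<notin> N"
    using N by (auto intro!: AE_not_in simp: null_sets_def)
  \<comment> \<open>Clipping at 0 keeps \<open>L\<close> nonnegative also at exceptional times,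
    where nothing is known about the sign of \<open>h\<close>.\<close>
  define L where "L t = 2 * sqrt (max 0 (h t))" for t
  have LH: "L t = 2 * H2_norm (\<lambda>x. v x t)" if "t \<notin> N" for t
  proof -
    have "h t = (H2_norm (\<lambda>x. v x t))\<^sup>2" using gN[OF that] by (simp add: good_def)
    then show ?thesis using H2_norm_bounds(4)[of "\<lambda>x. v x t"] by (simp add: L_def)
  qed
  define P where "P t u \<longleftrightarrow> t \<notin> N \<longrightarrow> (\<forall>x\<in>{0..1}. ((\<lambda>x. v x t) has_real_derivative u x) (at x within {0..1})) \<and>
      continuous_on {0..1} u \<and> v 0 t = 0 \<and> v 1 t = 0 \<and> (\<forall>x\<in>{0..1}. \<bar>u x\<bar> \<le> L t) \<and>
      (AE x in unit_B. wd (\<lambda>x. v x t) x = u x)" for t u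
  have "\<exists>u. P t u" for t
  proof (cases "t \<in> N")
    case False
    then have g: "(\<lambda>x. v x t) \<in> H2" "(\<lambda>x. v x t) \<in> H10" "continuous_on {0..1} (\<lambda>x. v x t)"
      using gN[OF False] by (auto simp: good_def)
    show ?thesis
    proof (rule H2_H10_regular[OF g])
      fix u assume "\<And>x. x \<in> {0..1} \<Longrightarrow> ((\<lambda>x. v x t) has_real_derivative u x) (at x within {0..1})"
        "continuous_on {0..1} u" "v 0 t = 0" "v 1 t = 0" "\<And>x. x \<in> {0..1} \<Longrightarrow> \<bar>u x\<bar> \<le> 2 * H2_norm (\<lambda>x. v x t)"
        "AE x in unit_B. wd (\<lambda>x. v x t) x = u x"
      then show ?thesis by (intro exI[of _ u]) (simp add: P_def LH[OF False])
    qed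
  qed (simp add: P_def)
  \<comment> \<open>The derivatives are chosen separately for each time; their joint measurability
    follows afterwards from \<open>Qmeas_derivative\<close>.\<close>
  then have "\<exists>w. \<forall>t. P t (w t)" by (intro choice allI)
  then obtain w where wP: "\<forall>t. P t (w t)" ..
  have w: "(\<forall>x\<in>{0..1}. ((\<lambda>x. v x t) has_real_derivative w t x) (at x within {0..1})) \<and>
      continuous_on {0..1} (w t) \<and> v 0 t = 0 \<and> v 1 t = 0 \<and> (\<forall>x\<in>{0..1}. \<bar>w t x\<bar> \<le> L t) \<and>
      (AE x in unit_B. wd (\<lambda>x. v x t) x = w t x)" if "t \<notin> N" for t
    using wP[rule_format, of t] that by (simp add: P_def)
  define V where "V x t = (if t \<in> N \<or> x \<notin> {0..1} then 0 else v x t)" for x t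
  define W where "W x t = (if t \<in> N \<or> x \<notin> {0..1} then 0 else w t x)" for x t
  define A where "A x t = (\<integral>y. indicator {..x} y * U y t \<partial>unit_B)" for x t
  have Am: "Qmeas A" unfolding A_def by (rule Qmeas_partial_integral[OF Um])
  have V0: "V x t = 0" if "t \<in> N \<or> x \<notin> {0..1}" for x t using that by (auto simp: V_def)
  have W0: "W x t = 0" if "t \<in> N \<or> x \<notin> {0..1}" for x t using that by (auto simp: W_def)
  have Vd: "((\<lambda>y. V y t) has_real_derivative W x t) (at x within {0..1})" if x: "x \<in> {0..1}" for x t
  proof (cases "t \<in> N")
    case True
    then show ?thesis by (simp add: V_def W_def)
  next
    case False
    have "((\<lambda>y. v y t) has_real_derivative W x t) (at x within {0..1})" using w[OF False] x False by (simp add: W_def)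
    then show ?thesis
      by (rule has_field_derivative_transform_within[OF _ zero_less_one x]) (use False in \<open>simp add: V_def\<close>)
  qed
  have Vm: "Qmeas V"
  proof (rule Qmeas_derivative[OF Am Nb V0])
    fix x t :: real assume t: "t \<notin> N" and x: "x \<in> {0..1}"
    note g = gN[OF t, unfolded good_def]
    have c: "continuous_on {0..1} (\<lambda>y. v y t)" using g by blast
    have Ue: "A y t = integral {0..y} (\<lambda>y. v y t)" if y: "y \<in> {0..1}" for y
    proof -
      have ae1: "AE u in unit_B. v u t = U u t" using g by blast
      have "(\<lambda>y. v y t) absolutely_integrable_on {0..1}" by (rule absolutely_integrable_continuous_real[OF c])
      then have iU: "integrable unit_B (\<lambda>u. U u t)"
        using unit_I_AE(1)[OF Qmeas_slice(1)[OF Um] ae1] unit_I_absolutely_integrable by blast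
      have "A y t = integral {0..y} (\<lambda>u. U u t)" unfolding A_def by (rule partial_integral_eq[OF iU y])
      also have "\<dots> = integral {0..y} (\<lambda>y. v y t)" using y by (intro integral_AE_eq[OF ae1, symmetric]) auto
      finally show ?thesis .
    qed
    have "((\<lambda>y. integral {0..y} (\<lambda>y. v y t)) has_real_derivative V x t) (at x within {0..1})"
      using integral_has_real_derivative[OF c x] t x by (simp add: V_def)
    then show "((\<lambda>y. A y t) has_real_derivative V x t) (at x within {0..1})"
      by (rule has_field_derivative_transform_within[OF _ zero_less_one x]) (simp add: Ue)
  qed
  have Wm: "Qmeas W" by (rule Qmeas_derivative[OF Vm Nb W0 Vd])
  have Lb: "L \<in> borel_measurable borel" unfolding L_def[abs_def] using h(1) by measurable
  show thesis
  proof (rule that)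
    show "velocity V W L"
    proof
      show "Qmeas V" "Qmeas W" "L \<in> borel_measurable borel" by (fact Vm Wm Lb)+
      show "integrable unit_B (\<lambda>t. (L t)\<^sup>2)" using hB by (simp add: L_def power_mult_distrib)
      show "0 \<le> L t" for t by (simp add: L_def)
      show "((\<lambda>y. V y t) has_real_derivative W x t) (at x within {0..1})" if "x \<in> {0..1}" for x t by (rule Vd[OF that])
      show "continuous_on {0..1} (\<lambda>x. W x t)" for t
      proof (cases "t \<in> N")
        case False
        then have "continuous_on {0..1} (w t)" using w by blast
        then show ?thesis by (rule continuous_on_eq) (use False in \<open>simp add: W_def\<close>)
      qed (simp add: W_def)
      show "V 0 t = 0" "V 1 t = 0" for t using w[of t] by (auto simp: V_def)
      show "\<bar>W x t\<bar> \<le> L t" if "x \<in> {0..1}" for x t using w[of t] that by (auto simp: W_def L_def)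
    qed
    show "AE t in unit_B. \<forall>x\<in>{0..1}. v x t = V x t" using aeN by eventually_elim (auto simp: V_def)
    show "AE t in unit_B. AE x in unit_B. wd (\<lambda>y. v y t) x = W x t"
      using aeN
    proof eventually_elim
      case (elim t)
      have "AE x in unit_B. wd (\<lambda>x. v x t) x = w t x" using w[OF elim] by blast
      then show ?case using AE_unit_B_interior by eventually_elim (use elim in \<open>simp add: W_def\<close>)
    qed
    show "AE t in unit_B. (H2_norm (\<lambda>x. v x t))\<^sup>2 = (L t)\<^sup>2 / 4"
      using aeN by eventually_elim (simp add: LH power_mult_distrib)
    show "AE t in unit_B. (\<lambda>x. v x t) \<in> H2" using vH by eventually_elim simp
  qed
qed

subsection \<open>The flow\<close>

text \<open>Continuity in x on each slice and a modulus in t that is uniform in x give joint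
  continuity. The modulus is an increment of a continuous function, since no Lipschitz bound in time
  is available.\<close>

lemma continuous_on_square_of_slices:
  fixes G :: "real \<Rightarrow> real \<Rightarrow> real" and l :: "real \<Rightarrow> real"
  assumes l: "continuous_on {0..1} l"
    and Gt: "\<And>x s t. x \<in> {0..1} \<Longrightarrow> s \<in> {0..1} \<Longrightarrow> t \<in> {0..1} \<Longrightarrow> \<bar>G x t - G x s\<bar> \<le> \<bar>l t - l s\<bar>"
    and Gx: "\<And>t. t \<in> {0..1} \<Longrightarrow> continuous_on {0..1} (\<lambda>x. G x t)"
  shows "continuous_on ({0..1} \<times> {0..1}) (\<lambda>p. G (fst p) (snd p))"
  unfolding continuous_on_sequentially
proof (intro allI ballI impI, elim conjE)
  fix u :: "nat \<Rightarrow> real \<times> real" and a assume a: "a \<in> {0..1} \<times> {0..1}"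
    and u: "\<forall>n. u n \<in> {0..1} \<times> {0..1}" and lim: "u \<longlonglongrightarrow> a"
  have x: "fst a \<in> {0..1}" "snd a \<in> {0..1}" "\<And>n. fst (u n) \<in> {0..1}" "\<And>n. snd (u n) \<in> {0..1}"
    using a u by (auto simp: mem_Times_iff)
  have lx: "(\<lambda>n. fst (u n)) \<longlonglongrightarrow> fst a" and lt: "(\<lambda>n. snd (u n)) \<longlonglongrightarrow> snd a"
    using lim by (auto intro: tendsto_fst tendsto_snd)
  have "(\<lambda>n. l (snd (u n))) \<longlonglongrightarrow> l (snd a)"
    by (rule continuous_on_tendsto_compose[OF l lt]) (use x in auto)
  then have l0: "(\<lambda>n. \<bar>l (snd (u n)) - l (snd a)\<bar>) \<longlonglongrightarrow> 0"
    by (simp add: LIM_zero tendsto_rabs_zero)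
  have "(\<lambda>n. G (fst (u n)) (snd (u n)) - G (fst (u n)) (snd a)) \<longlonglongrightarrow> 0"
    by (rule Lim_null_comparison[OF _ l0]) (use Gt x in auto)
  moreover have "(\<lambda>n. G (fst (u n)) (snd a)) \<longlonglongrightarrow> G (fst a) (snd a)"
    by (rule continuous_on_tendsto_compose[OF Gx[OF x(2)] lx]) (use x in auto)
  ultimately have "(\<lambda>n. (G (fst (u n)) (snd (u n)) - G (fst (u n)) (snd a)) + G (fst (u n)) (snd a)) \<longlonglongrightarrow> 0 + G (fst a) (snd a)"
    by (rule tendsto_add)
  then show "((\<lambda>p. G (fst p) (snd p)) \<circ> u) \<longlonglongrightarrow> G (fst a) (snd a)" by (simp add: comp_def)
qed

lemma has_real_derivative_within_sequentially:
  fixes f :: "real \<Rightarrow> real"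
  assumes "\<And>X. (\<And>n. X n \<in> S) \<Longrightarrow> (\<And>n. X n \<noteq> x) \<Longrightarrow> X \<longlonglongrightarrow> x \<Longrightarrow> (\<lambda>n. (f (X n) - f x) / (X n - x)) \<longlonglongrightarrow> D"
  shows "(f has_real_derivative D) (at x within S)"
  unfolding has_field_derivative_iff tendsto_at_iff_sequentially comp_def using assms by auto

lemma has_real_derivative_within_sequence:
  fixes f :: "real \<Rightarrow> real"
  assumes "(f has_real_derivative D) (at x within S)" "\<And>n. X n \<in> S" "\<And>n. X n \<noteq> x" "X \<longlonglongrightarrow> x"
  shows "(\<lambda>n. (f (X n) - f x) / (X n - x)) \<longlonglongrightarrow> D"
  using assms unfolding has_field_derivative_iff tendsto_at_iff_sequentially comp_def by auto

context velocity
begin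

lemma L_integrable: "integrable unit_B L"
proof -
  have "integrable unit_B (\<lambda>t. 1 + (L t)\<^sup>2)" using L_square by simp
  then show ?thesis
    by (rule Bochner_Integration.integrable_bound) (use abs_le_one_plus_square in auto)
qed

lemma L_absolutely_integrable: "L absolutely_integrable_on {0..1}"
  using L_integrable unit_B_absolutely_integrable(1)[OF L_meas] by blast

lemma L_integrable_on: "0 \<le> s \<Longrightarrow> t \<le> 1 \<Longrightarrow> L integrable_on {s..t}"
  using absolutely_integrable_sub[OF L_absolutely_integrable] set_lebesgue_integral_eq_integral(1) by blast

text \<open>The common modulus of continuity in time of the flow, of the logarithm of its Jacobian
  and, up to a factor, of the inverse flow.\<close>

definition Lam :: "real \<Rightarrow> real" where "Lam t = integral {0..t} L"

lemma Lam_diff: "0 \<le> s \<Longrightarrow> s \<le> t \<Longrightarrow> t \<le> 1 \<Longrightarrow> Lam t - Lam s = integral {s..t} L"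
  by (rule primitive_increment[OF L_absolutely_integrable, of _ 0]) (auto simp: Lam_def)

lemma Lam_mono: "0 \<le> s \<Longrightarrow> s \<le> t \<Longrightarrow> t \<le> 1 \<Longrightarrow> Lam s \<le> Lam t"
  using Lam_diff[of s t] integral_nonneg[of L "{s..t}"] L_integrable_on[of s t] L_nonneg by auto

lemma Lam_bounds: "t \<in> {0..1} \<Longrightarrow> 0 \<le> Lam t \<and> Lam t \<le> Lam 1"
  using Lam_mono[of 0 t] Lam_mono[of t 1] by (auto simp: Lam_def)

lemma Lam_continuous: "continuous_on {0..1} Lam"
  by (rule primitive_continuous[OF L_absolutely_integrable, of _ 0]) (simp add: Lam_def)

lemma V_lipschitz:
  assumes "x \<in> {0..1}" "y \<in> {0..1}"
  shows "\<bar>V x t - V y t\<bar> \<le> L t * \<bar>x - y\<bar>"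
  using field_differentiable_bound[of "{0..1}" "\<lambda>x. V x t" "\<lambda>x. W x t" "L t" x y] V_deriv W_le assms by auto

lemma V_le: "x \<in> {0..1} \<Longrightarrow> \<bar>V x t\<bar> \<le> L t"
proof -
  assume x: "x \<in> {0..1}"
  have "L t * \<bar>x - 0\<bar> \<le> L t * 1" using L_nonneg x by (intro mult_left_mono) auto
  with V_lipschitz[OF x, of 0 t] V_0 show ?thesis by simp
qed

lemma absolutely_integrable_dominated:
  assumes "f \<in> borel_measurable (lebesgue_on {0..1})" "\<And>s. s \<in> {0..1} \<Longrightarrow> \<bar>f s\<bar> \<le> C * L s"
  shows "f absolutely_integrable_on {0..1}"
proof (rule measurable_bounded_by_integrable_imp_absolutely_integrable[OF assms(1)])
  show "(\<lambda>s. C * L s) integrable_on {0..1}" by (intro integrable_on_mult_right L_integrable_on) auto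
qed (use assms(2) in auto)

text \<open>Caratheodory solutions in integrated form, confined to the interval on which
  \<open>V\<close> is controlled.\<close>

definition solution :: "real \<Rightarrow> (real \<Rightarrow> real) \<Rightarrow> bool"
  where "solution x \<alpha> \<longleftrightarrow> (\<forall>t\<in>{0..1}. \<alpha> t \<in> {0..1}) \<and> (\<lambda>s. V (\<alpha> s) s) absolutely_integrable_on {0..1} \<and>
      (\<forall>t\<in>{0..1}. \<alpha> t = x + integral {0..t} (\<lambda>s. V (\<alpha> s) s))"

lemma solutionD:
  assumes "solution x \<alpha>"
  shows "t \<in> {0..1} \<Longrightarrow> \<alpha> t \<in> {0..1}" "(\<lambda>s. V (\<alpha> s) s) absolutely_integrable_on {0..1}"
    "t \<in> {0..1} \<Longrightarrow> \<alpha> t = x + integral {0..t} (\<lambda>s. V (\<alpha> s) s)"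
  using assms unfolding solution_def by blast+

lemma solution_continuous: "solution x \<alpha> \<Longrightarrow> continuous_on {0..1} \<alpha>"
  by (rule primitive_continuous[of "\<lambda>s. V (\<alpha> s) s" _ x]) (auto simp: solution_def)

text \<open>The difference quotient of the velocity between two curves, bounded by \<open>L\<close>.
  Where the curves meet, division by zero gives 0, which is consistent because only the product with
  their difference is used in the equation.\<close>

definition slope :: "(real \<Rightarrow> real) \<Rightarrow> (real \<Rightarrow> real) \<Rightarrow> real \<Rightarrow> real"
  where "slope \<alpha> \<beta> s = (V (\<alpha> s) s - V (\<beta> s) s) / (\<alpha> s - \<beta> s)"

lemma slope_le:
  assumes "solution x \<alpha>" "solution y \<beta>" "s \<in> {0..1}"
  shows "\<bar>slope \<alpha> \<beta> s\<bar> \<le> L s"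
proof (cases "\<alpha> s = \<beta> s")
  case True
  then show ?thesis by (simp add: slope_def L_nonneg)
next
  case False
  have "\<bar>V (\<alpha> s) s - V (\<beta> s) s\<bar> \<le> L s * \<bar>\<alpha> s - \<beta> s\<bar>"
    using assms by (intro V_lipschitz) (auto simp: solution_def)
  then show ?thesis using False by (simp add: slope_def abs_divide divide_le_eq)
qed

lemma slope_measurable:
  assumes "solution x \<alpha>" "solution y \<beta>"
  shows "slope \<alpha> \<beta> \<in> borel_measurable (lebesgue_on {0..1})"
proof -
  have m: "\<alpha> \<in> borel_measurable (lebesgue_on {0..1})" "\<beta> \<in> borel_measurable (lebesgue_on {0..1})"
    using assms by (auto intro!: continuous_imp_measurable_on_sets_lebesgue solution_continuous)
  have "(\<lambda>s. V (\<alpha> s) s) integrable_on {0..1}" "(\<lambda>s. V (\<beta> s) s) integrable_on {0..1}"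
    using assms set_lebesgue_integral_eq_integral(1) by (auto simp: solution_def)
  then have "(\<lambda>s. V (\<alpha> s) s) \<in> borel_measurable (lebesgue_on {0..1})" "(\<lambda>s. V (\<beta> s) s) \<in> borel_measurable (lebesgue_on {0..1})"
    by (auto intro: integrable_imp_measurable)
  with m show ?thesis unfolding slope_def[abs_def] by measurable
qed

lemma slope_integrable:
  assumes "solution x \<alpha>" "solution y \<beta>"
  shows "slope \<alpha> \<beta> absolutely_integrable_on {0..1}"
  by (rule absolutely_integrable_dominated[where C=1]) (use slope_measurable[OF assms] slope_le[OF assms] in auto)

text \<open>The difference of two solutions solves a linear equation with coefficient
  \<open>slope\<close>. The exponential formula yields uniqueness, the two-sided Lipschitz bounds
  and the differentiability of the flow in its starting point all at once.\<close>

lemma solution_difference: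
  assumes a: "solution x \<alpha>" and b: "solution y \<beta>" and t: "t \<in> {0..1}"
  shows "\<alpha> t - \<beta> t = (x - y) * exp (integral {0..t} (slope \<alpha> \<beta>))"
proof -
  have "\<alpha> t - \<beta> t = exp (integral {0..t} (slope \<alpha> \<beta>)) *
      ((x - y) + integral {0..t} (\<lambda>s. 0 * exp (- integral {0..s} (slope \<alpha> \<beta>))))"
  proof (rule linear_ODE[OF slope_integrable[OF a b] _ _ _ t, where c="\<lambda>_. 0" and U="\<lambda>t. \<alpha> t - \<beta> t"])
    show "(\<lambda>_. 0::real) absolutely_integrable_on {0..1}" by (simp add: set_integrable_def)
    show "continuous_on {0..1} (\<lambda>t. \<alpha> t - \<beta> t)"
      using a b by (intro continuous_intros solution_continuous)
    fix t :: real assume t: "t \<in> {0..1}"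
    have i: "(\<lambda>s. V (\<alpha> s) s) integrable_on {0..t}" "(\<lambda>s. V (\<beta> s) s) integrable_on {0..t}"
      using a b t absolutely_integrable_sub[of _ 0 t] set_lebesgue_integral_eq_integral(1) by (auto simp: solution_def)
    have "\<alpha> t - \<beta> t = x - y + integral {0..t} (\<lambda>s. V (\<alpha> s) s - V (\<beta> s) s)"
      using a b t i by (simp add: solution_def integral_diff)
    also have "(\<lambda>s. V (\<alpha> s) s - V (\<beta> s) s) = (\<lambda>s. slope \<alpha> \<beta> s * (\<alpha> s - \<beta> s) + 0)"
      by (auto simp: slope_def)
    finally show "\<alpha> t - \<beta> t = x - y + integral {0..t} (\<lambda>s. slope \<alpha> \<beta> s * (\<alpha> s - \<beta> s) + 0)" .
  qed
  then show ?thesis by (simp add: mult.commute)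
qed

lemma abs_integral_le_Lam:
  assumes "f absolutely_integrable_on {0..1}" "\<And>s. s \<in> {0..1} \<Longrightarrow> \<bar>f s\<bar> \<le> L s" "0 \<le> s" "s \<le> t" "t \<le> 1"
  shows "\<bar>integral {s..t} f\<bar> \<le> Lam t - Lam s"
proof -
  have "norm (integral {s..t} f) \<le> integral {s..t} L"
  proof (rule integral_norm_bound_integral)
    show "f integrable_on {s..t}"
      by (rule set_lebesgue_integral_eq_integral(1)[OF absolutely_integrable_sub[OF assms(1,3,5)]])
  qed (use assms L_integrable_on in auto)
  then show ?thesis using Lam_diff[of s t] assms by simp
qed

lemma exp_slope_bounds:
  assumes "solution x \<alpha>" "solution y \<beta>" "t \<in> {0..1}"
  shows "exp (- Lam 1) \<le> exp (integral {0..t} (slope \<alpha> \<beta>))" "exp (integral {0..t} (slope \<alpha> \<beta>)) \<le> exp (Lam 1)"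
proof -
  have "\<bar>integral {0..t} (slope \<alpha> \<beta>)\<bar> \<le> Lam t - Lam 0"
    using assms by (intro abs_integral_le_Lam slope_integrable slope_le) auto
  then show "exp (- Lam 1) \<le> exp (integral {0..t} (slope \<alpha> \<beta>))" "exp (integral {0..t} (slope \<alpha> \<beta>)) \<le> exp (Lam 1)"
    using Lam_bounds[OF assms(3)] by (auto simp: Lam_def)
qed

lemma zero_solution: "solution 0 (\<lambda>_. 0)" and one_solution: "solution 1 (\<lambda>_. 1)"
  by (auto simp: solution_def V_0 V_1 set_integrable_def)

end

locale flow = velocity +
  fixes \<Phi> :: "real \<Rightarrow> real \<Rightarrow> real"
  assumes \<Phi>_solution: "x \<in> {0..1} \<Longrightarrow> solution x (\<Phi> x)"
begin

lemma \<Phi>_range: "x \<in> {0..1} \<Longrightarrow> t \<in> {0..1} \<Longrightarrow> \<Phi> x t \<in> {0..1}"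
  by (rule solutionD(1)[OF \<Phi>_solution])

lemma \<Phi>_diff_t:
  assumes "x \<in> {0..1}" "0 \<le> s" "s \<le> t" "t \<le> 1"
  shows "\<Phi> x t - \<Phi> x s = integral {s..t} (\<lambda>r. V (\<Phi> x r) r)"
  using \<Phi>_solution[OF assms(1)] assms unfolding solution_def
  by (intro primitive_increment[of "\<lambda>r. V (\<Phi> x r) r" "\<Phi> x" x]) auto

lemma V\<Phi>_integrable: "x \<in> {0..1} \<Longrightarrow> (\<lambda>r. V (\<Phi> x r) r) absolutely_integrable_on {0..1}"
  using \<Phi>_solution by (auto simp: solution_def)

lemma \<Phi>_0: "x \<in> {0..1} \<Longrightarrow> \<Phi> x 0 = x"
  using solutionD(3)[OF \<Phi>_solution, of x 0] by simp

lemma \<Phi>_lipschitz_t: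
  assumes "x \<in> {0..1}" "s \<in> {0..1}" "t \<in> {0..1}"
  shows "\<bar>\<Phi> x t - \<Phi> x s\<bar> \<le> \<bar>Lam t - Lam s\<bar>"
proof -
  have *: "\<bar>\<Phi> x t - \<Phi> x s\<bar> \<le> Lam t - Lam s" if "0 \<le> s" "s \<le> t" "t \<le> 1" for s t
    unfolding \<Phi>_diff_t[OF assms(1) that]
    by (rule abs_integral_le_Lam) (use that assms V\<Phi>_integrable V_le \<Phi>_range in auto)
  show ?thesis
    using *[of s t] *[of t s] assms by (cases "s \<le> t") (auto simp: abs_minus_commute)
qed

lemma \<Phi>_difference:
  assumes "x \<in> {0..1}" "y \<in> {0..1}" "t \<in> {0..1}"
  shows "\<Phi> x t - \<Phi> y t = (x - y) * exp (integral {0..t} (slope (\<Phi> x) (\<Phi> y)))"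
  using assms by (intro solution_difference \<Phi>_solution)

lemma \<Phi>_lipschitz_x:
  assumes "x \<in> {0..1}" "y \<in> {0..1}" "t \<in> {0..1}"
  shows "\<bar>\<Phi> x t - \<Phi> y t\<bar> \<le> exp (Lam 1) * \<bar>x - y\<bar>" "\<bar>x - y\<bar> \<le> exp (Lam 1) * \<bar>\<Phi> x t - \<Phi> y t\<bar>"
proof -
  note e = exp_slope_bounds[OF \<Phi>_solution[OF assms(1)] \<Phi>_solution[OF assms(2)] assms(3)]
  have eq: "\<bar>\<Phi> x t - \<Phi> y t\<bar> = exp (integral {0..t} (slope (\<Phi> x) (\<Phi> y))) * \<bar>x - y\<bar>"
    by (simp add: \<Phi>_difference[OF assms] abs_mult mult.commute)
  show "\<bar>\<Phi> x t - \<Phi> y t\<bar> \<le> exp (Lam 1) * \<bar>x - y\<bar>" unfolding eq by (rule mult_right_mono[OF e(2)]) simp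
  have "exp (- Lam 1) * \<bar>x - y\<bar> \<le> \<bar>\<Phi> x t - \<Phi> y t\<bar>" unfolding eq by (rule mult_right_mono[OF e(1)]) simp
  then have "exp (Lam 1) * (exp (- Lam 1) * \<bar>x - y\<bar>) \<le> exp (Lam 1) * \<bar>\<Phi> x t - \<Phi> y t\<bar>"
    by (rule mult_left_mono) simp
  moreover have "exp (Lam 1) * (exp (- Lam 1) * \<bar>x - y\<bar>) = \<bar>x - y\<bar>" by (simp add: exp_minus)
  ultimately show "\<bar>x - y\<bar> \<le> exp (Lam 1) * \<bar>\<Phi> x t - \<Phi> y t\<bar>" by simp
qed

lemma \<Phi>_continuous_x: "t \<in> {0..1} \<Longrightarrow> continuous_on {0..1} (\<lambda>x. \<Phi> x t)"
  by (rule lipschitz_on_continuous_on[of "exp (Lam 1)"], rule lipschitz_onI)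
    (use \<Phi>_lipschitz_x(1) in \<open>auto simp: dist_real_def\<close>)

lemma \<Phi>_continuous: "continuous_on ({0..1} \<times> {0..1}) (\<lambda>p. \<Phi> (fst p) (snd p))"
  by (rule continuous_on_square_of_slices[OF Lam_continuous \<Phi>_lipschitz_t \<Phi>_continuous_x])

text \<open>The velocity vanishes at the end points, so the constant curves there are solutions, and
  solutions are unique.\<close>

lemma \<Phi>_boundary: "t \<in> {0..1} \<Longrightarrow> \<Phi> 0 t = 0" "t \<in> {0..1} \<Longrightarrow> \<Phi> 1 t = 1"
  using solution_difference[OF \<Phi>_solution zero_solution, of 0 t] solution_difference[OF \<Phi>_solution one_solution, of 1 t]
  by auto

definition E :: "real \<Rightarrow> real \<Rightarrow> real" where "E x t = exp (integral {0..t} (\<lambda>s. W (\<Phi> x s) s))"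

text \<open>Characteristics from distinct points never meet, the exponential factor being positive,
  so \<open>slope\<close> is a genuine difference quotient of \<open>V\<close> and converges to its
  derivative.\<close>

lemma slope_tendsto:
  assumes x: "x \<in> {0..1}" and X: "\<And>n. X n \<in> {0..1}" "\<And>n. X n \<noteq> x" "X \<longlonglongrightarrow> x" and s: "s \<in> {0..1}"
  shows "(\<lambda>n. slope (\<Phi> (X n)) (\<Phi> x) s) \<longlonglongrightarrow> W (\<Phi> x s) s"
  unfolding slope_def
proof (rule has_real_derivative_within_sequence[OF V_deriv])
  show "\<Phi> x s \<in> {0..1}" "\<Phi> (X n) s \<in> {0..1}" for n using x X s \<Phi>_range by auto
  show "\<Phi> (X n) s \<noteq> \<Phi> x s" for n
    using \<Phi>_difference[OF X(1) x s, of n] X(2)[of n] by auto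
  show "(\<lambda>n. \<Phi> (X n) s) \<longlonglongrightarrow> \<Phi> x s"
    by (rule continuous_on_tendsto_compose[OF \<Phi>_continuous_x[OF s] X(3) x]) (use X in auto)
qed

text \<open>Along a characteristic \<open>W\<close> is the pointwise limit of slopes towards
  neighbouring characteristics, which gives measurability; \<open>L\<close> dominates.\<close>

lemma W\<Phi>_integrable:
  assumes x: "x \<in> {0..1}"
  shows "(\<lambda>s. W (\<Phi> x s) s) absolutely_integrable_on {0..1}"
proof -
  define X where "X n = (if x < 1 then x + (1 - x) / real (Suc n) else 1 - 1 / real (Suc n))" for n
  have l0: "(\<lambda>k. 1 / real (Suc k)) \<longlonglongrightarrow> 0"
    using LIMSEQ_inverse_real_of_nat by (simp add: inverse_eq_divide)
  have "X \<longlonglongrightarrow> x"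
    unfolding X_def using tendsto_add[OF tendsto_const[of x] tendsto_mult_left[OF l0, of "1 - x"]]
      tendsto_diff[OF tendsto_const[of 1] l0] x by (cases "x < 1") (simp_all del: of_nat_Suc)
  moreover have "X n \<in> {0..1}" "X n \<noteq> x" for n
  proof -
    have "0 \<le> (1 - x) / real (Suc n)" using x by auto
    moreover have "(1 - x) / real (Suc n) \<le> (1 - x) / 1" using x by (intro divide_left_mono) auto
    ultimately show "X n \<in> {0..1}" using x by (auto simp: X_def)
    show "X n \<noteq> x" using x by (auto simp: X_def)
  qed
  ultimately have lim: "(\<lambda>n. slope (\<Phi> (X n)) (\<Phi> x) s) \<longlonglongrightarrow> W (\<Phi> x s) s" if "s \<in> {0..1}" for s
    using that by (intro slope_tendsto x)
  have meas: "slope (\<Phi> (X n)) (\<Phi> x) \<in> borel_measurable (lebesgue_on {0..1})" for n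
    by (rule slope_measurable[OF \<Phi>_solution \<Phi>_solution]) (use \<open>\<And>n. X n \<in> {0..1}\<close> x in auto)
  have "(\<lambda>s. W (\<Phi> x s) s) \<in> borel_measurable (lebesgue_on {0..1})"
  proof (rule borel_measurable_LIMSEQ_real[where u="\<lambda>n. slope (\<Phi> (X n)) (\<Phi> x)", OF _ meas])
    fix s assume "s \<in> space (lebesgue_on {0..1::real})"
    then show "(\<lambda>n. slope (\<Phi> (X n)) (\<Phi> x) s) \<longlonglongrightarrow> W (\<Phi> x s) s" by (intro lim) simp
  qed
  then show ?thesis
  proof (rule absolutely_integrable_dominated[where C=1])
    fix s :: real assume "s \<in> {0..1}"
    then show "\<bar>W (\<Phi> x s) s\<bar> \<le> 1 * L s" using W_le[OF \<Phi>_range[OF x]] by simp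
  qed
qed

text \<open>By the exponential formula the difference quotient of the flow is the exponential of an
  integrated slope, so differentiability reduces to dominated convergence with majorant
  \<open>L\<close>.\<close>

lemma \<Phi>_deriv:
  assumes x: "x \<in> {0..1}" and t: "t \<in> {0..1}"
  shows "((\<lambda>y. \<Phi> y t) has_real_derivative E x t) (at x within {0..1})"
proof (rule has_real_derivative_within_sequentially)
  fix X assume X: "\<And>n. X n \<in> {0..1}" "\<And>n. X n \<noteq> x" "X \<longlonglongrightarrow> x"
  have "(\<lambda>n. integral {0..t} (slope (\<Phi> (X n)) (\<Phi> x))) \<longlonglongrightarrow> integral {0..t} (\<lambda>s. W (\<Phi> x s) s)"
  proof (rule dominated_convergence(2)[where h=L])
    fix n
    show "slope (\<Phi> (X n)) (\<Phi> x) integrable_on {0..t}"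
      using absolutely_integrable_sub[OF slope_integrable[OF \<Phi>_solution[OF X(1)[of n]] \<Phi>_solution[OF x]], of 0 t] t
        set_lebesgue_integral_eq_integral(1) by auto
    show "norm (slope (\<Phi> (X n)) (\<Phi> x) s) \<le> L s" if "s \<in> {0..t}" for s
      using slope_le[OF \<Phi>_solution[OF X(1)[of n]] \<Phi>_solution[OF x], of s] that t by auto
  next
    show "L integrable_on {0..t}" using t by (intro L_integrable_on) auto
    show "(\<lambda>n. slope (\<Phi> (X n)) (\<Phi> x) s) \<longlonglongrightarrow> W (\<Phi> x s) s" if "s \<in> {0..t}" for s
      using that t by (intro slope_tendsto x X) auto
  qed
  then have "(\<lambda>n. exp (integral {0..t} (slope (\<Phi> (X n)) (\<Phi> x)))) \<longlonglongrightarrow> E x t"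
    unfolding E_def by (rule tendsto_exp)
  moreover have "exp (integral {0..t} (slope (\<Phi> (X n)) (\<Phi> x))) = (\<Phi> (X n) t - \<Phi> x t) / (X n - x)" for n
    using \<Phi>_difference[OF X(1)[of n] x t] X(2)[of n] by simp
  ultimately show "(\<lambda>n. (\<Phi> (X n) t - \<Phi> x t) / (X n - x)) \<longlonglongrightarrow> E x t" by simp
qed

lemma E_pos: "0 < E x t" by (simp add: E_def)

text \<open>In time the exponent varies by at most an increment of \<open>Lam\<close>, uniformly in
  x; in x the continuity is dominated convergence, \<open>W\<close> being continuous in its first
  variable.\<close>

lemma E_continuous: "continuous_on ({0..1} \<times> {0..1}) (\<lambda>p. E (fst p) (snd p))"
  unfolding E_def
proof (rule continuous_on_exp, rule continuous_on_square_of_slices[OF Lam_continuous])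
  fix x s t :: real assume st: "x \<in> {0..1}" "s \<in> {0..1}" "t \<in> {0..1}"
  let ?w = "\<lambda>s. W (\<Phi> x s) s"
  have *: "\<bar>integral {0..t} ?w - integral {0..s} ?w\<bar> \<le> Lam t - Lam s" if "0 \<le> s" "s \<le> t" "t \<le> 1" for s t
  proof -
    have "integral {0..t} ?w - integral {0..s} ?w = integral {s..t} ?w"
      by (rule primitive_increment[OF W\<Phi>_integrable[OF st(1)], of _ 0]) (use that in auto)
    then show ?thesis
      using abs_integral_le_Lam[OF W\<Phi>_integrable[OF st(1)], of s t] that W_le \<Phi>_range st by auto
  qed
  show "\<bar>integral {0..t} ?w - integral {0..s} ?w\<bar> \<le> \<bar>Lam t - Lam s\<bar>"
    using *[of s t] *[of t s] st by (cases "s \<le> t") (auto simp: abs_minus_commute)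
next
  fix t :: real assume t: "t \<in> {0..1}"
  show "continuous_on {0..1} (\<lambda>x. integral {0..t} (\<lambda>s. W (\<Phi> x s) s))"
    unfolding continuous_on_sequentially comp_def
  proof (intro allI ballI impI, elim conjE)
    fix X :: "nat \<Rightarrow> real" and x assume x: "x \<in> {0..1}" and X: "\<forall>n. X n \<in> {0..1}" "X \<longlonglongrightarrow> x"
    show "(\<lambda>n. integral {0..t} (\<lambda>s. W (\<Phi> (X n) s) s)) \<longlonglongrightarrow> integral {0..t} (\<lambda>s. W (\<Phi> x s) s)"
    proof (rule dominated_convergence(2)[where h=L])
      fix n
      show "(\<lambda>s. W (\<Phi> (X n) s) s) integrable_on {0..t}"
        using absolutely_integrable_sub[OF W\<Phi>_integrable, of "X n" 0 t] t X
          set_lebesgue_integral_eq_integral(1) by auto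
      show "norm (W (\<Phi> (X n) s) s) \<le> L s" if "s \<in> {0..t}" for s
        using W_le \<Phi>_range X that t by auto
    next
      show "L integrable_on {0..t}" using t by (intro L_integrable_on) auto
      show "(\<lambda>n. W (\<Phi> (X n) s) s) \<longlonglongrightarrow> W (\<Phi> x s) s" if "s \<in> {0..t}" for s
      proof (rule continuous_on_tendsto_compose[OF W_cont[of s]])
        show "(\<lambda>n. \<Phi> (X n) s) \<longlonglongrightarrow> \<Phi> x s"
          by (rule continuous_on_tendsto_compose[OF \<Phi>_continuous_x X(2) x]) (use X that t in auto)
      qed (use X x that t \<Phi>_range in auto)
    qed
  qed
qed

definition X :: "real \<Rightarrow> real \<Rightarrow> real"
  where "X y t = (SOME x. x \<in> {0..1} \<and> \<Phi> x t = y)"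

text \<open>The end points are fixed by the flow, so the intermediate value theorem makes every
  point of the interval a value of it.\<close>

lemma X: "y \<in> {0..1} \<Longrightarrow> t \<in> {0..1} \<Longrightarrow> X y t \<in> {0..1}" "y \<in> {0..1} \<Longrightarrow> t \<in> {0..1} \<Longrightarrow> \<Phi> (X y t) t = y"
proof -
  assume y: "y \<in> {0..1}" and t: "t \<in> {0..1}"
  have "\<exists>x. x \<in> {0..1} \<and> \<Phi> x t = y"
    using IVT'[of "\<lambda>x. \<Phi> x t" 0 y 1] \<Phi>_boundary[OF t] y \<Phi>_continuous_x[OF t] by auto
  then have "X y t \<in> {0..1} \<and> \<Phi> (X y t) t = y" unfolding X_def by (rule someI_ex)
  then show "X y t \<in> {0..1}" "\<Phi> (X y t) t = y" by auto
qed

lemma X_\<Phi>: "x \<in> {0..1} \<Longrightarrow> t \<in> {0..1} \<Longrightarrow> X (\<Phi> x t) t = x"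
proof -
  assume x: "x \<in> {0..1}" and t: "t \<in> {0..1}"
  note y = \<Phi>_range[OF x t]
  show ?thesis using \<Phi>_lipschitz_x(2)[OF X(1)[OF y t] x t] X(2)[OF y t] by simp
qed

lemma X_0: "y \<in> {0..1} \<Longrightarrow> X y 0 = y"
  using X_\<Phi>[of y 0] \<Phi>_0[of y] by simp

lemma X_lipschitz_y:
  assumes "x \<in> {0..1}" "y \<in> {0..1}" "t \<in> {0..1}"
  shows "\<bar>X x t - X y t\<bar> \<le> exp (Lam 1) * \<bar>x - y\<bar>"
  using \<Phi>_lipschitz_x(2)[OF X(1)[OF assms(1,3)] X(1)[OF assms(2,3)] assms(3)] X(2) assms by simp

text \<open>The two starting points are compared at time s: there one characteristic is at y, and
  the other has still to reach y at time t, so their distance is a displacement along a single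
  characteristic.\<close>

lemma X_lipschitz_t:
  assumes "y \<in> {0..1}" "s \<in> {0..1}" "t \<in> {0..1}"
  shows "\<bar>X y t - X y s\<bar> \<le> exp (Lam 1) * \<bar>Lam t - Lam s\<bar>"
proof -
  have "\<bar>X y t - X y s\<bar> \<le> exp (Lam 1) * \<bar>\<Phi> (X y t) s - \<Phi> (X y s) s\<bar>"
    using assms by (intro \<Phi>_lipschitz_x X)
  also have "\<Phi> (X y t) s - \<Phi> (X y s) s = \<Phi> (X y t) s - \<Phi> (X y t) t" using X(2) assms by simp
  also have "exp (Lam 1) * \<bar>\<Phi> (X y t) s - \<Phi> (X y t) t\<bar> \<le> exp (Lam 1) * \<bar>Lam s - Lam t\<bar>"
    using assms by (intro mult_left_mono \<Phi>_lipschitz_t X) auto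
  finally show ?thesis by (simp add: abs_minus_commute)
qed

lemma X_continuous_y: "t \<in> {0..1} \<Longrightarrow> continuous_on {0..1} (\<lambda>y. X y t)"
  by (rule lipschitz_on_continuous_on[of "exp (Lam 1)"], rule lipschitz_onI)
    (use X_lipschitz_y in \<open>auto simp: dist_real_def\<close>)

lemma X_continuous: "continuous_on ({0..1} \<times> {0..1}) (\<lambda>p. X (fst p) (snd p))"
proof (rule continuous_on_square_of_slices[of "\<lambda>t. exp (Lam 1) * Lam t"])
  show "continuous_on {0..1} (\<lambda>t. exp (Lam 1) * Lam t)" by (intro continuous_intros Lam_continuous)
  show "\<bar>X x t - X x s\<bar> \<le> \<bar>exp (Lam 1) * Lam t - exp (Lam 1) * Lam s\<bar>" if "x \<in> {0..1}" "s \<in> {0..1}" "t \<in> {0..1}" for x s t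
    using X_lipschitz_t[OF that] by (simp add: right_diff_distrib[symmetric] abs_mult)
qed (rule X_continuous_y)

text \<open>The spatial derivative of the inverse flow, by the inverse function rule; see
  \<open>X_deriv\<close>.\<close>

definition K :: "real \<Rightarrow> real \<Rightarrow> real" where "K y t = 1 / E (X y t) t"

lemma K_continuous: "continuous_on ({0..1} \<times> {0..1}) (\<lambda>p. K (fst p) (snd p))"
proof -
  have "continuous_on ({0..1} \<times> {0..1}) (\<lambda>p. (X (fst p) (snd p), snd p))"
    by (intro continuous_intros X_continuous)
  moreover have "(\<lambda>p. (X (fst p) (snd p), snd p)) ` ({0..1} \<times> {0..1}) \<subseteq> {0..1} \<times> {0..1}"
    using X(1) by (force simp: mem_Times_iff)
  ultimately have "continuous_on ({0..1} \<times> {0..1}) (\<lambda>p. E (X (fst p) (snd p)) (snd p))"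
    using continuous_on_compose2[OF E_continuous] by fastforce
  then show ?thesis unfolding K_def using E_pos by (intro continuous_intros) (auto simp: less_imp_neq[symmetric])
qed

lemma X_deriv:
  assumes y: "y \<in> {0..1}" and t: "t \<in> {0..1}"
  shows "((\<lambda>y. X y t) has_real_derivative K y t) (at y within {0..1})"
proof (rule has_real_derivative_within_sequentially)
  fix Y assume Y: "\<And>n. Y n \<in> {0..1}" "\<And>n. Y n \<noteq> y" "Y \<longlonglongrightarrow> y"
  have ne: "X (Y n) t \<noteq> X y t" for n using X(2)[OF Y(1) t, of n] X(2)[OF y t] Y(2)[of n] by metis
  have "(\<lambda>n. (\<Phi> (X (Y n) t) t - \<Phi> (X y t) t) / (X (Y n) t - X y t)) \<longlonglongrightarrow> E (X y t) t"
  proof (rule has_real_derivative_within_sequence[OF \<Phi>_deriv[OF X(1)[OF y t] t] X(1)[OF Y(1) t] ne])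
    show "(\<lambda>n. X (Y n) t) \<longlonglongrightarrow> X y t"
      by (rule continuous_on_tendsto_compose[OF X_continuous_y[OF t] Y(3) y]) (use Y in auto)
  qed
  then have "(\<lambda>n. (Y n - y) / (X (Y n) t - X y t)) \<longlonglongrightarrow> E (X y t) t"
    using X(2)[OF Y(1) t] X(2)[OF y t] by simp
  then have "(\<lambda>n. inverse ((Y n - y) / (X (Y n) t - X y t))) \<longlonglongrightarrow> inverse (E (X y t) t)"
    by (rule tendsto_inverse) (use E_pos[of "X y t" t] in simp)
  then show "(\<lambda>n. (X (Y n) t - X y t) / (Y n - y)) \<longlonglongrightarrow> K y t" by (simp add: K_def inverse_eq_divide)
qed

end

lemma MVT_within_unit_interval:
  fixes f :: "real \<Rightarrow> real"
  assumes "\<And>x. x \<in> {0..1} \<Longrightarrow> (f has_real_derivative f' x) (at x within {0..1})" "a \<in> {0..1}" "b \<in> {0..1}"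
  obtains \<xi> where "\<xi> \<in> {0..1}" "\<bar>\<xi> - a\<bar> \<le> \<bar>b - a\<bar>" "\<bar>\<xi> - b\<bar> \<le> \<bar>b - a\<bar>" "f b - f a = f' \<xi> * (b - a)"
proof -
  have *: "\<exists>\<xi>\<in>{c..d}. f d - f c = f' \<xi> * (d - c)" if "0 \<le> c" "c \<le> d" "d \<le> 1" for c d
  proof (rule mvt_very_simple[OF that(2)])
    fix x assume "c \<le> x" "x \<le> d"
    then have "(f has_real_derivative f' x) (at x within {c..d})"
      using that by (intro DERIV_subset[OF assms(1)]) auto
    then show "(f has_derivative (*) (f' x)) (at x within {c..d})" by (simp add: has_field_derivative_def)
  qed
  show thesis
  proof (cases "a \<le> b")
    case True
    then obtain \<xi> where "\<xi> \<in> {a..b}" "f b - f a = f' \<xi> * (b - a)" using *[of a b] assms by auto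
    then show ?thesis using assms by (intro that[of \<xi>]) auto
  next
    case False
    then obtain \<xi> where "\<xi> \<in> {b..a}" "f a - f b = f' \<xi> * (a - b)" using *[of b a] assms by auto
    then show ?thesis using assms by (intro that[of \<xi>]) (auto simp: algebra_simps)
  qed
qed

lemma continuous_square_slice:
  fixes G :: "real \<Rightarrow> real \<Rightarrow> real"
  assumes "continuous_on ({0..1} \<times> {0..1}) (\<lambda>p. G (fst p) (snd p))"
  shows "x \<in> {0..1} \<Longrightarrow> continuous_on {0..1} (\<lambda>t. G x t)"
    and "t \<in> {0..1} \<Longrightarrow> continuous_on {0..1} (\<lambda>x. G x t)"
proof -
  show "continuous_on {0..1} (\<lambda>t. G x t)" if "x \<in> {0..1}"
  proof -
    have "continuous_on {0..1::real} (\<lambda>t. (x, t))" "(\<lambda>t. (x, t)) ` {0..1} \<subseteq> {0..1} \<times> {0..1}"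
      using that by (auto intro!: continuous_intros simp del: atLeastAtMost_iff)
    from continuous_on_compose2[OF assms this] show ?thesis by simp
  qed
  show "continuous_on {0..1} (\<lambda>x. G x t)" if "t \<in> {0..1}"
  proof -
    have "continuous_on {0..1::real} (\<lambda>x. (x, t))" "(\<lambda>x. (x, t)) ` {0..1} \<subseteq> {0..1} \<times> {0..1}"
      using that by (auto intro!: continuous_intros simp del: atLeastAtMost_iff)
    from continuous_on_compose2[OF assms this] show ?thesis by simp
  qed
qed

context flow
begin

lemma K_bounds:
  assumes "y \<in> {0..1}" "t \<in> {0..1}"
  shows "0 < K y t" "K y t \<le> exp (Lam 1)"
proof -
  show "0 < K y t" using E_pos by (simp add: K_def)
  have x: "X y t \<in> {0..1}" by (rule X(1)[OF assms])
  have "\<bar>integral {0..t} (\<lambda>s. W (\<Phi> (X y t) s) s)\<bar> \<le> Lam t - Lam 0"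
    using assms(2) x by (intro abs_integral_le_Lam W\<Phi>_integrable) (auto intro!: W_le \<Phi>_range)
  then have "- integral {0..t} (\<lambda>s. W (\<Phi> (X y t) s) s) \<le> Lam 1"
  proof -
    have "Lam 0 = 0" by (simp add: Lam_def)
    then show ?thesis using Lam_bounds[OF assms(2)] \<open>\<bar>_\<bar> \<le> Lam t - Lam 0\<close> by linarith
  qed
  moreover have "K y t = exp (- integral {0..t} (\<lambda>s. W (\<Phi> (X y t) s) s))"
    by (simp add: K_def E_def exp_minus inverse_eq_divide)
  ultimately show "K y t \<le> exp (Lam 1)" by simp
qed

lemma V_measurable_lebesgue: "(\<lambda>s. V y s) \<in> borel_measurable (lebesgue_on {0..1})"
  using Qmeas_slice(2)[OF V_meas, of y] by (simp add: measurable_completion measurable_restrict_space1)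

lemma VK_integrable: "y \<in> {0..1} \<Longrightarrow> (\<lambda>s. - (V y s * K y s)) absolutely_integrable_on {0..1}"
proof -
  assume y: "y \<in> {0..1}"
  have "(\<lambda>s. - V y s) absolutely_integrable_on {0..1}"
    by (rule absolutely_integrable_dominated[where C=1]) (use V_measurable_lebesgue V_le y in auto)
  from absolutely_integrable_mult_continuous[OF this continuous_square_slice(1)[OF K_continuous y]]
  show ?thesis by simp
qed

text \<open>Integrated form of X_t + v X_y = 0. The inverse flow is constant along characteristics,
  so its increment in time at fixed y is an increment in space at the earlier time, between y and
  the position from which a characteristic reaches y. The mean value theorem turns this into a value
  of \<open>K\<close> times a displacement.\<close>

lemma X_time:
  assumes y: "y \<in> {0..1}" and t: "t \<in> {0..1}"
  shows "X y t = y + integral {0..t} (\<lambda>s. - (V y s * K y s))"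
proof -
  define D where "D t = X y t - integral {0..t} (\<lambda>s. - (V y s * K y s))" for t
  define M where "M = exp (Lam 1)"
  have M: "M > 0" by (simp add: M_def)
  have "D t = D 0"
  proof (rule const_of_small_increments[OF L_integrable_on _ _ t])
    fix e :: real assume e: "e > 0"
    have uK: "uniformly_continuous_on ({0..1} \<times> {0..1}) (\<lambda>p. K (fst p) (snd p))"
      by (intro compact_uniformly_continuous K_continuous compact_Times compact_Icc)
    have e2: "e / 2 > 0" using e by simp
    obtain \<delta> where \<delta>: "\<delta> > 0" "\<And>p q. p \<in> {0..1} \<times> {0..1} \<Longrightarrow> q \<in> {0..1} \<times> {0..1} \<Longrightarrow> dist q p < \<delta> \<Longrightarrow>
        dist (K (fst q) (snd q)) (K (fst p) (snd p)) < e / 2"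
      by (rule uniformly_continuous_onE[OF uK e2]) blast
    \<comment> \<open>Half of e pays for freezing \<open>K\<close>, whose two arguments each move by
      less than \<open>\<delta> / 2\<close>; the other half pays for replacing the velocity on the
      characteristic by the velocity at y, with \<open>M\<close> bounding \<open>K\<close>.\<close>
    have m: "min (\<delta> / 2) (e / (2 * M)) > 0" using \<delta> e M by simp
    obtain d1 where d1: "d1 > 0" "\<And>s t. s \<in> {0..1} \<Longrightarrow> t \<in> {0..1} \<Longrightarrow> dist t s < d1 \<Longrightarrow> dist (Lam t) (Lam s) < min (\<delta> / 2) (e / (2 * M))"
      by (rule uniformly_continuous_onE[OF compact_uniformly_continuous[OF Lam_continuous compact_Icc] m]) blast
    show "\<exists>d>0. \<forall>s t. 0 \<le> s \<and> s \<le> t \<and> t \<le> 1 \<and> t - s < d \<longrightarrow> \<bar>D t - D s\<bar> \<le> e * integral {s..t} L"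
    proof (intro exI[of _ "min d1 (\<delta> / 2)"] conjI allI impI)
      fix s t assume st: "0 \<le> s \<and> s \<le> t \<and> t \<le> 1 \<and> t - s < min d1 (\<delta> / 2)"
      then have s: "s \<in> {0..1}" and t: "t \<in> {0..1}" by auto
      have "dist t s < d1" using st by (auto simp: dist_real_def)
      from d1(2)[OF s t this] have "\<bar>Lam t - Lam s\<bar> < min (\<delta> / 2) (e / (2 * M))" by (simp add: dist_real_def)
      then have lam: "Lam t - Lam s < \<delta> / 2" "(Lam t - Lam s) * M \<le> e / 2" "0 \<le> Lam t - Lam s"
        using Lam_mono[of s t] st M by (auto simp: field_simps)
      \<comment> \<open>The characteristic through (y, t) starts at \<open>x'\<close> and passes
        through \<open>Y\<close> at time s.\<close>
      define x' where "x' = X y t"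
      define Y where "Y = \<Phi> x' s"
      have x': "x' \<in> {0..1}" "\<Phi> x' t = y" unfolding x'_def using X y t by auto
      have Y: "Y \<in> {0..1}" "X Y s = x'" unfolding Y_def using X_\<Phi> \<Phi>_range x' s by auto
      have close: "\<bar>\<Phi> x' r - y\<bar> \<le> Lam t - Lam s" if "r \<in> {s..t}" for r
      proof -
        have "\<bar>\<Phi> x' t - \<Phi> x' r\<bar> \<le> \<bar>Lam t - Lam r\<bar>" using that st x' by (intro \<Phi>_lipschitz_t) auto
        also have "\<dots> \<le> Lam t - Lam s" using Lam_mono[of s r] Lam_mono[of r t] that st by auto
        finally show ?thesis using x'(2) by (simp add: abs_minus_commute)
      qed
      obtain \<xi> where \<xi>: "\<xi> \<in> {0..1}" "\<bar>\<xi> - y\<bar> \<le> \<bar>Y - y\<bar>" "X Y s - X y s = K \<xi> s * (Y - y)"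
        by (rule MVT_within_unit_interval[OF X_deriv[OF _ s] y Y(1)]) blast
      have "Y - y = - integral {s..t} (\<lambda>r. V (\<Phi> x' r) r)"
        using \<Phi>_diff_t[OF x'(1), of s t] st x'(2) by (simp add: Y_def)
      then have "X y t - X y s = - (K \<xi> s * integral {s..t} (\<lambda>r. V (\<Phi> x' r) r))"
        using \<xi>(3) Y(2) by (simp add: x'_def)
      also have "\<dots> = integral {s..t} (\<lambda>r. - (K \<xi> s * V (\<Phi> x' r) r))" by simp
      finally have "D t - D s = integral {s..t} (\<lambda>r. - (K \<xi> s * V (\<Phi> x' r) r)) - integral {s..t} (\<lambda>s. - (V y s * K y s))"
        using primitive_increment[OF VK_integrable[OF y], of "\<lambda>t. integral {0..t} (\<lambda>s. - (V y s * K y s))" 0 s t] st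
        by (simp add: D_def)
      also have "\<bar>\<dots>\<bar> \<le> e * integral {s..t} L"
      proof (rule integral_diff_le)
        have "(\<lambda>r. V (\<Phi> x' r) r) integrable_on {s..t}"
          using set_lebesgue_integral_eq_integral(1)[OF absolutely_integrable_sub[OF V\<Phi>_integrable[OF x'(1)], of s t]] st by simp
        then show "(\<lambda>r. - (K \<xi> s * V (\<Phi> x' r) r)) integrable_on {s..t}"
          by (intro integrable_neg integrable_on_mult_right)
        show "(\<lambda>s. - (V y s * K y s)) integrable_on {s..t}"
          using set_lebesgue_integral_eq_integral(1)[OF absolutely_integrable_sub[OF VK_integrable[OF y], of s t]] st by simp
        show "L integrable_on {s..t}" using st by (intro L_integrable_on) auto
        fix r assume r: "r \<in> {s..t}"
        then have r1: "r \<in> {0..1}" using st by auto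
        have "dist (\<xi>, s) (y, r) \<le> \<bar>\<xi> - y\<bar> + \<bar>s - r\<bar>"
          using dist_Pair_Pair[of \<xi> s y r] sqrt_sum_squares_le_sum_abs[of "dist \<xi> y" "dist s r"] by (simp add: dist_real_def)
        also have "\<dots> < \<delta>" using close[of s] \<xi>(2) lam r st by (auto simp: Y_def)
        finally have "dist (K \<xi> s) (K y r) < e / 2" using \<delta>(2)[of "(y, r)" "(\<xi>, s)"] \<xi>(1) y s r1 by simp
        then have k: "\<bar>K \<xi> s - K y r\<bar> \<le> e / 2" by (simp add: dist_real_def)
        have "\<bar>V (\<Phi> x' r) r - V y r\<bar> \<le> L r * \<bar>\<Phi> x' r - y\<bar>"
          by (intro V_lipschitz \<Phi>_range x' r1 y)
        also have "\<dots> \<le> L r * (Lam t - Lam s)" using close[OF r] L_nonneg by (intro mult_left_mono) auto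
        finally have "\<bar>K \<xi> s\<bar> * \<bar>V (\<Phi> x' r) r - V y r\<bar> \<le> M * (L r * (Lam t - Lam s))"
          using K_bounds[OF \<xi>(1) s] M by (intro mult_mono) (auto simp: M_def)
        also have "\<dots> = L r * ((Lam t - Lam s) * M)" by (simp add: mult_ac)
        also have "\<dots> \<le> L r * (e / 2)" using lam L_nonneg by (intro mult_left_mono) auto
        finally have 1: "\<bar>K \<xi> s * (V (\<Phi> x' r) r - V y r)\<bar> \<le> L r * (e / 2)" by (simp add: abs_mult)
        have "\<bar>V y r\<bar> * \<bar>K \<xi> s - K y r\<bar> \<le> L r * (e / 2)" using V_le[OF y] k L_nonneg by (intro mult_mono) auto
        then have 2: "\<bar>V y r * (K \<xi> s - K y r)\<bar> \<le> L r * (e / 2)" by (simp add: abs_mult)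
        have "- (K \<xi> s * V (\<Phi> x' r) r) - - (V y r * K y r) = - (K \<xi> s * (V (\<Phi> x' r) r - V y r)) - V y r * (K \<xi> s - K y r)"
          by (simp add: algebra_simps)
        moreover have "e * L r = L r * (e / 2) + L r * (e / 2)" by simp
        ultimately show "\<bar>- (K \<xi> s * V (\<Phi> x' r) r) - - (V y r * K y r)\<bar> \<le> e * L r" using 1 2 by linarith
      qed
      finally show "\<bar>D t - D s\<bar> \<le> e * integral {s..t} L" .
    qed (use d1 \<delta> in auto)
  qed (use L_nonneg in auto)
  then show ?thesis using X_0[OF y] by (simp add: D_def)
qed

end

subsection \<open>Approximation by Bernstein polynomials\<close>

text \<open>The derivative is a difference of neighbouring basis functions of one degree less. For k
  = 0 the lower neighbour is absent, whereas the truncated \<open>k - 1\<close> would name an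
  existing one.\<close>

lemma DERIV_Bernstein:
  "(Bernstein (Suc m) k has_real_derivative
      real (Suc m) * ((if k = 0 then 0 else Bernstein m (k - 1) x) - Bernstein m k x)) (at x)"
proof (cases k)
  case 0
  have "((\<lambda>x. (1 - x) ^ Suc m) has_real_derivative real (Suc m) * (1 - x) ^ m * (- 1)) (at x)"
    by (rule DERIV_chain2[OF DERIV_power_Suc]) (auto intro!: derivative_eq_intros)
  then show ?thesis by (simp add: Bernstein_def[abs_def] 0 del: power_Suc)
next
  case (Suc i)
  \<comment> \<open>Two absorption identities bring both terms of the product rule to the common
    factor m + 1.\<close>
  have a: "real (Suc i) * real (Suc m choose Suc i) = real (Suc m) * real (m choose i)"
    by (simp only: of_nat_mult[symmetric] Suc_times_binomial)
  have b: "real (m - i) * real (Suc m choose Suc i) = real (Suc m) * real (m choose Suc i)"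
    using binomial_absorb_comp[of "Suc m" "Suc i"] by (simp only: of_nat_mult[symmetric] diff_Suc_Suc diff_Suc_1)
  have dp: "((\<lambda>x. (1 - x) ^ (m - i)) has_real_derivative - (real (m - i) * (1 - x) ^ (m - Suc i))) (at x)"
    by (rule DERIV_cong, rule DERIV_chain2[OF DERIV_pow]) (auto intro!: derivative_eq_intros)
  have "((\<lambda>x. real (Suc m choose Suc i) * (x ^ Suc i * (1 - x) ^ (m - i))) has_real_derivative
      real (Suc m choose Suc i) * (real (Suc i) * x ^ i * (1 - x) ^ (m - i) + - (real (m - i) * (1 - x) ^ (m - Suc i)) * x ^ Suc i)) (at x)"
    by (intro DERIV_cmult DERIV_mult DERIV_power_Suc dp)
  also have "real (Suc m choose Suc i) * (real (Suc i) * x ^ i * (1 - x) ^ (m - i) + - (real (m - i) * (1 - x) ^ (m - Suc i)) * x ^ Suc i)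
      = (real (Suc i) * real (Suc m choose Suc i)) * (x ^ i * (1 - x) ^ (m - i))
        - (real (m - i) * real (Suc m choose Suc i)) * (x ^ Suc i * (1 - x) ^ (m - Suc i))"
    by (simp add: algebra_simps del: power_Suc of_nat_Suc binomial_Suc_Suc)
  also have "\<dots> = real (Suc m) * (Bernstein m i x - Bernstein m (Suc i) x)"
    unfolding a b Bernstein_def by (simp add: algebra_simps del: power_Suc of_nat_Suc)
  finally show ?thesis by (simp add: Suc Bernstein_def[abs_def] mult.assoc del: power_Suc binomial_Suc_Suc of_nat_Suc)
qed

definition bsum :: "nat \<Rightarrow> (real \<Rightarrow> real) \<Rightarrow> real poly"
  where "bsum n f = (\<Sum>k\<le>n. smult (f (k / n)) (bern n k))"

lemma poly_bsum: "poly (bsum n f) x = (\<Sum>k\<le>n. f (k / n) * Bernstein n k x)"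
  by (simp add: bsum_def poly_sum poly_bern)

text \<open>The weights are nonnegative and sum to 1, so the sum is an average of its coefficients.
  Bounds on samples thus pass to the approximants and to their derivatives.\<close>

lemma Bernstein_sum_le:
  assumes "x \<in> {0..1}" "\<And>k. k \<le> n \<Longrightarrow> \<bar>c k\<bar> \<le> C"
  shows "\<bar>\<Sum>k\<le>n. c k * Bernstein n k x\<bar> \<le> C"
proof -
  have "\<bar>\<Sum>k\<le>n. c k * Bernstein n k x\<bar> \<le> (\<Sum>k\<le>n. \<bar>c k * Bernstein n k x\<bar>)" by (rule sum_abs)
  also have "\<dots> \<le> (\<Sum>k\<le>n. C * Bernstein n k x)"
    using assms Bernstein_nonneg[of x n] by (intro sum_mono) (auto simp: abs_mult intro!: mult_right_mono)
  also have "\<dots> = C" by (simp add: sum_distrib_left[symmetric])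
  finally show ?thesis .
qed

lemma unit_fraction: "k \<le> n \<Longrightarrow> real k / real n \<in> {0..1}"
  by (cases "n = 0") auto

lemma bsum_bound:
  assumes "x \<in> {0..1}" "\<And>y. y \<in> {0..1} \<Longrightarrow> \<bar>f y\<bar> \<le> C"
  shows "\<bar>poly (bsum n f) x\<bar> \<le> C"
  unfolding poly_bsum by (rule Bernstein_sum_le[OF assms(1)]) (use assms(2) unit_fraction in blast)

lemma bsum_tendsto:
  assumes "continuous_on {0..1} f" "x \<in> {0..1}"
  shows "(\<lambda>m. poly (bsum (Suc m) f) x) \<longlonglongrightarrow> f x"
proof (rule LIMSEQ_I)
  fix e :: real assume "e > 0"
  then obtain N where "\<And>n x. N \<le> n \<Longrightarrow> x \<in> {0..1} \<Longrightarrow> \<bar>f x - (\<Sum>k\<le>n. f (k / n) * Bernstein n k x)\<bar> < e"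
    using Bernstein_Weierstrass[OF assms(1)] by metis
  then have "\<forall>m\<ge>N. norm (poly (bsum (Suc m) f) x - f x) < e"
    using assms(2) unfolding poly_bsum real_norm_def by (metis abs_minus_commute le_SucI)
  then show "\<exists>N. \<forall>m\<ge>N. norm (poly (bsum (Suc m) f) x - f x) < e" by blast
qed

text \<open>Summation by parts: the coefficients become forward differences of samples, scaled by
  the degree, which drops by one.\<close>

lemma pderiv_bsum:
  "poly (pderiv (bsum (Suc m) f)) x = (\<Sum>k\<le>m. (real (Suc m) * (f (Suc k / Suc m) - f (k / Suc m))) * Bernstein m k x)"
proof -
  let ?n = "Suc m"
  have "((\<lambda>x. \<Sum>k\<le>?n. f (k / ?n) * Bernstein ?n k x) has_real_derivative
      (\<Sum>k\<le>?n. f (k / ?n) * (real ?n * ((if k = 0 then 0 else Bernstein m (k - 1) x) - Bernstein m k x)))) (at x)"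
    by (intro DERIV_sum DERIV_cmult DERIV_Bernstein)
  then have "(poly (bsum ?n f) has_real_derivative
      (\<Sum>k\<le>?n. f (k / ?n) * (real ?n * ((if k = 0 then 0 else Bernstein m (k - 1) x) - Bernstein m k x)))) (at x)"
    by (simp only: poly_bsum[abs_def, symmetric])
  from DERIV_unique[OF poly_DERIV this]
  have "poly (pderiv (bsum ?n f)) x = (\<Sum>k\<le>?n. f (k / ?n) * (real ?n * ((if k = 0 then 0 else Bernstein m (k - 1) x) - Bernstein m k x)))" .
  also have "\<dots> = (\<Sum>k\<le>?n. real ?n * f (k / ?n) * (if k = 0 then 0 else Bernstein m (k - 1) x)) - (\<Sum>k\<le>?n. real ?n * f (k / ?n) * Bernstein m k x)"
    by (simp only: sum_subtractf[symmetric] right_diff_distrib mult_ac)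
  also have "(\<Sum>k\<le>?n. real ?n * f (k / ?n) * (if k = 0 then 0 else Bernstein m (k - 1) x)) = (\<Sum>k\<le>m. real ?n * f (Suc k / ?n) * Bernstein m k x)"
    by (subst sum.atMost_Suc_shift) simp
  \<comment> \<open>The top term vanishes because the binomial coefficient m over m + 1 is
    0.\<close>
  also have "(\<Sum>k\<le>?n. real ?n * f (k / ?n) * Bernstein m k x) = (\<Sum>k\<le>m. real ?n * f (k / ?n) * Bernstein m k x)"
    by (subst sum.atMost_Suc) (simp add: Bernstein_def)
  finally show ?thesis by (simp only: sum_subtractf[symmetric] right_diff_distrib left_diff_distrib)
qed

text \<open>By the mean value theorem a scaled forward difference is a value of \<open>f'\<close>.
  The sample point k/m of degree m lies between k/(m+1) and (k+1)/(m+1), hence close to the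
  intermediate point. For m = 0 there is a single coefficient and nothing to compare.\<close>

lemma bsum_increment:
  assumes f: "\<And>x. x \<in> {0..1} \<Longrightarrow> (f has_real_derivative f' x) (at x within {0..1})" and k: "k \<le> m"
  obtains \<xi> where "\<xi> \<in> {0..1}" "\<bar>\<xi> - k / m\<bar> \<le> 1 / Suc m \<or> m = 0" "real (Suc m) * (f (Suc k / Suc m) - f (k / Suc m)) = f' \<xi>"
proof -
  have a: "real k / Suc m \<in> {0..1}" "real (Suc k) / Suc m \<in> {0..1}" using k by (auto simp: divide_le_eq_1)
  have d: "real (Suc k) / Suc m - real k / Suc m = 1 / Suc m" by (simp add: field_simps)
  obtain \<xi> where \<xi>: "\<xi> \<in> {0..1}" "\<bar>\<xi> - k / Suc m\<bar> \<le> \<bar>real (Suc k) / Suc m - real k / Suc m\<bar>"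
      "\<bar>\<xi> - real (Suc k) / Suc m\<bar> \<le> \<bar>real (Suc k) / Suc m - real k / Suc m\<bar>"
      "f (Suc k / Suc m) - f (k / Suc m) = f' \<xi> * (real (Suc k) / Suc m - real k / Suc m)"
    by (rule MVT_within_unit_interval[OF f a]) blast
  have "\<bar>\<xi> - k / m\<bar> \<le> 1 / Suc m" if "m \<noteq> 0"
  proof -
    have "real k / Suc m \<le> k / m" using that by (intro divide_left_mono) auto
    moreover have "real k / m \<le> Suc k / Suc m" using k that by (simp add: field_simps)
    moreover have "\<bar>x - c\<bar> \<le> h" if "\<bar>x - a\<bar> \<le> \<bar>h\<bar>" "\<bar>x - b\<bar> \<le> \<bar>h\<bar>" "b - a = h" "0 \<le> h" "a \<le> c" "c \<le> b" for x a b c h :: real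
      using that by linarith
    ultimately show ?thesis using \<xi>(2,3) d unfolding d by simp
  qed
  then show thesis using \<xi>(1,4) unfolding d by (intro that[of \<xi>]) auto
qed

lemma pderiv_bsum_bound:
  assumes f: "\<And>x. x \<in> {0..1} \<Longrightarrow> (f has_real_derivative f' x) (at x within {0..1})"
    and C: "\<And>x. x \<in> {0..1} \<Longrightarrow> \<bar>f' x\<bar> \<le> C" and x: "x \<in> {0..1}"
  shows "\<bar>poly (pderiv (bsum (Suc m) f)) x\<bar> \<le> C"
  unfolding pderiv_bsum
proof (rule Bernstein_sum_le[OF x])
  fix k assume k: "k \<le> m"
  show "\<bar>real (Suc m) * (f (real (Suc k) / real (Suc m)) - f (real k / real (Suc m)))\<bar> \<le> C"
    by (rule bsum_increment[OF f k]) (use C in auto)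
qed

text \<open>The derivative of the approximant is compared with the approximant of \<open>f'\<close>
  of one degree less: coefficients are values of \<open>f'\<close> at nearby points, and uniform
  continuity makes the difference small. The index is shifted so that this degree is
  positive.\<close>

lemma pderiv_bsum_tendsto:
  assumes f: "\<And>x. x \<in> {0..1} \<Longrightarrow> (f has_real_derivative f' x) (at x within {0..1})"
    and c: "continuous_on {0..1} f'" and x: "x \<in> {0..1}"
  shows "(\<lambda>m. poly (pderiv (bsum (Suc m) f)) x) \<longlonglongrightarrow> f' x"
proof -
  have "(\<lambda>m. poly (pderiv (bsum (Suc (Suc m)) f)) x - poly (bsum (Suc m) f') x) \<longlonglongrightarrow> 0"
  proof (rule LIMSEQ_I)
    fix e :: real assume e: "e > 0"
    then have e2: "e / 2 > 0" by simp
    obtain d where d: "d > 0" "\<And>x y. x \<in> {0..1} \<Longrightarrow> y \<in> {0..1} \<Longrightarrow> dist y x < d \<Longrightarrow> dist (f' y) (f' x) < e / 2"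
      by (rule uniformly_continuous_onE[OF compact_uniformly_continuous[OF c compact_Icc] e2]) blast
    obtain N :: nat where N: "1 / Suc N < d" using nat_approx_posE[OF d(1)] by auto
    have "norm (poly (pderiv (bsum (Suc (Suc m)) f)) x - poly (bsum (Suc m) f') x - 0) < e" if m: "m \<ge> N" for m
    proof -
      have "poly (pderiv (bsum (Suc (Suc m)) f)) x - poly (bsum (Suc m) f') x =
          (\<Sum>k\<le>Suc m. (real (Suc (Suc m)) * (f (Suc k / Suc (Suc m)) - f (k / Suc (Suc m))) - f' (k / Suc m)) * Bernstein (Suc m) k x)"
        unfolding pderiv_bsum poly_bsum by (simp only: sum_subtractf[symmetric] left_diff_distrib)
      also have "\<bar>\<dots>\<bar> \<le> e / 2"
      proof (rule Bernstein_sum_le[OF x])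
        fix k assume k: "k \<le> Suc m"
        obtain \<xi> where \<xi>: "\<xi> \<in> {0..1}" "\<bar>\<xi> - k / Suc m\<bar> \<le> 1 / Suc (Suc m) \<or> Suc m = 0"
          "real (Suc (Suc m)) * (f (Suc k / Suc (Suc m)) - f (k / Suc (Suc m))) = f' \<xi>"
          by (rule bsum_increment[OF f k]) blast
        have "1 / real (Suc (Suc m)) \<le> 1 / Suc N" using m by (intro divide_left_mono) auto
        then have "dist \<xi> (k / Suc m) < d" using \<xi>(2) N by (auto simp: dist_real_def)
        then have "dist (f' \<xi>) (f' (k / Suc m)) < e / 2" using d(2) \<xi>(1) unit_fraction[OF k] by blast
        then show "\<bar>real (Suc (Suc m)) * (f (Suc k / Suc (Suc m)) - f (k / Suc (Suc m))) - f' (k / Suc m)\<bar> \<le> e / 2"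
          unfolding \<xi>(3) by (simp add: dist_real_def)
      qed
      also have "\<dots> < e" using e by simp
      finally show ?thesis by simp
    qed
    then show "\<exists>N. \<forall>m\<ge>N. norm (poly (pderiv (bsum (Suc (Suc m)) f)) x - poly (bsum (Suc m) f') x - 0) < e" by blast
  qed
  from tendsto_add[OF this bsum_tendsto[OF c x]]
  have "(\<lambda>m. poly (pderiv (bsum (Suc (Suc m)) f)) x) \<longlonglongrightarrow> f' x" by simp
  then show ?thesis by (rule LIMSEQ_imp_Suc)
qed

subsection \<open>Enlarging the class of test functions\<close>

lemma AE_Q_interior: "AE p in unit_Q. fst p \<in> {0<..<1} \<and> snd p \<in> {0<..<1}"
proof (rule unit_Q.AE_pair_measure)
  have "{0<..<1} \<times> {0<..<1} \<in> sets (borel \<Otimes>\<^sub>M (borel :: real measure) :: (real \<times> real) measure)"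
    by (rule pair_measureI) auto
  moreover have "{x \<in> space unit_Q. fst x \<in> {0<..<1} \<and> snd x \<in> {0<..<1}} = {0<..<1} \<times> {0<..<1}" by auto
  ultimately show "{x \<in> space unit_Q. fst x \<in> {0<..<1} \<and> snd x \<in> {0<..<1}} \<in> sets unit_Q" by simp
  show "AE x in unit_B. AE y in unit_B. fst (x, y) \<in> {0<..<1} \<and> snd (x, y) \<in> {0<..<1}"
    using AE_unit_B_interior
  proof eventually_elim
    case (elim x)
    show ?case using AE_unit_B_interior by eventually_elim (use elim in simp)
  qed
qed

lemma Qintegrable_bound:
  assumes u: "Qintegrable u" and w: "Qmeas w"
    and le: "\<And>x t. x \<in> {0<..<1} \<Longrightarrow> t \<in> {0<..<1} \<Longrightarrow> \<bar>w x t\<bar> \<le> \<bar>u x t\<bar>"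
  shows "Qintegrable w"
proof (rule Bochner_Integration.integrable_bound[OF u])
  show "AE p in unit_Q. norm (w (fst p) (snd p)) \<le> norm (u (fst p) (snd p))"
    using AE_Q_interior by eventually_elim (use le in auto)
qed (use w in simp)

lemma Qintegrable_mult_bounded:
  assumes u: "Qintegrable u" and w: "Qmeas w"
    and le: "\<And>x t. x \<in> {0<..<1} \<Longrightarrow> t \<in> {0<..<1} \<Longrightarrow> \<bar>w x t\<bar> \<le> C"
  shows "Qintegrable (\<lambda>x t. u x t * w x t)"
proof (rule Qintegrable_bound[of "\<lambda>x t. \<bar>u x t\<bar> * C"])
  show "Qintegrable (\<lambda>x t. \<bar>u x t\<bar> * C)" using u by simp
  show "Qmeas (\<lambda>x t. u x t * w x t)" using w borel_measurable_integrable[OF u] by simp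
  fix x t :: real assume "x \<in> {0<..<1}" "t \<in> {0<..<1}"
  then have "\<bar>w x t\<bar> \<le> \<bar>C\<bar>" using le by fastforce
  then show "\<bar>u x t * w x t\<bar> \<le> \<bar>\<bar>u x t\<bar> * C\<bar>" by (simp add: abs_mult mult_left_mono)
qed

lemma Qmeas_fst: "h \<in> borel_measurable borel \<Longrightarrow> Qmeas (\<lambda>x t. h x)"
  and Qmeas_snd: "h \<in> borel_measurable borel \<Longrightarrow> Qmeas (\<lambda>x t. h t)"
  by (auto intro: measurable_compose[OF measurable_fst] measurable_compose[OF measurable_snd])

lemma poly_bounded_unit:
  fixes P :: "real poly"
  obtains C where "C \<ge> 0" "\<And>x. x \<in> {0..1} \<Longrightarrow> \<bar>poly P x\<bar> \<le> C"
proof -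
  obtain C where "\<And>x. x \<in> {0..1} \<Longrightarrow> \<bar>poly P x\<bar> \<le> C"
    by (rule abs_le_bound_on_unit_interval[of "poly P"]) (auto intro!: continuous_intros)
  moreover from this[of 0] have "C \<ge> 0" by simp
  ultimately show thesis using that by blast
qed

lemma pderiv_sum: "pderiv (\<Sum>i\<in>A. f i) = (\<Sum>i\<in>A. pderiv (f i))"
  by (induction A rule: infinite_finite_induct) (auto simp: pderiv_add)

text \<open>The time derivative of the moment of \<alpha> against \<open>P\<close> is the integral
  of \<beta> P + \<gamma> P', with \<open>B0 P\<close> and \<open>B1 P\<close> the moments at the
  end times. The equation for f has \<beta> = v_x f + z and \<gamma> = f v, the one for z has
  \<beta> = 0 and \<gamma> = z v, so one argument serves both.\<close>

locale transport = velocity +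
  fixes \<alpha> \<beta> \<gamma> :: "real \<Rightarrow> real \<Rightarrow> real" and B0 B1 :: "real poly \<Rightarrow> real"
  assumes \<alpha>: "Qintegrable \<alpha>" and \<alpha>L: "Qintegrable (\<lambda>x t. \<alpha> x t * L t)"
    and \<beta>: "Qintegrable \<beta>" and \<gamma>: "Qintegrable \<gamma>"
    and weak0: "AE t in unit_B. (\<integral>x. \<alpha> x t * poly P x \<partial>unit_B) =
      B0 P + prim (\<lambda>t. \<integral>x. \<beta> x t * poly P x + \<gamma> x t * poly (pderiv P) x \<partial>unit_B) t"
    and weak1: "B1 P = B0 P + integral {0..1} (\<lambda>t. \<integral>x. \<beta> x t * poly P x + \<gamma> x t * poly (pderiv P) x \<partial>unit_B)"
begin

lemma meas [measurable]: "Qmeas \<alpha>" "Qmeas \<beta>" "Qmeas \<gamma>"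
  using borel_measurable_integrable[OF \<alpha>] borel_measurable_integrable[OF \<beta>] borel_measurable_integrable[OF \<gamma>] by simp_all

lemma \<alpha>_mult_integrable:
  assumes w: "Qmeas w" and le: "\<And>x t. x \<in> {0<..<1} \<Longrightarrow> t \<in> {0<..<1} \<Longrightarrow> \<bar>w x t\<bar> \<le> C * (1 + L t)"
  shows "Qintegrable (\<lambda>x t. \<alpha> x t * w x t)"
proof (rule Qintegrable_bound[of "\<lambda>x t. C * (\<bar>\<alpha> x t\<bar> + \<bar>\<alpha> x t * L t\<bar>)"])
  show "Qintegrable (\<lambda>x t. C * (\<bar>\<alpha> x t\<bar> + \<bar>\<alpha> x t * L t\<bar>))" using \<alpha> \<alpha>L by simp
  show "Qmeas (\<lambda>x t. \<alpha> x t * w x t)" using w by measurable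
  fix x t :: real assume "x \<in> {0<..<1}" "t \<in> {0<..<1}"
  from mult_left_mono[OF le[OF this], of "\<bar>\<alpha> x t\<bar>"]
  have "\<bar>\<alpha> x t * w x t\<bar> \<le> C * (\<bar>\<alpha> x t\<bar> + \<bar>\<alpha> x t * L t\<bar>)"
    using L_nonneg[of t] by (simp add: abs_mult algebra_simps)
  then show "\<bar>\<alpha> x t * w x t\<bar> \<le> \<bar>C * (\<bar>\<alpha> x t\<bar> + \<bar>\<alpha> x t * L t\<bar>)\<bar>" by linarith
qed

lemma separated_test:
  assumes b': "b' \<in> borel_measurable borel" "\<And>t. t \<in> {0..1} \<Longrightarrow> \<bar>b' t\<bar> \<le> C * (1 + L t)"
    and b: "b \<in> borel_measurable borel" "\<And>t. t \<in> {0..1} \<Longrightarrow> b t = b 0 + integral {0..t} b'"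
  shows "Qintegrable (\<lambda>x t. \<alpha> x t * (b' t * poly P x) + \<beta> x t * (b t * poly P x) + \<gamma> x t * (b t * poly (pderiv P) x))"
    and "Qint (\<lambda>x t. \<alpha> x t * (b' t * poly P x) + \<beta> x t * (b t * poly P x) + \<gamma> x t * (b t * poly (pderiv P) x)) = b 1 * B1 P - b 0 * B0 P"
proof -
  obtain CP where CP: "CP \<ge> 0" "\<And>x. x \<in> {0..1} \<Longrightarrow> \<bar>poly P x\<bar> \<le> CP" by (rule poly_bounded_unit[where P=P]) blast
  obtain CD where CD: "CD \<ge> 0" "\<And>x. x \<in> {0..1} \<Longrightarrow> \<bar>poly (pderiv P) x\<bar> \<le> CD" by (rule poly_bounded_unit[where P="pderiv P"]) blast
  have C: "C \<ge> 0"
  proof (rule ccontr)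
    assume "\<not> C \<ge> 0"
    then have "C * (1 + L 0) < 0" using L_nonneg[of 0] by (intro mult_neg_pos) auto
    then show False using b'(2)[of 0] by simp
  qed
  define g where "g t = (\<integral>x. \<beta> x t * poly P x + \<gamma> x t * poly (pderiv P) x \<partial>unit_B)" for t
  have Pm: "Qmeas (\<lambda>x t. poly P x)" "Qmeas (\<lambda>x t. poly (pderiv P) x)" by (intro Qmeas_fst borel_measurable_poly)+
  note bm = Qmeas_snd[OF b'(1)] Qmeas_snd[OF b(1)]
  have ib': "integrable unit_B b'"
  proof (rule Bochner_Integration.integrable_bound[of _ "\<lambda>t. C * (1 + L t)"])
    show "integrable unit_B (\<lambda>t. C * (1 + L t))" using L_integrable by simp
    show "AE t in unit_B. norm (b' t) \<le> norm (C * (1 + L t))"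
      using AE_unit_B_interior
    proof eventually_elim
      case (elim t)
      then show ?case using order_trans[OF b'(2)[of t] abs_ge_self] by simp
    qed
  qed (use b' in simp)
  have ab': "b' absolutely_integrable_on {0..1}" using ib' unit_B_absolutely_integrable(1)[OF b'(1)] by blast
  have cb: "continuous_on {0..1} b" by (rule primitive_continuous[OF ab' b(2)])
  obtain Cb where Cb: "\<And>t. t \<in> {0..1} \<Longrightarrow> \<bar>b t\<bar> \<le> Cb" by (rule abs_le_bound_on_unit_interval[OF cb])  blast
  have iP: "Qintegrable (\<lambda>x t. \<alpha> x t * poly P x)" "Qintegrable (\<lambda>x t. \<beta> x t * poly P x)"
    "Qintegrable (\<lambda>x t. \<gamma> x t * poly (pderiv P) x)"
    by (rule Qintegrable_mult_bounded[OF \<alpha> Pm(1), of CP] Qintegrable_mult_bounded[OF \<beta> Pm(1), of CP]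
        Qintegrable_mult_bounded[OF \<gamma> Pm(2), of CD]; use CP CD in force)+
  have i1: "Qintegrable (\<lambda>x t. \<alpha> x t * (b' t * poly P x))"
  proof (rule \<alpha>_mult_integrable[where C="C * CP"])
    show "Qmeas (\<lambda>x t. b' t * poly P x)" using bm(1) Pm(1) by measurable
    fix x t :: real assume xt: "x \<in> {0<..<1}" "t \<in> {0<..<1}"
    have "\<bar>b' t\<bar> * \<bar>poly P x\<bar> \<le> (C * (1 + L t)) * CP"
      using xt b'(2)[of t] CP C L_nonneg by (intro mult_mono) auto
    then show "\<bar>b' t * poly P x\<bar> \<le> C * CP * (1 + L t)" by (simp add: abs_mult mult_ac)
  qed
  have i2: "Qintegrable (\<lambda>x t. \<beta> x t * poly P x * b t)" "Qintegrable (\<lambda>x t. \<gamma> x t * poly (pderiv P) x * b t)"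
    by (rule Qintegrable_mult_bounded[OF iP(2) bm(2), of Cb] Qintegrable_mult_bounded[OF iP(3) bm(2), of Cb]; use Cb in force)+
  show int: "Qintegrable (\<lambda>x t. \<alpha> x t * (b' t * poly P x) + \<beta> x t * (b t * poly P x) + \<gamma> x t * (b t * poly (pderiv P) x))"
    using i1 i2 by (simp add: mult_ac)
  have ig: "integrable unit_B g" unfolding g_def
    by (rule Q_Fubini(6)) (use iP in simp)
  have gm: "g \<in> borel_measurable borel" using borel_measurable_integrable[OF ig] by simp
  have ag: "g absolutely_integrable_on {0..1}" using ig unit_B_absolutely_integrable(1)[OF gm] by blast
  define U where "U t = B0 P + prim g t" for t
  have Um: "U \<in> borel_measurable borel" unfolding U_def[abs_def] using prim_continuous(2)[OF ag] by measurable
  have U: "U t = B0 P + integral {0..t} g" if "t \<in> {0..1}" for t using that by (simp add: U_def prim_eq)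
  have "Qint (\<lambda>x t. \<alpha> x t * (b' t * poly P x) + \<beta> x t * (b t * poly P x) + \<gamma> x t * (b t * poly (pderiv P) x))
     = (\<integral>t. (\<integral>x. \<alpha> x t * (b' t * poly P x) + \<beta> x t * (b t * poly P x) + \<gamma> x t * (b t * poly (pderiv P) x) \<partial>unit_B) \<partial>unit_B)"
    by (rule Q_Fubini(2)[OF int])
  also have "\<dots> = (\<integral>t. g t * b t + b' t * U t \<partial>unit_B)"
  proof (rule integral_cong_AE)
    show "(\<lambda>t. \<integral>x. \<alpha> x t * (b' t * poly P x) + \<beta> x t * (b t * poly P x) + \<gamma> x t * (b t * poly (pderiv P) x) \<partial>unit_B) \<in> borel_measurable unit_B"
      using borel_measurable_integrable[OF Q_Fubini(6)[OF int]] .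
    show "(\<lambda>t. g t * b t + b' t * U t) \<in> borel_measurable unit_B" using gm b(1) b'(1) Um by simp
    show "AE t in unit_B. (\<integral>x. \<alpha> x t * (b' t * poly P x) + \<beta> x t * (b t * poly P x) + \<gamma> x t * (b t * poly (pderiv P) x) \<partial>unit_B) = g t * b t + b' t * U t"
      using weak0[of P] Q_Fubini(4)[OF iP(1)] Q_Fubini(4)[OF iP(2)] Q_Fubini(4)[OF iP(3)]
    proof eventually_elim
      case (elim t)
      have "(\<integral>x. \<alpha> x t * (b' t * poly P x) + \<beta> x t * (b t * poly P x) + \<gamma> x t * (b t * poly (pderiv P) x) \<partial>unit_B)
          = (\<integral>x. b' t * (\<alpha> x t * poly P x) + b t * (\<beta> x t * poly P x + \<gamma> x t * poly (pderiv P) x) \<partial>unit_B)"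
        by (intro Bochner_Integration.integral_cong refl) (simp add: algebra_simps)
      also have "\<dots> = b' t * (\<integral>x. \<alpha> x t * poly P x \<partial>unit_B) + b t * g t"
        unfolding g_def using elim(2-4) by simp
      finally show ?case using elim(1) by (simp add: U_def g_def[abs_def] mult.commute)
    qed
  qed
  also have "\<dots> = integral {0..1} (\<lambda>t. g t * b t + b' t * U t)"
  proof (rule unit_B_absolutely_integrable(2))
    show m: "(\<lambda>t. g t * b t + b' t * U t) \<in> borel_measurable borel" using gm b(1) b'(1) Um by measurable
    show "integrable unit_B (\<lambda>t. g t * b t + b' t * U t)"
      using primitive_product(1)[OF ag U ab' b(2)] unit_B_absolutely_integrable(1)[OF m] by blast
  qed
  also have "\<dots> = U 1 * b 1 - B0 P * b 0"
    using primitive_product(2)[OF ag U ab' b(2), of 1] by simp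
  also have "U 1 = B1 P" using U[of 1] weak1[of P] by (simp add: g_def[abs_def])
  finally show "Qint (\<lambda>x t. \<alpha> x t * (b' t * poly P x) + \<beta> x t * (b t * poly P x) + \<gamma> x t * (b t * poly (pderiv P) x)) = b 1 * B1 P - b 0 * B0 P"
    by (simp add: mult.commute)
qed

text \<open>The Bernstein sums of \<phi> in y are sums of separated tests, and they converge
  together with their y-derivative while keeping all bounds, so dominated convergence applies. The
  limit of the end terms is an assumption, since no continuity of \<open>B0\<close> and
  \<open>B1\<close> is available.\<close>

lemma regular_test:
  fixes \<phi> p q :: "real \<Rightarrow> real \<Rightarrow> real"
  assumes m: "Qmeas \<phi>" "Qmeas p" "Qmeas q"
    and prim: "\<And>y t. y \<in> {0..1} \<Longrightarrow> t \<in> {0..1} \<Longrightarrow> \<phi> y t = \<phi> y 0 + integral {0..t} (p y)"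
    and pb: "\<And>y t. y \<in> {0..1} \<Longrightarrow> t \<in> {0..1} \<Longrightarrow> \<bar>p y t\<bar> \<le> C * (1 + L t)"
    and pc: "\<And>t. t \<in> {0..1} \<Longrightarrow> continuous_on {0..1} (\<lambda>y. p y t)"
    and d: "\<And>y t. y \<in> {0..1} \<Longrightarrow> t \<in> {0..1} \<Longrightarrow> ((\<lambda>y. \<phi> y t) has_real_derivative q y t) (at y within {0..1})"
    and qc: "\<And>t. t \<in> {0..1} \<Longrightarrow> continuous_on {0..1} (\<lambda>y. q y t)"
    and b: "\<And>y t. y \<in> {0..1} \<Longrightarrow> t \<in> {0..1} \<Longrightarrow> \<bar>\<phi> y t\<bar> \<le> C" "\<And>y t. y \<in> {0..1} \<Longrightarrow> t \<in> {0..1} \<Longrightarrow> \<bar>q y t\<bar> \<le> C"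
    and lim: "(\<lambda>n. \<Sum>k\<le>Suc n. \<phi> (k / Suc n) 1 * B1 (bern (Suc n) k) - \<phi> (k / Suc n) 0 * B0 (bern (Suc n) k)) \<longlonglongrightarrow> R"
  shows "Qint (\<lambda>x t. \<alpha> x t * p x t + \<beta> x t * \<phi> x t + \<gamma> x t * q x t) = R"
proof -
  define G where "G n x t = \<alpha> x t * poly (bsum (Suc n) (\<lambda>y. p y t)) x + \<beta> x t * poly (bsum (Suc n) (\<lambda>y. \<phi> y t)) x
      + \<gamma> x t * poly (pderiv (bsum (Suc n) (\<lambda>y. \<phi> y t))) x" for n x t
  define S where "S n k x t = \<alpha> x t * (p (k / Suc n) t * poly (bern (Suc n) k) x) + \<beta> x t * (\<phi> (k / Suc n) t * poly (bern (Suc n) k) x)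
      + \<gamma> x t * (\<phi> (k / Suc n) t * poly (pderiv (bern (Suc n) k)) x)" for n k :: nat and x t
  \<comment> \<open>Each Bernstein term depends on t only through a sample of \<phi> at a fixed grid
    point, so it has the form treated by \<open>separated_test\<close>.\<close>
  have G_S: "G n x t = (\<Sum>k\<le>Suc n. S n k x t)" for n x t
    unfolding G_def S_def bsum_def
    by (simp only: poly_sum poly_smult pderiv_sum pderiv_smult sum_distrib_left sum.distrib)
  have S: "Qintegrable (S n k)" "Qint (S n k) = \<phi> (k / Suc n) 1 * B1 (bern (Suc n) k) - \<phi> (k / Suc n) 0 * B0 (bern (Suc n) k)"
    if "k \<le> Suc n" for n k
    unfolding S_def
    by (rule separated_test[OF Qmeas_slice(2)[OF m(2)] pb[OF unit_fraction[OF that]] Qmeas_slice(2)[OF m(1)] prim[OF unit_fraction[OF that]]]; assumption)+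
  have Gi: "Qintegrable (G n)" for n
    unfolding G_S using S(1) by (intro Bochner_Integration.integrable_sum) auto
  have "Qint (G n) = (\<Sum>k\<le>Suc n. \<phi> (k / Suc n) 1 * B1 (bern (Suc n) k) - \<phi> (k / Suc n) 0 * B0 (bern (Suc n) k))" for n
    unfolding G_S by (subst Bochner_Integration.integral_sum) (use S in auto)
  then have l1: "(\<lambda>n. Qint (G n)) \<longlonglongrightarrow> R" using lim by simp
  have "(\<lambda>n. Qint (G n)) \<longlonglongrightarrow> Qint (\<lambda>x t. \<alpha> x t * p x t + \<beta> x t * \<phi> x t + \<gamma> x t * q x t)"
  proof (rule integral_dominated_convergence[where
        w="\<lambda>z. C * (\<bar>\<alpha> (fst z) (snd z)\<bar> + \<bar>\<alpha> (fst z) (snd z) * L (snd z)\<bar> + \<bar>\<beta> (fst z) (snd z)\<bar> + \<bar>\<gamma> (fst z) (snd z)\<bar>)"])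
    show "(\<lambda>z. \<alpha> (fst z) (snd z) * p (fst z) (snd z) + \<beta> (fst z) (snd z) * \<phi> (fst z) (snd z) + \<gamma> (fst z) (snd z) * q (fst z) (snd z)) \<in> borel_measurable unit_Q"
      using m by simp
    show "(\<lambda>z. G n (fst z) (snd z)) \<in> borel_measurable unit_Q" for n using Gi borel_measurable_integrable by blast
    show "integrable unit_Q (\<lambda>z. C * (\<bar>\<alpha> (fst z) (snd z)\<bar> + \<bar>\<alpha> (fst z) (snd z) * L (snd z)\<bar> + \<bar>\<beta> (fst z) (snd z)\<bar> + \<bar>\<gamma> (fst z) (snd z)\<bar>))"
      using \<alpha> \<alpha>L \<beta> \<gamma> by simp
    show "AE z in unit_Q. (\<lambda>n. G n (fst z) (snd z)) \<longlonglongrightarrow> \<alpha> (fst z) (snd z) * p (fst z) (snd z) + \<beta> (fst z) (snd z) * \<phi> (fst z) (snd z) + \<gamma> (fst z) (snd z) * q (fst z) (snd z)"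
      using AE_Q_interior
    proof eventually_elim
      case (elim z)
      then have x: "fst z \<in> {0..1}" "snd z \<in> {0..1}" by auto
      have c\<phi>: "continuous_on {0..1} (\<lambda>y. \<phi> y (snd z))"
        by (rule DERIV_continuous_on[OF d]) (use x in auto)
      show ?case unfolding G_def
        by (intro tendsto_add tendsto_mult_left bsum_tendsto pderiv_bsum_tendsto pc qc d c\<phi> x)
    qed
    fix n
    show "AE z in unit_Q. norm (G n (fst z) (snd z)) \<le> C * (\<bar>\<alpha> (fst z) (snd z)\<bar> + \<bar>\<alpha> (fst z) (snd z) * L (snd z)\<bar> + \<bar>\<beta> (fst z) (snd z)\<bar> + \<bar>\<gamma> (fst z) (snd z)\<bar>)"
      using AE_Q_interior
    proof eventually_elim
      case (elim z)
      define x t where "x = fst z" and "t = snd z"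
      have xt: "x \<in> {0..1}" "t \<in> {0..1}" using elim by (auto simp: x_def t_def)
      have "\<bar>\<alpha> x t\<bar> * \<bar>poly (bsum (Suc n) (\<lambda>y. p y t)) x\<bar> \<le> \<bar>\<alpha> x t\<bar> * (C * (1 + L t))"
        using xt pb by (intro mult_left_mono bsum_bound) auto
      moreover have "\<bar>\<beta> x t\<bar> * \<bar>poly (bsum (Suc n) (\<lambda>y. \<phi> y t)) x\<bar> \<le> \<bar>\<beta> x t\<bar> * C"
        using xt b by (intro mult_left_mono bsum_bound) auto
      moreover have "\<bar>\<gamma> x t\<bar> * \<bar>poly (pderiv (bsum (Suc n) (\<lambda>y. \<phi> y t))) x\<bar> \<le> \<bar>\<gamma> x t\<bar> * C"
        by (intro mult_left_mono pderiv_bsum_bound[OF d[OF _ xt(2)] b(2)[OF _ xt(2)] xt(1)]) auto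
      moreover have "\<bar>G n x t\<bar> \<le> \<bar>\<alpha> x t * poly (bsum (Suc n) (\<lambda>y. p y t)) x\<bar> + \<bar>\<beta> x t * poly (bsum (Suc n) (\<lambda>y. \<phi> y t)) x\<bar>
          + \<bar>\<gamma> x t * poly (pderiv (bsum (Suc n) (\<lambda>y. \<phi> y t))) x\<bar>"
        unfolding G_def by linarith
      moreover have "\<bar>\<alpha> x t * L t\<bar> = \<bar>\<alpha> x t\<bar> * L t" using L_nonneg by (simp add: abs_mult)
      ultimately have "\<bar>G n x t\<bar> \<le> C * (\<bar>\<alpha> x t\<bar> + \<bar>\<alpha> x t * L t\<bar> + \<bar>\<beta> x t\<bar> + \<bar>\<gamma> x t\<bar>)"
        unfolding abs_mult by (simp add: algebra_simps abs_of_nonneg L_nonneg)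
      then show ?case by (simp add: x_def t_def)
    qed
  qed
  with l1 show ?thesis by (intro LIMSEQ_unique)
qed

end

text \<open>Composition with this retraction extends a continuous function on the closed square to a
  continuous, hence Borel, function on the plane.\<close>

definition clamp01 :: "real \<Rightarrow> real" where "clamp01 x = min 1 (max 0 x)"

lemma clamp01_range [simp]: "clamp01 x \<in> {0..1}" and clamp01_id: "x \<in> {0..1} \<Longrightarrow> clamp01 x = x"
  by (auto simp: clamp01_def)

lemma continuous_clamp:
  fixes G :: "real \<Rightarrow> real \<Rightarrow> real"
  assumes "continuous_on ({0..1} \<times> {0..1}) (\<lambda>p. G (fst p) (snd p))"
  shows "continuous_on UNIV (\<lambda>p. G (clamp01 (fst p)) (clamp01 (snd p)))"
proof -
  have "continuous_on UNIV (\<lambda>p::real \<times> real. (clamp01 (fst p), clamp01 (snd p)))"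
    unfolding clamp01_def by (intro continuous_intros)
  moreover have "range (\<lambda>p::real \<times> real. (clamp01 (fst p), clamp01 (snd p))) \<subseteq> {0..1} \<times> {0..1}"
    by (intro image_subsetI SigmaI clamp01_range)
  ultimately show ?thesis
    using assms continuous_on_compose2[of "{0..1} \<times> {0..1}" "\<lambda>p. G (fst p) (snd p)" UNIV "\<lambda>p. (clamp01 (fst p), clamp01 (snd p))"]
    by (simp only: fst_conv snd_conv)
qed

lemma Qmeas_clamp:
  assumes "continuous_on ({0..1} \<times> {0..1}) (\<lambda>p. G (fst p) (snd p))"
  shows "Qmeas (\<lambda>x t. G (clamp01 x) (clamp01 t) :: real)"
  unfolding borel_prod by (rule borel_measurable_continuous_onI[OF continuous_clamp[OF assms]])

locale flow_transport = flow + transport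
begin

definition Xc :: "real \<Rightarrow> real \<Rightarrow> real" where "Xc y t = X (clamp01 y) (clamp01 t)"

lemma Xc: "y \<in> {0..1} \<Longrightarrow> t \<in> {0..1} \<Longrightarrow> Xc y t = X y t"
  by (simp add: Xc_def clamp01_id)

text \<open>The function \<open>(X y t) ^ j\<close> is constant along characteristics, so only the time
  derivative of \<open>\<theta>\<close> survives.\<close>

lemma characteristic_test:
  fixes \<theta> :: "real poly"
  assumes \<gamma>\<alpha>: "\<And>x t. \<gamma> x t = \<alpha> x t * V x t"
    and lim: "(\<lambda>n. \<Sum>k\<le>Suc n. (Xc (k / Suc n) 1 ^ j * poly \<theta> 1) * B1 (bern (Suc n) k)
        - (Xc (k / Suc n) 0 ^ j * poly \<theta> 0) * B0 (bern (Suc n) k)) \<longlonglongrightarrow> R"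
  shows "Qint (\<lambda>x t. Xc x t ^ j * (\<alpha> x t * poly (pderiv \<theta>) t + \<beta> x t * poly \<theta> t)) = R"
proof -
  define Kc where "Kc y t = K (clamp01 y) (clamp01 t)" for y t
  have Kc: "y \<in> {0..1} \<Longrightarrow> t \<in> {0..1} \<Longrightarrow> Kc y t = K y t" for y t by (simp add: Kc_def clamp01_id)
  have mX [measurable]: "Qmeas Xc" unfolding Xc_def by (rule Qmeas_clamp[OF X_continuous])
  have mK [measurable]: "Qmeas Kc" unfolding Kc_def by (rule Qmeas_clamp[OF K_continuous])
  define \<phi> where "\<phi> y t = Xc y t ^ j * poly \<theta> t" for y t
  define q where "q y t = real j * Xc y t ^ (j - 1) * Kc y t * poly \<theta> t" for y t
  \<comment> \<open>The time derivative of \<phi> at fixed y: by \<open>X_time\<close> the inverse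
    flow has density \<open>- (V * K)\<close> in time, and the chain rule contributes
    \<open>j * X ^ (j - 1)\<close>.\<close>
  define p where "p y t = (- (V y t * Kc y t) * (real j * Xc y t ^ (j - 1))) * poly \<theta> t + poly (pderiv \<theta>) t * Xc y t ^ j" for y t
  obtain C1 where C1: "C1 \<ge> 0" "\<And>x. x \<in> {0..1} \<Longrightarrow> \<bar>poly \<theta> x\<bar> \<le> C1" by (rule poly_bounded_unit[where P=\<theta>]) blast
  obtain C2 where C2: "C2 \<ge> 0" "\<And>x. x \<in> {0..1} \<Longrightarrow> \<bar>poly (pderiv \<theta>) x\<bar> \<le> C2" by (rule poly_bounded_unit[where P="pderiv \<theta>"]) blast
  define M where "M = exp (Lam 1)"
  have M: "M > 0" by (simp add: M_def)
  define C where "C = real j * M * C1 + C1 + C2"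
  have pow: "\<bar>Xc y t ^ i\<bar> \<le> 1" for y t i
    using X(1)[OF clamp01_range clamp01_range, of y t] by (simp add: Xc_def power_abs power_le_one)
  have Kb: "\<bar>Kc y t\<bar> \<le> M" for y t
    using K_bounds[OF clamp01_range clamp01_range, of y t] by (simp add: Kc_def M_def)
  have jb: "\<bar>real j * Xc y t ^ i\<bar> \<le> real j" for y t i
    using mult_left_mono[OF pow[of y t i], of "real j"] by (simp add: abs_mult)
  have cX: "continuous_on {0..1} (\<lambda>y. Xc y t)" if "t \<in> {0..1}" for t
    by (rule continuous_on_eq[OF continuous_square_slice(2)[OF X_continuous that]]) (rule Xc[symmetric, OF _ that])
  have cK: "continuous_on {0..1} (\<lambda>y. Kc y t)" if "t \<in> {0..1}" for t
    by (rule continuous_on_eq[OF continuous_square_slice(2)[OF K_continuous that]]) (rule Kc[symmetric, OF _ that])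
  have cV: "continuous_on {0..1} (\<lambda>y. V y t)" for t by (rule DERIV_continuous_on[OF V_deriv])
  have "Qint (\<lambda>x t. \<alpha> x t * p x t + \<beta> x t * \<phi> x t + \<gamma> x t * q x t) = R"
  proof (rule regular_test[where C=C])
    have mp: "Qmeas (\<lambda>x t. poly \<theta> t)" "Qmeas (\<lambda>x t. poly (pderiv \<theta>) t)" by (intro Qmeas_snd borel_measurable_poly)+
    show "Qmeas \<phi>" "Qmeas p" "Qmeas q" unfolding \<phi>_def p_def q_def using mp mX mK V_meas by measurable
    show "(\<lambda>n. \<Sum>k\<le>Suc n. \<phi> (k / Suc n) 1 * B1 (bern (Suc n) k) - \<phi> (k / Suc n) 0 * B0 (bern (Suc n) k)) \<longlonglongrightarrow> R"
      unfolding \<phi>_def by (rule lim)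
    fix t :: real assume t: "t \<in> {0..1}"
    show "continuous_on {0..1} (\<lambda>y. p y t)" "continuous_on {0..1} (\<lambda>y. q y t)"
      unfolding p_def q_def by (intro continuous_intros cX[OF t] cK[OF t] cV)+
    fix y :: real assume y: "y \<in> {0..1}"
    show "\<bar>\<phi> y t\<bar> \<le> C"
    proof -
      have "\<bar>Xc y t ^ j\<bar> * \<bar>poly \<theta> t\<bar> \<le> 1 * C1" using pow C1 t by (intro mult_mono) auto
      moreover have "0 \<le> real j * M * C1" using M C1 by simp
      ultimately show ?thesis using C2(1) by (simp add: \<phi>_def C_def abs_mult)
    qed
    have jK: "\<bar>real j * Xc y t ^ (j - 1)\<bar> * \<bar>Kc y t\<bar> * \<bar>poly \<theta> t\<bar> \<le> real j * M * C1"
      using jb Kb C1 t M by (intro mult_mono) auto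
    then show "\<bar>q y t\<bar> \<le> C" using C1(1) C2(1) unfolding q_def C_def abs_mult by simp
    show "\<bar>p y t\<bar> \<le> C * (1 + L t)"
    proof -
      have "\<bar>(- (V y t * Kc y t) * (real j * Xc y t ^ (j - 1))) * poly \<theta> t\<bar> = \<bar>V y t\<bar> * (\<bar>real j * Xc y t ^ (j - 1)\<bar> * \<bar>Kc y t\<bar> * \<bar>poly \<theta> t\<bar>)"
        by (simp add: abs_mult mult_ac)
      also have "\<dots> \<le> L t * (real j * M * C1)" by (intro mult_mono[OF V_le[OF y] jK] L_nonneg) auto
      finally have 1: "\<bar>(- (V y t * Kc y t) * (real j * Xc y t ^ (j - 1))) * poly \<theta> t\<bar> \<le> L t * (real j * M * C1)" .
      have 2: "\<bar>poly (pderiv \<theta>) t * Xc y t ^ j\<bar> \<le> C2 * 1"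
        unfolding abs_mult using pow C2 t by (intro mult_mono) auto
      have 3: "0 \<le> L t * (C1 + C2)" "0 \<le> real j * M * C1" using L_nonneg C1 C2 M by auto
      have "\<bar>p y t\<bar> \<le> L t * (real j * M * C1) + C2" unfolding p_def using 1 2 by linarith
      also have "\<dots> \<le> C * (1 + L t)" using 3 C1(1) by (simp add: C_def algebra_simps)
      finally show ?thesis .
    qed
    show "((\<lambda>y. \<phi> y t) has_real_derivative q y t) (at y within {0..1})"
    proof -
      have "((\<lambda>y. X y t ^ j * poly \<theta> t) has_real_derivative (real j * X y t ^ (j - 1) * K y t) * poly \<theta> t) (at y within {0..1})"
        by (rule DERIV_cmult_right) (rule DERIV_cong[OF DERIV_power[OF X_deriv[OF y t]]], simp)
      then have "((\<lambda>y. X y t ^ j * poly \<theta> t) has_real_derivative q y t) (at y within {0..1})"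
        by (simp add: q_def Xc[OF y t] Kc[OF y t])
      then show ?thesis
        by (rule has_field_derivative_transform_within[OF _ zero_less_one y]) (simp add: \<phi>_def Xc[OF _ t])
    qed
    show "\<phi> y t = \<phi> y 0 + integral {0..t} (p y)"
    proof -
      note a = VK_integrable[OF y] and A = X_time[OF y]
      have dF: "((\<lambda>x. x ^ j) has_real_derivative real j * x ^ (j - 1)) (at x)" for x :: real
        using DERIV_pow[of j x] by simp
      have cF: "continuous_on UNIV (\<lambda>x::real. real j * x ^ (j - 1))" by (intro continuous_intros)
      note u = primitive_chain(1)[OF a A dF cF] and U = primitive_chain(2)[OF a A dF cF]
      have w: "poly (pderiv \<theta>) absolutely_integrable_on {0..1}"
        by (intro absolutely_integrable_continuous_real continuous_intros)
      have Wp: "poly \<theta> t = poly \<theta> 0 + integral {0..t} (poly (pderiv \<theta>))" if "t \<in> {0..1}" for t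
      proof -
        have "(poly (pderiv \<theta>) has_integral poly \<theta> t - poly \<theta> 0) {0..t}"
          using that by (intro fundamental_theorem_of_calculus)
            (auto simp: has_real_derivative_iff_has_vector_derivative[symmetric] intro!: DERIV_subset[OF poly_DERIV])
        then show ?thesis by (simp add: integral_unique)
      qed
      have "X y t ^ j * poly \<theta> t = y ^ j * poly \<theta> 0 + integral {0..t} (\<lambda>t. (- (V y t * K y t) * (real j * X y t ^ (j - 1))) * poly \<theta> t + poly (pderiv \<theta>) t * X y t ^ j)"
        by (rule primitive_product(2)[OF u U w Wp t])
      moreover have "integral {0..t} (\<lambda>t. (- (V y t * K y t) * (real j * X y t ^ (j - 1))) * poly \<theta> t + poly (pderiv \<theta>) t * X y t ^ j) = integral {0..t} (p y)"
        by (rule integral_cong) (use t in \<open>simp add: p_def Xc[OF y] Kc[OF y]\<close>)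
      ultimately show ?thesis using t by (simp add: \<phi>_def Xc[OF y] X_0[OF y])
    qed
  qed
  \<comment> \<open>The part of \<alpha> p that contains \<open>V * K\<close> cancels against
    \<gamma> q, because \<gamma> = \<alpha> V.\<close>
  also have "Qint (\<lambda>x t. \<alpha> x t * p x t + \<beta> x t * \<phi> x t + \<gamma> x t * q x t) = Qint (\<lambda>x t. Xc x t ^ j * (\<alpha> x t * poly (pderiv \<theta>) t + \<beta> x t * poly \<theta> t))"
    by (intro Bochner_Integration.integral_cong refl) (simp add: p_def q_def \<phi>_def \<gamma>\<alpha> algebra_simps)
  finally show ?thesis .
qed

end

subsection \<open>Lagrangian coordinates\<close>

context flow
begin

definition \<Phi>c :: "real \<Rightarrow> real \<Rightarrow> real" where "\<Phi>c x t = \<Phi> (clamp01 x) (clamp01 t)"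

definition Ec :: "real \<Rightarrow> real \<Rightarrow> real" where "Ec x t = E (clamp01 x) (clamp01 t)"

lemma \<Phi>c: "x \<in> {0..1} \<Longrightarrow> t \<in> {0..1} \<Longrightarrow> \<Phi>c x t = \<Phi> x t"
  by (simp add: \<Phi>c_def clamp01_id)

lemma Ec: "x \<in> {0..1} \<Longrightarrow> t \<in> {0..1} \<Longrightarrow> Ec x t = E x t"
  by (simp add: Ec_def clamp01_id)

lemma Ec_pos: "0 < Ec x t" by (simp add: Ec_def E_pos)

lemma \<Phi>c_meas [measurable]: "Qmeas \<Phi>c" unfolding \<Phi>c_def by (rule Qmeas_clamp[OF \<Phi>_continuous])

lemma Ec_meas [measurable]: "Qmeas Ec" unfolding Ec_def by (rule Qmeas_clamp[OF E_continuous])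

text \<open>At a fixed time the flow is a bijection of the interval with positive derivative
  \<open>E\<close>. The formula for indicators identifies \<open>unit_B\<close> as an image measure,
  through which integrals and null sets are both transported.\<close>

lemma slice_change_of_variables:
  assumes t: "t \<in> {0..1}" and A: "A \<in> sets borel"
  shows "(\<integral>\<^sup>+x. ennreal (Ec x t) * indicator A (\<Phi>c x t) \<partial>unit_B) = emeasure unit_B A"
proof -
  let ?f = "indicator A :: real \<Rightarrow> real"
  define h where "h x = Ec x t * ?f (\<Phi>c x t)" for x
  have fm: "?f \<in> borel_measurable borel" using A by simp
  have hm: "h \<in> borel_measurable borel"
    unfolding h_def[abs_def] using Qmeas_slice(1)[OF \<Phi>c_meas, of t] Qmeas_slice(1)[OF Ec_meas, of t] A by measurable
  have fi: "integrable unit_B ?f" using A by (intro integrable_real_indicator) (auto simp: less_top[symmetric])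
  have fa: "?f absolutely_integrable_on {0..1}" using fi unit_B_absolutely_integrable(1)[OF fm] by blast
  have img: "(\<lambda>x. \<Phi> x t) ` {0..1} = {0..1}"
  proof
    show "(\<lambda>x. \<Phi> x t) ` {0..1} \<subseteq> {0..1}" using \<Phi>_range t by blast
    show "{0..1} \<subseteq> (\<lambda>x. \<Phi> x t) ` {0..1}"
    proof
      fix y :: real assume y: "y \<in> {0..1}"
      show "y \<in> (\<lambda>x. \<Phi> x t) ` {0..1}" using X[OF y t] by (metis imageI)
    qed
  qed
  have inj: "inj_on (\<lambda>x. \<Phi> x t) {0..1}" by (rule inj_on_inverseI[of _ "\<lambda>y. X y t"]) (rule X_\<Phi>[OF _ t])
  have cov: "(\<lambda>x. \<bar>E x t\<bar> * ?f (\<Phi> x t)) absolutely_integrable_on {0..1} \<and> integral {0..1} (\<lambda>x. \<bar>E x t\<bar> * ?f (\<Phi> x t)) = integral {0..1} ?f"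
    using has_absolute_integral_change_of_variables_1'[of "{0..1}" "\<lambda>x. \<Phi> x t" "\<lambda>x. E x t" ?f "integral {0..1} ?f"]
      \<Phi>_deriv[OF _ t] inj fa unfolding img by simp
  have eq: "h x = \<bar>E x t\<bar> * ?f (\<Phi> x t)" if "x \<in> {0..1}" for x
    using that E_pos[of x t] by (simp add: h_def \<Phi>c[OF _ t] Ec[OF _ t])
  have ha: "h absolutely_integrable_on {0..1}"
  proof -
    have "h absolutely_integrable_on {0..1} \<longleftrightarrow> (\<lambda>x. \<bar>E x t\<bar> * ?f (\<Phi> x t)) absolutely_integrable_on {0..1}"
      by (rule set_integrable_cong) (auto intro: eq)
    then show ?thesis using cov by blast
  qed
  have hi: "integrable unit_B h" using ha unit_B_absolutely_integrable(1)[OF hm] by blast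
  have "(\<integral>x. h x \<partial>unit_B) = integral {0..1} h" by (rule unit_B_absolutely_integrable(2)[OF hm hi])
  also have "\<dots> = integral {0..1} ?f" using cov integral_cong[of "{0..1}" h, OF eq] by simp
  also have "\<dots> = (\<integral>x. ?f x \<partial>unit_B)" by (rule unit_B_absolutely_integrable(2)[OF fm fi, symmetric])
  also have "\<dots> = measure unit_B A" using A by simp
  finally have I: "(\<integral>x. h x \<partial>unit_B) = measure unit_B A" .
  have "(\<integral>\<^sup>+x. ennreal (Ec x t) * indicator A (\<Phi>c x t) \<partial>unit_B) = (\<integral>\<^sup>+x. ennreal (h x) \<partial>unit_B)"
    by (intro nn_integral_cong) (auto simp: h_def indicator_def)
  also have "\<dots> = ennreal (\<integral>x. h x \<partial>unit_B)"
    using Ec_pos by (intro nn_integral_eq_integral hi) (auto simp: h_def less_imp_le)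
  also have "\<dots> = emeasure unit_B A" unfolding I by (simp add: unit_B.emeasure_eq_measure)
  finally show ?thesis .
qed

lemma distr_slice:
  assumes t: "t \<in> {0..1}"
  shows "distr (density unit_B (\<lambda>x. ennreal (Ec x t))) borel (\<lambda>x. \<Phi>c x t) = unit_B"
proof (rule measure_eqI)
  note m [measurable] = Qmeas_slice(1)[OF \<Phi>c_meas, of t] Qmeas_slice(1)[OF Ec_meas, of t]
  fix A assume "A \<in> sets (distr (density unit_B (\<lambda>x. ennreal (Ec x t))) borel (\<lambda>x. \<Phi>c x t))"
  then have A [measurable]: "A \<in> sets borel" by simp
  have A': "(\<lambda>x. \<Phi>c x t) -` A \<in> sets borel" using measurable_sets[OF m(1) A] by simp
  have "emeasure (distr (density unit_B (\<lambda>x. ennreal (Ec x t))) borel (\<lambda>x. \<Phi>c x t)) A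
     = emeasure (density unit_B (\<lambda>x. ennreal (Ec x t))) ((\<lambda>x. \<Phi>c x t) -` A)"
    by (subst emeasure_distr) (auto simp: m)
  also have "\<dots> = (\<integral>\<^sup>+x. ennreal (Ec x t) * indicator ((\<lambda>x. \<Phi>c x t) -` A) x \<partial>unit_B)"
    using A' m(2) by (intro emeasure_density) auto
  also have "\<dots> = emeasure unit_B A" using slice_change_of_variables[OF t A] by (simp add: indicator_def)
  finally show "emeasure (distr (density unit_B (\<lambda>x. ennreal (Ec x t))) borel (\<lambda>x. \<Phi>c x t)) A = emeasure unit_B A" .
qed simp

definition T :: "real \<times> real \<Rightarrow> real \<times> real" where "T p = (\<Phi>c (fst p) (snd p), snd p)"

lemma T_meas: "T \<in> borel \<Otimes>\<^sub>M borel \<rightarrow>\<^sub>M borel \<Otimes>\<^sub>M borel"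
  unfolding T_def[abs_def] by measurable

text \<open>The map moves only the space variable, so the change of variables on each time slice
  extends to the square by Tonelli.\<close>

lemma distr_T: "distr (density unit_Q (\<lambda>p. ennreal (Ec (fst p) (snd p)))) (borel \<Otimes>\<^sub>M borel) T = unit_Q"
proof (rule measure_eqI)
  fix A assume "A \<in> sets (distr (density unit_Q (\<lambda>p. ennreal (Ec (fst p) (snd p)))) (borel \<Otimes>\<^sub>M borel) T)"
  then have A: "A \<in> sets (borel \<Otimes>\<^sub>M borel)" by simp
  then have AQ: "A \<in> sets unit_Q" by simp
  have A': "T -` A \<in> sets (borel \<Otimes>\<^sub>M borel)" using measurable_sets[OF T_meas A] by (simp add: space_pair_measure)
  have fm: "(\<lambda>p. ennreal (Ec (fst p) (snd p)) * indicator (T -` A) p) \<in> borel_measurable (borel \<Otimes>\<^sub>M borel)"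
    using A' Ec_meas by measurable
  have "emeasure (distr (density unit_Q (\<lambda>p. ennreal (Ec (fst p) (snd p)))) (borel \<Otimes>\<^sub>M borel) T) A
     = emeasure (density unit_Q (\<lambda>p. ennreal (Ec (fst p) (snd p)))) (T -` A)"
    using T_meas A by (subst emeasure_distr) (auto simp: space_pair_measure)
  also have "\<dots> = (\<integral>\<^sup>+p. ennreal (Ec (fst p) (snd p)) * indicator (T -` A) p \<partial>unit_Q)"
    using A' Ec_meas by (intro emeasure_density) auto
  also have "\<dots> = (\<integral>\<^sup>+t. (\<integral>\<^sup>+x. ennreal (Ec x t) * indicator (T -` A) (x, t) \<partial>unit_B) \<partial>unit_B)"
    using unit_Q.nn_integral_snd[of "\<lambda>p. ennreal (Ec (fst p) (snd p)) * indicator (T -` A) p"] fm by simp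
  also have "\<dots> = (\<integral>\<^sup>+t. emeasure unit_B ((\<lambda>x. (x, t)) -` A) \<partial>unit_B)"
  proof (rule nn_integral_cong_AE)
    show "AE t in unit_B. (\<integral>\<^sup>+x. ennreal (Ec x t) * indicator (T -` A) (x, t) \<partial>unit_B) = emeasure unit_B ((\<lambda>x. (x, t)) -` A)"
      using AE_unit_B_interior
    proof eventually_elim
      case (elim t)
      have "(\<lambda>x. (x, t)) -` A \<in> sets borel" using sets_Pair2[OF AQ, of t] by simp
      from slice_change_of_variables[OF _ this, of t] elim
      show ?case by (simp add: indicator_def T_def)
    qed
  qed
  also have "\<dots> = emeasure unit_Q A" by (rule unit_Q.emeasure_pair_measure_alt2[OF AQ, symmetric])
  finally show "emeasure (distr (density unit_Q (\<lambda>p. ennreal (Ec (fst p) (snd p)))) (borel \<Otimes>\<^sub>M borel) T) A = emeasure unit_Q A" .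
qed simp

lemma Q_change_of_variables:
  assumes h: "Qintegrable h"
  shows "Qintegrable (\<lambda>x t. Ec x t * h (\<Phi>c x t) t)" and "Qint h = Qint (\<lambda>x t. Ec x t * h (\<Phi>c x t) t)"
proof -
  let ?h = "\<lambda>p. h (fst p) (snd p)"
  have hm: "?h \<in> borel_measurable (borel \<Otimes>\<^sub>M borel)" using borel_measurable_integrable[OF h] by simp
  have hT: "(\<lambda>p. ?h (T p)) \<in> borel_measurable unit_Q" using measurable_compose[OF T_meas hm] by simp
  have Em: "(\<lambda>p. Ec (fst p) (snd p)) \<in> borel_measurable unit_Q" using Ec_meas by simp
  have nn: "AE p in unit_Q. 0 \<le> Ec (fst p) (snd p)" using Ec_pos by (simp add: less_imp_le)
  have Td: "T \<in> density unit_Q (\<lambda>p. ennreal (Ec (fst p) (snd p))) \<rightarrow>\<^sub>M borel \<Otimes>\<^sub>M borel" using T_meas by simp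
  have "integrable (density unit_Q (\<lambda>p. ennreal (Ec (fst p) (snd p)))) (\<lambda>p. ?h (T p))"
    using h integrable_distr_eq[OF Td hm] unfolding distr_T by blast
  then have "integrable unit_Q (\<lambda>p. Ec (fst p) (snd p) *\<^sub>R ?h (T p))"
    using integrable_density[OF hT Em nn] by blast
  then show "Qintegrable (\<lambda>x t. Ec x t * h (\<Phi>c x t) t)" by (simp add: T_def)
  have "Qint h = integral\<^sup>L (density unit_Q (\<lambda>p. ennreal (Ec (fst p) (snd p)))) (\<lambda>p. ?h (T p))"
    using integral_distr[OF Td hm] unfolding distr_T .
  also have "\<dots> = integral\<^sup>L unit_Q (\<lambda>p. Ec (fst p) (snd p) *\<^sub>R ?h (T p))"
    by (rule integral_density[OF hT Em nn])
  finally show "Qint h = Qint (\<lambda>x t. Ec x t * h (\<Phi>c x t) t)" by (simp add: T_def)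
qed

text \<open>The density is strictly positive, so preimages of null sets under the map to Eulerian
  coordinates are null for the undistorted measure as well. Without this, almost everywhere defined
  functions could not be composed with the flow.\<close>

lemma Q_AE_Lagrangian:
  assumes "AE p in unit_Q. P (fst p) (snd p)"
  shows "AE p in unit_Q. P (\<Phi>c (fst p) (snd p)) (snd p)"
proof -
  have "AE p in distr (density unit_Q (\<lambda>p. ennreal (Ec (fst p) (snd p)))) (borel \<Otimes>\<^sub>M borel) T. P (fst p) (snd p)"
    unfolding distr_T by (rule assms)
  then have "AE p in density unit_Q (\<lambda>p. ennreal (Ec (fst p) (snd p))). P (fst (T p)) (snd (T p))"
    by (rule AE_distrD[rotated]) (use T_meas in simp)
  then have "AE p in unit_Q. 0 < ennreal (Ec (fst p) (snd p)) \<longrightarrow> P (fst (T p)) (snd (T p))"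
    by (subst (asm) AE_density) (use Ec_meas in auto)
  then show ?thesis by eventually_elim (use Ec_pos in \<open>simp add: T_def\<close>)
qed

lemma slice_AE_Lagrangian:
  assumes "AE x in unit_B. P x" "t \<in> {0..1}"
  shows "AE x in unit_B. P (\<Phi>c x t)"
proof -
  note m = Qmeas_slice(1)[OF \<Phi>c_meas, of t] Qmeas_slice(1)[OF Ec_meas, of t]
  have "AE x in distr (density unit_B (\<lambda>x. ennreal (Ec x t))) borel (\<lambda>x. \<Phi>c x t). P x"
    unfolding distr_slice[OF assms(2)] by (rule assms)
  then have "AE x in density unit_B (\<lambda>x. ennreal (Ec x t)). P (\<Phi>c x t)"
    by (rule AE_distrD[rotated]) (use m in simp)
  then have "AE x in unit_B. 0 < ennreal (Ec x t) \<longrightarrow> P (\<Phi>c x t)"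
    by (subst (asm) AE_density) (use m in auto)
  then show ?thesis by eventually_elim (use Ec_pos in simp)
qed

lemma slice_integral_Lagrangian:
  fixes h :: "real \<Rightarrow> real"
  assumes h: "integrable unit_B h" and t: "t \<in> {0..1}"
  shows "integrable unit_B (\<lambda>x. Ec x t * h (\<Phi>c x t))" "(\<integral>x. h x \<partial>unit_B) = (\<integral>x. Ec x t * h (\<Phi>c x t) \<partial>unit_B)"
proof -
  note m = Qmeas_slice(1)[OF \<Phi>c_meas, of t] Qmeas_slice(1)[OF Ec_meas, of t]
  have hm: "h \<in> borel_measurable borel" using borel_measurable_integrable[OF h] by simp
  have hT: "(\<lambda>x. h (\<Phi>c x t)) \<in> borel_measurable unit_B" using measurable_compose[OF m(1) hm] by simp
  have Em: "(\<lambda>x. Ec x t) \<in> borel_measurable unit_B" using m by simp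
  have nn: "AE x in unit_B. 0 \<le> Ec x t" using Ec_pos by (simp add: less_imp_le)
  have Td: "(\<lambda>x. \<Phi>c x t) \<in> density unit_B (\<lambda>x. ennreal (Ec x t)) \<rightarrow>\<^sub>M borel" using m by simp
  have "integrable (density unit_B (\<lambda>x. ennreal (Ec x t))) (\<lambda>x. h (\<Phi>c x t))"
    using h integrable_distr_eq[OF Td hm] unfolding distr_slice[OF t] by blast
  then show "integrable unit_B (\<lambda>x. Ec x t * h (\<Phi>c x t))"
    using integrable_density[OF hT Em nn] by simp
  have "(\<integral>x. h x \<partial>unit_B) = integral\<^sup>L (density unit_B (\<lambda>x. ennreal (Ec x t))) (\<lambda>x. h (\<Phi>c x t))"
    using integral_distr[OF Td hm] unfolding distr_slice[OF t] .
  then show "(\<integral>x. h x \<partial>unit_B) = (\<integral>x. Ec x t * h (\<Phi>c x t) \<partial>unit_B)"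
    using integral_density[OF hT Em nn] by simp
qed

end

text \<open>Supplies the limit at the end times that \<open>regular_test\<close> asks for when the
  boundary functional is integration against an integrable function.\<close>

lemma bsum_integral_tendsto:
  fixes h g :: "real \<Rightarrow> real"
  assumes h: "integrable unit_B h" and g: "g \<in> borel_measurable borel" "continuous_on {0..1} g"
  shows "(\<lambda>n. \<Sum>k\<le>Suc n. g (k / Suc n) * (\<integral>x. h x * poly (bern (Suc n) k) x \<partial>unit_B)) \<longlonglongrightarrow> (\<integral>x. h x * g x \<partial>unit_B)"
proof -
  have hm: "h \<in> borel_measurable borel" using borel_measurable_integrable[OF h] by simp
  obtain C where C: "\<And>x. x \<in> {0..1} \<Longrightarrow> \<bar>g x\<bar> \<le> C" by (rule abs_le_bound_on_unit_interval[OF g(2)]) blast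
  have ib: "integrable unit_B (\<lambda>x. h x * poly P x)" for P
    by (rule integrable_unit_B_mult_continuous[OF h]) (auto intro!: continuous_intros)
  have "(\<Sum>k\<le>Suc n. g (k / Suc n) * (\<integral>x. h x * poly (bern (Suc n) k) x \<partial>unit_B)) = (\<integral>x. h x * poly (bsum (Suc n) g) x \<partial>unit_B)" for n
  proof -
    have "(\<integral>x. h x * poly (bsum (Suc n) g) x \<partial>unit_B) = (\<integral>x. (\<Sum>k\<le>Suc n. g (k / Suc n) * (h x * poly (bern (Suc n) k) x)) \<partial>unit_B)"
      unfolding poly_bsum poly_bern sum_distrib_left by (simp only: mult.left_commute)
    also have "\<dots> = (\<Sum>k\<le>Suc n. \<integral>x. g (k / Suc n) * (h x * poly (bern (Suc n) k) x) \<partial>unit_B)"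
      by (rule Bochner_Integration.integral_sum) (use ib in simp)
    also have "\<dots> = (\<Sum>k\<le>Suc n. g (k / Suc n) * (\<integral>x. h x * poly (bern (Suc n) k) x \<partial>unit_B))"
      by (simp only: integral_mult_right_zero)
    finally show ?thesis by simp
  qed
  moreover have "(\<lambda>n. \<integral>x. h x * poly (bsum (Suc n) g) x \<partial>unit_B) \<longlonglongrightarrow> (\<integral>x. h x * g x \<partial>unit_B)"
  proof (rule integral_dominated_convergence[where w="\<lambda>x. \<bar>h x\<bar> * C"])
    show "AE x in unit_B. (\<lambda>n. h x * poly (bsum (Suc n) g) x) \<longlonglongrightarrow> h x * g x"
      using AE_unit_B_interior
    proof eventually_elim
      case (elim x)
      then show ?case by (intro tendsto_mult_left bsum_tendsto g(2)) auto
    qed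
    show "AE x in unit_B. norm (h x * poly (bsum (Suc n) g) x) \<le> \<bar>h x\<bar> * C" for n
      using AE_unit_B_interior
    proof eventually_elim
      case (elim x)
      then show ?case unfolding real_norm_def abs_mult by (intro mult_left_mono bsum_bound C) auto
    qed
  qed (use h hm g(1) in \<open>auto intro: borel_measurable_times\<close>)
  ultimately show ?thesis by simp
qed

context flow_transport
begin

lemma Lagrangian_test:
  fixes \<theta> :: "real poly"
  assumes \<gamma>\<alpha>: "\<And>x t. \<gamma> x t = \<alpha> x t * V x t"
    and lim: "(\<lambda>n. \<Sum>k\<le>Suc n. (Xc (k / Suc n) 1 ^ j * poly \<theta> 1) * B1 (bern (Suc n) k)
        - (Xc (k / Suc n) 0 ^ j * poly \<theta> 0) * B0 (bern (Suc n) k)) \<longlonglongrightarrow> R"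
  shows "Qint (\<lambda>x t. x ^ j * (Ec x t * (\<alpha> (\<Phi>c x t) t * poly (pderiv \<theta>) t + \<beta> (\<Phi>c x t) t * poly \<theta> t))) = R"
    and "Qintegrable (\<lambda>x t. Ec x t * (\<alpha> (\<Phi>c x t) t * poly (pderiv \<theta>) t + \<beta> (\<Phi>c x t) t * poly \<theta> t))"
proof -
  obtain C1 where C1: "C1 \<ge> 0" "\<And>x. x \<in> {0..1} \<Longrightarrow> \<bar>poly \<theta> x\<bar> \<le> C1" by (rule poly_bounded_unit[where P=\<theta>]) blast
  obtain C2 where C2: "C2 \<ge> 0" "\<And>x. x \<in> {0..1} \<Longrightarrow> \<bar>poly (pderiv \<theta>) x\<bar> \<le> C2" by (rule poly_bounded_unit[where P="pderiv \<theta>"]) blast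
  have mp: "Qmeas (\<lambda>x t. poly \<theta> t)" "Qmeas (\<lambda>x t. poly (pderiv \<theta>) t)" by (intro Qmeas_snd borel_measurable_poly)+
  have mX [measurable]: "Qmeas Xc" unfolding Xc_def by (rule Qmeas_clamp[OF X_continuous])
  define G where "G x t = \<alpha> x t * poly (pderiv \<theta>) t + \<beta> x t * poly \<theta> t" for x t
  have i1: "Qintegrable (\<lambda>x t. \<alpha> x t * poly (pderiv \<theta>) t)" "Qintegrable (\<lambda>x t. \<beta> x t * poly \<theta> t)"
    by (rule Qintegrable_mult_bounded[OF \<alpha> mp(2), of C2] Qintegrable_mult_bounded[OF \<beta> mp(1), of C1]; use C1 C2 in force)+
  have G: "Qintegrable G" unfolding G_def using i1 by simp
  show EG: "Qintegrable (\<lambda>x t. Ec x t * (\<alpha> (\<Phi>c x t) t * poly (pderiv \<theta>) t + \<beta> (\<Phi>c x t) t * poly \<theta> t))"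
    using Q_change_of_variables(1)[OF G] by (simp add: G_def)
  have Xb: "\<bar>Xc x t ^ j\<bar> \<le> 1" for x t
    using X(1)[OF clamp01_range clamp01_range, of x t] by (simp add: Xc_def power_abs power_le_one)
  have GX: "Qintegrable (\<lambda>x t. G x t * Xc x t ^ j)"
    by (rule Qintegrable_mult_bounded[OF G, of _ 1]) (use mX Xb in auto)
  have "R = Qint (\<lambda>x t. G x t * Xc x t ^ j)"
    using characteristic_test[OF \<gamma>\<alpha> lim] by (simp add: G_def mult.commute)
  also have "\<dots> = Qint (\<lambda>x t. Ec x t * (G (\<Phi>c x t) t * Xc (\<Phi>c x t) t ^ j))"
    by (rule Q_change_of_variables(2)[OF GX])
  also have "\<dots> = Qint (\<lambda>x t. x ^ j * (Ec x t * G (\<Phi>c x t) t))"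
  proof (rule integral_cong_AE)
    have m1: "(\<lambda>p. Ec (fst p) (snd p) * (G (\<Phi>c (fst p) (snd p)) (snd p) * Xc (\<Phi>c (fst p) (snd p)) (snd p) ^ j)) \<in> borel_measurable unit_Q"
      using borel_measurable_integrable[OF Q_change_of_variables(1)[OF GX]] .
    have m2: "(\<lambda>p. Ec (fst p) (snd p) * G (\<Phi>c (fst p) (snd p)) (snd p)) \<in> borel_measurable unit_Q"
      using borel_measurable_integrable[OF Q_change_of_variables(1)[OF G]] .
    show "(\<lambda>p. Ec (fst p) (snd p) * (G (\<Phi>c (fst p) (snd p)) (snd p) * Xc (\<Phi>c (fst p) (snd p)) (snd p) ^ j)) \<in> borel_measurable unit_Q" by (rule m1)
    have m3: "(\<lambda>p. fst p ^ j) \<in> borel_measurable unit_Q" by simp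
    show "(\<lambda>p. fst p ^ j * (Ec (fst p) (snd p) * G (\<Phi>c (fst p) (snd p)) (snd p))) \<in> borel_measurable unit_Q"
      by (rule borel_measurable_times[OF m3 m2])
    show "AE p in unit_Q. Ec (fst p) (snd p) * (G (\<Phi>c (fst p) (snd p)) (snd p) * Xc (\<Phi>c (fst p) (snd p)) (snd p) ^ j)
        = fst p ^ j * (Ec (fst p) (snd p) * G (\<Phi>c (fst p) (snd p)) (snd p))"
      using AE_Q_interior
    proof eventually_elim
      case (elim p)
      then have x: "fst p \<in> {0..1}" "snd p \<in> {0..1}" by auto
      then have "Xc (\<Phi>c (fst p) (snd p)) (snd p) = fst p"
        using \<Phi>_range[OF x] X_\<Phi>[OF x] by (simp only: \<Phi>c Xc)
      then show ?case by (simp add: mult_ac)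
    qed
  qed
  finally show "Qint (\<lambda>x t. x ^ j * (Ec x t * (\<alpha> (\<Phi>c x t) t * poly (pderiv \<theta>) t + \<beta> (\<Phi>c x t) t * poly \<theta> t))) = R"
    by (simp add: G_def)
qed

end

text \<open>By Fubini the time integral of \<open>h\<close> and the function \<open>r\<close> have
  the same moments in x.\<close>

lemma Q_moments_zero:
  assumes h: "Qintegrable h" and r: "integrable unit_B r"
    and mom: "\<And>j. Qint (\<lambda>x t. x ^ j * h x t) = (\<integral>x. r x * x ^ j \<partial>unit_B)"
  shows "AE x in unit_B. (\<integral>t. h x t \<partial>unit_B) = r x"
proof -
  define H where "H x = (\<integral>t. h x t \<partial>unit_B) - r x" for x
  have Hi: "integrable unit_B (\<lambda>x. \<integral>t. h x t \<partial>unit_B)" by (rule Q_Fubini(5)[OF h])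
  have iH: "integrable unit_B H" unfolding H_def[abs_def] using Hi r by simp
  have "(\<integral>x. H x * x ^ j \<partial>unit_B) = 0" for j
  proof -
    have "Qintegrable (\<lambda>x t. h x t * x ^ j)"
      by (rule Qintegrable_mult_bounded[OF h, of _ 1]) (auto simp: power_abs power_le_one)
    then have "Qint (\<lambda>x t. x ^ j * h x t) = (\<integral>x. (\<integral>t. x ^ j * h x t \<partial>unit_B) \<partial>unit_B)"
      by (intro Q_Fubini(1)) (simp add: mult.commute)
    also have "\<dots> = (\<integral>x. (\<integral>t. h x t \<partial>unit_B) * x ^ j \<partial>unit_B)" by (simp add: mult.commute)
    finally have "(\<integral>x. (\<integral>t. h x t \<partial>unit_B) * x ^ j \<partial>unit_B) = (\<integral>x. r x * x ^ j \<partial>unit_B)" using mom[of j] by simp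
    moreover have "integrable unit_B (\<lambda>x. (\<integral>t. h x t \<partial>unit_B) * x ^ j)" "integrable unit_B (\<lambda>x. r x * x ^ j)"
      by (intro integrable_unit_B_mult_continuous Hi r; auto intro!: continuous_intros)+
    ultimately show ?thesis by (simp add: H_def left_diff_distrib)
  qed
  from moments_zero_imp_AE_zero[OF iH this] show ?thesis by eventually_elim (simp add: H_def)
qed

subsection \<open>The weak equations as transport problems\<close>

lemma borel_repI:
  assumes "Qmeas U" "\<And>x t. x \<in> {0<..<1} \<Longrightarrow> t \<in> {0<..<1} \<Longrightarrow> u x t = U x t"
  shows "borel_rep u U"
  unfolding borel_rep_def
proof (intro conjI assms(1))
  show "AE t in unit_B. AE x in unit_B. u x t = U x t"
    using AE_unit_B_interior
  proof eventually_elim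
    case (elim t)
    show ?case using AE_unit_B_interior by eventually_elim (use elim assms(2) in simp)
  qed
qed

lemma borel_rep_binop:
  assumes u: "borel_rep u U" and w: "borel_rep w W" and m: "Qmeas (\<lambda>x t. g (U x t) (W x t))"
  shows "borel_rep (\<lambda>x t. g (u x t) (w x t)) (\<lambda>x t. g (U x t) (W x t))"
  unfolding borel_rep_def
proof (intro conjI m)
  have "AE t in unit_B. AE x in unit_B. u x t = U x t" "AE t in unit_B. AE x in unit_B. w x t = W x t"
    using u w by (auto simp: borel_rep_def)
  then show "AE t in unit_B. AE x in unit_B. g (u x t) (w x t) = g (U x t) (W x t)"
  proof eventually_elim
    case (elim t)
    from elim(1) elim(2) show ?case by eventually_elim simp
  qed
qed

lemma borel_rep_mult: "borel_rep u U \<Longrightarrow> borel_rep w W \<Longrightarrow> borel_rep (\<lambda>x t. u x t * w x t) (\<lambda>x t. U x t * W x t)"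
  and borel_rep_add: "borel_rep u U \<Longrightarrow> borel_rep w W \<Longrightarrow> borel_rep (\<lambda>x t. u x t + w x t) (\<lambda>x t. U x t + W x t)"
  by (rule borel_rep_binop; assumption?; auto simp: borel_rep_def)+

lemma borel_rep_velocity:
  assumes "Qmeas V" "AE t in unit_B. \<forall>x\<in>{0..1}. v x t = V x t"
  shows "borel_rep v V"
  unfolding borel_rep_def
proof (intro conjI assms(1))
  show "AE t in unit_B. AE x in unit_B. v x t = V x t"
    using assms(2)
  proof eventually_elim
    case (elim t)
    show ?case using AE_unit_B_interior by eventually_elim (use elim in auto)
  qed
qed

lemma vector_derivative_unit_interval:
  fixes f :: "real \<Rightarrow> real"
  assumes "x \<in> {0..1}" "(f has_real_derivative D) (at x within {0..1})"
  shows "vector_derivative f (at x within {0..1}) = D"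
  using vector_derivative_within_cbox[of 0 1 x f D] assms
  by (simp add: has_real_derivative_iff_has_vector_derivative)

lemma dx_eq: "x \<in> {0..1} \<Longrightarrow> ((\<lambda>y. u y t) has_real_derivative D) (at x within {0..1}) \<Longrightarrow> dx u x t = D"
  and dt_eq: "t \<in> {0..1} \<Longrightarrow> ((\<lambda>s. u x s) has_real_derivative D) (at t within {0..1}) \<Longrightarrow> dt u x t = D"
  by (simp_all add: dx_def dt_def vector_derivative_unit_interval)

lemma Qintegrable_snd:
  assumes "integrable unit_B h"
  shows "Qintegrable (\<lambda>x t. h t)"
proof (rule Qintegrable_Fubini)
  show "Qmeas (\<lambda>x t. h t)" using borel_measurable_integrable[OF assms] by (intro Qmeas_snd) simp
qed (use assms in auto)

lemma Qintegrable_mult_squares: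
  assumes "Qmeas u" "Qintegrable (\<lambda>x t. (u x t)\<^sup>2)" "Qmeas w" "Qintegrable (\<lambda>x t. (w x t)\<^sup>2)"
  shows "Qintegrable (\<lambda>x t. u x t * w x t)"
proof (rule Qintegrable_bound[of "\<lambda>x t. (u x t)\<^sup>2 + (w x t)\<^sup>2"])
  show "Qintegrable (\<lambda>x t. (u x t)\<^sup>2 + (w x t)\<^sup>2)" using assms by simp
  show "Qmeas (\<lambda>x t. u x t * w x t)" using assms(1,3) by measurable
  fix x t
  have "2 * \<bar>u x t\<bar> * \<bar>w x t\<bar> \<le> \<bar>u x t\<bar>\<^sup>2 + \<bar>w x t\<bar>\<^sup>2" by (rule sum_squares_bound)
  then have "2 * (\<bar>u x t\<bar> * \<bar>w x t\<bar>) \<le> (u x t)\<^sup>2 + (w x t)\<^sup>2" by (simp only: power2_abs mult.assoc)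
  moreover have "0 \<le> \<bar>u x t\<bar> * \<bar>w x t\<bar>" by simp
  ultimately have "\<bar>u x t\<bar> * \<bar>w x t\<bar> \<le> (u x t)\<^sup>2 + (w x t)\<^sup>2"
    by linarith
  then show "\<bar>u x t * w x t\<bar> \<le> \<bar>(u x t)\<^sup>2 + (w x t)\<^sup>2\<bar>" by (simp add: abs_mult)
qed

lemma smooth1_power: "smooth1 (\<lambda>x. x ^ k)"
  using smooth1_poly[of "monom 1 k"] by (simp add: poly_monom[abs_def])

context velocity
begin

lemma mult_L_integrable:
  assumes "Qmeas F" "Qintegrable (\<lambda>x t. (F x t)\<^sup>2)"
  shows "Qintegrable (\<lambda>x t. F x t * L t)"
  by (rule Qintegrable_mult_squares[OF assms, of "\<lambda>x t. L t"])
    (use Qintegrable_snd[OF L_square] Qmeas_snd[OF L_meas] in auto)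

lemma mult_W_integrable:
  assumes "Qmeas F" "Qintegrable (\<lambda>x t. (F x t)\<^sup>2)"
  shows "Qintegrable (\<lambda>x t. F x t * W x t)"
proof (rule Qintegrable_bound[OF mult_L_integrable[OF assms]])
  show "Qmeas (\<lambda>x t. F x t * W x t)" using assms(1) by measurable
  fix x t :: real assume "x \<in> {0<..<1}"
  then show "\<bar>F x t * W x t\<bar> \<le> \<bar>F x t * L t\<bar>"
    using W_le[of x t] L_nonneg[of t] by (simp add: abs_mult mult_left_mono)
qed

lemma mult_V_integrable:
  assumes "Qmeas F" "Qintegrable (\<lambda>x t. (F x t)\<^sup>2)"
  shows "Qintegrable (\<lambda>x t. F x t * V x t)"
proof (rule Qintegrable_bound[OF mult_L_integrable[OF assms]])
  show "Qmeas (\<lambda>x t. F x t * V x t)" using assms(1) by measurable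
  fix x t :: real assume "x \<in> {0<..<1}"
  then show "\<bar>F x t * V x t\<bar> \<le> \<bar>F x t * L t\<bar>"
    using V_le[of x t] L_nonneg[of t] by (simp add: abs_mult mult_left_mono)
qed

text \<open>The tests \<open>poly P x * t ^ k\<close> are smooth up to the boundary, so both end
  data enter and no cutoff is involved. For fixed \<open>P\<close> the identities over all k are
  exactly the hypothesis of \<open>polynomial_weak_primitive\<close>.\<close>

lemma transport_of_transport_eq:
  assumes vV: "borel_rep v V" and wW: "borel_rep (\<lambda>x t. wd (\<lambda>y. v y t) x) W"
    and f: "borel_rep f F" "Qintegrable (\<lambda>x t. (F x t)\<^sup>2)" "Qintegrable F"
    and z: "borel_rep z Z" "Qintegrable (\<lambda>x t. (Z x t)\<^sup>2)" "Qintegrable Z"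
    and f0: "integrable unit_B F0" "AE x in unit_B. f0 x = F0 x"
    and f1: "integrable unit_B F1" "AE x in unit_B. f1 x = F1 x"
    and eq: "transport_eq f0 f1 f v z"
  shows "transport V W L F (\<lambda>x t. F x t * W x t + Z x t) (\<lambda>x t. F x t * V x t)
      (\<lambda>P. \<integral>x. F0 x * poly P x \<partial>unit_B) (\<lambda>P. \<integral>x. F1 x * poly P x \<partial>unit_B)"
proof
  have mF: "Qmeas F" using f(1) by (simp add: borel_rep_def)
  show "Qintegrable F" by (rule f(3))
  show "Qintegrable (\<lambda>x t. F x t * L t)" by (rule mult_L_integrable[OF mF f(2)])
  note FW = mult_W_integrable[OF mF f(2)] and FV = mult_V_integrable[OF mF f(2)]
  show \<beta>: "Qintegrable (\<lambda>x t. F x t * W x t + Z x t)" using FW z(3) by simp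
  show "Qintegrable (\<lambda>x t. F x t * V x t)" by (rule FV)
  fix P :: "real poly"
  obtain CP where CP: "\<And>x. x \<in> {0..1} \<Longrightarrow> \<bar>poly P x\<bar> \<le> CP" by (rule poly_bounded_unit[where P=P]) blast
  obtain CD where CD: "\<And>x. x \<in> {0..1} \<Longrightarrow> \<bar>poly (pderiv P) x\<bar> \<le> CD" by (rule poly_bounded_unit[where P="pderiv P"]) blast
  have Pm: "Qmeas (\<lambda>x t. poly P x)" "Qmeas (\<lambda>x t. poly (pderiv P) x)" by (intro Qmeas_fst borel_measurable_poly)+
  define m where "m t = (\<integral>x. F x t * poly P x \<partial>unit_B)" for t
  define g where "g t = (\<integral>x. (F x t * W x t + Z x t) * poly P x + F x t * V x t * poly (pderiv P) x \<partial>unit_B)" for t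
  have i: "Qintegrable (\<lambda>x t. F x t * poly P x)" "Qintegrable (\<lambda>x t. F x t * W x t * poly P x)"
    "Qintegrable (\<lambda>x t. Z x t * poly P x)" "Qintegrable (\<lambda>x t. F x t * V x t * poly (pderiv P) x)"
    by (rule Qintegrable_mult_bounded[OF f(3) Pm(1), of CP] Qintegrable_mult_bounded[OF FW Pm(1), of CP]
        Qintegrable_mult_bounded[OF z(3) Pm(1), of CP] Qintegrable_mult_bounded[OF FV Pm(2), of CD]; use CP CD in force)+
  have ig: "Qintegrable (\<lambda>x t. (F x t * W x t + Z x t) * poly P x + F x t * V x t * poly (pderiv P) x)"
    using i by (simp add: distrib_right)
  have im: "integrable unit_B m" unfolding m_def by (rule Q_Fubini(6)[OF i(1)])
  have igg: "integrable unit_B g" unfolding g_def by (rule Q_Fubini(6)[OF ig])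
  define d where "d = (\<integral>x. F1 x * poly P x \<partial>unit_B)"
  define c where "c = (\<integral>x. F0 x * poly P x \<partial>unit_B)"
  have weak: "(\<integral>t. m t * (real k * t ^ (k - 1)) + g t * t ^ k \<partial>unit_B) = d - c * 0 ^ k" for k
  proof -
    define \<phi> where "\<phi> x t = poly P x * t ^ k" for x t
    have \<phi>: "\<phi> \<in> smooth2 {0..1} {0..1}"
      unfolding \<phi>_def[abs_def] by (intro smooth2_product smooth1_poly smooth1_power)
    have tm: "Qmeas (\<lambda>x t. real k * t ^ (k - 1))" "Qmeas (\<lambda>x t. t ^ k)" by (intro Qmeas_snd; measurable)+
    have tb: "\<bar>real k * t ^ (k - 1)\<bar> \<le> real k" "\<bar>t ^ k\<bar> \<le> 1" if "t \<in> {0<..<1}" for t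
    proof -
      have "\<bar>t ^ (k - 1)\<bar> \<le> 1" using that by (simp add: power_abs power_le_one)
      from mult_left_mono[OF this, of "real k"] show "\<bar>real k * t ^ (k - 1)\<bar> \<le> real k" by (simp add: abs_mult)
      show "\<bar>t ^ k\<bar> \<le> 1" using that by (simp add: power_abs power_le_one)
    qed
    have \<phi>t: "dt \<phi> x t = poly P x * (real k * t ^ (k - 1))" if "t \<in> {0<..<1}" for x t
    proof (rule dt_eq)
      have "((\<lambda>s. s ^ k) has_real_derivative real k * t ^ (k - 1)) (at t within {0..1})"
        using DERIV_subset[OF DERIV_pow[of k t] subset_UNIV] by simp
      then show "((\<lambda>s. \<phi> x s) has_real_derivative poly P x * (real k * t ^ (k - 1))) (at t within {0..1})"
        unfolding \<phi>_def by (rule DERIV_cmult)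
    qed (use that in auto)
    have \<phi>x: "dx \<phi> x t = poly (pderiv P) x * t ^ k" if "x \<in> {0<..<1}" for x t
    proof (rule dx_eq)
      show "((\<lambda>y. \<phi> y t) has_real_derivative poly (pderiv P) x * t ^ k) (at x within {0..1})"
        unfolding \<phi>_def by (intro DERIV_cmult_right DERIV_subset[OF poly_DERIV subset_UNIV])
    qed (use that in auto)
    have r\<phi>t: "borel_rep (dt \<phi>) (\<lambda>x t. poly P x * (real k * t ^ (k - 1)))"
      by (rule borel_repI) (use Pm tm \<phi>t in \<open>auto intro: borel_measurable_times\<close>)
    have r\<phi>x: "borel_rep (dx \<phi>) (\<lambda>x t. poly (pderiv P) x * t ^ k)"
      by (rule borel_repI) (use Pm tm \<phi>x in \<open>auto intro: borel_measurable_times\<close>)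
    have r\<phi>: "borel_rep \<phi> (\<lambda>x t. poly P x * t ^ k)"
      by (rule borel_repI) (use Pm tm in \<open>auto intro: borel_measurable_times simp: \<phi>_def\<close>)
    have j: "Qintegrable (\<lambda>x t. F x t * poly P x * (real k * t ^ (k - 1)))"
      "Qintegrable (\<lambda>x t. F x t * W x t * poly P x * t ^ k)" "Qintegrable (\<lambda>x t. Z x t * poly P x * t ^ k)"
      "Qintegrable (\<lambda>x t. F x t * V x t * poly (pderiv P) x * t ^ k)"
      by (rule Qintegrable_mult_bounded[OF i(1) tm(1), of "real k"] Qintegrable_mult_bounded[OF i(2) tm(2), of 1]
          Qintegrable_mult_bounded[OF i(3) tm(2), of 1] Qintegrable_mult_bounded[OF i(4) tm(2), of 1]; use tb in blast)+
    have e1: "iint (\<lambda>x t. f x t * dt \<phi> x t) = Qint (\<lambda>x t. F x t * poly P x * (real k * t ^ (k - 1)))"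
      using iint_eq_Qint[OF borel_rep_mult[OF f(1) r\<phi>t]] j(1) by (simp add: mult.assoc)
    have e2: "iint (\<lambda>x t. f x t * \<phi> x t * wd (\<lambda>y. v y t) x) = Qint (\<lambda>x t. F x t * W x t * poly P x * t ^ k)"
      using iint_eq_Qint[OF borel_rep_mult[OF borel_rep_mult[OF f(1) r\<phi>] wW]] j(2) by (simp add: mult_ac)
    have e3: "iint (\<lambda>x t. f x t * dx \<phi> x t * v x t) = Qint (\<lambda>x t. F x t * V x t * poly (pderiv P) x * t ^ k)"
      using iint_eq_Qint[OF borel_rep_mult[OF borel_rep_mult[OF f(1) r\<phi>x] vV]] j(4) by (simp add: mult_ac)
    have e4: "iint (\<lambda>x t. \<phi> x t * z x t) = Qint (\<lambda>x t. Z x t * poly P x * t ^ k)"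
      using iint_eq_Qint[OF borel_rep_mult[OF r\<phi> z(1)]] j(3) by (simp add: mult_ac)
    have b: "(\<integral>x. h x * \<phi> x s \<partial>unit_I) = (\<integral>x. H x * poly P x \<partial>unit_B) * s ^ k"
      if h: "integrable unit_B H" "AE x in unit_B. h x = H x" for h H and s :: real
    proof -
      have "H \<in> borel_measurable borel" using borel_measurable_integrable[OF h(1)] by simp
      then have mm: "(\<lambda>x. H x * poly P x * s ^ k) \<in> borel_measurable borel" by measurable
      have "AE x in unit_B. h x * \<phi> x s = H x * poly P x * s ^ k" using h(2) by eventually_elim (simp add: \<phi>_def)
      from unit_I_AE(2)[OF mm this] show ?thesis by simp
    qed
    have "- Qint (\<lambda>x t. F x t * poly P x * (real k * t ^ (k - 1))) + d * 1 ^ k - c * 0 ^ k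
        = Qint (\<lambda>x t. F x t * W x t * poly P x * t ^ k) + Qint (\<lambda>x t. F x t * V x t * poly (pderiv P) x * t ^ k)
          + Qint (\<lambda>x t. Z x t * poly P x * t ^ k)"
      using eq[unfolded transport_eq_def, rule_format, OF \<phi>] unfolding e1 e2 e3 e4 b[OF f0] b[OF f1] c_def d_def .
    then have "d - c * 0 ^ k = Qint (\<lambda>x t. F x t * poly P x * (real k * t ^ (k - 1)) + (F x t * W x t * poly P x * t ^ k
        + Z x t * poly P x * t ^ k + F x t * V x t * poly (pderiv P) x * t ^ k))"
      using j by simp
    also have "\<dots> = (\<integral>t. (\<integral>x. F x t * poly P x * (real k * t ^ (k - 1)) + (F x t * W x t * poly P x * t ^ k
        + Z x t * poly P x * t ^ k + F x t * V x t * poly (pderiv P) x * t ^ k) \<partial>unit_B) \<partial>unit_B)"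
      by (rule Q_Fubini(2)) (use j in simp)
    also have "\<dots> = (\<integral>t. m t * (real k * t ^ (k - 1)) + g t * t ^ k \<partial>unit_B)"
    proof (rule integral_cong_AE)
      show "(\<lambda>t. \<integral>x. F x t * poly P x * (real k * t ^ (k - 1)) + (F x t * W x t * poly P x * t ^ k
        + Z x t * poly P x * t ^ k + F x t * V x t * poly (pderiv P) x * t ^ k) \<partial>unit_B) \<in> borel_measurable unit_B"
        by (rule borel_measurable_integrable, rule Q_Fubini(6)) (use j in simp)
      show "(\<lambda>t. m t * (real k * t ^ (k - 1)) + g t * t ^ k) \<in> borel_measurable unit_B"
        using borel_measurable_integrable[OF im] borel_measurable_integrable[OF igg] by simp
      show "AE t in unit_B. (\<integral>x. F x t * poly P x * (real k * t ^ (k - 1)) + (F x t * W x t * poly P x * t ^ k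
        + Z x t * poly P x * t ^ k + F x t * V x t * poly (pderiv P) x * t ^ k) \<partial>unit_B) = m t * (real k * t ^ (k - 1)) + g t * t ^ k"
        using Q_Fubini(4)[OF i(1)] Q_Fubini(4)[OF ig]
      proof eventually_elim
        case (elim t)
        have "(\<integral>x. F x t * poly P x * (real k * t ^ (k - 1)) + (F x t * W x t * poly P x * t ^ k
          + Z x t * poly P x * t ^ k + F x t * V x t * poly (pderiv P) x * t ^ k) \<partial>unit_B)
          = (\<integral>x. F x t * poly P x * (real k * t ^ (k - 1)) + ((F x t * W x t + Z x t) * poly P x + F x t * V x t * poly (pderiv P) x) * t ^ k \<partial>unit_B)"
          by (simp add: distrib_right add.assoc)
        also have "\<dots> = m t * (real k * t ^ (k - 1)) + g t * t ^ k"
          unfolding m_def g_def using elim by (subst Bochner_Integration.integral_add) auto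
        finally show ?case .
      qed
    qed
    finally show ?thesis by simp
  qed
  show "AE t in unit_B. (\<integral>x. F x t * poly P x \<partial>unit_B) = (\<integral>x. F0 x * poly P x \<partial>unit_B)
      + prim (\<lambda>t. \<integral>x. (F x t * W x t + Z x t) * poly P x + F x t * V x t * poly (pderiv P) x \<partial>unit_B) t"
    using polynomial_weak_primitive(1)[OF im igg weak] unfolding m_def g_def c_def .
  show "(\<integral>x. F1 x * poly P x \<partial>unit_B) = (\<integral>x. F0 x * poly P x \<partial>unit_B)
      + integral {0..1} (\<lambda>t. \<integral>x. (F x t * W x t + Z x t) * poly P x + F x t * V x t * poly (pderiv P) x \<partial>unit_B)"
    using polynomial_weak_primitive(2)[OF im igg weak] unfolding d_def g_def c_def .
qed

text \<open>The cutoff functions cost nothing in the limit, because the velocity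
  vanishes on the boundary at a linear rate.\<close>

lemma transport_of_weak_continuity_eq:
  assumes vV: "borel_rep v V" and z: "borel_rep z Z" "Qintegrable (\<lambda>x t. (Z x t)\<^sup>2)" "Qintegrable Z"
    and eq: "weak_continuity_eq v z"
  obtains C0 C1 where "transport V W L Z (\<lambda>_ _. 0) (\<lambda>x t. Z x t * V x t) C0 C1"
proof -
  have mZ: "Qmeas Z" using z(1) by (auto simp: borel_rep_def)
  note ZV = mult_V_integrable[OF mZ z(2)] and ZL = mult_L_integrable[OF mZ z(2)]
  obtain cut :: "nat \<Rightarrow> real \<Rightarrow> real" and C where cut: "\<And>n. cut n \<in> test_fun" "\<And>n x. \<bar>cut n x\<bar> \<le> 1"
    "\<And>x. 0 < x \<Longrightarrow> x < 1 \<Longrightarrow> \<forall>\<^sub>F n in sequentially. cut n x = 1 \<and> deriv (cut n) x = 0"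
    "\<And>n x. 0 < x \<Longrightarrow> x < 1 \<Longrightarrow> \<bar>deriv (cut n) x\<bar> * min x (1 - x) \<le> C"
    by (rule cutoff_exists) blast
  define m where "m P t = (\<integral>x. Z x t * poly P x \<partial>unit_B)" for P t
  define g where "g P t = (\<integral>x. 0 * poly P x + Z x t * V x t * poly (pderiv P) x \<partial>unit_B)" for P t
  \<comment> \<open>No end values of z are prescribed: the constant is the mean value delivered by
    the du Bois-Reymond lemma, and \<open>C1\<close> is defined by the balance over the whole time
    interval.\<close>
  define C0 where "C0 P = (\<integral>t. m P t - prim (g P) t \<partial>unit_B)" for P
  define C1 where "C1 P = C0 P + integral {0..1} (g P)" for P
  have main: "AE t in unit_B. m P t = C0 P + prim (g P) t" for P
  proof -
    obtain CP where CP: "CP \<ge> 0" "\<And>x. x \<in> {0..1} \<Longrightarrow> \<bar>poly P x\<bar> \<le> CP" by (rule poly_bounded_unit[where P=P]) blast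
    obtain CD where CD: "CD \<ge> 0" "\<And>x. x \<in> {0..1} \<Longrightarrow> \<bar>poly (pderiv P) x\<bar> \<le> CD" by (rule poly_bounded_unit[where P="pderiv P"]) blast
    have Pm: "Qmeas (\<lambda>x t. poly P x)" "Qmeas (\<lambda>x t. poly (pderiv P) x)" by (intro Qmeas_fst borel_measurable_poly)+
    have i: "Qintegrable (\<lambda>x t. Z x t * poly P x)" "Qintegrable (\<lambda>x t. Z x t * V x t * poly (pderiv P) x)"
      by (rule Qintegrable_mult_bounded[OF z(3) Pm(1), of CP] Qintegrable_mult_bounded[OF ZV Pm(2), of CD]; use CP CD in force)+
    have im: "integrable unit_B (m P)" unfolding m_def by (rule Q_Fubini(6)[OF i(1)])
    have ig: "integrable unit_B (g P)" unfolding g_def using Q_Fubini(6)[OF i(2)] by simp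
    have gm: "g P \<in> borel_measurable borel" using borel_measurable_integrable[OF ig] by simp
    have ga: "g P absolutely_integrable_on {0..1}" using ig unit_B_absolutely_integrable(1)[OF gm] by blast
    have ip: "integrable unit_B (prim (g P))"
      by (intro integrable_unit_B_continuous prim_continuous[OF ga])
    define h where "h t = m P t - prim (g P) t" for t
    have ih: "integrable unit_B h" unfolding h_def[abs_def] using im ip by simp
    have test: "(\<integral>t. h t * deriv b t \<partial>unit_B) = 0" if b: "b \<in> test_fun" for b
    proof -
      note tb = test_fun_facts[OF b]
      obtain Cb where Cb: "\<And>t. t \<in> {0..1} \<Longrightarrow> \<bar>b t\<bar> \<le> Cb" by (rule abs_le_bound_on_unit_interval[OF tb(3)]) blast
      obtain Cd where Cd: "\<And>t. t \<in> {0..1} \<Longrightarrow> \<bar>deriv b t\<bar> \<le> Cd" by (rule abs_le_bound_on_unit_interval[OF tb(4)]) blast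
      have bm: "Qmeas (\<lambda>x t. b t)" "Qmeas (\<lambda>x t. deriv b t)" by (intro Qmeas_snd tb)+
      have j: "Qintegrable (\<lambda>x t. Z x t * poly P x * deriv b t)" "Qintegrable (\<lambda>x t. Z x t * V x t * poly (pderiv P) x * b t)"
        by (rule Qintegrable_mult_bounded[OF i(1) bm(2), of Cd] Qintegrable_mult_bounded[OF i(2) bm(1), of Cb]; use Cb Cd in force)+
      define a where "a n x = poly P x * cut n x" for n x
      define a' where "a' n x = poly (pderiv P) x * cut n x + poly P x * deriv (cut n) x" for n x
      have at: "a n \<in> test_fun" for n unfolding a_def[abs_def] by (intro test_fun_mult smooth1_poly cut(1))
      have da: "(a n has_real_derivative a' n x) (at x within {0..1})" for n x
        unfolding a_def a'_def
        by (rule DERIV_cong[OF DERIV_mult[OF DERIV_subset[OF poly_DERIV subset_UNIV] test_fun_facts(1)[OF cut(1)]]]) (simp add: mult.commute)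
      have am: "a n \<in> borel_measurable borel" "a' n \<in> borel_measurable borel" for n
        unfolding a_def[abs_def] a'_def[abs_def] using test_fun_facts(5,6)[OF cut(1)[of n]] by measurable
      have amQ: "Qmeas (\<lambda>x t. a n x)" "Qmeas (\<lambda>x t. a' n x)" for n by (intro Qmeas_fst am)+
      have ab: "\<bar>a n x\<bar> \<le> CP" if "x \<in> {0<..<1}" for n x
      proof -
        have "\<bar>poly P x\<bar> * \<bar>cut n x\<bar> \<le> CP * 1" using CP cut(2) that by (intro mult_mono) auto
        then show ?thesis by (simp add: a_def abs_mult)
      qed
      have Va: "\<bar>V x t * a' n x\<bar> \<le> (CD + CP * C) * L t" if x: "x \<in> {0<..<1}" for n x t
      proof -
        \<comment> \<open>The Lipschitz bound is used against both end points, where the velocity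
          vanishes; the factor \<open>min x (1 - x)\<close> absorbs the derivative of the
          cutoff.\<close>
        have "\<bar>V x t\<bar> \<le> L t * min x (1 - x)"
          using V_lipschitz[of x 0 t] V_lipschitz[of x 1 t] V_0[of t] V_1[of t] x by (auto simp: min_def)
        then have "\<bar>V x t\<bar> * \<bar>deriv (cut n) x\<bar> \<le> L t * min x (1 - x) * \<bar>deriv (cut n) x\<bar>" by (rule mult_right_mono) simp
        also have "\<dots> = L t * (\<bar>deriv (cut n) x\<bar> * min x (1 - x))" by (simp add: mult_ac)
        also have "\<dots> \<le> L t * C" using cut(4)[of x n] x L_nonneg by (intro mult_left_mono) auto
        finally have vb: "\<bar>V x t\<bar> * \<bar>deriv (cut n) x\<bar> \<le> L t * C" .
        have "\<bar>poly P x\<bar> * (\<bar>V x t\<bar> * \<bar>deriv (cut n) x\<bar>) \<le> CP * (L t * C)"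
          using CP(1) x by (intro mult_mono[OF CP(2) vb]) auto
        moreover have "\<bar>poly (pderiv P) x\<bar> * \<bar>cut n x\<bar> * \<bar>V x t\<bar> \<le> CD * 1 * L t"
          using CD cut(2) V_le[of x t] x by (intro mult_mono) auto
        moreover have "\<bar>V x t * a' n x\<bar> \<le> \<bar>poly (pderiv P) x\<bar> * \<bar>cut n x\<bar> * \<bar>V x t\<bar> + \<bar>poly P x\<bar> * (\<bar>V x t\<bar> * \<bar>deriv (cut n) x\<bar>)"
        proof -
          have "V x t * a' n x = poly (pderiv P) x * cut n x * V x t + poly P x * (V x t * deriv (cut n) x)"
            by (simp add: a'_def algebra_simps)
          then show ?thesis by (simp only: abs_mult[symmetric] abs_triangle_ineq)
        qed
        ultimately show ?thesis by (simp add: algebra_simps)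
      qed
      have Z0: "Qint (\<lambda>x t. Z x t * a n x * deriv b t + Z x t * V x t * a' n x * b t) = 0" for n
      proof -
        define \<phi> where "\<phi> x t = a n x * b t" for x t
        have \<phi>: "\<phi> \<in> test_fun2" unfolding \<phi>_def[abs_def] by (rule test_fun2_product[OF at b])
        have r1: "borel_rep (dt \<phi>) (\<lambda>x t. a n x * deriv b t)"
        proof (rule borel_repI)
          show "Qmeas (\<lambda>x t. a n x * deriv b t)" using amQ(1)[of n] bm(2) by measurable
          show "dt \<phi> x t = a n x * deriv b t" if "t \<in> {0<..<1}" for x t
            by (rule dt_eq) (use that in \<open>auto simp: \<phi>_def intro!: DERIV_cmult tb(1)\<close>)
        qed
        have r2: "borel_rep (dx \<phi>) (\<lambda>x t. a' n x * b t)"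
        proof (rule borel_repI)
          show "Qmeas (\<lambda>x t. a' n x * b t)" using amQ(2)[of n] bm(1) by measurable
          show "dx \<phi> x t = a' n x * b t" if "x \<in> {0<..<1}" for x t
            by (rule dx_eq) (use that in \<open>auto simp: \<phi>_def intro!: DERIV_cmult_right da\<close>)
        qed
        have k1: "Qintegrable (\<lambda>x t. Z x t * a n x)"
          by (rule Qintegrable_mult_bounded[OF z(3) amQ(1)[of n], of CP]) (use ab in blast)
        have k2: "Qintegrable (\<lambda>x t. Z x t * V x t * a' n x)"
        proof (rule Qintegrable_bound[of "\<lambda>x t. (CD + CP * C) * (Z x t * L t)"])
          show "Qintegrable (\<lambda>x t. (CD + CP * C) * (Z x t * L t))" using ZL by simp
          show "Qmeas (\<lambda>x t. Z x t * V x t * a' n x)" using mZ amQ(2)[of n] by measurable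
          fix x t :: real assume x: "x \<in> {0<..<1}"
          have "\<bar>Z x t\<bar> * \<bar>V x t * a' n x\<bar> \<le> \<bar>Z x t\<bar> * ((CD + CP * C) * L t)"
            using Va[OF x] by (intro mult_left_mono) auto
          also have "\<dots> \<le> \<bar>(CD + CP * C) * (Z x t * L t)\<bar>"
          proof -
            have "(CD + CP * C) * L t \<le> \<bar>CD + CP * C\<bar> * \<bar>L t\<bar>" by (simp add: abs_mult[symmetric])
            then have "\<bar>Z x t\<bar> * ((CD + CP * C) * L t) \<le> \<bar>Z x t\<bar> * (\<bar>CD + CP * C\<bar> * \<bar>L t\<bar>)" by (intro mult_left_mono) auto
            then show ?thesis by (simp add: abs_mult mult_ac)
          qed
          finally show "\<bar>Z x t * V x t * a' n x\<bar> \<le> \<bar>(CD + CP * C) * (Z x t * L t)\<bar>" by (simp add: abs_mult mult_ac)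
        qed
        have k: "Qintegrable (\<lambda>x t. Z x t * a n x * deriv b t)" "Qintegrable (\<lambda>x t. Z x t * V x t * a' n x * b t)"
          by (rule Qintegrable_mult_bounded[OF k1 bm(2), of Cd] Qintegrable_mult_bounded[OF k2 bm(1), of Cb]; use Cb Cd in force)+
        have "iint (\<lambda>x t. z x t * dt \<phi> x t + z x t * v x t * dx \<phi> x t) = Qint (\<lambda>x t. Z x t * (a n x * deriv b t) + Z x t * V x t * (a' n x * b t))"
          by (rule iint_eq_Qint[OF borel_rep_add[OF borel_rep_mult[OF z(1) r1] borel_rep_mult[OF borel_rep_mult[OF z(1) vV] r2]]])
            (use k in \<open>simp add: mult.assoc\<close>)
        then show ?thesis using eq \<phi> unfolding weak_continuity_eq_def by (simp add: mult.assoc)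
      qed
      have "(\<lambda>n. Qint (\<lambda>x t. Z x t * a n x * deriv b t + Z x t * V x t * a' n x * b t)) \<longlonglongrightarrow>
          Qint (\<lambda>x t. Z x t * poly P x * deriv b t + Z x t * V x t * poly (pderiv P) x * b t)"
      proof (rule integral_dominated_convergence[where w="\<lambda>p. \<bar>Z (fst p) (snd p)\<bar> * (CP * Cd) + (CD + CP * C) * \<bar>Z (fst p) (snd p) * L (snd p)\<bar> * Cb"])
        show "(\<lambda>p. Z (fst p) (snd p) * poly P (fst p) * deriv b (snd p) + Z (fst p) (snd p) * V (fst p) (snd p) * poly (pderiv P) (fst p) * b (snd p)) \<in> borel_measurable unit_Q"
          using borel_measurable_integrable[OF j(1)] borel_measurable_integrable[OF j(2)] by (rule borel_measurable_add)
        show "(\<lambda>p. Z (fst p) (snd p) * a n (fst p) * deriv b (snd p) + Z (fst p) (snd p) * V (fst p) (snd p) * a' n (fst p) * b (snd p)) \<in> borel_measurable unit_Q" for n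
          using mZ amQ[of n] bm V_meas by simp
        show "integrable unit_Q (\<lambda>p. \<bar>Z (fst p) (snd p)\<bar> * (CP * Cd) + (CD + CP * C) * \<bar>Z (fst p) (snd p) * L (snd p)\<bar> * Cb)"
          using z(3) ZL by simp
        show "AE p in unit_Q. (\<lambda>n. Z (fst p) (snd p) * a n (fst p) * deriv b (snd p) + Z (fst p) (snd p) * V (fst p) (snd p) * a' n (fst p) * b (snd p))
            \<longlonglongrightarrow> Z (fst p) (snd p) * poly P (fst p) * deriv b (snd p) + Z (fst p) (snd p) * V (fst p) (snd p) * poly (pderiv P) (fst p) * b (snd p)"
          using AE_Q_interior
        proof eventually_elim
          case (elim p)
          then have "\<forall>\<^sub>F n in sequentially. cut n (fst p) = 1 \<and> deriv (cut n) (fst p) = 0" using cut(3) by auto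
          then have "\<forall>\<^sub>F n in sequentially. Z (fst p) (snd p) * a n (fst p) * deriv b (snd p) + Z (fst p) (snd p) * V (fst p) (snd p) * a' n (fst p) * b (snd p)
              = Z (fst p) (snd p) * poly P (fst p) * deriv b (snd p) + Z (fst p) (snd p) * V (fst p) (snd p) * poly (pderiv P) (fst p) * b (snd p)"
            by eventually_elim (simp add: a_def a'_def)
          then show ?case by (rule tendsto_eventually)
        qed
        show "AE p in unit_Q. norm (Z (fst p) (snd p) * a n (fst p) * deriv b (snd p) + Z (fst p) (snd p) * V (fst p) (snd p) * a' n (fst p) * b (snd p))
            \<le> \<bar>Z (fst p) (snd p)\<bar> * (CP * Cd) + (CD + CP * C) * \<bar>Z (fst p) (snd p) * L (snd p)\<bar> * Cb" for n
          using AE_Q_interior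
        proof eventually_elim
          case (elim p)
          define x t where "x = fst p" and "t = snd p"
          have xt: "x \<in> {0<..<1}" "t \<in> {0..1}" using elim by (auto simp: x_def t_def)
          have "\<bar>a n x\<bar> * \<bar>deriv b t\<bar> \<le> CP * Cd" using ab[OF xt(1)] Cd[OF xt(2)] CP by (intro mult_mono) auto
          then have 1: "\<bar>Z x t\<bar> * (\<bar>a n x\<bar> * \<bar>deriv b t\<bar>) \<le> \<bar>Z x t\<bar> * (CP * Cd)" by (intro mult_left_mono) auto
          have "\<bar>V x t * a' n x\<bar> * \<bar>b t\<bar> \<le> (CD + CP * C) * L t * Cb"
            using Va[OF xt(1), of t n] Cb[OF xt(2)] by (intro mult_mono) (auto intro: order_trans[OF abs_ge_zero])
          then have 2: "\<bar>Z x t\<bar> * (\<bar>V x t * a' n x\<bar> * \<bar>b t\<bar>) \<le> \<bar>Z x t\<bar> * ((CD + CP * C) * L t * Cb)" by (intro mult_left_mono) auto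
          have "\<bar>Z x t * a n x * deriv b t + Z x t * V x t * a' n x * b t\<bar> \<le> \<bar>Z x t * a n x * deriv b t\<bar> + \<bar>Z x t * V x t * a' n x * b t\<bar>"
            by (rule abs_triangle_ineq)
          also have "\<dots> = \<bar>Z x t\<bar> * (\<bar>a n x\<bar> * \<bar>deriv b t\<bar>) + \<bar>Z x t\<bar> * (\<bar>V x t * a' n x\<bar> * \<bar>b t\<bar>)"
            by (simp add: abs_mult mult.assoc)
          also have "\<dots> \<le> \<bar>Z x t\<bar> * (CP * Cd) + \<bar>Z x t\<bar> * ((CD + CP * C) * L t * Cb)" using 1 2 by simp
          also have "\<dots> = \<bar>Z x t\<bar> * (CP * Cd) + (CD + CP * C) * \<bar>Z x t * L t\<bar> * Cb"
            using L_nonneg by (simp add: abs_mult mult_ac)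
          finally show ?case by (simp add: x_def t_def)
        qed
      qed
      then have "0 = Qint (\<lambda>x t. Z x t * poly P x * deriv b t + Z x t * V x t * poly (pderiv P) x * b t)"
        unfolding Z0 by (simp add: LIMSEQ_const_iff)
      also have "\<dots> = Qint (\<lambda>x t. Z x t * poly P x * deriv b t) + Qint (\<lambda>x t. Z x t * V x t * poly (pderiv P) x * b t)"
        using j by simp
      also have "Qint (\<lambda>x t. Z x t * poly P x * deriv b t) = (\<integral>t. m P t * deriv b t \<partial>unit_B)"
        using Q_Fubini(2)[OF j(1)] by (simp add: m_def)
      also have "Qint (\<lambda>x t. Z x t * V x t * poly (pderiv P) x * b t) = (\<integral>t. g P t * b t \<partial>unit_B)"
        using Q_Fubini(2)[OF j(2)] by (simp add: g_def)
      finally have "0 = (\<integral>t. m P t * deriv b t \<partial>unit_B) + (\<integral>t. g P t * b t \<partial>unit_B)" .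
      moreover have "(\<integral>t. prim (g P) t * deriv b t \<partial>unit_B) = integral {0..1} (g P) * b 1 - (\<integral>t. g P t * b t \<partial>unit_B)"
        by (rule integral_prim_by_parts[OF gm ig]) (use tb in auto)
      moreover have "b 1 = 0" using tb(2)[of 1] by simp
      moreover have "integrable unit_B (\<lambda>t. m P t * deriv b t)" "integrable unit_B (\<lambda>t. prim (g P) t * deriv b t)"
        by (intro integrable_unit_B_mult_continuous im ip tb)+
      ultimately show ?thesis by (simp add: h_def left_diff_distrib)
    qed
    have "AE t in unit_B. h t = (\<integral>t. h t \<partial>unit_B)" by (rule du_Bois_Reymond[OF ih test])
    then show ?thesis
      by eventually_elim (simp add: h_def[abs_def] C0_def[symmetric])
  qed
  show thesis
  proof (rule that[of C0 C1], unfold_locales)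
    show "Qintegrable Z" by (rule z(3))
    show "Qintegrable (\<lambda>x t. Z x t * L t)" by (rule ZL)
    show "Qintegrable (\<lambda>x t. 0)" by simp
    show "Qintegrable (\<lambda>x t. Z x t * V x t)" by (rule ZV)
    fix P
    show "AE t in unit_B. (\<integral>x. Z x t * poly P x \<partial>unit_B) = C0 P + prim (\<lambda>t. \<integral>x. 0 * poly P x + Z x t * V x t * poly (pderiv P) x \<partial>unit_B) t"
      using main[of P] unfolding m_def g_def .
    show "C1 P = C0 P + integral {0..1} (\<lambda>t. \<integral>x. 0 * poly P x + Z x t * V x t * poly (pderiv P) x \<partial>unit_B)"
      unfolding C1_def g_def ..
  qed
qed

end

subsection \<open>Solution along characteristics\<close>

context flow
begin

definition J :: "real \<Rightarrow> real \<Rightarrow> real" where "J x t = exp (- integral {0..t} (\<lambda>s. W (\<Phi> x s) s))"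

lemma E_J: "E x t * J x t = 1"
  by (simp add: E_def J_def exp_minus)

lemma J_continuous:
  assumes "x \<in> {0..1}" shows "continuous_on {0..1} (J x)"
proof -
  have "continuous_on {0..1} (\<lambda>t. inverse (E x t))"
    using E_pos by (intro continuous_intros continuous_square_slice(1)[OF E_continuous assms]) (auto simp: less_imp_neq[symmetric])
  then show ?thesis by (rule continuous_on_eq) (simp add: E_def J_def exp_minus)
qed

text \<open>\<open>J\<close> is bounded below by \<open>exp (- Lam 1)\<close>; this makes the
  quotients in the representation meaningful.\<close>

lemma J_integral_pos:
  assumes x: "x \<in> {0..1}" shows "0 < integral {0..1} (J x)"
proof -
  have "exp (- Lam 1) \<le> J x t" if t: "t \<in> {0..1}" for t
  proof -
    have "\<bar>integral {0..t} (\<lambda>s. W (\<Phi> x s) s)\<bar> \<le> Lam t - Lam 0"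
      using t x by (intro abs_integral_le_Lam W\<Phi>_integrable) (auto intro!: W_le \<Phi>_range)
    moreover have "Lam 0 = 0" by (simp add: Lam_def)
    ultimately have "integral {0..t} (\<lambda>s. W (\<Phi> x s) s) \<le> Lam 1" using Lam_bounds[OF t] by linarith
    then show ?thesis by (simp add: J_def)
  qed
  then have "integral {0..1} (\<lambda>t::real. exp (- Lam 1)) \<le> integral {0..1} (J x)"
    by (intro integral_le integrable_continuous_real J_continuous x) auto
  then have "exp (- Lam 1) \<le> integral {0..1} (J x)" by simp
  then show ?thesis using exp_gt_zero[of "- Lam 1"] by linarith
qed

lemma Lagrangian_solution:
  assumes TF: "transport V W L F (\<lambda>x t. F x t * W x t + Z x t) (\<lambda>x t. F x t * V x t)
      (\<lambda>P. \<integral>x. F0 x * poly P x \<partial>unit_B) (\<lambda>P. \<integral>x. F1 x * poly P x \<partial>unit_B)"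
    and TZ: "transport V W L Z (\<lambda>_ _. 0) (\<lambda>x t. Z x t * V x t) C0 C1"
    and F0: "integrable unit_B F0" and F1: "integrable unit_B F1"
  shows "AE x in unit_B. AE t in unit_B.
      Z (\<Phi>c x t) t = (F1 (\<Phi>c x 1) - F0 x) * (J x t / integral {0..1} (J x)) \<and>
      F (\<Phi>c x t) t = (1 - integral {0..t} (J x) / integral {0..1} (J x)) * F0 x
        + integral {0..t} (J x) / integral {0..1} (J x) * F1 (\<Phi>c x 1)"
proof -
  interpret TF: flow_transport V W L \<Phi> F "\<lambda>x t. F x t * W x t + Z x t" "\<lambda>x t. F x t * V x t"
      "\<lambda>P. \<integral>x. F0 x * poly P x \<partial>unit_B" "\<lambda>P. \<integral>x. F1 x * poly P x \<partial>unit_B"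
    by (rule flow_transport.intro[OF flow_axioms TF])
  interpret TZ: flow_transport V W L \<Phi> Z "\<lambda>_ _. 0" "\<lambda>x t. Z x t * V x t" C0 C1
    by (rule flow_transport.intro[OF flow_axioms TZ])
  define G where "G x t = F x t * W x t + Z x t" for x t
  have mX: "Qmeas TF.Xc" unfolding TF.Xc_def by (rule Qmeas_clamp[OF X_continuous])
  define FE where "FE x = Ec x 1 * F1 (\<Phi>c x 1)" for x
  have FEi: "integrable unit_B FE" unfolding FE_def[abs_def] by (rule slice_integral_Lagrangian(1)[OF F1]) simp
  \<comment> \<open>The integrand for \<theta> = t^k in Lagrangian coordinates. Its time integral is
    the difference of the end data, transported to the starting point; the initial one survives only
    for k = 0.\<close>
  define hF where "hF k x t = Ec x t * (F (\<Phi>c x t) t * (real k * t ^ (k - 1)) + G (\<Phi>c x t) t * t ^ k)" for k :: nat and x t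
  have hF: "AE x in unit_B. (\<integral>t. hF k x t \<partial>unit_B) = FE x - 0 ^ k * F0 x" for k
  proof (rule Q_moments_zero)
    let ?\<theta> = "monom 1 k :: real poly"
    have \<theta>: "poly ?\<theta> t = t ^ k" "poly (pderiv ?\<theta>) t = real k * t ^ (k - 1)" for t
      by (simp_all add: poly_monom pderiv_monom)
    \<comment> \<open>The limit of the boundary sums: moments of the end data against powers of the
      inverse flow, with \<open>0 ^ k\<close> the value of \<theta> at time 0.\<close>
    define R where "R j = (\<integral>x. F1 x * TF.Xc x 1 ^ j \<partial>unit_B) - 0 ^ k * (\<integral>x. F0 x * TF.Xc x 0 ^ j \<partial>unit_B)" for j
    have lim: "(\<lambda>n. \<Sum>i\<le>Suc n. (TF.Xc (i / Suc n) 1 ^ j * poly ?\<theta> 1) * (\<integral>x. F1 x * poly (bern (Suc n) i) x \<partial>unit_B)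
        - (TF.Xc (i / Suc n) 0 ^ j * poly ?\<theta> 0) * (\<integral>x. F0 x * poly (bern (Suc n) i) x \<partial>unit_B)) \<longlonglongrightarrow> R j" for j
    proof -
      have l: "(\<lambda>n. \<Sum>i\<le>Suc n. TF.Xc (i / Suc n) s ^ j * (\<integral>x. H x * poly (bern (Suc n) i) x \<partial>unit_B)) \<longlonglongrightarrow> (\<integral>x. H x * TF.Xc x s ^ j \<partial>unit_B)"
        if "integrable unit_B H" "s \<in> {0..1}" for H s
      proof (rule bsum_integral_tendsto[OF that(1)])
        show "(\<lambda>x. TF.Xc x s ^ j) \<in> borel_measurable borel" using Qmeas_slice(1)[OF mX, of s] by measurable
        have "continuous_on {0..1} (\<lambda>x. X x s ^ j)" by (intro continuous_intros X_continuous_y that)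
        then show "continuous_on {0..1} (\<lambda>x. TF.Xc x s ^ j)" by (rule continuous_on_eq) (use that TF.Xc in simp)
      qed
      have one: "(1::real) \<in> {0..1}" and zero: "(0::real) \<in> {0..1}" by auto
      have "(\<lambda>n. (\<Sum>i\<le>Suc n. TF.Xc (i / Suc n) 1 ^ j * (\<integral>x. F1 x * poly (bern (Suc n) i) x \<partial>unit_B))
          - 0 ^ k * (\<Sum>i\<le>Suc n. TF.Xc (i / Suc n) 0 ^ j * (\<integral>x. F0 x * poly (bern (Suc n) i) x \<partial>unit_B))) \<longlonglongrightarrow> R j"
        unfolding R_def by (intro tendsto_diff tendsto_mult_left l F0 F1 one zero)
      then show ?thesis
        unfolding \<theta> power_one mult_1_right sum_subtractf sum_distrib_left by (simp only: mult_ac)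
    qed
    note test = TF.Lagrangian_test[OF refl lim]
    show "Qintegrable (hF k)" using test(2) by (simp add: hF_def \<theta> G_def)
    show "integrable unit_B (\<lambda>x. FE x - 0 ^ k * F0 x)" using FEi F0 by simp
    fix j
    have p: "(\<lambda>x::real. x ^ j) \<in> borel_measurable borel" "continuous_on {0..1} (\<lambda>x::real. x ^ j)" by (auto intro!: continuous_intros)
    have R: "R j = (\<integral>x. (FE x - 0 ^ k * F0 x) * x ^ j \<partial>unit_B)"
    proof -
      have m1: "(\<lambda>x. TF.Xc x 1 ^ j) \<in> borel_measurable borel" using Qmeas_slice(1)[OF mX, of 1] by measurable
      have Xb: "\<bar>TF.Xc x 1 ^ j\<bar> \<le> 1" for x
        using X(1)[OF clamp01_range clamp01_range, of x 1] by (simp add: TF.Xc_def power_abs power_le_one)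
      have F1X: "integrable unit_B (\<lambda>x. F1 x * TF.Xc x 1 ^ j)"
        by (rule integrable_unit_B_mult_bounded[OF F1 m1 Xb])
      have one: "(1::real) \<in> {0..1}" by simp
      note si = slice_integral_Lagrangian[OF F1X one]
      have "(\<integral>x. F1 x * TF.Xc x 1 ^ j \<partial>unit_B) = (\<integral>x. FE x * x ^ j \<partial>unit_B)"
        unfolding si(2)
      proof (rule integral_cong_AE)
        show "(\<lambda>x. Ec x 1 * (F1 (\<Phi>c x 1) * TF.Xc (\<Phi>c x 1) 1 ^ j)) \<in> borel_measurable unit_B"
          using borel_measurable_integrable[OF si(1)] .
        show "(\<lambda>x. FE x * x ^ j) \<in> borel_measurable unit_B"
          using borel_measurable_integrable[OF FEi] p(1) by simp
        show "AE x in unit_B. Ec x 1 * (F1 (\<Phi>c x 1) * TF.Xc (\<Phi>c x 1) 1 ^ j) = FE x * x ^ j"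
          using AE_unit_B_interior
        proof eventually_elim
          case (elim x)
          then have x: "x \<in> {0..1}" by auto
          have "TF.Xc (\<Phi>c x 1) 1 = x" using \<Phi>_range[OF x one] X_\<Phi>[OF x one] by (simp only: \<Phi>c[OF x one] TF.Xc[OF _ one])
          then show ?case by (simp add: FE_def)
        qed
      qed
      moreover have "(\<integral>x. F0 x * TF.Xc x 0 ^ j \<partial>unit_B) = (\<integral>x. F0 x * x ^ j \<partial>unit_B)"
      proof (rule integral_cong_AE)
        have m0: "(\<lambda>x. TF.Xc x 0 ^ j) \<in> borel_measurable borel" using Qmeas_slice(1)[OF mX, of 0] by measurable
        show "(\<lambda>x. F0 x * TF.Xc x 0 ^ j) \<in> borel_measurable unit_B" "(\<lambda>x. F0 x * x ^ j) \<in> borel_measurable unit_B"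
          using borel_measurable_integrable[OF F0] m0 p(1) by simp_all
        show "AE x in unit_B. F0 x * TF.Xc x 0 ^ j = F0 x * x ^ j"
          using AE_unit_B_interior by eventually_elim (simp add: TF.Xc X_0)
      qed
      moreover have "integrable unit_B (\<lambda>x. FE x * x ^ j)" "integrable unit_B (\<lambda>x. F0 x * x ^ j)"
        by (intro integrable_unit_B_mult_continuous FEi F0 p)+
      ultimately show ?thesis by (simp add: R_def left_diff_distrib mult.assoc)
    qed
    show "Qint (\<lambda>x t. x ^ j * hF k x t) = (\<integral>x. (FE x - 0 ^ k * F0 x) * x ^ j \<partial>unit_B)"
      using test(1)[of j] unfolding R by (simp add: hF_def \<theta> G_def)
  qed
  define hZ where "hZ k x t = Ec x t * (Z (\<Phi>c x t) t * (t ^ k - 1 / (real k + 1)))" for k :: nat and x t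
  have hZ: "AE x in unit_B. (\<integral>t. hZ k x t \<partial>unit_B) = 0" for k
  proof (rule Q_moments_zero)
    \<comment> \<open>This \<theta> vanishes at both end times, which removes the unknown traces of
      z, and its derivative is \<open>t ^ k\<close> minus its mean.\<close>
    let ?\<theta> = "smult (1 / (real k + 1)) (monom 1 (Suc k) - monom 1 1) :: real poly"
    have \<theta>: "poly ?\<theta> 0 = 0" "poly ?\<theta> 1 = 0" by (simp_all add: poly_monom)
    have \<theta>': "poly (pderiv ?\<theta>) t = t ^ k - 1 / (real k + 1)" for t
      by (simp add: pderiv_smult pderiv_diff pderiv_monom poly_monom field_simps)
    have lim: "(\<lambda>n. \<Sum>i\<le>Suc n. (TZ.Xc (i / Suc n) 1 ^ j * poly ?\<theta> 1) * C1 (bern (Suc n) i)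
        - (TZ.Xc (i / Suc n) 0 ^ j * poly ?\<theta> 0) * C0 (bern (Suc n) i)) \<longlonglongrightarrow> 0" for j
      unfolding \<theta> by simp
    note test = TZ.Lagrangian_test[OF refl lim]
    show "Qintegrable (hZ k)" using test(2) unfolding \<theta>' by (simp add: hZ_def)
    show "integrable unit_B (\<lambda>x. 0::real)" by simp
    show "Qint (\<lambda>x t. x ^ j * hZ k x t) = (\<integral>x. 0 * x ^ j \<partial>unit_B)" for j
      using test(1)[of j] unfolding \<theta>' by (simp add: hZ_def)
  qed
  \<comment> \<open>Countably many k: one null set of starting points serves for all time
    moments.\<close>
  have aF: "AE x in unit_B. \<forall>k. (\<integral>t. hF k x t \<partial>unit_B) = FE x - 0 ^ k * F0 x" using hF by (simp add: AE_all_countable)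
  have aZ: "AE x in unit_B. \<forall>k. (\<integral>t. hZ k x t \<partial>unit_B) = 0" using hZ by (simp add: AE_all_countable)
  note iF = Q_Fubini(3)[OF Q_change_of_variables(1)[OF TF.\<alpha>]]
  note iG = Q_Fubini(3)[OF Q_change_of_variables(1)[OF TF.\<beta>]]
  note iZ = Q_Fubini(3)[OF Q_change_of_variables(1)[OF TZ.\<alpha>]]
  show ?thesis using aF aZ iF iG iZ AE_unit_B_interior
  proof eventually_elim
    case (elim x)
    then have x: "x \<in> {0..1}" by auto
    define m where "m t = Ec x t * F (\<Phi>c x t) t" for t
    define g where "g t = Ec x t * G (\<Phi>c x t) t" for t
    define u where "u t = Ec x t * Z (\<Phi>c x t) t" for t
    have m: "integrable unit_B m" and g: "integrable unit_B g" and u: "integrable unit_B u"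
      using elim(3,4,5) by (simp_all add: m_def[abs_def] g_def[abs_def] u_def[abs_def] G_def)
    have gm: "g \<in> borel_measurable borel" using borel_measurable_integrable[OF g] by simp
    have ga: "g absolutely_integrable_on {0..1}" using g unit_B_absolutely_integrable(1)[OF gm] by blast
    have weak: "(\<integral>t. m t * (real k * t ^ (k - 1)) + g t * t ^ k \<partial>unit_B) = FE x - F0 x * 0 ^ k" for k
      using elim(1) by (simp add: hF_def m_def g_def algebra_simps)
    note P = polynomial_weak_primitive[OF m g weak]
    define c where "c = (\<integral>t. u t \<partial>unit_B)"
    have uc: "AE t in unit_B. u t = c"
    proof -
      have i: "integrable unit_B (\<lambda>t. u t - c)" using u by simp
      have "(\<integral>t. (u t - c) * t ^ k \<partial>unit_B) = 0" for k
      proof -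
        have p: "(\<lambda>t::real. t ^ k) \<in> borel_measurable borel" "continuous_on {0..1} (\<lambda>t::real. t ^ k)" by (auto intro!: continuous_intros)
        have uk: "integrable unit_B (\<lambda>t. u t * t ^ k)" by (rule integrable_unit_B_mult_continuous[OF u p])
        have pk: "integrable unit_B (\<lambda>t::real. t ^ k)" by (rule integrable_unit_B_continuous[OF p])
        have "0 = (\<integral>t. u t * t ^ k - u t * (1 / (real k + 1)) \<partial>unit_B)"
          using elim(2) by (simp add: hZ_def u_def algebra_simps)
        also have "\<dots> = (\<integral>t. u t * t ^ k \<partial>unit_B) - c * (1 / (real k + 1))"
          unfolding c_def using uk u by simp
        finally have "(\<integral>t. u t * t ^ k \<partial>unit_B) = c * (1 / (real k + 1))" by simp
        moreover have "(\<integral>t. (u t - c) * t ^ k \<partial>unit_B) = (\<integral>t. u t * t ^ k \<partial>unit_B) - c * (1 / (real k + 1))"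
          using uk pk by (simp add: left_diff_distrib integral_unit_B_power)
        ultimately show ?thesis by simp
      qed
      from moments_zero_imp_AE_zero[OF i this] show ?thesis by eventually_elim simp
    qed
    define U where "U t = F0 x + prim g t" for t
    define a where "a s = W (\<Phi> x s) s" for s
    have aa: "a absolutely_integrable_on {0..1}" unfolding a_def[abs_def] by (rule W\<Phi>_integrable[OF x])
    have ca: "(\<lambda>_. c) absolutely_integrable_on {0..1::real}" by (intro absolutely_integrable_continuous_real continuous_intros)
    \<comment> \<open>m is replaced by its continuous version \<open>U\<close> and the source by the
      constant c. As \<open>U\<close> is also the primitive of \<open>g\<close>, this closes to a
      linear equation for \<open>U\<close>.\<close>
    have gU: "AE s in unit_B. g s = a s * U s + c"
      using P(1) uc AE_unit_B_interior
    proof eventually_elim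
      case (elim s)
      then have s: "s \<in> {0..1}" by auto
      have "g s = W (\<Phi>c x s) s * m s + u s" by (simp add: g_def G_def m_def u_def algebra_simps)
      then show ?case using elim by (simp add: U_def a_def \<Phi>c[OF x s])
    qed
    have cU: "continuous_on {0..1} U" unfolding U_def[abs_def] by (intro continuous_intros prim_continuous ga)
    have Ueq: "U t = F0 x + integral {0..t} (\<lambda>s. a s * U s + c)" if "t \<in> {0..1}" for t
      using integral_AE_eq[OF gU, of 0 t] that by (simp add: U_def prim_eq)
    have sol: "U t = E x t * (F0 x + c * integral {0..t} (J x))" if t: "t \<in> {0..1}" for t
    proof -
      have "U t = exp (integral {0..t} a) * (F0 x + integral {0..t} (\<lambda>s. c * exp (- integral {0..s} a)))"
        by (rule linear_ODE[OF aa ca cU Ueq t])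
      then show ?thesis by (simp add: E_def J_def[abs_def] a_def[abs_def])
    qed
    define I where "I = integral {0..1} (J x)"
    have I: "I > 0" unfolding I_def by (rule J_integral_pos[OF x])
    have one: "(1::real) \<in> {0..1}" by simp
    \<comment> \<open>The prescribed value at time 1; the Jacobian cancels on both sides and leaves
      the increment of the data equal to \<open>c * I\<close>.\<close>
    have "FE x = U 1" using P(2) by (simp add: U_def prim_eq)
    then have "E x 1 * F1 (\<Phi>c x 1) = E x 1 * (F0 x + c * I)"
      unfolding sol[OF one] I_def FE_def Ec[OF x one] by simp
    then have F1x: "F1 (\<Phi>c x 1) = F0 x + c * I" using E_pos[of x 1] by simp
    show ?case using P(1) uc AE_unit_B_interior
    proof eventually_elim
      case (elim t)
      then have t: "t \<in> {0..1}" by auto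
      have Et: "Ec x t = E x t" by (rule Ec[OF x t])
      have "E x t * Z (\<Phi>c x t) t = c" using elim(2) by (simp add: u_def Et)
      then have "E x t * J x t * Z (\<Phi>c x t) t = c * J x t" by (simp add: mult_ac)
      then have z: "Z (\<Phi>c x t) t = c * J x t" unfolding E_J by simp
      have "E x t * F (\<Phi>c x t) t = E x t * (F0 x + c * integral {0..t} (J x))"
        using elim(1) sol[OF t] by (simp add: m_def Et U_def)
      then have f: "F (\<Phi>c x t) t = F0 x + c * integral {0..t} (J x)" using E_pos[of x t] by simp
      have I0: "I \<noteq> 0" using I by simp
      have "(F0 x + c * I - F0 x) * (J x t / I) = c * J x t"
        "\<And>A. (1 - A / I) * F0 x + A / I * (F0 x + c * I) = F0 x + c * A"
        using I0 by (simp_all add: left_diff_distrib distrib_left)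
      then show ?case unfolding I_def[symmetric] z f F1x by simp
    qed
  qed
qed

end

section \<open>Null sets of the square and the flow of the given velocity\<close>

lemma AE_unit_Q: "(AE p in unit_Q. P p) \<longleftrightarrow> (AE p in lborel. p \<in> {0<..<1} \<times> {0<..<1} \<longrightarrow> P p)"
proof -
  let ?i = "\<lambda>x::real. ennreal (indicator {0<..<1} x)"
  have "unit_Q = density (lborel \<Otimes>\<^sub>M lborel) (\<lambda>(x, y). ?i x * ?i y)"
    unfolding unit_B_def
    by (rule pair_measure_density)
      (use finite_measure_unit_B in \<open>auto simp: unit_B_def[symmetric] finite_measure_def sigma_finite_lborel\<close>)
  also have "\<dots> = density lborel (\<lambda>(x, y). ?i x * ?i y)" by (simp only: lborel_prod)
  finally have eq: "unit_Q = density lborel (\<lambda>(x, y). ?i x * ?i y)" .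
  have "(\<lambda>(x, y). ?i x * ?i y) \<in> borel_measurable (borel \<Otimes>\<^sub>M borel)" by measurable
  then have "(\<lambda>(x, y). ?i x * ?i y) \<in> borel_measurable lborel" by (simp only: borel_prod measurable_lborel2)
  then have "(AE p in unit_Q. P p) \<longleftrightarrow> (AE p in lborel. 0 < (case p of (x, y) \<Rightarrow> ?i x * ?i y) \<longrightarrow> P p)"
    unfolding eq by (rule AE_density)
  also have "\<dots> \<longleftrightarrow> (AE p in lborel. p \<in> {0<..<1} \<times> {0<..<1} \<longrightarrow> P p)"
    by (intro arg_cong[where f="\<lambda>Q. almost_everywhere lborel Q"] ext) (auto simp: indicator_def of_bool_def split: if_splits)
  finally show ?thesis .
qed

lemma AE_Q_fst:
  assumes "AE x in unit_B. P x"
  shows "AE p in unit_Q. P (fst p)"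
proof -
  obtain N where N: "{x \<in> space unit_B. \<not> P x} \<subseteq> N" "emeasure unit_B N = 0" "N \<in> sets unit_B"
    by (rule AE_E[OF assms])
  have "AE p in unit_Q. fst p \<notin> N"
  proof (rule unit_Q.AE_pair_measure)
    have "N \<times> UNIV \<in> sets (borel \<Otimes>\<^sub>M (borel :: real measure))" using N(3) by (intro pair_measureI) auto
    then have "UNIV - N \<times> UNIV \<in> sets (borel \<Otimes>\<^sub>M (borel :: real measure))"
      using sets.compl_sets[of "N \<times> UNIV" "borel \<Otimes>\<^sub>M (borel :: real measure)"] by (simp add: space_pair_measure)
    moreover have "{x \<in> space unit_Q. fst x \<notin> N} = UNIV - N \<times> UNIV" by auto
    ultimately show "{x \<in> space unit_Q. fst x \<notin> N} \<in> sets unit_Q" by simp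
    have "AE x in unit_B. x \<notin> N" using N(2,3) by (intro AE_not_in) (auto simp: null_sets_def)
    then show "AE x in unit_B. AE y in unit_B. fst (x, y) \<notin> N" by eventually_elim simp
  qed
  then show ?thesis by eventually_elim (use N(1) in auto)
qed

text \<open>The closed and the open square differ by four segments, which lie on null lines of the
  plane.\<close>

lemma AE_closed_square:
  assumes "AE p in unit_Q. P p"
  shows "AE p in lebesgue_on ({0..1} \<times> {0..1}). P p"
proof -
  have hyp: "AE p in lborel. fst p \<noteq> (0::real) \<and> fst p \<noteq> 1 \<and> snd p \<noteq> 0 \<and> snd p \<noteq> (1::real)"
  proof -
    have "AE p in lborel \<Otimes>\<^sub>M lborel. fst p \<noteq> (0::real) \<and> fst p \<noteq> 1 \<and> snd p \<noteq> 0 \<and> snd p \<noteq> (1::real)"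
    proof (rule lborel_pair.AE_pair_measure)
      have "open {p::real \<times> real. fst p \<noteq> 0 \<and> fst p \<noteq> 1 \<and> snd p \<noteq> 0 \<and> snd p \<noteq> 1}"
        by (intro open_Collect_conj open_Collect_neq continuous_intros)
      then have "{p::real \<times> real. fst p \<noteq> 0 \<and> fst p \<noteq> 1 \<and> snd p \<noteq> 0 \<and> snd p \<noteq> 1} \<in> sets (borel \<Otimes>\<^sub>M borel)"
        unfolding borel_prod by (rule borel_open)
      then show "{p \<in> space (lborel \<Otimes>\<^sub>M lborel). fst p \<noteq> (0::real) \<and> fst p \<noteq> 1 \<and> snd p \<noteq> 0 \<and> snd p \<noteq> (1::real)} \<in> sets (lborel \<Otimes>\<^sub>M lborel)"
        by (simp add: space_pair_measure)
      have ne: "AE x in lborel. x \<noteq> 0 \<and> x \<noteq> (1::real)"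
        by (intro AE_conjI) (simp_all add: AE_lborel_singleton)
      then show "AE x in lborel. AE y in lborel. fst (x, y) \<noteq> (0::real) \<and> fst (x, y) \<noteq> 1 \<and> snd (x, y) \<noteq> 0 \<and> snd (x, y) \<noteq> (1::real)"
      proof eventually_elim
        case (elim x)
        show ?case using ne by eventually_elim (use elim in simp)
      qed
    qed
    then show ?thesis by (simp only: lborel_prod)
  qed
  have "AE p in lborel. p \<in> {0..1} \<times> {0..1} \<longrightarrow> P p"
    using assms[unfolded AE_unit_Q] hyp
  proof eventually_elim
    case (elim p)
    then show ?case by (cases p) auto
  qed
  then show ?thesis
    using lmeasurable_cbox[of "(0::real, 0::real)" "(1, 1)"]
    by (subst AE_restrict_space_iff) (auto simp: AE_completion_iff cbox_Pair_eq fmeasurableD)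
qed

lemma lebesgue_on_integral_AE:
  fixes g u :: "real \<Rightarrow> real"
  assumes u: "u absolutely_integrable_on {0..t}" and t: "t \<in> {0..1}" and ae: "AE s in unit_B. g s = u s"
  shows "(\<integral>s. g s \<partial>lebesgue_on {0..t}) = integral {0..t} u"
proof -
  obtain N where N: "{x \<in> space lebesgue. \<not> (x \<in> {0<..<1} \<longrightarrow> g x = u x)} \<subseteq> N" "N \<in> null_sets lebesgue"
    using AE_completion[OF ae[unfolded AE_unit_B]] unfolding eventually_ae_filter by blast
  have n: "negligible (N \<union> {0, 1})"
    using N(2) by (simp add: negligible_iff_null_sets[symmetric] insert_is_Un[of 0 "{1}"])
  have eq: "g s = u s" if "s \<in> {0..t} - (N \<union> {0, 1})" for s
  proof -
    from that t have "s \<in> {0<..<1}" by auto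
    then show ?thesis using that N(1) by auto
  qed
  have "g absolutely_integrable_on {0..t}" by (rule absolutely_integrable_spike[OF u n eq])
  then have "integrable (lebesgue_on {0..t}) g" by (simp add: set_integrable_def integrable_restrict_space)
  then have "(\<integral>s. g s \<partial>lebesgue_on {0..t}) = integral {0..t} g" by (rule lebesgue_integral_eq_integral) simp
  also have "\<dots> = integral {0..t} u" by (rule integral_spike[OF n]) (use eq in auto)
  finally show ?thesis .
qed

context velocity
begin

text \<open>Absolute continuity turns the differential equation, valid for almost every time, into
  the integral equation. Since v and \<open>V\<close> agree on the whole interval for almost every
  time, the position of the curve does not matter.\<close>

lemma flow_of_is_flow:
  assumes vV: "AE t in unit_B. \<forall>x\<in>{0..1}. v x t = V x t" and \<Phi>: "is_flow v \<Phi>"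
  shows "flow V W L \<Phi>"
proof
  fix x :: real assume x: "x \<in> {0..1}"
  have range: "\<Phi> x t \<in> {0..1}" if "t \<in> {0..1}" for t using \<Phi> x that by (auto simp: is_flow_def)
  have \<Phi>0: "\<Phi> x 0 = x" and ac: "absolutely_continuous_fun 0 1 (\<Phi> x)"
    and der: "AE t in unit_B. (\<Phi> x has_real_derivative v (\<Phi> x t) t) (at t)"
    using \<Phi> x unfolding is_flow_def AE_unit_I by auto
  have "AE t in unit_B. (\<Phi> x has_real_derivative V (\<Phi> x t) t) (at t)"
    using der vV AE_unit_B_interior
  proof eventually_elim
    case (elim t)
    then have "v (\<Phi> x t) t = V (\<Phi> x t) t" using range[of t] by auto
    with elim(1) show ?case by simp
  qed
  then have ae: "AE t in lborel. t \<in> {0<..<1} \<longrightarrow> (\<Phi> x has_real_derivative V (\<Phi> x t) t) (at t)"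
    unfolding AE_unit_B .
  obtain N where N: "{t \<in> space lebesgue. \<not> (t \<in> {0<..<1} \<longrightarrow> (\<Phi> x has_real_derivative V (\<Phi> x t) t) (at t))} \<subseteq> N" "N \<in> null_sets lebesgue"
    using AE_completion[OF ae] unfolding eventually_ae_filter by blast
  have n: "negligible (N \<union> {0, 1})"
    using N(2) by (simp add: negligible_iff_null_sets[symmetric] insert_is_Un[of 0 "{1}"])
  have hi: "((\<lambda>s. V (\<Phi> x s) s) has_integral \<Phi> x c - \<Phi> x 0) {0..c}" if c: "c \<in> {0..1}" for c
  proof (rule absolutely_continuous_FTC[OF ac n])
    fix t assume t: "t \<in> {0..c} - (N \<union> {0, 1})"
    then have "t \<in> {0<..<1}" using c by auto
    then show "(\<Phi> x has_real_derivative V (\<Phi> x t) t) (at t)" using t N(1) by auto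
  qed (use c in auto)
  show "solution x (\<Phi> x)"
    unfolding solution_def
  proof (intro conjI ballI range)
    show "(\<lambda>s. V (\<Phi> x s) s) absolutely_integrable_on {0..1}"
    proof (rule absolutely_integrable_integrable_bound)
      show "(\<lambda>s. V (\<Phi> x s) s) integrable_on {0..1}" using hi[of 1] by (auto simp: integrable_on_def)
      show "L integrable_on {0..1}" by (rule L_integrable_on) auto
      show "norm (V (\<Phi> x s) s) \<le> L s" if "s \<in> {0..1}" for s using V_le[OF range[OF that]] by simp
    qed
    fix t :: real assume "t \<in> {0..1}"
    then show "\<Phi> x t = x + integral {0..t} (\<lambda>s. V (\<Phi> x s) s)"
      using hi[of t] \<Phi>0 by (simp add: integral_unique)
  qed
qed

end

context flow
begin

text \<open>For almost every time v equals \<open>V\<close> on the entire closed interval, so its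
  one-sided derivative is \<open>W\<close> at every point, in particular at the position of the
  flow.\<close>

lemma flow_jac_eq:
  assumes vV: "AE t in unit_B. \<forall>x\<in>{0..1}. v x t = V x t" and x: "x \<in> {0..1}" and t: "t \<in> {0..1}"
  shows "flow_jac v \<Phi> x t = J x t"
proof -
  have "AE s in unit_B. dx v (\<Phi> x s) s = W (\<Phi> x s) s"
    using vV AE_unit_B_interior
  proof eventually_elim
    case (elim s)
    then have y: "\<Phi> x s \<in> {0..1}" using \<Phi>_range[OF x] by auto
    show ?case
    proof (rule dx_eq[OF y])
      show "((\<lambda>y. v y s) has_real_derivative W (\<Phi> x s) s) (at (\<Phi> x s) within {0..1})"
        by (rule has_field_derivative_transform_within[OF V_deriv[OF y] zero_less_one y]) (use elim in simp)
    qed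
  qed
  moreover have "(\<lambda>s. W (\<Phi> x s) s) absolutely_integrable_on {0..t}"
    by (rule absolutely_integrable_sub[OF W\<Phi>_integrable[OF x]]) (use t in auto)
  ultimately have "(\<integral>s. dx v (\<Phi> x s) s \<partial>lebesgue_on {0..t}) = integral {0..t} (\<lambda>s. W (\<Phi> x s) s)"
    using t by (intro lebesgue_on_integral_AE)
  then show ?thesis by (simp add: flow_jac_def J_def)
qed

lemma flow_jac_integral:
  assumes vV: "AE t in unit_B. \<forall>x\<in>{0..1}. v x t = V x t" and x: "x \<in> {0..1}" and t: "t \<in> {0..1}"
  shows "(\<integral>s. flow_jac v \<Phi> x s \<partial>lebesgue_on {0..t}) = integral {0..t} (J x)"
proof (rule lebesgue_on_integral_AE[OF _ t])
  show "J x absolutely_integrable_on {0..t}"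
    by (rule absolutely_integrable_continuous_real, rule continuous_on_subset[OF J_continuous[OF x]]) (use t in auto)
  show "AE s in unit_B. flow_jac v \<Phi> x s = J x s"
    using AE_unit_B_interior by eventually_elim (use flow_jac_eq[OF vV x] in simp)
qed

text \<open>A jointly Borel version of the primitive of \<open>J\<close>, so that the representation
  formula describes a measurable subset of the square.\<close>

definition Ic :: "real \<Rightarrow> real \<Rightarrow> real" where "Ic x t = (\<integral>s. indicator {..t} s * inverse (Ec x s) \<partial>unit_B)"

lemma inverse_Ec: "x \<in> {0..1} \<Longrightarrow> t \<in> {0..1} \<Longrightarrow> inverse (Ec x t) = J x t"
  using E_J[of x t] by (simp add: Ec inverse_unique)

lemma Ic:
  assumes x: "x \<in> {0..1}" and t: "t \<in> {0..1}"
  shows "Ic x t = integral {0..t} (J x)"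
proof -
  have m: "(\<lambda>s. inverse (Ec x s)) \<in> borel_measurable borel" using Qmeas_slice(2)[OF Ec_meas, of x] by measurable
  have "continuous_on {0..1} (\<lambda>s. inverse (Ec x s))"
    by (rule continuous_on_eq[OF J_continuous[OF x]]) (simp add: inverse_Ec[OF x])
  then have "integrable unit_B (\<lambda>s. inverse (Ec x s))" by (rule integrable_unit_B_continuous[OF m])
  then have "Ic x t = integral {0..t} (\<lambda>s. inverse (Ec x s))" unfolding Ic_def by (rule partial_integral_eq[OF _ t])
  also have "\<dots> = integral {0..t} (J x)" by (rule integral_cong) (use t inverse_Ec[OF x] in auto)
  finally show ?thesis .
qed

lemma Ic_meas: "Qmeas Ic"
proof -
  have "Qmeas (\<lambda>y t. inverse (Ec t y))" using Qmeas_swap[OF Ec_meas] by measurable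
  from Qmeas_swap[OF Qmeas_partial_integral[OF this]] show ?thesis by (simp add: Ic_def)
qed

end

lemma representation_along_flow:
  assumes f0: "f0 \<in> L2" and f1: "f1 \<in> L2" and adm: "(f, v, z) \<in> admissible f0 f1"
    and wc: "weak_continuity_eq v z" and fl: "is_flow v \<Phi>"
  shows "AE (x, t) in lebesgue_on ({0..1} \<times> {0..1}).
                z (\<Phi> x t) t = (f1 (\<Phi> x 1) - f0 x) *
                  (flow_jac v \<Phi> x t / (\<integral>\<tau>. flow_jac v \<Phi> x \<tau> \<partial>lebesgue_on {0..1})) \<and>
                f (\<Phi> x t) t = (1 - flow_weight v \<Phi> x t) * f0 x
                  + flow_weight v \<Phi> x t * f1 (\<Phi> x 1)"
proof -
  have f: "f \<in> L2L2" and v: "v \<in> Vel" and z: "z \<in> L2L2" and te: "transport_eq f0 f1 f v z"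
    using adm by (auto simp: admissible_def)
  obtain F where F: "borel_rep f F" "Qintegrable (\<lambda>x t. (F x t)\<^sup>2)" "Qintegrable F"
    "AE p in lborel. p \<in> {0<..<1} \<times> {0<..<1} \<longrightarrow> f (fst p) (snd p) = F (fst p) (snd p)"
    by (rule L2L2_borel_rep[OF f])
  obtain Z where Z: "borel_rep z Z" "Qintegrable (\<lambda>x t. (Z x t)\<^sup>2)" "Qintegrable Z"
    "AE p in lborel. p \<in> {0<..<1} \<times> {0<..<1} \<longrightarrow> z (fst p) (snd p) = Z (fst p) (snd p)"
    by (rule L2L2_borel_rep[OF z])
  obtain F0 where F0: "F0 \<in> borel_measurable borel" "AE x in unit_B. f0 x = F0 x" "integrable unit_B F0"
    using L2_borel_version[OF f0] by metis
  obtain F1 where F1: "F1 \<in> borel_measurable borel" "AE x in unit_B. f1 x = F1 x" "integrable unit_B F1"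
    using L2_borel_version[OF f1] by metis
  obtain V W L where vel: "velocity V W L" and vV: "AE t in unit_B. \<forall>x\<in>{0..1}. v x t = V x t"
    and wW: "AE t in unit_B. AE x in unit_B. wd (\<lambda>y. v y t) x = W x t"
    by (rule Vel_velocity[OF v])
  interpret velocity V W L by (rule vel)
  interpret flow V W L \<Phi> by (rule flow_of_is_flow[OF vV fl])
  have rV: "borel_rep v V" by (rule borel_rep_velocity[OF V_meas vV])
  have rW: "borel_rep (\<lambda>x t. wd (\<lambda>y. v y t) x) W" using wW W_meas by (simp add: borel_rep_def)
  have TF: "transport V W L F (\<lambda>x t. F x t * W x t + Z x t) (\<lambda>x t. F x t * V x t)
      (\<lambda>P. \<integral>x. F0 x * poly P x \<partial>unit_B) (\<lambda>P. \<integral>x. F1 x * poly P x \<partial>unit_B)"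
    by (rule transport_of_transport_eq[OF rV rW F(1-3) Z(1-3) F0(3,2) F1(3,2) te])
  obtain C0 C1 where TZ: "transport V W L Z (\<lambda>_ _. 0) (\<lambda>x t. Z x t * V x t) C0 C1"
    by (rule transport_of_weak_continuity_eq[OF rV Z(1-3) wc])
  \<comment> \<open>The formulas written with Borel functions only: the set of points where they
    hold is measurable, so validity for almost every x and t separately becomes validity almost
    everywhere on the square.\<close>
  define R where "R x t \<longleftrightarrow> Z (\<Phi>c x t) t = (F1 (\<Phi>c x 1) - F0 x) * (inverse (Ec x t) / Ic x 1) \<and>
      F (\<Phi>c x t) t = (1 - Ic x t / Ic x 1) * F0 x + Ic x t / Ic x 1 * F1 (\<Phi>c x 1)" for x t
  have "AE p in unit_Q. R (fst p) (snd p)"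
  proof (rule unit_Q.AE_pair_measure)
    have mF: "(\<lambda>p. F (\<Phi>c (fst p) (snd p)) (snd p)) \<in> borel_measurable (borel \<Otimes>\<^sub>M borel)"
      and mZ: "(\<lambda>p. Z (\<Phi>c (fst p) (snd p)) (snd p)) \<in> borel_measurable (borel \<Otimes>\<^sub>M borel)"
      using F(1) Z(1) measurable_compose[OF T_meas, of "\<lambda>p. F (fst p) (snd p)" borel]
        measurable_compose[OF T_meas, of "\<lambda>p. Z (fst p) (snd p)" borel]
      by (simp_all add: borel_rep_def T_def)
    have m0: "Qmeas (\<lambda>x t. F0 x)" by (rule Qmeas_fst[OF F0(1)])
    have m1: "Qmeas (\<lambda>x t. F1 (\<Phi>c x 1))"
      by (rule Qmeas_fst, rule measurable_compose[OF Qmeas_slice(1)[OF \<Phi>c_meas] F1(1)])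
    have i1: "Qmeas (\<lambda>x t. Ic x 1)" by (rule Qmeas_fst[OF Qmeas_slice(1)[OF Ic_meas]])
    have "{p \<in> space (borel \<Otimes>\<^sub>M borel). R (fst p) (snd p)} \<in> sets (borel \<Otimes>\<^sub>M borel)"
      unfolding R_def using mF mZ m0 m1 i1 Ic_meas Ec_meas
      by (intro sets.sets_Collect_conj borel_measurable_eq borel_measurable_times borel_measurable_diff borel_measurable_add
          borel_measurable_divide borel_measurable_inverse borel_measurable_const)
    then show "{p \<in> space unit_Q. R (fst p) (snd p)} \<in> sets unit_Q" by (simp add: space_pair_measure)
    show "AE x in unit_B. AE t in unit_B. R (fst (x, t)) (snd (x, t))"
      using Lagrangian_solution[OF TF TZ F0(3) F1(3)] AE_unit_B_interior
    proof eventually_elim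
      case (elim x)
      then have x: "x \<in> {0..1}" by auto
      have one: "(1::real) \<in> {0..1}" by simp
      show ?case using elim(1) AE_unit_B_interior
      proof eventually_elim
        case (elim t)
        then have t: "t \<in> {0..1}" by auto
        show ?case using elim(1) unfolding R_def fst_conv snd_conv inverse_Ec[OF x t] Ic[OF x t] Ic[OF x one] .
      qed
    qed
  qed
  \<comment> \<open>Here the equality with the representative on the plane, not merely slice by
    slice, is moved along the flow.\<close>
  moreover have "AE p in unit_Q. f (\<Phi>c (fst p) (snd p)) (snd p) = F (\<Phi>c (fst p) (snd p)) (snd p)"
    by (rule Q_AE_Lagrangian) (use F(4) in \<open>simp add: AE_unit_Q\<close>)
  moreover have "AE p in unit_Q. z (\<Phi>c (fst p) (snd p)) (snd p) = Z (\<Phi>c (fst p) (snd p)) (snd p)"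
    by (rule Q_AE_Lagrangian) (use Z(4) in \<open>simp add: AE_unit_Q\<close>)
  moreover have "AE p in unit_Q. f0 (fst p) = F0 (fst p)" by (rule AE_Q_fst[OF F0(2)])
  moreover have "AE p in unit_Q. f1 (\<Phi>c (fst p) 1) = F1 (\<Phi>c (fst p) 1)"
    by (rule AE_Q_fst[OF slice_AE_Lagrangian[OF F1(2)]]) simp
  ultimately have "AE p in unit_Q. z (\<Phi> (fst p) (snd p)) (snd p) = (f1 (\<Phi> (fst p) 1) - f0 (fst p)) *
        (flow_jac v \<Phi> (fst p) (snd p) / (\<integral>\<tau>. flow_jac v \<Phi> (fst p) \<tau> \<partial>lebesgue_on {0..1})) \<and>
      f (\<Phi> (fst p) (snd p)) (snd p) = (1 - flow_weight v \<Phi> (fst p) (snd p)) * f0 (fst p)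
        + flow_weight v \<Phi> (fst p) (snd p) * f1 (\<Phi> (fst p) 1)"
    using AE_Q_interior
  proof eventually_elim
    case (elim p)
    then have x: "fst p \<in> {0..1}" and t: "snd p \<in> {0..1}" by auto
    have one: "(1::real) \<in> {0..1}" by simp
    have e: "\<Phi>c (fst p) (snd p) = \<Phi> (fst p) (snd p)" "\<Phi>c (fst p) 1 = \<Phi> (fst p) 1"
      using \<Phi>c[OF x t] \<Phi>c[OF x one] by auto
    show ?case
      using elim(1-5)
      unfolding flow_weight_def flow_jac_eq[OF vV x t] flow_jac_integral[OF vV x t] flow_jac_integral[OF vV x one]
        R_def e inverse_Ec[OF x t] Ic[OF x t] Ic[OF x one] by simp
  qed
  from AE_closed_square[OF this] show ?thesis by (simp add: case_prod_beta)
qed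

subsection \<open>Perturbing an admissible path\<close>

lemma tendsto_zero_of_square_le:
  fixes a b :: "nat \<Rightarrow> real"
  assumes "\<And>n. (a n)\<^sup>2 \<le> b n" "b \<longlonglongrightarrow> 0"
  shows "a \<longlonglongrightarrow> 0"
proof -
  have "(\<lambda>n. (a n)\<^sup>2) \<longlonglongrightarrow> 0"
    by (rule tendsto_sandwich[OF _ _ tendsto_const assms(2)]) (auto simp: assms(1))
  then show ?thesis by (simp add: power_tendsto_0_iff)
qed

lemma L2_diff: "u \<in> L2 \<Longrightarrow> w \<in> L2 \<Longrightarrow> (\<lambda>x. u x - w x) \<in> L2"
  using L2_linear(1)[of u w 1 "-1"] by simp

lemma L2_mult_bounded:
  assumes u: "u \<in> L2" and \<phi>: "\<phi> \<in> borel_measurable borel" "\<And>x. x \<in> {0..1} \<Longrightarrow> \<bar>\<phi> x\<bar> \<le> C"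
  shows "(\<lambda>x. u x * \<phi> x) \<in> L2" and "(L2_norm (\<lambda>x. u x * \<phi> x))\<^sup>2 \<le> C\<^sup>2 * (L2_norm u)\<^sup>2"
proof -
  obtain U where U: "U \<in> borel_measurable borel" "AE x in unit_B. u x = U x" "integrable unit_B (\<lambda>x. (U x)\<^sup>2)"
    using L2_borel_version[OF u] by metis
  have m: "(\<lambda>x. U x * \<phi> x) \<in> borel_measurable borel" using U(1) \<phi>(1) by measurable
  have ae: "AE x in unit_B. u x * \<phi> x = U x * \<phi> x" using U(2) by eventually_elim simp
  have sq: "(\<phi> x)\<^sup>2 \<le> C\<^sup>2" if "x \<in> {0..1}" for x using power_mono[OF \<phi>(2)[OF that], of 2] by simp
  have i: "integrable unit_B (\<lambda>x. (U x)\<^sup>2 * (\<phi> x)\<^sup>2)"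
    by (rule integrable_unit_B_mult_bounded[OF U(3), of _ "C\<^sup>2"]) (use \<phi>(1) sq in auto)
  then show "(\<lambda>x. u x * \<phi> x) \<in> L2" unfolding L2_borel_iff[OF m ae] by (simp add: power_mult_distrib)
  have "(\<integral>x. (U x)\<^sup>2 * (\<phi> x)\<^sup>2 \<partial>unit_B) \<le> (\<integral>x. (U x)\<^sup>2 * C\<^sup>2 \<partial>unit_B)"
  proof (rule integral_mono_AE[OF i])
    show "integrable unit_B (\<lambda>x. (U x)\<^sup>2 * C\<^sup>2)" using U(3) by simp
    show "AE x in unit_B. (U x)\<^sup>2 * (\<phi> x)\<^sup>2 \<le> (U x)\<^sup>2 * C\<^sup>2"
      using AE_unit_B_interior by eventually_elim (use sq in \<open>simp add: mult_left_mono\<close>)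
  qed
  then show "(L2_norm (\<lambda>x. u x * \<phi> x))\<^sup>2 \<le> C\<^sup>2 * (L2_norm u)\<^sup>2"
    unfolding L2_norm_borel[OF m ae] L2_norm_borel[OF U(1,2)] by (simp add: power_mult_distrib mult.commute)
qed

lemma L2_mult_integrable:
  assumes "u \<in> L2" "w \<in> L2"
  shows "integrable unit_I (\<lambda>x. u x * w x)"
proof (rule Bochner_Integration.integrable_bound[of _ "\<lambda>x. (u x)\<^sup>2 + (w x)\<^sup>2"])
  show "integrable unit_I (\<lambda>x. (u x)\<^sup>2 + (w x)\<^sup>2)" "(\<lambda>x. u x * w x) \<in> borel_measurable unit_I"
    using assms by (auto simp: L2_def)
  have "\<bar>a * b\<bar> \<le> a\<^sup>2 + b\<^sup>2" for a b :: real
  proof -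
    have "2 * \<bar>a\<bar> * \<bar>b\<bar> \<le> \<bar>a\<bar>\<^sup>2 + \<bar>b\<bar>\<^sup>2" by (rule sum_squares_bound)
    moreover have "0 \<le> \<bar>a\<bar> * \<bar>b\<bar>" by simp
    ultimately show ?thesis unfolding abs_mult power2_abs by linarith
  qed
  then show "AE x in unit_I. norm (u x * w x) \<le> norm ((u x)\<^sup>2 + (w x)\<^sup>2)" by simp
qed

lemma continuous_slice:
  fixes G :: "real \<Rightarrow> real \<Rightarrow> real"
  assumes "continuous_on UNIV (\<lambda>p. G (fst p) (snd p))"
  shows "continuous_on A (\<lambda>x. G x t)" "(\<lambda>x. G x t) \<in> borel_measurable borel" "Qmeas G"
proof -
  show c: "continuous_on A (\<lambda>x. G x t)" for A
    using continuous_on_compose2[OF assms, of A "\<lambda>x. (x, t)"] by (simp add: continuous_on_Pair)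
  show "(\<lambda>x. G x t) \<in> borel_measurable borel" by (intro borel_measurable_continuous_onI c)
  show "Qmeas G" unfolding borel_prod by (rule borel_measurable_continuous_onI[OF assms])
qed

lemma bounded_on_square:
  fixes G :: "real \<Rightarrow> real \<Rightarrow> real"
  assumes "continuous_on ({0..1} \<times> {0..1}) (\<lambda>p. G (fst p) (snd p))"
  obtains C where "0 \<le> C" "\<And>x t. x \<in> {0..1} \<Longrightarrow> t \<in> {0..1} \<Longrightarrow> \<bar>G x t\<bar> \<le> C"
proof -
  have "bounded ((\<lambda>p. G (fst p) (snd p)) ` ({0..1} \<times> {0..1}))"
    by (intro compact_imp_bounded compact_continuous_image assms compact_Times compact_Icc)
  then obtain C where C: "\<And>p. p \<in> {0..1} \<times> {0..1} \<Longrightarrow> \<bar>G (fst p) (snd p)\<bar> \<le> C"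
    unfolding bounded_iff real_norm_def by (metis (no_types, lifting) imageI)
  from C[of "(0, 0)"] have "0 \<le> C" by simp
  moreover have "\<bar>G x t\<bar> \<le> C" if "x \<in> {0..1}" "t \<in> {0..1}" for x t using C[of "(x, t)"] that by simp
  ultimately show thesis by (rule that)
qed

text \<open>The supremum over x of the increments in time tends to 0 by uniform continuity on the
  compact square; it serves both for L2 slices and for the dual norm.\<close>

lemma slice_modulus:
  fixes G :: "real \<Rightarrow> real \<Rightarrow> real"
  assumes G: "continuous_on ({0..1} \<times> {0..1}) (\<lambda>p. G (fst p) (snd p))" and t: "t \<in> {0..1}"
  obtains \<delta> where "\<And>x r. x \<in> {0..1} \<Longrightarrow> r \<in> {0..1} \<Longrightarrow> \<bar>G x r - G x t\<bar> \<le> \<delta> r"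
    "(\<delta> \<longlongrightarrow> 0) (at t within {0..1})" "\<delta> t = 0"
proof
  define \<delta> where "\<delta> r = (SUP x\<in>{0..1}. \<bar>G x r - G x t\<bar>)" for r
  obtain C where C: "\<And>x t. x \<in> {0..1} \<Longrightarrow> t \<in> {0..1} \<Longrightarrow> \<bar>G x t\<bar> \<le> C" by (rule bounded_on_square[OF G]) blast
  have bdd: "bdd_above ((\<lambda>x. \<bar>G x r - G x t\<bar>) ` {0..1})" if "r \<in> {0..1}" for r
  proof (rule bdd_aboveI2)
    show "\<bar>G x r - G x t\<bar> \<le> 2 * C" if "x \<in> {0..1}" for x
      using C[OF that t] C[OF that \<open>r \<in> {0..1}\<close>] by linarith
  qed
  show le: "\<bar>G x r - G x t\<bar> \<le> \<delta> r" if "x \<in> {0..1}" "r \<in> {0..1}" for x r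
    unfolding \<delta>_def by (rule cSUP_upper[OF that(1) bdd[OF that(2)]])
  show "\<delta> t = 0" by (simp add: \<delta>_def)
  show "(\<delta> \<longlongrightarrow> 0) (at t within {0..1})"
    unfolding tendsto_iff
  proof (intro allI impI)
    fix e :: real assume e: "0 < e"
    have "uniformly_continuous_on ({0..1} \<times> {0..1}) (\<lambda>p. G (fst p) (snd p))"
      by (intro compact_uniformly_continuous G compact_Times compact_Icc)
    then obtain d where d: "d > 0" "\<And>p q. p \<in> {0..1} \<times> {0..1} \<Longrightarrow> q \<in> {0..1} \<times> {0..1} \<Longrightarrow> dist q p < d \<Longrightarrow>
        dist (G (fst q) (snd q)) (G (fst p) (snd p)) < e / 2"
      unfolding uniformly_continuous_on_def using half_gt_zero[OF e] by metis
    show "\<forall>\<^sub>F r in at t within {0..1}. dist (\<delta> r) 0 < e"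
      unfolding eventually_at
    proof (intro exI[of _ d] conjI ballI impI)
      fix r :: real assume r: "r \<in> {0..1}" "r \<noteq> t \<and> dist r t < d"
      have "\<bar>G x r - G x t\<bar> \<le> e / 2" if "x \<in> {0..1}" for x
        using d(2)[of "(x, t)" "(x, r)"] r t that by (simp add: dist_Pair_Pair dist_real_def)
      then have "\<delta> r \<le> e / 2" unfolding \<delta>_def by (intro cSUP_least) auto
      moreover have "0 \<le> \<delta> r" using le[of 0 r] r by force
      ultimately show "dist (\<delta> r) 0 < e" using e by simp
    qed (rule d(1))
  qed
qed

lemma L2L2I:
  assumes meas: "(\<lambda>(x, t). u x t) \<in> borel_measurable (lebesgue_on ({0<..<1} \<times> {0<..<1}))"
    and U: "borel_rep u U" "Qintegrable (\<lambda>x t. (U x t)\<^sup>2)"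
    and s: "\<And>n. simple_function unit_I (s n)" "\<And>n t. t \<in> {0<..<1} \<Longrightarrow> s n t \<in> L2"
      "AE t in unit_B. (\<lambda>n. L2_norm (\<lambda>x. s n t x - u x t)) \<longlonglongrightarrow> 0"
  shows "u \<in> L2L2"
proof -
  have m: "Qmeas U" and ae: "AE t in unit_B. AE x in unit_B. u x t = U x t" using U by (auto simp: borel_rep_def)
  have m2: "Qmeas (\<lambda>x t. (U x t)\<^sup>2)" using m by measurable
  have L2: "AE t in unit_B. (\<lambda>x. u x t) \<in> L2"
    using Q_Fubini(4)[OF U(2)] ae by eventually_elim (rule L2_borel_iff[OF Qmeas_slice(1)[OF m], THEN iffD2])
  have nrm: "AE t in unit_B. (L2_norm (\<lambda>x. u x t))\<^sup>2 = (\<integral>x. (U x t)\<^sup>2 \<partial>unit_B)"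
    using ae by eventually_elim (rule L2_norm_borel[OF Qmeas_slice(1)[OF m]])
  have "integrable unit_I (\<lambda>t. (L2_norm (\<lambda>x. u x t))\<^sup>2)"
    using Q_Fubini(6)[OF U(2)] unit_I_AE(1)[OF Qmeas_integral(1)[OF m2] nrm] by blast
  then show ?thesis using meas L2 s unfolding bochner_L2_def mem_Collect_eq AE_unit_I
    by (intro conjI exI[of _ s]) auto
qed

lemma L2L2_approx:
  assumes "u \<in> L2L2"
  obtains s where "\<And>n. simple_function unit_I (s n)" "\<And>n t. t \<in> {0<..<1} \<Longrightarrow> s n t \<in> L2"
    "AE t in unit_B. (\<lambda>x. u x t) \<in> L2 \<and> (\<lambda>n. L2_norm (\<lambda>x. s n t x - u x t)) \<longlonglongrightarrow> 0"
proof -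
  have 2: "AE t in unit_B. (\<lambda>x. u x t) \<in> L2" using bochner_L2_D(2)[OF assms] unfolding AE_unit_I .
  obtain s where s: "\<forall>n. simple_function unit_I (s n) \<and> s n ` {0<..<1} \<subseteq> L2"
    "AE t in unit_B. (\<lambda>n. L2_norm (\<lambda>x. s n t x - u x t)) \<longlonglongrightarrow> 0"
    using assms unfolding bochner_L2_def mem_Collect_eq AE_unit_I by blast
  show thesis
  proof (rule that[of s])
    show "AE t in unit_B. (\<lambda>x. u x t) \<in> L2 \<and> (\<lambda>n. L2_norm (\<lambda>x. s n t x - u x t)) \<longlonglongrightarrow> 0"
      using 2 s(2) by eventually_elim simp
    show "simple_function unit_I (s n)" "t \<in> {0<..<1} \<Longrightarrow> s n t \<in> L2" for n t using s(1) by blast+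
  qed
qed

lemma L2L2_add_scaled:
  assumes u: "u \<in> L2L2" and w: "w \<in> L2L2"
  shows "(\<lambda>x t. u x t + c * w x t) \<in> L2L2"
proof -
  obtain U where U: "borel_rep u U" "Qintegrable (\<lambda>x t. (U x t)\<^sup>2)" by (rule L2L2_borel_rep[OF u])
  obtain W where W: "borel_rep w W" "Qintegrable (\<lambda>x t. (W x t)\<^sup>2)" by (rule L2L2_borel_rep[OF w])
  have m: "Qmeas U" "Qmeas W" using U(1) W(1) by (auto simp: borel_rep_def)
  obtain s where s: "\<And>n. simple_function unit_I (s n)" "\<And>n t. t \<in> {0<..<1} \<Longrightarrow> s n t \<in> L2"
    "AE t in unit_B. (\<lambda>x. u x t) \<in> L2 \<and> (\<lambda>n. L2_norm (\<lambda>x. s n t x - u x t)) \<longlonglongrightarrow> 0"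
    by (rule L2L2_approx[OF u]) blast
  obtain r where r: "\<And>n. simple_function unit_I (r n)" "\<And>n t. t \<in> {0<..<1} \<Longrightarrow> r n t \<in> L2"
    "AE t in unit_B. (\<lambda>x. w x t) \<in> L2 \<and> (\<lambda>n. L2_norm (\<lambda>x. r n t x - w x t)) \<longlonglongrightarrow> 0"
    by (rule L2L2_approx[OF w]) blast
  show ?thesis
  proof (rule L2L2I[of _ "\<lambda>x t. U x t + c * W x t" "\<lambda>n t x. s n t x + c * r n t x"])
    show "(\<lambda>(x, t). u x t + c * w x t) \<in> borel_measurable (lebesgue_on ({0<..<1} \<times> {0<..<1}))"
      using bochner_L2_D(1)[OF u] bochner_L2_D(1)[OF w] by (simp add: case_prod_beta')
    show "borel_rep (\<lambda>x t. u x t + c * w x t) (\<lambda>x t. U x t + c * W x t)"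
      by (rule borel_rep_binop[OF U(1) W(1), of "\<lambda>a b. a + c * b"]) (use m in measurable)
    have "Qintegrable (\<lambda>x t. (U x t)\<^sup>2 + (2 * c * (U x t * W x t) + c\<^sup>2 * (W x t)\<^sup>2))"
      using U(2) W(2) Qintegrable_mult_squares[OF m(1) U(2) m(2) W(2)] by simp
    then show "Qintegrable (\<lambda>x t. (U x t + c * W x t)\<^sup>2)"
      by (simp add: power2_sum power_mult_distrib algebra_simps)
    show "simple_function unit_I (\<lambda>t x. s n t x + c * r n t x)" for n
      by (rule simple_function_compose2[OF s(1) r(1), of "\<lambda>h k x. h x + c * k x"])
    show "(\<lambda>x. s n t x + c * r n t x) \<in> L2" if "t \<in> {0<..<1}" for n t
      using L2_linear(1)[OF s(2)[OF that] r(2)[OF that], where a=1 and b=c] by simp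
    show "AE t in unit_B. (\<lambda>n. L2_norm (\<lambda>x. s n t x + c * r n t x - (u x t + c * w x t))) \<longlonglongrightarrow> 0"
      using s(3) r(3) AE_unit_B_interior
    proof eventually_elim
      case (elim t)
      then have t: "t \<in> {0<..<1}" by simp
      show ?case
      proof (rule tendsto_zero_of_square_le)
        show "(L2_norm (\<lambda>x. s n t x + c * r n t x - (u x t + c * w x t)))\<^sup>2
            \<le> 2 * 1\<^sup>2 * (L2_norm (\<lambda>x. s n t x - u x t))\<^sup>2 + 2 * c\<^sup>2 * (L2_norm (\<lambda>x. r n t x - w x t))\<^sup>2" for n
        proof -
          have e: "(\<lambda>x. s n t x + c * r n t x - (u x t + c * w x t)) = (\<lambda>x. 1 * (s n t x - u x t) + c * (r n t x - w x t))"
            by (simp add: algebra_simps)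
          show ?thesis unfolding e by (rule L2_linear(2)) (use elim s(2)[OF t] r(2)[OF t] in \<open>auto intro: L2_diff\<close>)
        qed
        have "(\<lambda>n. L2_norm (\<lambda>x. s n t x - u x t)) \<longlonglongrightarrow> 0" "(\<lambda>n. L2_norm (\<lambda>x. r n t x - w x t)) \<longlonglongrightarrow> 0"
          using elim by auto
        then show "(\<lambda>n. 2 * 1\<^sup>2 * (L2_norm (\<lambda>x. s n t x - u x t))\<^sup>2 + 2 * c\<^sup>2 * (L2_norm (\<lambda>x. r n t x - w x t))\<^sup>2) \<longlonglongrightarrow> 0"
          by (auto intro!: tendsto_eq_intros)
      qed
    qed
  qed
qed

lemma L2L2_mult_continuous:
  assumes u: "u \<in> L2L2" and G: "continuous_on UNIV (\<lambda>p. G (fst p) (snd p))"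
  shows "(\<lambda>x t. u x t * G x t) \<in> L2L2"
proof -
  have Gs: "continuous_on ({0..1} \<times> {0..1}) (\<lambda>p. G (fst p) (snd p))" by (rule continuous_on_subset[OF G subset_UNIV])
  obtain C where C: "\<And>x t. x \<in> {0..1} \<Longrightarrow> t \<in> {0..1} \<Longrightarrow> \<bar>G x t\<bar> \<le> C" by (rule bounded_on_square[OF Gs]) blast
  obtain U where U: "borel_rep u U" "Qintegrable (\<lambda>x t. (U x t)\<^sup>2)" by (rule L2L2_borel_rep[OF u])
  note mG = continuous_slice(3)[OF G] and mGs = continuous_slice(2)[OF G]
  obtain s where s: "\<And>n. simple_function unit_I (s n)" "\<And>n t. t \<in> {0<..<1} \<Longrightarrow> s n t \<in> L2"
    "AE t in unit_B. (\<lambda>x. u x t) \<in> L2 \<and> (\<lambda>n. L2_norm (\<lambda>x. s n t x - u x t)) \<longlonglongrightarrow> 0"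
    by (rule L2L2_approx[OF u]) blast
  \<comment> \<open>Time is rounded down to a grid of mesh 1/(n+1). The factor \<open>G\<close>
    sampled at \<open>q n t\<close> takes only finitely many values as a function of x, so its
    product with a simple function is simple.\<close>
  define q where "q n t = real_of_int \<lfloor>real (Suc n) * t\<rfloor> / real (Suc n)" for n t
  have q01: "q n t \<in> {0..1}" if "t \<in> {0<..<1}" for n t
  proof -
    have "real_of_int \<lfloor>real (Suc n) * t\<rfloor> \<le> real (Suc n) * t" by (rule of_int_floor_le)
    also have "\<dots> \<le> real (Suc n)" using that by (simp add: mult_left_le)
    finally show ?thesis using that by (simp add: q_def)
  qed
  have qs: "simple_function unit_I (q n)" for n
  proof (rule simple_function_borel_measurable)
    have "q n \<in> borel_measurable borel" unfolding q_def by measurable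
    then show "q n \<in> borel_measurable unit_I" by (rule borel_measurable_unit_I)
    have "q n ` space unit_I \<subseteq> (\<lambda>k. real_of_int k / real (Suc n)) ` {0..int (Suc n)}"
    proof
      fix y assume "y \<in> q n ` space unit_I"
      then obtain t where t: "t \<in> {0<..<1}" "y = q n t" by auto
      have "0 \<le> real (Suc n) * t" "real (Suc n) * t \<le> real_of_int (int (Suc n))" using t(1) by (simp_all add: mult_left_le)
      then have "\<lfloor>real (Suc n) * t\<rfloor> \<in> {0..int (Suc n)}" using floor_mono[of "real (Suc n) * t" "real_of_int (int (Suc n))"]
        by (simp add: le_floor_iff)
      then show "y \<in> (\<lambda>k. real_of_int k / real (Suc n)) ` {0..int (Suc n)}" unfolding t(2) q_def by (rule imageI)
    qed
    then show "finite (q n ` space unit_I)" by (rule finite_subset) simp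
  qed
  have qlim: "(\<lambda>n. q n t) \<longlonglongrightarrow> t" for t
  proof (rule Lim_transform_bound[of _ "\<lambda>n. 1 / real (Suc n)", THEN LIM_zero_cancel])
    show "\<forall>\<^sub>F n in sequentially. norm (q n t - t) \<le> norm (1 / real (Suc n))"
    proof (intro always_eventually allI)
      fix n
      have "real (Suc n) * t - 1 \<le> real_of_int \<lfloor>real (Suc n) * t\<rfloor>" "real_of_int \<lfloor>real (Suc n) * t\<rfloor> \<le> real (Suc n) * t"
        by linarith+
      then have "\<bar>real_of_int \<lfloor>real (Suc n) * t\<rfloor> - real (Suc n) * t\<bar> \<le> 1" by linarith
      moreover have "q n t - t = (real_of_int \<lfloor>real (Suc n) * t\<rfloor> - real (Suc n) * t) / real (Suc n)"
        by (simp add: q_def diff_divide_distrib)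
      ultimately show "norm (q n t - t) \<le> norm (1 / real (Suc n))" by (simp add: divide_right_mono)
    qed
    show "(\<lambda>n. 1 / real (Suc n)) \<longlonglongrightarrow> 0" by (rule LIMSEQ_Suc[OF lim_1_over_n])
  qed
  show ?thesis
  proof (rule L2L2I[of _ "\<lambda>x t. U x t * G x t" "\<lambda>n t x. s n t x * G x (q n t)"])
    have "(\<lambda>p. G (fst p) (snd p)) \<in> borel_measurable borel" by (rule borel_measurable_continuous_onI[OF G])
    then have "(\<lambda>p. G (fst p) (snd p)) \<in> borel_measurable (lebesgue_on ({0<..<1} \<times> {0<..<1}))"
      by (intro measurable_restrict_space1 measurable_completion) simp
    then show "(\<lambda>(x, t). u x t * G x t) \<in> borel_measurable (lebesgue_on ({0<..<1} \<times> {0<..<1}))"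
      using bochner_L2_D(1)[OF u] by (simp add: case_prod_beta')
    show "borel_rep (\<lambda>x t. u x t * G x t) (\<lambda>x t. U x t * G x t)"
      by (rule borel_rep_mult[OF U(1)]) (rule borel_repI[OF mG], simp)
    have "Qintegrable (\<lambda>x t. (U x t)\<^sup>2 * (G x t)\<^sup>2)"
    proof (rule Qintegrable_mult_bounded[OF U(2)])
      show "Qmeas (\<lambda>x t. (G x t)\<^sup>2)" using mG by measurable
      show "\<bar>(G x t)\<^sup>2\<bar> \<le> C\<^sup>2" if "x \<in> {0<..<1}" "t \<in> {0<..<1}" for x t
        using power_mono[OF C[of x t], of 2] that by simp
    qed
    then show "Qintegrable (\<lambda>x t. (U x t * G x t)\<^sup>2)" by (simp add: power_mult_distrib)
    show "simple_function unit_I (\<lambda>t x. s n t x * G x (q n t))" for n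
      by (rule simple_function_compose2[OF s(1) qs, of "\<lambda>h r x. h x * G x r"])
    show "(\<lambda>x. s n t x * G x (q n t)) \<in> L2" if "t \<in> {0<..<1}" for n t
      by (rule L2_mult_bounded(1)[OF s(2)[OF that] mGs C]) (use q01[OF that] in auto)
    show "AE t in unit_B. (\<lambda>n. L2_norm (\<lambda>x. s n t x * G x (q n t) - u x t * G x t)) \<longlonglongrightarrow> 0"
      using s(3) AE_unit_B_interior
    proof eventually_elim
      case (elim t)
      then have t: "t \<in> {0<..<1}" "t \<in> {0..1}" and ut: "(\<lambda>x. u x t) \<in> L2"
        and lim: "(\<lambda>n. L2_norm (\<lambda>x. s n t x - u x t)) \<longlonglongrightarrow> 0" by auto
      obtain \<delta> where \<delta>: "\<And>x r. x \<in> {0..1} \<Longrightarrow> r \<in> {0..1} \<Longrightarrow> \<bar>G x r - G x t\<bar> \<le> \<delta> r"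
        "(\<delta> \<longlongrightarrow> 0) (at t within {0..1})" "\<delta> t = 0"
        by (rule slice_modulus[OF Gs t(2)]) blast
      have "continuous (at t within {0..1}) \<delta>" using \<delta>(2,3) by (simp add: continuous_within)
      from continuous_within_tendsto_compose'[OF this q01[OF t(1)] qlim]
      have dq: "(\<lambda>n. \<delta> (q n t)) \<longlonglongrightarrow> 0" by (simp add: \<delta>(3))
      show ?case
      proof (rule tendsto_zero_of_square_le)
        fix n
        \<comment> \<open>The error splits into the approximation of u, multiplied by the bounded
          factor, and the effect of rounding time, controlled by the modulus \<delta>.\<close>
        define a where "a x = (s n t x - u x t) * G x (q n t)" for x
        define b where "b x = u x t * (G x (q n t) - G x t)" for x
        have mb: "(\<lambda>x. G x (q n t) - G x t) \<in> borel_measurable borel" using mGs by measurable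
        have su: "(\<lambda>x. s n t x - u x t) \<in> L2" by (rule L2_diff[OF s(2)[OF t(1)] ut])
        note A = L2_mult_bounded[OF su mGs C[OF _ q01[OF t(1)]]]
        note B = L2_mult_bounded[OF ut mb \<delta>(1)[OF _ q01[OF t(1)]]]
        have "(\<lambda>x. s n t x * G x (q n t) - u x t * G x t) = (\<lambda>x. 1 * a x + 1 * b x)"
          by (simp add: a_def b_def algebra_simps)
        then have "(L2_norm (\<lambda>x. s n t x * G x (q n t) - u x t * G x t))\<^sup>2 \<le> 2 * 1\<^sup>2 * (L2_norm a)\<^sup>2 + 2 * 1\<^sup>2 * (L2_norm b)\<^sup>2"
          using L2_linear(2)[of a b 1 1] A(1) B(1) unfolding a_def[abs_def] b_def[abs_def] by simp
        also have "\<dots> \<le> 2 * (C\<^sup>2 * (L2_norm (\<lambda>x. s n t x - u x t))\<^sup>2) + 2 * ((\<delta> (q n t))\<^sup>2 * (L2_norm (\<lambda>x. u x t))\<^sup>2)"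
          using A(2)[of n] B(2) unfolding a_def[abs_def] b_def[abs_def] by simp
        finally show "(L2_norm (\<lambda>x. s n t x * G x (q n t) - u x t * G x t))\<^sup>2
          \<le> 2 * (C\<^sup>2 * (L2_norm (\<lambda>x. s n t x - u x t))\<^sup>2) + 2 * ((\<delta> (q n t))\<^sup>2 * (L2_norm (\<lambda>x. u x t))\<^sup>2)" .
      next
        show "(\<lambda>n. 2 * (C\<^sup>2 * (L2_norm (\<lambda>x. s n t x - u x t))\<^sup>2) + 2 * ((\<delta> (q n t))\<^sup>2 * (L2_norm (\<lambda>x. u x t))\<^sup>2)) \<longlonglongrightarrow> 0"
          by (auto intro!: tendsto_eq_intros lim dq)
      qed
    qed
  qed
qed

lemma L2L2_one: "(\<lambda>x t. 1) \<in> L2L2"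
proof (rule L2L2I[of _ "\<lambda>x t. 1" "\<lambda>n t x. 1"])
  show "(\<lambda>x. 1) \<in> L2" by (rule continuous_L2) auto
  show "AE t in unit_B. (\<lambda>n. L2_norm (\<lambda>x. 1 - 1)) \<longlonglongrightarrow> 0" by (simp add: L2_norm_def)
qed (auto simp: case_prod_beta' finite_measure.integrable_const[OF finite_measure_unit_B] intro!: borel_repI finite_measure.integrable_const finite_measure_pair_measure finite_measure_unit_B)

lemma L2L2_continuous:
  assumes "continuous_on UNIV (\<lambda>p. G (fst p) (snd p))"
  shows "G \<in> L2L2"
  using L2L2_mult_continuous[OF L2L2_one assms] by simp

context velocity
begin

lemma V_square: "Qintegrable (\<lambda>x t. (V x t)\<^sup>2)" and W_square: "Qintegrable (\<lambda>x t. (W x t)\<^sup>2)"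
proof -
  show "Qintegrable (\<lambda>x t. (V x t)\<^sup>2)"
  proof (rule Qintegrable_bound[OF Qintegrable_snd[OF L_square]])
    show "\<bar>(V x t)\<^sup>2\<bar> \<le> \<bar>(L t)\<^sup>2\<bar>" if "x \<in> {0<..<1}" for x t using power_mono[OF V_le[of x t], of 2] that by simp
  qed measurable
  show "Qintegrable (\<lambda>x t. (W x t)\<^sup>2)"
  proof (rule Qintegrable_bound[OF Qintegrable_snd[OF L_square]])
    show "\<bar>(W x t)\<^sup>2\<bar> \<le> \<bar>(L t)\<^sup>2\<bar>" if "x \<in> {0<..<1}" for x t using power_mono[OF W_le[of x t], of 2] that by simp
  qed measurable
qed

end

text \<open>The same simple approximants serve, since the H2 norm dominates the L2 norm.\<close>

lemma Vel_L2L2: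
  assumes v: "v \<in> Vel"
  shows "v \<in> L2L2"
proof -
  have b: "v \<in> bochner_L2 (H2 \<inter> H10) H2_norm" using v by (simp add: Vel_def)
  have L2: "u \<in> L2" if "u \<in> H2 \<inter> H10" for u using that by (auto simp: H2_def H1_def weak_deriv_def)
  obtain V W L where vel: "velocity V W L" and vV: "AE t in unit_B. \<forall>x\<in>{0..1}. v x t = V x t"
    by (rule Vel_velocity[OF v])
  interpret velocity V W L by (rule vel)
  obtain s where s: "\<forall>n. simple_function unit_I (s n) \<and> s n ` {0<..<1} \<subseteq> H2 \<inter> H10"
    "AE t in unit_B. (\<lambda>n. H2_norm (\<lambda>x. s n t x - v x t)) \<longlonglongrightarrow> 0"
    using b unfolding bochner_L2_def mem_Collect_eq AE_unit_I by blast
  show ?thesis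
  proof (rule L2L2I[of _ V s])
    show "(\<lambda>(x, t). v x t) \<in> borel_measurable (lebesgue_on ({0<..<1} \<times> {0<..<1}))" by (rule bochner_L2_D(1)[OF b])
    show "borel_rep v V" by (rule borel_rep_velocity[OF V_meas vV])
    show "Qintegrable (\<lambda>x t. (V x t)\<^sup>2)" by (rule V_square)
    show "simple_function unit_I (s n)" "t \<in> {0<..<1} \<Longrightarrow> s n t \<in> L2" for n t using s(1) L2 by blast+
    show "AE t in unit_B. (\<lambda>n. L2_norm (\<lambda>x. s n t x - v x t)) \<longlonglongrightarrow> 0"
      using s(2)
    proof eventually_elim
      case (elim t)
      show ?case by (rule tendsto_sandwich[OF _ _ tendsto_const elim]) (auto simp: H2_norm_bounds(1))
    qed
  qed
qed

lemma zero_test_fun: "(\<lambda>_. 0) \<in> test_fun"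
proof -
  have "poly 0 = (\<lambda>_::real. 0::real)" by (simp add: fun_eq_iff)
  then show ?thesis unfolding test_fun_def smooth1_iff_deriv[symmetric]
    using smooth1_poly[of 0] by (auto intro: exI[of _ "{}"])
qed

text \<open>\<open>wd\<close> is an arbitrary choice, so even here uniqueness of the weak derivative
  must be invoked: its primitive vanishes identically, and integration by parts makes all its
  moments vanish.\<close>

lemma wd_zero: "AE x in unit_B. wd (\<lambda>_. 0) x = 0"
proof -
  from test_fun_weak_deriv[OF zero_test_fun] have d: "weak_deriv (\<lambda>_. 0) (wd (\<lambda>_. 0))"
    by (intro wd_weak_deriv weak_deriv_H1)
  then have "wd (\<lambda>_. 0) \<in> L2" by (simp add: weak_deriv_def)
  from L2_borel_version[OF this] obtain h where h: "h \<in> borel_measurable borel"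
    "AE x in unit_B. wd (\<lambda>_. 0) x = h x" "integrable unit_B h" by metis
  have ha: "h absolutely_integrable_on {0..1}" using h(3) unit_B_absolutely_integrable(1)[OF h(1)] by blast
  obtain c where c: "AE x in unit_B. 0 = c + prim (wd (\<lambda>_. 0)) x" by (rule weak_deriv_prim[OF d])
  have "AE x in unit_B. 0 = c + prim h x"
    using c by eventually_elim (use prim_AE_eq[OF h(2)] in simp)
  then have e: "0 = c + prim h x" if "x \<in> {0..1}" for x
    by (rule continuous_AE_eq[OF _ _ _ that, rotated 2]) (intro continuous_intros prim_continuous ha)+
  from e[of 0] have "c = 0" by (simp add: prim_eq)
  with e have z: "prim h x = 0" if "x \<in> {0..1}" for x using that by simp
  have "(\<integral>x. h x * x ^ k \<partial>unit_B) = 0" for k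
  proof -
    have "(\<integral>t. prim h t * (real k * t ^ (k - 1)) \<partial>unit_B) = integral {0..1} h * 1 ^ k - (\<integral>t. h t * t ^ k \<partial>unit_B)"
    proof (rule integral_prim_by_parts[OF h(1,3)])
      show "((\<lambda>x. x ^ k) has_real_derivative real k * x ^ (k - 1)) (at x within {0..1})" for x :: real
        using DERIV_subset[OF DERIV_pow[of k x] subset_UNIV] by simp
    qed (auto intro!: continuous_intros)
    moreover have "integral {0..1} h = 0" using z[of 1] by (simp add: prim_eq)
    moreover have "(\<integral>t. prim h t * (real k * t ^ (k - 1)) \<partial>unit_B) = (\<integral>t. 0 \<partial>unit_B)"
    proof (rule integral_cong_AE)
      show "AE t in unit_B. prim h t * (real k * t ^ (k - 1)) = 0"
        using AE_unit_B_interior by eventually_elim (simp add: z)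
    qed (use prim_continuous(2)[OF ha] in auto)
    ultimately show ?thesis by simp
  qed
  from moments_zero_imp_AE_zero[OF h(3) this] h(2) show ?thesis by eventually_elim simp
qed

text \<open>Makes the unit ball of \<open>H10\<close> nonempty, so that the supremum defining
  \<open>Hm1_norm\<close> is taken over a nonempty set.\<close>

lemma zero_in_H10: "(\<lambda>_. 0) \<in> H10" and H1_norm_zero: "H1_norm (\<lambda>_. 0) = 0"
proof -
  have "(L2_norm (wd (\<lambda>_. 0)))\<^sup>2 = 0" using L2_norm_borel[of "\<lambda>_. 0", OF _ wd_zero] by simp
  then show n: "H1_norm (\<lambda>_. 0) = 0" by (simp add: H1_norm_def L2_norm_def)
  show "(\<lambda>_. 0) \<in> H10" unfolding H10_def mem_Collect_eq
  proof (intro conjI exI[of _ "\<lambda>_ _. 0"])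
    show "(\<lambda>_. 0) \<in> H1" by (rule weak_deriv_H1[OF test_fun_weak_deriv[OF zero_test_fun]])
  qed (use zero_test_fun n in auto)
qed

lemma H10_L2: "u \<in> H10 \<Longrightarrow> u \<in> L2"
  by (auto simp: H10_def H1_def weak_deriv_def)

lemma L2_functional_linear:
  assumes "h \<in> L2" "u \<in> L2" "w \<in> L2"
  shows "L2_functional h (\<lambda>x. a * u x + b * w x) = a * L2_functional h u + b * L2_functional h w"
proof -
  have "L2_functional h (\<lambda>x. a * u x + b * w x) = (\<integral>x. a * (h x * u x) + b * (h x * w x) \<partial>unit_I)"
    by (simp add: L2_functional_def algebra_simps)
  then show ?thesis using L2_mult_integrable[OF assms(1,2)] L2_mult_integrable[OF assms(1,3)]
    by (simp add: L2_functional_def)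
qed

lemma L2_functional_commute: "L2_functional h w = L2_functional w h"
  by (simp add: L2_functional_def mult.commute)

lemma L2_functional_add_scaled:
  assumes "h \<in> L2" "g \<in> L2" "w \<in> L2"
  shows "L2_functional (\<lambda>x. h x + c * g x) w = L2_functional h w + c * L2_functional g w"
  using L2_functional_linear[OF assms(3,1,2), of 1 c] by (simp add: L2_functional_commute[of w])

lemma L2_functional_bound:
  assumes h: "h \<in> L2" and w: "w \<in> L2" and le: "\<And>x. x \<in> {0..1} \<Longrightarrow> \<bar>h x\<bar> \<le> K"
  shows "\<bar>L2_functional h w\<bar> \<le> K * H1_norm w"
proof -
  have K: "0 \<le> K" using le[of 0] by simp
  have i: "integrable unit_I (\<lambda>x. h x * w x)" by (rule L2_mult_integrable[OF h w])
  have "(\<lambda>x. 1) \<in> L2" by (rule continuous_L2) auto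
  from L2_mult_integrable[OF this w] have iw: "integrable unit_I (\<lambda>x. \<bar>w x\<bar>)" by simp
  have "\<bar>L2_functional h w\<bar> \<le> (\<integral>x. \<bar>h x * w x\<bar> \<partial>unit_I)"
    unfolding L2_functional_def by (rule integral_abs_bound)
  also have "\<dots> \<le> (\<integral>x. K * \<bar>w x\<bar> \<partial>unit_I)"
  proof (rule integral_mono)
    show "integrable unit_I (\<lambda>x. \<bar>h x * w x\<bar>)" "integrable unit_I (\<lambda>x. K * \<bar>w x\<bar>)" using i iw by simp_all
    show "\<bar>h x * w x\<bar> \<le> K * \<bar>w x\<bar>" if "x \<in> space unit_I" for x
      using le[of x] that by (simp add: abs_mult mult_right_mono)
  qed
  also have "\<dots> = K * integral {0..1} (\<lambda>x. \<bar>w x\<bar>)"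
    using iw unit_I_absolutely_integrable unit_I_integral by simp
  also have "\<dots> \<le> K * H1_norm w"
    by (rule mult_left_mono[OF order_trans[OF L1_le_L2_norm[OF w] H1_norm_bounds(1)] K])
  finally show ?thesis .
qed

text \<open>The supremum over the unit ball is meaningful only when the values are bounded, hence
  the explicit bounds on both functionals.\<close>

lemma Hm1_norm_add_le:
  assumes A: "\<And>w. w \<in> H10 \<Longrightarrow> \<bar>A w\<bar> \<le> C * H1_norm w"
    and B: "\<And>w. w \<in> H10 \<Longrightarrow> \<bar>B w\<bar> \<le> K * H1_norm w"
  shows "Hm1_norm (\<lambda>w. A w + B w) \<le> Hm1_norm A + \<bar>K\<bar>" and "0 \<le> Hm1_norm (\<lambda>w. A w + B w)"
proof -
  let ?S = "{w \<in> H10. H1_norm w \<le> 1}"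
  have ne: "(\<lambda>_. 0) \<in> ?S" using zero_in_H10 H1_norm_zero by simp
  have unit: "\<bar>D w\<bar> \<le> \<bar>M\<bar>" if D: "\<And>w. w \<in> H10 \<Longrightarrow> \<bar>D w\<bar> \<le> M * H1_norm w" and w: "w \<in> ?S"
    for D :: "(real \<Rightarrow> real) \<Rightarrow> real" and M w
  proof -
    have "M * H1_norm w \<le> \<bar>M\<bar> * 1" using w H1_norm_bounds(3)[of w] by (intro mult_mono) auto
    then show ?thesis using D[of w] w by simp
  qed
  have bA: "bdd_above ((\<lambda>w. \<bar>A w\<bar>) ` ?S)" by (rule bdd_aboveI2, rule unit[of A C]) (use A in auto)
  have le: "\<bar>A w + B w\<bar> \<le> Hm1_norm A + \<bar>K\<bar>" if w: "w \<in> ?S" for w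
  proof -
    have "\<bar>A w\<bar> \<le> Hm1_norm A" unfolding Hm1_norm_def by (rule cSUP_upper[OF w bA])
    moreover have "\<bar>B w\<bar> \<le> \<bar>K\<bar>" by (rule unit[OF B w])
    ultimately show ?thesis by linarith
  qed
  show "Hm1_norm (\<lambda>w. A w + B w) \<le> Hm1_norm A + \<bar>K\<bar>"
    unfolding Hm1_norm_def[of "\<lambda>w. A w + B w"] by (rule cSUP_least) (use ne le in auto)
  have "bdd_above ((\<lambda>w. \<bar>A w + B w\<bar>) ` ?S)" by (rule bdd_aboveI2, rule le)
  from cSUP_upper[OF ne this] show "0 \<le> Hm1_norm (\<lambda>w. A w + B w)" unfolding Hm1_norm_def by linarith
qed

text \<open>The H1 norm dominates the L1 norm, so the dual norm of an increment of \<open>G\<close>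
  in time is at most its supremum over x, and that tends to 0.\<close>

lemma Hm1_continuous_rep_add:
  assumes F: "Hm1_continuous_rep f F" and f: "f \<in> L2L2" and G: "continuous_on UNIV (\<lambda>p. G (fst p) (snd p))"
  shows "Hm1_continuous_rep (\<lambda>x t. f x t + c * G x t) (\<lambda>t w. F t w + c * L2_functional (\<lambda>x. G x t) w)"
proof -
  have Gs: "continuous_on ({0..1} \<times> {0..1}) (\<lambda>p. G (fst p) (snd p))" by (rule continuous_on_subset[OF G subset_UNIV])
  have GL2: "(\<lambda>x. G x t) \<in> L2" for t by (rule continuous_L2[OF continuous_slice(2,1)[OF G]])
  have FH: "F t \<in> Hm1" if "t \<in> {0..1}" for t using F that by (auto simp: Hm1_continuous_rep_def)
  have Fb: "\<exists>C. \<forall>w\<in>H10. \<bar>F t w\<bar> \<le> C * H1_norm w" if "t \<in> {0..1}" for t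
    using FH[OF that] by (auto simp: Hm1_def)
  obtain M where M: "\<And>x t. x \<in> {0..1} \<Longrightarrow> t \<in> {0..1} \<Longrightarrow> \<bar>G x t\<bar> \<le> M" by (rule bounded_on_square[OF Gs]) blast
  have Gb: "\<bar>L2_functional (\<lambda>x. G x t) w\<bar> \<le> M * H1_norm w" if "t \<in> {0..1}" "w \<in> H10" for t w
    by (rule L2_functional_bound[OF GL2 H10_L2[OF that(2)] M]) (use that in auto)
  show ?thesis unfolding Hm1_continuous_rep_def
  proof (intro conjI ballI)
    fix t :: real assume t: "t \<in> {0..1}"
    show "(\<lambda>w. F t w + c * L2_functional (\<lambda>x. G x t) w) \<in> Hm1"
      unfolding Hm1_def mem_Collect_eq
    proof (intro conjI ballI allI)
      fix u w a b assume u: "u \<in> H10" and w: "w \<in> H10"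
      have "F t (\<lambda>x. a * u x + b * w x) = a * F t u + b * F t w" using FH[OF t] u w unfolding Hm1_def by blast
      then show "F t (\<lambda>x. a * u x + b * w x) + c * L2_functional (\<lambda>x. G x t) (\<lambda>x. a * u x + b * w x) =
          a * (F t u + c * L2_functional (\<lambda>x. G x t) u) + b * (F t w + c * L2_functional (\<lambda>x. G x t) w)"
        unfolding L2_functional_linear[OF GL2 H10_L2[OF u] H10_L2[OF w]] by (simp add: algebra_simps)
    next
      obtain C where C: "\<forall>w\<in>H10. \<bar>F t w\<bar> \<le> C * H1_norm w" using Fb[OF t] by blast
      have "\<bar>F t w + c * L2_functional (\<lambda>x. G x t) w\<bar> \<le> (C + \<bar>c\<bar> * M) * H1_norm w" if w: "w \<in> H10" for w
      proof -
        have "\<bar>c * L2_functional (\<lambda>x. G x t) w\<bar> \<le> \<bar>c\<bar> * (M * H1_norm w)"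
          unfolding abs_mult by (rule mult_left_mono[OF Gb[OF t w]]) simp
        moreover have "\<bar>F t w\<bar> \<le> C * H1_norm w" using C w by blast
        ultimately show ?thesis by (simp add: distrib_right)
      qed
      then show "\<exists>C. \<forall>w\<in>H10. \<bar>F t w + c * L2_functional (\<lambda>x. G x t) w\<bar> \<le> C * H1_norm w" by blast
    qed
    obtain \<delta> where \<delta>: "\<And>x r. x \<in> {0..1} \<Longrightarrow> r \<in> {0..1} \<Longrightarrow> \<bar>G x r - G x t\<bar> \<le> \<delta> r"
      "(\<delta> \<longlongrightarrow> 0) (at t within {0..1})" by (rule slice_modulus[OF Gs t]) blast
    have lim: "((\<lambda>s. Hm1_norm (\<lambda>w. F s w - F t w) + \<bar>\<bar>c\<bar> * \<delta> s\<bar>) \<longlongrightarrow> 0) (at t within {0..1})"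
    proof -
      have "((\<lambda>s. Hm1_norm (\<lambda>w. F s w - F t w)) \<longlongrightarrow> 0) (at t within {0..1})"
        using F t by (auto simp: Hm1_continuous_rep_def)
      from tendsto_add[OF this tendsto_rabs[OF tendsto_mult_left[OF \<delta>(2), of "\<bar>c\<bar>"]]] show ?thesis by simp
    qed
    have est: "Hm1_norm (\<lambda>w. F s w + c * L2_functional (\<lambda>x. G x s) w - (F t w + c * L2_functional (\<lambda>x. G x t) w))
          \<le> Hm1_norm (\<lambda>w. F s w - F t w) + \<bar>\<bar>c\<bar> * \<delta> s\<bar>
        \<and> 0 \<le> Hm1_norm (\<lambda>w. F s w + c * L2_functional (\<lambda>x. G x s) w - (F t w + c * L2_functional (\<lambda>x. G x t) w))"
      if s: "s \<in> {0..1}" for s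
    proof -
      obtain C1 where C1: "\<forall>w\<in>H10. \<bar>F s w\<bar> \<le> C1 * H1_norm w" using Fb[OF s] by blast
      obtain C2 where C2: "\<forall>w\<in>H10. \<bar>F t w\<bar> \<le> C2 * H1_norm w" using Fb[OF t] by blast
      have A: "\<bar>F s w - F t w\<bar> \<le> (C1 + C2) * H1_norm w" if "w \<in> H10" for w
      proof -
        have "\<bar>F s w\<bar> \<le> C1 * H1_norm w" "\<bar>F t w\<bar> \<le> C2 * H1_norm w" using C1 C2 that by blast+
        then show ?thesis by (simp add: distrib_right)
      qed
      have B: "\<bar>c * (L2_functional (\<lambda>x. G x s) w - L2_functional (\<lambda>x. G x t) w)\<bar> \<le> (\<bar>c\<bar> * \<delta> s) * H1_norm w"
        if w: "w \<in> H10" for w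
      proof -
        have "L2_functional (\<lambda>x. G x s) w - L2_functional (\<lambda>x. G x t) w = L2_functional (\<lambda>x. G x s - G x t) w"
          using L2_functional_add_scaled[OF GL2 GL2 H10_L2[OF w], of s "-1" t] by simp
        moreover have "\<bar>L2_functional (\<lambda>x. G x s - G x t) w\<bar> \<le> \<delta> s * H1_norm w"
          by (rule L2_functional_bound[OF L2_diff[OF GL2 GL2] H10_L2[OF w] \<delta>(1)[OF _ s]])
        ultimately show ?thesis by (simp add: abs_mult mult_left_mono mult.assoc)
      qed
      have e: "(\<lambda>w. F s w + c * L2_functional (\<lambda>x. G x s) w - (F t w + c * L2_functional (\<lambda>x. G x t) w))
          = (\<lambda>w. (F s w - F t w) + c * (L2_functional (\<lambda>x. G x s) w - L2_functional (\<lambda>x. G x t) w))"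
        by (simp add: algebra_simps)
      show ?thesis unfolding e
        using Hm1_norm_add_le[of "\<lambda>w. F s w - F t w" "C1 + C2", OF A B] by blast
    qed
    have ev: "\<forall>\<^sub>F s in at t within {0..1}. s \<in> {0..1}" by (simp add: eventually_at_filter)
    show "((\<lambda>s. Hm1_norm (\<lambda>w. F s w + c * L2_functional (\<lambda>x. G x s) w - (F t w + c * L2_functional (\<lambda>x. G x t) w))) \<longlongrightarrow> 0)
        (at t within {0..1})"
    proof (rule tendsto_sandwich[OF _ _ tendsto_const lim])
      show "\<forall>\<^sub>F s in at t within {0..1}. 0 \<le> Hm1_norm (\<lambda>w. F s w + c * L2_functional (\<lambda>x. G x s) w - (F t w + c * L2_functional (\<lambda>x. G x t) w))"
        using ev by eventually_elim (use est in blast)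
      show "\<forall>\<^sub>F s in at t within {0..1}. Hm1_norm (\<lambda>w. F s w + c * L2_functional (\<lambda>x. G x s) w - (F t w + c * L2_functional (\<lambda>x. G x t) w))
          \<le> Hm1_norm (\<lambda>w. F s w - F t w) + \<bar>\<bar>c\<bar> * \<delta> s\<bar>"
        using ev by eventually_elim (use est in blast)
    qed
  next
    have "AE t in unit_B. \<forall>w\<in>H10. F t w = L2_functional (\<lambda>x. f x t) w" "AE t in unit_B. (\<lambda>x. f x t) \<in> L2"
      using F bochner_L2_D(2)[OF f] unfolding AE_unit_I[symmetric] by (auto simp: Hm1_continuous_rep_def)
    then have "AE t in unit_B. \<forall>w\<in>H10. F t w + c * L2_functional (\<lambda>x. G x t) w = L2_functional (\<lambda>x. f x t + c * G x t) w"
      by eventually_elim (simp add: L2_functional_add_scaled[OF _ GL2 H10_L2])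
    then show "AE t in unit_I. \<forall>w\<in>H10. F t w + c * L2_functional (\<lambda>x. G x t) w = L2_functional (\<lambda>x. f x t + c * G x t) w"
      unfolding AE_unit_I .
  qed
qed

lemma continuous_slice_snd:
  fixes G :: "real \<Rightarrow> real \<Rightarrow> real"
  assumes "continuous_on UNIV (\<lambda>p. G (fst p) (snd p))"
  shows "continuous_on A (\<lambda>t. G x t)"
  using continuous_on_compose2[OF assms, of A "\<lambda>t. (x, t)"] by (simp add: continuous_on_Pair)

lemma Qintegrable_continuous_mult:
  assumes u: "Qintegrable u" and G: "continuous_on UNIV (\<lambda>p. G (fst p) (snd p))"
  shows "Qintegrable (\<lambda>x t. u x t * G x t)"
proof -
  obtain C where "\<And>x t. x \<in> {0..1} \<Longrightarrow> t \<in> {0..1} \<Longrightarrow> \<bar>G x t\<bar> \<le> C"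
    by (rule bounded_on_square[OF continuous_on_subset[OF G subset_UNIV]]) blast
  then show ?thesis by (intro Qintegrable_mult_bounded[OF u continuous_slice(3)[OF G], of C]) auto
qed

lemma Qintegrable_one: "Qintegrable (\<lambda>x t. 1)"
  by (intro finite_measure.integrable_const finite_measure_pair_measure finite_measure_unit_B)

lemma Qintegrable_continuous:
  assumes "continuous_on UNIV (\<lambda>p. G (fst p) (snd p))"
  shows "Qintegrable G"
  using Qintegrable_continuous_mult[OF Qintegrable_one assms] by simp

text \<open>Linearity of \<open>iint\<close> is obtained on the Borel representatives, where it is
  linearity of the integral over the square.\<close>

lemma iint_add_scaled:
  assumes u: "borel_rep u U" "Qintegrable U" and w: "borel_rep w W" "Qintegrable W"
  shows "iint (\<lambda>x t. u x t + c * w x t) = iint u + c * Qint W"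
proof -
  have m: "Qmeas U" "Qmeas W" using u(1) w(1) by (auto simp: borel_rep_def)
  have "borel_rep (\<lambda>x t. u x t + c * w x t) (\<lambda>x t. U x t + c * W x t)"
    by (rule borel_rep_binop[OF u(1) w(1), of "\<lambda>a b. a + c * b"]) (use m in measurable)
  from iint_eq_Qint[OF this] show ?thesis using u w(2) by (simp add: iint_eq_Qint)
qed

context velocity
begin

text \<open>Integrating \<open>(G p)\<^sub>t\<close> and \<open>(G p V)\<^sub>x\<close> over the square gives zero, because
  \<open>G\<close> vanishes at the initial and final time and \<open>V\<close> on the lateral boundary.\<close>

lemma perturbation_identity:
  assumes G: "continuous_on UNIV (\<lambda>p. G (fst p) (snd p))" "continuous_on UNIV (\<lambda>p. Gx (fst p) (snd p))"
      "continuous_on UNIV (\<lambda>p. Gt (fst p) (snd p))"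
    and dG: "\<And>x t. ((\<lambda>y. G y t) has_real_derivative Gx x t) (at x)" "\<And>x t. ((\<lambda>s. G x s) has_real_derivative Gt x t) (at t)"
    and G0: "\<And>x. G x 0 = 0" "\<And>x. G x 1 = 0"
    and p: "continuous_on UNIV (\<lambda>p. P (fst p) (snd p))" "continuous_on UNIV (\<lambda>p. Px (fst p) (snd p))"
      "continuous_on UNIV (\<lambda>p. Pt (fst p) (snd p))"
    and dp: "\<And>x t. x \<in> {0..1} \<Longrightarrow> t \<in> {0..1} \<Longrightarrow> ((\<lambda>y. P y t) has_real_derivative Px x t) (at x within {0..1})"
      "\<And>x t. x \<in> {0..1} \<Longrightarrow> t \<in> {0..1} \<Longrightarrow> ((\<lambda>s. P x s) has_real_derivative Pt x t) (at t within {0..1})"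
  shows "Qint (\<lambda>x t. G x t * Pt x t) + Qint (\<lambda>x t. G x t * P x t * W x t) + Qint (\<lambda>x t. G x t * Px x t * V x t)
      + Qint (\<lambda>x t. P x t * (Gt x t + V x t * Gx x t)) = 0" (is "?a + ?b + ?c + ?d = 0")
    and "Qintegrable (\<lambda>x t. G x t * Pt x t)" "Qintegrable (\<lambda>x t. G x t * P x t * W x t)"
      "Qintegrable (\<lambda>x t. G x t * Px x t * V x t)" "Qintegrable (\<lambda>x t. P x t * (Gt x t + V x t * Gx x t))"
proof -
  have iW: "Qintegrable W" and iV: "Qintegrable V"
    using mult_W_integrable[of "\<lambda>_ _. 1"] mult_V_integrable[of "\<lambda>_ _. 1"] Qintegrable_one by simp_all
  show ia: "Qintegrable (\<lambda>x t. G x t * Pt x t)"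
    by (rule Qintegrable_continuous_mult[OF Qintegrable_continuous[OF G(1)] p(3)])
  have "Qintegrable (\<lambda>x t. W x t * G x t * P x t)"
    by (intro Qintegrable_continuous_mult iW G p)
  then show ib: "Qintegrable (\<lambda>x t. G x t * P x t * W x t)" by (simp add: mult_ac)
  have "Qintegrable (\<lambda>x t. V x t * G x t * Px x t)"
    by (intro Qintegrable_continuous_mult iV G p)
  then show ic: "Qintegrable (\<lambda>x t. G x t * Px x t * V x t)" by (simp add: mult_ac)
  have i1: "Qintegrable (\<lambda>x t. Gt x t * P x t)"
    by (rule Qintegrable_continuous_mult[OF Qintegrable_continuous[OF G(3)] p(1)])
  have "Qintegrable (\<lambda>x t. V x t * Gx x t * P x t)"
    by (intro Qintegrable_continuous_mult iV G p)
  then have i2: "Qintegrable (\<lambda>x t. Gx x t * P x t * V x t)" by (simp add: mult_ac)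
  have "Qintegrable (\<lambda>x t. Gt x t * P x t + Gx x t * P x t * V x t)" using i1 i2 by simp
  then show "Qintegrable (\<lambda>x t. P x t * (Gt x t + V x t * Gx x t))" by (simp add: algebra_simps)
  have d: "?d = Qint (\<lambda>x t. Gt x t * P x t) + Qint (\<lambda>x t. Gx x t * P x t * V x t)"
    using Bochner_Integration.integral_add[OF i1 i2] by (simp add: algebra_simps)
  have "Qint (\<lambda>x t. Gt x t * P x t + G x t * Pt x t) = (\<integral>x. (\<integral>t. Gt x t * P x t + G x t * Pt x t \<partial>unit_B) \<partial>unit_B)"
    by (rule Q_Fubini(1)) (use i1 ia in simp)
  also have "\<dots> = (\<integral>x. 0 \<partial>unit_B)"
  proof (rule integral_cong_AE)
    show "(\<lambda>x. \<integral>t. Gt x t * P x t + G x t * Pt x t \<partial>unit_B) \<in> borel_measurable unit_B"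
      by (rule borel_measurable_integrable[OF Q_Fubini(5)]) (use i1 ia in simp)
    show "AE x in unit_B. (\<integral>t. Gt x t * P x t + G x t * Pt x t \<partial>unit_B) = 0"
      using AE_unit_B_interior
    proof eventually_elim
      case (elim x)
      then have x: "x \<in> {0..1}" by auto
      have "continuous_on A (\<lambda>t. Gt x t * P x t + G x t * Pt x t)" for A
        by (intro continuous_intros continuous_slice_snd G p)
      moreover have "((\<lambda>t. G x t * P x t) has_real_derivative Gt x t * P x t + G x t * Pt x t) (at t within {0..1})"
        if "t \<in> {0..1}" for t
        using DERIV_mult[OF DERIV_subset[OF dG(2) subset_UNIV] dp(2)[OF x that]] by (simp add: mult.commute)
      ultimately have "(\<integral>t. Gt x t * P x t + G x t * Pt x t \<partial>unit_B) = G x 1 * P x 1 - G x 0 * P x 0"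
        by (intro integral_unit_B_FTC(1)[where G="\<lambda>t. G x t * P x t"] borel_measurable_continuous_onI)
      then show ?case by (simp add: G0)
    qed
  qed simp
  finally have t: "Qint (\<lambda>x t. Gt x t * P x t) + ?a = 0" using i1 ia by simp
  have "Qint (\<lambda>x t. G x t * P x t * W x t + (Gx x t * P x t * V x t + G x t * Px x t * V x t))
      = (\<integral>t. (\<integral>x. G x t * P x t * W x t + (Gx x t * P x t * V x t + G x t * Px x t * V x t) \<partial>unit_B) \<partial>unit_B)"
    by (rule Q_Fubini(2)) (use ib i2 ic in simp)
  also have "\<dots> = (\<integral>t. 0 \<partial>unit_B)"
  proof (rule integral_cong_AE)
    show "(\<lambda>t. \<integral>x. G x t * P x t * W x t + (Gx x t * P x t * V x t + G x t * Px x t * V x t) \<partial>unit_B) \<in> borel_measurable unit_B"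
      by (rule borel_measurable_integrable[OF Q_Fubini(6)]) (use ib i2 ic in simp)
    show "AE t in unit_B. (\<integral>x. G x t * P x t * W x t + (Gx x t * P x t * V x t + G x t * Px x t * V x t) \<partial>unit_B) = 0"
      using AE_unit_B_interior
    proof eventually_elim
      case (elim t)
      then have t: "t \<in> {0..1}" by auto
      have V: "continuous_on {0..1} (\<lambda>x. V x t)" by (rule DERIV_continuous_on) (rule V_deriv)
      have ms: "(\<lambda>x. G x t) \<in> borel_measurable borel" "(\<lambda>x. Gx x t) \<in> borel_measurable borel"
        "(\<lambda>x. P x t) \<in> borel_measurable borel" "(\<lambda>x. Px x t) \<in> borel_measurable borel"
        "(\<lambda>x. V x t) \<in> borel_measurable borel" "(\<lambda>x. W x t) \<in> borel_measurable borel"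
        by (fact continuous_slice(2)[OF G(1)] continuous_slice(2)[OF G(2)] continuous_slice(2)[OF p(1)]
            continuous_slice(2)[OF p(2)] Qmeas_slice(1)[OF V_meas] Qmeas_slice(1)[OF W_meas])+
      have cs: "continuous_on {0..1} (\<lambda>x. G x t)" "continuous_on {0..1} (\<lambda>x. Gx x t)"
        "continuous_on {0..1} (\<lambda>x. P x t)" "continuous_on {0..1} (\<lambda>x. Px x t)"
        by (fact continuous_slice(1)[OF G(1)] continuous_slice(1)[OF G(2)] continuous_slice(1)[OF p(1)]
            continuous_slice(1)[OF p(2)])+
      have "(\<integral>x. G x t * P x t * W x t + (Gx x t * P x t * V x t + G x t * Px x t * V x t) \<partial>unit_B)
          = G 1 t * P 1 t * V 1 t - G 0 t * P 0 t * V 0 t"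
      proof (rule integral_unit_B_FTC(1)[where G="\<lambda>x. G x t * P x t * V x t"])
        show "(\<lambda>x. G x t * P x t * W x t + (Gx x t * P x t * V x t + G x t * Px x t * V x t)) \<in> borel_measurable borel"
          by (intro borel_measurable_add borel_measurable_times ms)
        show "continuous_on {0..1} (\<lambda>x. G x t * P x t * W x t + (Gx x t * P x t * V x t + G x t * Px x t * V x t))"
          by (intro continuous_on_add continuous_on_mult cs V W_cont)
        show "((\<lambda>x. G x t * P x t * V x t) has_real_derivative
            G x t * P x t * W x t + (Gx x t * P x t * V x t + G x t * Px x t * V x t)) (at x within {0..1})"
          if x: "x \<in> {0..1}" for x
          using DERIV_mult[OF DERIV_mult[OF DERIV_subset[OF dG(1) subset_UNIV] dp(1)[OF x t]] V_deriv[OF x]]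
          by (simp add: algebra_simps)
      qed
      then show ?case by (simp add: V_0 V_1)
    qed
  qed simp
  finally have "?b + (Qint (\<lambda>x t. Gx x t * P x t * V x t) + ?c) = 0" using ib i2 ic by simp
  with t d show "?a + ?b + ?c + ?d = 0" by linarith
qed

text \<open>Each of the four double integrals changes by c times the corresponding integral of
  \<open>perturbation_identity\<close>, whose sum vanishes once the time term is moved to the other
  side; the terms with f0 and f1 stay as they are.\<close>

lemma transport_eq_perturbation:
  assumes vV: "borel_rep v V" and wW: "borel_rep (\<lambda>x t. wd (\<lambda>y. v y t) x) W"
    and f: "borel_rep f F" "Qintegrable (\<lambda>x t. (F x t)\<^sup>2)" "Qintegrable F"
    and z: "borel_rep z Z" "Qintegrable Z"
    and eq: "transport_eq f0 f1 f v z"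
    and G: "continuous_on UNIV (\<lambda>p. G (fst p) (snd p))" "continuous_on UNIV (\<lambda>p. Gx (fst p) (snd p))"
      "continuous_on UNIV (\<lambda>p. Gt (fst p) (snd p))"
    and dG: "\<And>x t. ((\<lambda>y. G y t) has_real_derivative Gx x t) (at x)" "\<And>x t. ((\<lambda>s. G x s) has_real_derivative Gt x t) (at t)"
    and G0: "\<And>x. G x 0 = 0" "\<And>x. G x 1 = 0"
  shows "transport_eq f0 f1 (\<lambda>x t. f x t + c * G x t) v (\<lambda>x t. z x t + c * (Gt x t + v x t * Gx x t))"
  unfolding transport_eq_def
proof
  fix \<phi> assume \<phi>: "\<phi> \<in> smooth2 {0..1} {0..1}"
  then obtain D :: "nat \<Rightarrow> nat \<Rightarrow> real \<Rightarrow> real \<Rightarrow> real" where D0: "\<And>x t. x \<in> {0..1} \<Longrightarrow> t \<in> {0..1} \<Longrightarrow> D 0 0 x t = \<phi> x t"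
    and Dc: "\<And>i j. continuous_on ({0..1} \<times> {0..1}) (\<lambda>(x, t). D i j x t)"
    and Dd: "\<And>i j x t. x \<in> {0..1} \<Longrightarrow> t \<in> {0..1} \<Longrightarrow> ((\<lambda>y. D i j y t) has_real_derivative D (Suc i) j x t) (at x within {0..1})"
      "\<And>i j x t. x \<in> {0..1} \<Longrightarrow> t \<in> {0..1} \<Longrightarrow> ((\<lambda>s. D i j x s) has_real_derivative D i (Suc j) x t) (at t within {0..1})"
    unfolding smooth2_def by blast
  \<comment> \<open>The test function is given on the closed square only. Clamping extends it and
    its derivatives continuously to the plane; on the square the one-sided derivatives are still
    those of \<phi>.\<close>
  define P where "P x t = D 0 0 (clamp01 x) (clamp01 t)" for x t
  define Px where "Px x t = D 1 0 (clamp01 x) (clamp01 t)" for x t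
  define Pt where "Pt x t = D 0 1 (clamp01 x) (clamp01 t)" for x t
  have p: "continuous_on UNIV (\<lambda>p. P (fst p) (snd p))" "continuous_on UNIV (\<lambda>p. Px (fst p) (snd p))"
    "continuous_on UNIV (\<lambda>p. Pt (fst p) (snd p))"
    unfolding P_def Px_def Pt_def by (rule continuous_clamp[OF Dc[unfolded case_prod_beta']])+
  have P\<phi>: "P x t = \<phi> x t" if "x \<in> {0..1}" "t \<in> {0..1}" for x t using that by (simp add: P_def clamp01_id D0)
  have d\<phi>: "((\<lambda>y. \<phi> y t) has_real_derivative Px x t) (at x within {0..1})"
    "((\<lambda>s. \<phi> x s) has_real_derivative Pt x t) (at t within {0..1})" if x: "x \<in> {0..1}" and t: "t \<in> {0..1}" for x t
  proof -
    show "((\<lambda>y. \<phi> y t) has_real_derivative Px x t) (at x within {0..1})"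
      by (rule has_field_derivative_transform_within[OF _ zero_less_one x, of "\<lambda>y. D 0 0 y t"])
        (use Dd(1)[OF x t, of 0 0] x t D0 in \<open>simp_all add: Px_def clamp01_id\<close>)
    show "((\<lambda>s. \<phi> x s) has_real_derivative Pt x t) (at t within {0..1})"
      by (rule has_field_derivative_transform_within[OF _ zero_less_one t, of "\<lambda>s. D 0 0 x s"])
        (use Dd(2)[OF x t, of 0 0] x t D0 in \<open>simp_all add: Pt_def clamp01_id\<close>)
  qed
  have dp: "((\<lambda>y. P y t) has_real_derivative Px x t) (at x within {0..1})"
    "((\<lambda>s. P x s) has_real_derivative Pt x t) (at t within {0..1})" if x: "x \<in> {0..1}" and t: "t \<in> {0..1}" for x t
    by (rule has_field_derivative_transform_within[OF d\<phi>(1)[OF x t] zero_less_one x], use P\<phi> t in simp)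
      (rule has_field_derivative_transform_within[OF d\<phi>(2)[OF x t] zero_less_one t], use P\<phi> x in simp)
  note I = perturbation_identity[where G=G and Gx=Gx and Gt=Gt and P=P and Px=Px and Pt=Pt, OF G dG G0 p dp]
  have rp: "borel_rep \<phi> P" "borel_rep (dx \<phi>) Px" "borel_rep (dt \<phi>) Pt"
    by (rule borel_repI[OF continuous_slice(3)[OF p(1)]], use P\<phi> in simp,
        rule borel_repI[OF continuous_slice(3)[OF p(2)]], use dx_eq[OF _ d\<phi>(1)] in simp,
        rule borel_repI[OF continuous_slice(3)[OF p(3)]], use dt_eq[OF _ d\<phi>(2)] in simp)
  have rG: "borel_rep G G" "borel_rep Gx Gx" "borel_rep Gt Gt"
    by (rule borel_repI[OF continuous_slice(3)[OF G(1)]], simp,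
        rule borel_repI[OF continuous_slice(3)[OF G(2)]], simp, rule borel_repI[OF continuous_slice(3)[OF G(3)]], simp)
  have mF: "Qmeas F" using f(1) by (simp add: borel_rep_def)
  have j1: "Qintegrable (\<lambda>x t. F x t * Pt x t)" by (rule Qintegrable_continuous_mult[OF f(3) p(3)])
  have j2: "Qintegrable (\<lambda>x t. F x t * P x t * W x t)"
    using Qintegrable_continuous_mult[OF mult_W_integrable[OF mF f(2)] p(1)] by (simp add: mult_ac)
  have j3: "Qintegrable (\<lambda>x t. F x t * Px x t * V x t)"
    using Qintegrable_continuous_mult[OF mult_V_integrable[OF mF f(2)] p(2)] by (simp add: mult_ac)
  have j4: "Qintegrable (\<lambda>x t. P x t * Z x t)"
    using Qintegrable_continuous_mult[OF z(2) p(1)] by (simp add: mult_ac)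
  have e1: "iint (\<lambda>x t. (f x t + c * G x t) * dt \<phi> x t) = iint (\<lambda>x t. f x t * dt \<phi> x t) + c * Qint (\<lambda>x t. G x t * Pt x t)"
    using iint_add_scaled[OF borel_rep_mult[OF f(1) rp(3)] j1 borel_rep_mult[OF rG(1) rp(3)] I(2), of c]
    by (simp add: algebra_simps)
  have e2: "iint (\<lambda>x t. (f x t + c * G x t) * \<phi> x t * wd (\<lambda>y. v y t) x)
      = iint (\<lambda>x t. f x t * \<phi> x t * wd (\<lambda>y. v y t) x) + c * Qint (\<lambda>x t. G x t * P x t * W x t)"
    using iint_add_scaled[OF borel_rep_mult[OF borel_rep_mult[OF f(1) rp(1)] wW] j2
        borel_rep_mult[OF borel_rep_mult[OF rG(1) rp(1)] wW] I(3), of c]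
    by (simp add: algebra_simps)
  have e3: "iint (\<lambda>x t. (f x t + c * G x t) * dx \<phi> x t * v x t)
      = iint (\<lambda>x t. f x t * dx \<phi> x t * v x t) + c * Qint (\<lambda>x t. G x t * Px x t * V x t)"
    using iint_add_scaled[OF borel_rep_mult[OF borel_rep_mult[OF f(1) rp(2)] vV] j3
        borel_rep_mult[OF borel_rep_mult[OF rG(1) rp(2)] vV] I(4), of c]
    by (simp add: algebra_simps)
  have e4: "iint (\<lambda>x t. \<phi> x t * (z x t + c * (Gt x t + v x t * Gx x t)))
      = iint (\<lambda>x t. \<phi> x t * z x t) + c * Qint (\<lambda>x t. P x t * (Gt x t + V x t * Gx x t))"
    using iint_add_scaled[OF borel_rep_mult[OF rp(1) z(1)] j4
        borel_rep_mult[OF rp(1) borel_rep_add[OF rG(3) borel_rep_mult[OF vV rG(2)]]] I(5), of c]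
    by (simp add: algebra_simps)
  have "c * (Qint (\<lambda>x t. G x t * Pt x t) + Qint (\<lambda>x t. G x t * P x t * W x t) + Qint (\<lambda>x t. G x t * Px x t * V x t)
      + Qint (\<lambda>x t. P x t * (Gt x t + V x t * Gx x t))) = 0" by (simp only: I(1) mult_zero_right)
  then show "- iint (\<lambda>x t. (f x t + c * G x t) * dt \<phi> x t) + (\<integral>x. f1 x * \<phi> x 1 \<partial>unit_I) - (\<integral>x. f0 x * \<phi> x 0 \<partial>unit_I)
      = iint (\<lambda>x t. (f x t + c * G x t) * \<phi> x t * wd (\<lambda>y. v y t) x) + iint (\<lambda>x t. (f x t + c * G x t) * dx \<phi> x t * v x t)
        + iint (\<lambda>x t. \<phi> x t * (z x t + c * (Gt x t + v x t * Gx x t)))"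
    using eq[unfolded transport_eq_def, rule_format, OF \<phi>] unfolding e1 e2 e3 e4 by (simp add: distrib_left)
qed

end

lemma L2_norm_square: "(L2_norm u)\<^sup>2 = (\<integral>x. (u x)\<^sup>2 \<partial>unit_I)"
  by (simp add: L2_norm_def)

text \<open>Only the squared \<open>H2_norm\<close> of the slices of \<open>v\<close> is known to be measurable in
  time, so the second derivative enters the action as a difference.\<close>

lemma action_eq:
  assumes v: "v \<in> Vel"
  obtains C where "\<And>z Z. borel_rep z Z \<Longrightarrow> Qintegrable (\<lambda>x t. (Z x t)\<^sup>2) \<Longrightarrow>
      action \<kappa> \<mu> \<epsilon> v z = 1/2 * (C + Qint (\<lambda>x t. (Z x t)\<^sup>2))"
proof -
  obtain V W L where vel: "velocity V W L" and vV: "AE t in unit_B. \<forall>x\<in>{0..1}. v x t = V x t"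
    and wW: "AE t in unit_B. AE x in unit_B. wd (\<lambda>y. v y t) x = W x t"
    and H2: "AE t in unit_B. (H2_norm (\<lambda>x. v x t))\<^sup>2 = (L t)\<^sup>2 / 4" "AE t in unit_B. (\<lambda>x. v x t) \<in> H2"
    by (rule Vel_velocity[OF v])
  interpret velocity V W L by (rule vel)
  have rV: "AE t in unit_B. AE x in unit_B. v x t = V x t" using borel_rep_velocity[OF V_meas vV] by (simp add: borel_rep_def)
  define a where "a t = (\<integral>x. (V x t)\<^sup>2 \<partial>unit_B)" for t
  define b where "b t = (\<integral>x. (W x t)\<^sup>2 \<partial>unit_B)" for t
  define \<alpha> where "\<alpha> t = \<kappa> * a t + \<mu> * b t + \<epsilon> * ((L t)\<^sup>2 / 4 - a t - b t)" for t
  have ab: "integrable unit_B a" "integrable unit_B b"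
    unfolding a_def b_def by (rule Q_Fubini(6)[OF V_square] Q_Fubini(6)[OF W_square])+
  have \<alpha>: "integrable unit_B \<alpha>" unfolding \<alpha>_def[abs_def] using ab L_square by simp
  show thesis
  proof (rule that[of "\<integral>t. \<alpha> t \<partial>unit_B"])
    fix z Z assume z: "borel_rep z Z" and Z2: "Qintegrable (\<lambda>x t. (Z x t)\<^sup>2)"
    have mZ: "Qmeas Z" and zZ: "AE t in unit_B. AE x in unit_B. z x t = Z x t" using z by (auto simp: borel_rep_def)
    have ae: "AE t in unit_B. (\<integral>x. \<kappa> * (v x t)\<^sup>2 + \<mu> * (wd (\<lambda>y. v y t) x)\<^sup>2 + \<epsilon> * (wd (wd (\<lambda>y. v y t)) x)\<^sup>2 + (z x t)\<^sup>2 \<partial>unit_I)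
        = \<alpha> t + (\<integral>x. (Z x t)\<^sup>2 \<partial>unit_B)"
      using rV wW H2 zZ Q_Fubini(4)[OF Z2]
    proof eventually_elim
      case (elim t)
      let ?u = "\<lambda>x. v x t"
      have L2: "?u \<in> L2" "wd ?u \<in> L2" "wd (wd ?u) \<in> L2"
        using elim(4) wd_weak_deriv[of ?u] wd_weak_deriv[of "wd ?u"] by (auto simp: H2_def weak_deriv_def)
      have n: "(L2_norm ?u)\<^sup>2 = a t" "(L2_norm (wd ?u))\<^sup>2 = b t"
        unfolding a_def b_def using L2_norm_borel[OF Qmeas_slice(1)[OF V_meas] elim(1)]
          L2_norm_borel[OF Qmeas_slice(1)[OF W_meas] elim(2)] by simp_all
      have "(H2_norm ?u)\<^sup>2 = (L2_norm ?u)\<^sup>2 + (L2_norm (wd ?u))\<^sup>2 + (L2_norm (wd (wd ?u)))\<^sup>2" by (simp add: H2_norm_def)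
      then have n3: "(L2_norm (wd (wd ?u)))\<^sup>2 = (L t)\<^sup>2 / 4 - a t - b t" 
        unfolding elim(3)[symmetric] n by simp
      have zi: "integrable unit_I (\<lambda>x. (z x t)\<^sup>2)" "(\<integral>x. (z x t)\<^sup>2 \<partial>unit_I) = (\<integral>x. (Z x t)\<^sup>2 \<partial>unit_B)"
        using unit_I_AE_square[OF Qmeas_slice(1)[OF mZ] elim(5)] elim(6) by simp_all
      have "integrable unit_I (\<lambda>x. (v x t)\<^sup>2)" "integrable unit_I (\<lambda>x. (wd ?u x)\<^sup>2)" "integrable unit_I (\<lambda>x. (wd (wd ?u) x)\<^sup>2)"
        using L2 by (simp_all add: L2_def)
      then show ?case using zi n n3 by (simp add: \<alpha>_def L2_norm_square)
    qed
    have m: "(\<lambda>t. \<alpha> t + (\<integral>x. (Z x t)\<^sup>2 \<partial>unit_B)) \<in> borel_measurable borel"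
      using borel_measurable_integrable[OF \<alpha>] borel_measurable_integrable[OF Q_Fubini(6)[OF Z2]] by simp
    have "iint (\<lambda>x t. \<kappa> * (v x t)\<^sup>2 + \<mu> * (wd (\<lambda>y. v y t) x)\<^sup>2 + \<epsilon> * (wd (wd (\<lambda>y. v y t)) x)\<^sup>2 + (z x t)\<^sup>2)
        = (\<integral>t. \<alpha> t + (\<integral>x. (Z x t)\<^sup>2 \<partial>unit_B) \<partial>unit_B)"
      unfolding iint_def by (rule unit_I_AE(2)[OF m ae])
    also have "\<dots> = (\<integral>t. \<alpha> t \<partial>unit_B) + Qint (\<lambda>x t. (Z x t)\<^sup>2)"
      using \<alpha> Q_Fubini(6)[OF Z2] Q_Fubini(2)[OF Z2] by simp
    finally show "action \<kappa> \<mu> \<epsilon> v z = 1/2 * ((\<integral>t. \<alpha> t \<partial>unit_B) + Qint (\<lambda>x t. (Z x t)\<^sup>2))"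
      by (simp add: action_def)
  qed
qed

text \<open>A quadratic in c without constant term that is nowhere negative has no linear part. The
  choice \<open>c = - B / (1 + E)\<close> also covers E = 0.\<close>

lemma linear_coefficient_zero:
  fixes B E :: real
  assumes E: "0 \<le> E" and nonneg: "\<And>c. 0 \<le> 2 * c * B + c\<^sup>2 * E"
  shows "B = 0"
proof -
  define k where "k = 1 / (1 + E)"
  have k: "0 < k" "k * E \<le> 1" using E by (simp_all add: k_def)
  have "0 \<le> k * B\<^sup>2 * (k * E - 2)"
    using nonneg[of "- (k * B)"] by (simp add: power2_eq_square algebra_simps)
  also have "\<dots> \<le> k * B\<^sup>2 * (- 1)" using k by (intro mult_left_mono) auto
  finally show ?thesis using k(1) by (simp add: mult_le_0_iff)
qed

text \<open>The velocity is kept fixed, so its terms of the action form a common constant. The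
  remaining integral of the squared source is quadratic in the perturbation parameter, and its
  linear coefficient is twice the integral of z w, which is the weak equation tested with
  \<open>G\<close>.\<close>

lemma weak_continuity_eq_of_minimizer:
  assumes min: "minimizer \<kappa> \<mu> \<epsilon> f0 f1 f v z"
  shows "weak_continuity_eq v z"
  unfolding weak_continuity_eq_def
proof
  fix G assume G: "G \<in> test_fun2"
  have adm: "(f, v, z) \<in> admissible f0 f1"
    and le: "\<And>f' z'. (f', v, z') \<in> admissible f0 f1 \<Longrightarrow> action \<kappa> \<mu> \<epsilon> v z \<le> action \<kappa> \<mu> \<epsilon> v z'"
    using min by (auto simp: minimizer_def)
  have f: "f \<in> L2L2" and v: "v \<in> Vel" and z: "z \<in> L2L2" and te: "transport_eq f0 f1 f v z"
    using adm by (auto simp: admissible_def)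
  obtain H where H: "Hm1_continuous_rep f H" "\<forall>w\<in>H10. H 0 w = L2_functional f0 w" "\<forall>w\<in>H10. H 1 w = L2_functional f1 w"
    using adm unfolding admissible_def by blast
  obtain D :: "nat \<Rightarrow> nat \<Rightarrow> real \<Rightarrow> real \<Rightarrow> real" where D0: "\<And>x t. D 0 0 x t = G x t"
    and Dc: "\<And>i j. continuous_on (UNIV \<times> UNIV) (\<lambda>(x, t). D i j x t)"
    and Dd: "\<And>i j x t. ((\<lambda>y. D i j y t) has_real_derivative D (Suc i) j x t) (at x)"
      "\<And>i j x t. ((\<lambda>s. D i j x s) has_real_derivative D i (Suc j) x t) (at t)"
    using G unfolding test_fun2_def smooth2_def by blast
  note c = Dc[unfolded UNIV_Times_UNIV case_prod_beta']
  have cG: "continuous_on UNIV (\<lambda>p. G (fst p) (snd p))" using c[of 0 0] by (simp add: D0)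
  have dG: "((\<lambda>y. G y t) has_real_derivative D 1 0 x t) (at x)" "((\<lambda>s. G x s) has_real_derivative D 0 1 x t) (at t)" for x t
    using Dd(1)[of 0 0 t x] Dd(2)[of 0 0 x t] by (simp_all add: D0)
  obtain K where K: "K \<subseteq> {0<..<1} \<times> {0<..<1}" "\<forall>x t. (x, t) \<notin> K \<longrightarrow> G x t = 0"
    using G unfolding test_fun2_def by blast
  have G0: "G x 0 = 0" "G x 1 = 0" for x
  proof -
    have "(x, 0) \<notin> K" "(x, 1) \<notin> K" using K(1) by auto
    then show "G x 0 = 0" "G x 1 = 0" using K(2) by blast+
  qed
  \<comment> \<open>The material derivative of \<open>G\<close> along v: the source produced by
    adding \<open>G\<close> to f.\<close>
  define w where "w x t = D 0 1 x t + v x t * D 1 0 x t" for x t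
  have w: "w \<in> L2L2"
    unfolding w_def[abs_def]
    using L2L2_add_scaled[OF L2L2_continuous[OF c[of 0 1]] L2L2_mult_continuous[OF Vel_L2L2[OF v] c[of 1 0]], of 1] by simp
  obtain F where F: "borel_rep f F" "Qintegrable (\<lambda>x t. (F x t)\<^sup>2)" "Qintegrable F" by (rule L2L2_borel_rep[OF f])
  obtain Z where Z: "borel_rep z Z" "Qintegrable (\<lambda>x t. (Z x t)\<^sup>2)" "Qintegrable Z" by (rule L2L2_borel_rep[OF z])
  obtain \<omega> where \<omega>: "borel_rep w \<omega>" "Qintegrable (\<lambda>x t. (\<omega> x t)\<^sup>2)" by (rule L2L2_borel_rep[OF w])
  have m: "Qmeas Z" "Qmeas \<omega>" using Z(1) \<omega>(1) by (auto simp: borel_rep_def)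
  obtain V W L where vel: "velocity V W L" and vV: "AE t in unit_B. \<forall>x\<in>{0..1}. v x t = V x t"
    and wW: "AE t in unit_B. AE x in unit_B. wd (\<lambda>y. v y t) x = W x t"
    by (rule Vel_velocity[OF v])
  interpret velocity V W L by (rule vel)
  have rV: "borel_rep v V" by (rule borel_rep_velocity[OF V_meas vV])
  have rW: "borel_rep (\<lambda>x t. wd (\<lambda>y. v y t) x) W" using wW W_meas by (simp add: borel_rep_def)
  have path: "(\<lambda>x t. f x t + s * G x t, v, \<lambda>x t. z x t + s * w x t) \<in> admissible f0 f1" for s
    unfolding admissible_def mem_Collect_eq case_prod_conv
  proof (intro conjI exI[of _ "\<lambda>t u. H t u + s * L2_functional (\<lambda>x. G x t) u"])
    show "(\<lambda>x t. f x t + s * G x t) \<in> L2L2" by (rule L2L2_add_scaled[OF f L2L2_continuous[OF cG]])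
    show "v \<in> Vel" by (rule v)
    show "(\<lambda>x t. z x t + s * w x t) \<in> L2L2" by (rule L2L2_add_scaled[OF z w])
    show "Hm1_continuous_rep (\<lambda>x t. f x t + s * G x t) (\<lambda>t u. H t u + s * L2_functional (\<lambda>x. G x t) u)"
      by (rule Hm1_continuous_rep_add[OF H(1) f cG])
    show "\<forall>u\<in>H10. H 0 u + s * L2_functional (\<lambda>x. G x 0) u = L2_functional f0 u"
      "\<forall>u\<in>H10. H 1 u + s * L2_functional (\<lambda>x. G x 1) u = L2_functional f1 u"
      using H(2,3) by (simp_all add: G0 L2_functional_def[of "\<lambda>_. 0"])
    show "transport_eq f0 f1 (\<lambda>x t. f x t + s * G x t) v (\<lambda>x t. z x t + s * w x t)"
      unfolding w_def by (rule transport_eq_perturbation[OF rV rW F Z(1,3) te cG c c dG G0])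
  qed
  obtain C where C: "\<And>z Z. borel_rep z Z \<Longrightarrow> Qintegrable (\<lambda>x t. (Z x t)\<^sup>2) \<Longrightarrow>
      action \<kappa> \<mu> \<epsilon> v z = 1/2 * (C + Qint (\<lambda>x t. (Z x t)\<^sup>2))" by (rule action_eq[OF v]) blast
  have Z\<omega>: "Qintegrable (\<lambda>x t. Z x t * \<omega> x t)" by (rule Qintegrable_mult_squares[OF m(1) Z(2) m(2) \<omega>(2)])
  have "Qint (\<lambda>x t. Z x t * \<omega> x t) = 0"
  proof (rule linear_coefficient_zero)
    show "0 \<le> Qint (\<lambda>x t. (\<omega> x t)\<^sup>2)" by simp
    fix s
    have sq: "(Z x t + s * \<omega> x t)\<^sup>2 = (Z x t)\<^sup>2 + (2 * s * (Z x t * \<omega> x t) + s\<^sup>2 * (\<omega> x t)\<^sup>2)" for x t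
      by (simp add: power2_sum power_mult_distrib algebra_simps)
    have i: "Qintegrable (\<lambda>x t. (Z x t + s * \<omega> x t)\<^sup>2)" unfolding sq using Z(2) \<omega>(2) Z\<omega> by simp
    have r: "borel_rep (\<lambda>x t. z x t + s * w x t) (\<lambda>x t. Z x t + s * \<omega> x t)"
      by (rule borel_rep_binop[OF Z(1) \<omega>(1), of "\<lambda>a b. a + s * b"]) (use m in measurable)
    have "Qint (\<lambda>x t. (Z x t)\<^sup>2) \<le> Qint (\<lambda>x t. (Z x t + s * \<omega> x t)\<^sup>2)"
      using le[OF path[of s]] unfolding C[OF Z(1,2)] C[OF r i] by simp
    then show "0 \<le> 2 * s * Qint (\<lambda>x t. Z x t * \<omega> x t) + s\<^sup>2 * Qint (\<lambda>x t. (\<omega> x t)\<^sup>2)"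
      unfolding sq using Z(2) \<omega>(2) Z\<omega> by simp
  qed
  moreover have "borel_rep (\<lambda>x t. z x t * dt G x t + z x t * v x t * dx G x t) (\<lambda>x t. Z x t * \<omega> x t)"
    unfolding borel_rep_def
  proof
    have "AE t in unit_B. AE x in unit_B. z x t * w x t = Z x t * \<omega> x t"
      using borel_rep_mult[OF Z(1) \<omega>(1)] by (simp add: borel_rep_def)
    then show "AE t in unit_B. AE x in unit_B. z x t * dt G x t + z x t * v x t * dx G x t = Z x t * \<omega> x t"
      using AE_unit_B_interior
    proof eventually_elim
      case (elim t)
      show ?case using elim(1) AE_unit_B_interior
      proof eventually_elim
        case (elim x)
        have "dt G x t = D 0 1 x t" "dx G x t = D 1 0 x t"
          using elim \<open>0 < t \<and> t < 1\<close>
            dt_eq[of t G x, OF _ DERIV_subset[OF dG(2) subset_UNIV]] dx_eq[of x G t, OF _ DERIV_subset[OF dG(1) subset_UNIV]]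
          by simp_all
        then show ?case using elim(1) by (simp add: w_def algebra_simps)
      qed
    qed
  qed (use m in measurable)
  ultimately show "iint (\<lambda>x t. z x t * dt G x t + z x t * v x t * dx G x t) = 0"
    using iint_eq_Qint Z\<omega> by simp
qed

theorem mainTheorem9:
  fixes f0 f1 :: "real \<Rightarrow> real" and f v z :: "real \<Rightarrow> real \<Rightarrow> real"
  assumes "f0 \<in> L2" and "f1 \<in> L2"
    and "(f, v, z) \<in> admissible f0 f1"
  shows "(\<forall>\<kappa> \<mu> \<epsilon>. \<kappa> > 0 \<and> \<mu> \<ge> 0 \<and> \<epsilon> > 0 \<and> minimizer \<kappa> \<mu> \<epsilon> f0 f1 f v z
            \<longrightarrow> weak_continuity_eq v z) \<and>
         (weak_continuity_eq v z \<longrightarrow>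
           (\<forall>\<Phi>. is_flow v \<Phi> \<longrightarrow>
             (AE (x, t) in lebesgue_on ({0..1} \<times> {0..1}).
                z (\<Phi> x t) t = (f1 (\<Phi> x 1) - f0 x) *
                  (flow_jac v \<Phi> x t / (\<integral>\<tau>. flow_jac v \<Phi> x \<tau> \<partial>lebesgue_on {0..1})) \<and>
                f (\<Phi> x t) t = (1 - flow_weight v \<Phi> x t) * f0 x
                  + flow_weight v \<Phi> x t * f1 (\<Phi> x 1))))"
  using weak_continuity_eq_of_minimizer representation_along_flow[OF assms] by blast

end
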